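(* Let $\mathbb F_2$ be the (discrete) free group on two generators. Then the Fourier algebra $A(\mathbb F_2)$ is not operator approximately amenable.
   Context: For a discrete group $\Gamma$, $VN(\Gamma)$ is the group von Neumann algebra generated by the left regular representation on $\ell^2(\Gamma)$, and the Fourier algebra $A(\Gamma)$ is its predual, regarded as a Banach algebra of functions on $\Gamma$ with pointwise multiplication; equivalently $A(\Gamma)$ is the completion of the finitely supported functions on $\Gamma$ in the norm $\|f\|_{A(\Gamma)}=\inf\{\|\xi\|_2\|\eta\|_2: \xi,\eta\in\ell^2(\Gamma),\ f=\xi*\eta\}$. It carries the operator space structure it has as the predual of the von Neumann algebra $VN(\Gamma)$, which makes it a quantized Banach algebra. A quantized Banach algebra is a Banach algebra $A$ that is an operator space and whose multiplication induces a completely bounded map $A\widehat\otimes_{\rm op}A\to A$ ($\widehat\otimes_{\rm op}$ denotes the operator space projective tensor product). A quantized Banach $A$-bimodule is a Banach $A$-bimodule $X$ that is an operator space and whose module actions induce completely bounded maps $A\widehat\otimes_{\rm op}X\to X$ and $X\widehat\otimes_{\rm op}A\to X$; the dual $X^*$ is then also one. A quantized Banach algebra $A$ is operator approximately amenable if, for each quantized Banach $A$-bimodule $X$, every completely bounded derivation $D:A\to X^*$ is approximately inner, i.e. there is a net $(x_i)$ in $X^*$ with $a\cdot x_i-x_i\cdot a\to D(a)$ in norm for every $a\in A$. *)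

theory Defs
  imports "HOL-Analysis.Analysis" "HOL-Library.Function_Algebras"
begin

section \<open>Free groups\<close>

text \<open>
  Groups are types of class \<^class>\<open>group_add\<close>, which does not assume commutativity: the
  group law is written additively, \<open>0\<close> is the identity and \<open>- x\<close> the inverse.
  The free group on the set of generators \<open>'a\<close> consists of the reduced words, where the
  letter \<open>(s, True)\<close> stands for the generator \<open>s\<close> and \<open>(s, False)\<close> for its inverse.
\<close>

definition inv_letter :: "'a \<times> bool \<Rightarrow> 'a \<times> bool" where
  "inv_letter l = (fst l, \<not> snd l)"

fun reduced_word :: "('a \<times> bool) list \<Rightarrow> bool" where
  "reduced_word [] \<longleftrightarrow> True"
| "reduced_word [l] \<longleftrightarrow> True"
| "reduced_word (l # m # w) \<longleftrightarrow> m \<noteq> inv_letter l \<and> reduced_word (m # w)"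

fun cons_cancel :: "'a \<times> bool \<Rightarrow> ('a \<times> bool) list \<Rightarrow> ('a \<times> bool) list" where
  "cons_cancel l [] = [l]"
| "cons_cancel l (m # w) = (if m = inv_letter l then w else l # m # w)"

definition word_mult :: "('a \<times> bool) list \<Rightarrow> ('a \<times> bool) list \<Rightarrow> ('a \<times> bool) list" where
  "word_mult u v = foldr cons_cancel u v"

definition word_inv :: "('a \<times> bool) list \<Rightarrow> ('a \<times> bool) list" where
  "word_inv u = rev (map inv_letter u)"

lemma inv_letter_inv_letter [simp]: "inv_letter (inv_letter l) = l"
  by (simp add: inv_letter_def)

lemma reduced_Cons: "reduced_word (l # w) \<longleftrightarrow> (w = [] \<or> hd w \<noteq> inv_letter l) \<and> reduced_word w"
  by (cases w) auto

lemma reduced_cons_cancel: "reduced_word w \<Longrightarrow> reduced_word (cons_cancel l w)"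
  by (cases w) (auto simp: reduced_Cons)

lemma cons_cancel_inv: "reduced_word w \<Longrightarrow> cons_cancel (inv_letter l) (cons_cancel l w) = w"
proof (cases w)
  case (Cons m v)
  assume "reduced_word w"
  then show ?thesis using Cons by (cases v) auto
qed simp

lemma cons_cancel_inv': "reduced_word w \<Longrightarrow> cons_cancel l (cons_cancel (inv_letter l) w) = w"
  using cons_cancel_inv[of w "inv_letter l"] by simp

lemma reduced_word_mult: "reduced_word v \<Longrightarrow> reduced_word (word_mult u v)"
  unfolding word_mult_def by (induction u) (auto intro: reduced_cons_cancel)

lemma word_mult_cons_cancel:
  assumes "reduced_word w"
  shows "word_mult (cons_cancel l u) w = cons_cancel l (word_mult u w)"
proof (cases u)
  case (Cons m v)
  then show ?thesis
    using cons_cancel_inv'[OF reduced_word_mult[OF assms]] by (simp add: word_mult_def)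
qed (simp add: word_mult_def)

lemma word_mult_assoc:
  assumes "reduced_word w"
  shows "word_mult (word_mult u v) w = word_mult u (word_mult v w)"
proof (induction u)
  case (Cons l u)
  have "word_mult (word_mult (l # u) v) w = word_mult (cons_cancel l (word_mult u v)) w"
    by (simp add: word_mult_def)
  also have "\<dots> = cons_cancel l (word_mult u (word_mult v w))"
    using word_mult_cons_cancel[OF assms] Cons by simp
  finally show ?case by (simp add: word_mult_def)
qed (simp add: word_mult_def)

lemma word_mult_Nil: "reduced_word u \<Longrightarrow> word_mult u [] = u"
proof (induction u)
  case (Cons l u)
  then show ?case by (cases u) (auto simp: word_mult_def)
qed (simp add: word_mult_def)

lemma word_mult_inv: "reduced_word w \<Longrightarrow> word_mult (word_inv u) (word_mult u w) = w"
proof (induction u)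
  case (Cons l u)
  have "word_mult (word_inv (l # u)) (word_mult (l # u) w)
      = word_mult (word_inv u) (cons_cancel (inv_letter l) (cons_cancel l (word_mult u w)))"
    by (simp add: word_mult_def word_inv_def)
  then show ?case
    using cons_cancel_inv[OF reduced_word_mult[OF Cons.prems]] Cons by simp
qed (simp add: word_mult_def word_inv_def)

lemma reduced_append_single:
  "reduced_word (u @ [l]) \<longleftrightarrow> reduced_word u \<and> (u = [] \<or> l \<noteq> inv_letter (last u))"
  by (induction u rule: reduced_word.induct) auto

lemma reduced_word_inv: "reduced_word u \<Longrightarrow> reduced_word (word_inv u)"
proof (induction u)
  case (Cons l u)
  have "inv_letter l \<noteq> inv_letter (last (word_inv u))" if "word_inv u \<noteq> []"
    using Cons.prems that
    by (cases u) (auto simp: word_inv_def reduced_Cons inv_letter_def prod_eq_iff)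
  moreover have "reduced_word (word_inv u)"
    using Cons by (simp add: reduced_Cons)
  ultimately have "reduced_word (word_inv u @ [inv_letter l])"
    by (auto simp: reduced_append_single)
  then show ?case by (simp add: word_inv_def)
qed (simp add: word_inv_def)

typedef 'a free_group = "{w :: ('a \<times> bool) list. reduced_word w}"
  by (rule exI[of _ "[]"]) simp

instantiation free_group :: (type) group_add
begin

definition "0 = Abs_free_group []"
definition "x + y = Abs_free_group (word_mult (Rep_free_group x) (Rep_free_group y))"
definition "- x = Abs_free_group (word_inv (Rep_free_group x))"
definition "x - y = x + - y" for x y :: "'a free_group"

lemma reduced_Rep_free_group: "reduced_word (Rep_free_group x)"
  using Rep_free_group by auto

lemma Rep_free_group_zero: "Rep_free_group 0 = []"
  by (simp add: zero_free_group_def Abs_free_group_inverse)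

lemma Rep_free_group_plus:
  "Rep_free_group (x + y) = word_mult (Rep_free_group x) (Rep_free_group y)"
  by (simp add: plus_free_group_def Abs_free_group_inverse reduced_word_mult reduced_Rep_free_group)

lemma Rep_free_group_uminus: "Rep_free_group (- x) = word_inv (Rep_free_group x)"
  by (simp add: uminus_free_group_def Abs_free_group_inverse reduced_word_inv reduced_Rep_free_group)

instance
proof
  fix x y z :: "'a free_group"
  note reps = Rep_free_group_zero Rep_free_group_plus Rep_free_group_uminus
  show "x + y + z = x + (y + z)"
    by (simp add: Rep_free_group_inject[symmetric] reps word_mult_assoc reduced_Rep_free_group)
  show "0 + x = x"
    by (simp add: Rep_free_group_inject[symmetric] reps word_mult_def)
  show "x + 0 = x"
    by (simp add: Rep_free_group_inject[symmetric] reps word_mult_Nil reduced_Rep_free_group)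
  show "- x + x = 0"
    using word_mult_inv[of "[]" "Rep_free_group x"]
    by (simp add: Rep_free_group_inject[symmetric] reps word_mult_Nil reduced_Rep_free_group)
  show "x + - y = x - y"
    by (simp add: minus_free_group_def)
qed

end

type_synonym F2 = "bool free_group"


section \<open>Complex vector spaces of functions, and matrices over them\<close>

text \<open>
  Vector spaces are subspaces of some \<open>'i \<Rightarrow> complex\<close> with the pointwise operations
  (every complex vector space is isomorphic to one of these: take for \<open>'i\<close> a basis).
  The norms carried by such a subspace are additional data.
\<close>

definition smul :: "complex \<Rightarrow> ('i \<Rightarrow> complex) \<Rightarrow> 'i \<Rightarrow> complex" where
  "smul c f = (\<lambda>i. c * f i)"

interpretation cfun: vector_space smul
  by standard (auto simp: smul_def algebra_simps fun_eq_iff)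

definition clinear_on ::
  "('i \<Rightarrow> complex) set \<Rightarrow> ('j \<Rightarrow> complex) set \<Rightarrow> (('i \<Rightarrow> complex) \<Rightarrow> 'j \<Rightarrow> complex) \<Rightarrow> bool" where
  "clinear_on V W T \<longleftrightarrow>
     (\<forall>x\<in>V. T x \<in> W) \<and>
     (\<forall>x\<in>V. \<forall>y\<in>V. T (x + y) = T x + T y) \<and>
     (\<forall>c. \<forall>x\<in>V. T (smul c x) = smul c (T x))"

text \<open>
  An \<open>n \<times> n\<close> matrix is a function on \<open>nat \<times> nat\<close> (curried) of which only the entries with
  indices below \<open>n\<close> matter.
\<close>

type_synonym 'v mat = "nat \<Rightarrow> nat \<Rightarrow> 'v"

definition mats :: "nat \<Rightarrow> 'v set \<Rightarrow> 'v mat set" where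
  "mats n V = {x. \<forall>i<n. \<forall>j<n. x i j \<in> V}"

definition opnorm :: "nat \<Rightarrow> nat \<Rightarrow> complex mat \<Rightarrow> real" where
  "opnorm m n \<alpha> =
     Sup {sqrt (\<Sum>i<m. (cmod (\<Sum>j<n. \<alpha> i j * z j))\<^sup>2) | z. (\<Sum>j<n. (cmod (z j))\<^sup>2) \<le> 1}"

definition mat_compress :: "nat \<Rightarrow> complex mat \<Rightarrow> ('i \<Rightarrow> complex) mat \<Rightarrow> complex mat \<Rightarrow> ('i \<Rightarrow> complex) mat"
  where "mat_compress n \<alpha> x \<beta> = (\<lambda>i j. \<Sum>k<n. \<Sum>l<n. smul (\<alpha> i k * \<beta> l j) (x k l))"

definition mat_dsum :: "nat \<Rightarrow> ('i \<Rightarrow> complex) mat \<Rightarrow> ('i \<Rightarrow> complex) mat \<Rightarrow> ('i \<Rightarrow> complex) mat"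
  where "mat_dsum n x y =
    (\<lambda>i j. if i < n \<and> j < n then x i j
           else if n \<le> i \<and> n \<le> j then y (i - n) (j - n)
           else 0)"

text \<open>
  The matrix \<open>[B(a\<^sub>i\<^sub>j, b\<^sub>k\<^sub>l)]\<close> of size \<open>p * q\<close>, for \<open>a\<close> of size \<open>p\<close> and \<open>b\<close> of size \<open>q\<close>; the
  index pair \<open>(i, k)\<close> is encoded as \<open>i * q + k\<close>.
\<close>

definition mat_pair :: "('u \<Rightarrow> 'v \<Rightarrow> 'w) \<Rightarrow> nat \<Rightarrow> 'u mat \<Rightarrow> 'v mat \<Rightarrow> 'w mat" where
  "mat_pair B q a b = (\<lambda>I J. B (a (I div q) (J div q)) (b (I mod q) (J mod q)))"


section \<open>Operator spaces\<close>

text \<open>(Complete) operator spaces, given by Ruan's axioms on the matrix norms \<open>N n\<close>.\<close>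

locale operator_space =
  fixes V :: "('i \<Rightarrow> complex) set" and N :: "nat \<Rightarrow> ('i \<Rightarrow> complex) mat \<Rightarrow> real"
  assumes subspace: "cfun.subspace V"
    and norm_eq_0_iff: "x \<in> mats n V \<Longrightarrow> N n x = 0 \<longleftrightarrow> (\<forall>i<n. \<forall>j<n. x i j = 0)"
    and norm_smul: "x \<in> mats n V \<Longrightarrow> N n (\<lambda>i j. smul c (x i j)) = cmod c * N n x"
    and norm_triangle: "x \<in> mats n V \<Longrightarrow> y \<in> mats n V \<Longrightarrow> N n (x + y) \<le> N n x + N n y"
    and norm_dsum: "x \<in> mats n V \<Longrightarrow> y \<in> mats m V \<Longrightarrow>
      N (n + m) (mat_dsum n x y) = max (N n x) (N m y)"
    and norm_compress: "x \<in> mats n V \<Longrightarrow>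
      N m (mat_compress n \<alpha> x \<beta>) \<le> opnorm m n \<alpha> * N n x * opnorm n m \<beta>"
    and complete: "\<lbrakk>\<And>k. s k \<in> V;
        \<And>e. e > 0 \<Longrightarrow> \<exists>K. \<forall>k\<ge>K. \<forall>l\<ge>K. N 1 (\<lambda>_ _. s k - s l) < e\<rbrakk>
      \<Longrightarrow> \<exists>v\<in>V. (\<lambda>k. N 1 (\<lambda>_ _. s k - v)) \<longlonglongrightarrow> 0"

definition completely_bounded ::
  "('i \<Rightarrow> complex) set \<Rightarrow> (nat \<Rightarrow> ('i \<Rightarrow> complex) mat \<Rightarrow> real) \<Rightarrow>
   ('j \<Rightarrow> complex) set \<Rightarrow> (nat \<Rightarrow> ('j \<Rightarrow> complex) mat \<Rightarrow> real) \<Rightarrow>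
   (('i \<Rightarrow> complex) \<Rightarrow> 'j \<Rightarrow> complex) \<Rightarrow> bool" where
  "completely_bounded V NV W NW T \<longleftrightarrow>
     clinear_on V W T \<and>
     (\<exists>C. \<forall>n. \<forall>x\<in>mats n V. NW n (\<lambda>i j. T (x i j)) \<le> C * NV n x)"

text \<open>
  The dual of a normed space; functionals are set to \<open>0\<close> outside \<open>V\<close>. The matrix norms are
  those of \<open>M\<^sub>n(V\<^sup>*) = CB(V, M\<^sub>n)\<close>; only \<open>V\<close> and its matrix norms enter, so
  \<open>V\<close> need not be a space of functions here.
\<close>

definition dual_space ::
  "('i \<Rightarrow> complex) set \<Rightarrow> (nat \<Rightarrow> ('i \<Rightarrow> complex) mat \<Rightarrow> real) \<Rightarrow> (('i \<Rightarrow> complex) \<Rightarrow> complex) set"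
  where "dual_space V N = {\<phi>.
     (\<forall>x\<in>V. \<forall>y\<in>V. \<phi> (x + y) = \<phi> x + \<phi> y) \<and>
     (\<forall>c. \<forall>x\<in>V. \<phi> (smul c x) = c * \<phi> x) \<and>
     (\<exists>C. \<forall>x\<in>V. cmod (\<phi> x) \<le> C * N 1 (\<lambda>_ _. x)) \<and>
     (\<forall>x. x \<notin> V \<longrightarrow> \<phi> x = 0)}"

definition dual_mnorm ::
  "'v set \<Rightarrow> (nat \<Rightarrow> 'v mat \<Rightarrow> real) \<Rightarrow> nat \<Rightarrow> ('v \<Rightarrow> complex) mat \<Rightarrow> real" where
  "dual_mnorm V N n \<phi> =
     Sup {opnorm (n * m) (n * m) (mat_pair (\<lambda>f v. f v) m \<phi> x) | m x. x \<in> mats m V \<and> N m x \<le> 1}"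

text \<open>
  The algebraic tensor product of \<open>V\<close> and \<open>W\<close>, realized in \<open>'i \<times> 'j \<Rightarrow> complex\<close>, with the
  operator space projective matrix norms: the infimum is over all representations
  \<open>u = \<alpha> (v \<otimes> w) \<beta>\<close>. Maps into a complete space that are completely bounded on it are the same
  as completely bounded maps on its completion.
\<close>

definition tens :: "('i \<Rightarrow> complex) \<Rightarrow> ('j \<Rightarrow> complex) \<Rightarrow> 'i \<times> 'j \<Rightarrow> complex" where
  "tens f g = (\<lambda>(i, j). f i * g j)"

definition tensor_space ::
  "('i \<Rightarrow> complex) set \<Rightarrow> ('j \<Rightarrow> complex) set \<Rightarrow> ('i \<times> 'j \<Rightarrow> complex) set" where
  "tensor_space V W = cfun.span {tens v w | v w. v \<in> V \<and> w \<in> W}"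

definition proj_mnorm ::
  "('i \<Rightarrow> complex) set \<Rightarrow> (nat \<Rightarrow> ('i \<Rightarrow> complex) mat \<Rightarrow> real) \<Rightarrow>
   ('j \<Rightarrow> complex) set \<Rightarrow> (nat \<Rightarrow> ('j \<Rightarrow> complex) mat \<Rightarrow> real) \<Rightarrow>
   nat \<Rightarrow> ('i \<times> 'j \<Rightarrow> complex) mat \<Rightarrow> real" where
  "proj_mnorm V NV W NW n u = Inf
     {opnorm n (p * q) \<alpha> * NV p v * NW q w * opnorm (p * q) n \<beta> | p q \<alpha> v w \<beta>.
        v \<in> mats p V \<and> w \<in> mats q W \<and>
        (\<forall>i<n. \<forall>j<n. u i j = mat_compress (p * q) \<alpha> (mat_pair tens q v w) \<beta> i j)}"

text \<open>
  The map \<open>m\<close> is bilinear and induces a completely bounded map on the operator space projective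
  tensor product (bilinearity of \<open>m\<close> is implied by linearity of \<open>\<Phi>\<close>).
\<close>

definition induces_cb ::
  "('i \<Rightarrow> complex) set \<Rightarrow> (nat \<Rightarrow> ('i \<Rightarrow> complex) mat \<Rightarrow> real) \<Rightarrow>
   ('j \<Rightarrow> complex) set \<Rightarrow> (nat \<Rightarrow> ('j \<Rightarrow> complex) mat \<Rightarrow> real) \<Rightarrow>
   ('k \<Rightarrow> complex) set \<Rightarrow> (nat \<Rightarrow> ('k \<Rightarrow> complex) mat \<Rightarrow> real) \<Rightarrow>
   (('i \<Rightarrow> complex) \<Rightarrow> ('j \<Rightarrow> complex) \<Rightarrow> 'k \<Rightarrow> complex) \<Rightarrow> bool" where
  "induces_cb V NV W NW Z NZ m \<longleftrightarrow>
     (\<exists>\<Phi>. completely_bounded (tensor_space V W) (proj_mnorm V NV W NW) Z NZ \<Phi> \<and>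
          (\<forall>v\<in>V. \<forall>w\<in>W. \<Phi> (tens v w) = m v w))"


section \<open>Quantized Banach algebras and operator approximate amenability\<close>

locale quantized_banach_algebra = operator_space A NA
  for A :: "('a \<Rightarrow> complex) set" and NA :: "nat \<Rightarrow> ('a \<Rightarrow> complex) mat \<Rightarrow> real" +
  fixes amult :: "('a \<Rightarrow> complex) \<Rightarrow> ('a \<Rightarrow> complex) \<Rightarrow> 'a \<Rightarrow> complex"
  assumes mult_cb: "induces_cb A NA A NA A NA amult"
    and mult_assoc: "a \<in> A \<Longrightarrow> b \<in> A \<Longrightarrow> c \<in> A \<Longrightarrow> amult (amult a b) c = amult a (amult b c)"

locale quantized_banach_bimodule =
  quantized_banach_algebra A NA amult + X: operator_space X NX
  for A :: "('a \<Rightarrow> complex) set" and NA amult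
    and X :: "('x \<Rightarrow> complex) set" and NX :: "nat \<Rightarrow> ('x \<Rightarrow> complex) mat \<Rightarrow> real" +
  fixes left :: "('a \<Rightarrow> complex) \<Rightarrow> ('x \<Rightarrow> complex) \<Rightarrow> 'x \<Rightarrow> complex"
    and right :: "('x \<Rightarrow> complex) \<Rightarrow> ('a \<Rightarrow> complex) \<Rightarrow> 'x \<Rightarrow> complex"
  assumes left_cb: "induces_cb A NA X NX X NX left"
    and right_cb: "induces_cb X NX A NA X NX right"
    and left_mult: "a \<in> A \<Longrightarrow> b \<in> A \<Longrightarrow> x \<in> X \<Longrightarrow> left (amult a b) x = left a (left b x)"
    and right_mult: "a \<in> A \<Longrightarrow> b \<in> A \<Longrightarrow> x \<in> X \<Longrightarrow> right x (amult a b) = right (right x a) b"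
    and left_right: "a \<in> A \<Longrightarrow> b \<in> A \<Longrightarrow> x \<in> X \<Longrightarrow> left a (right x b) = right (left a x) b"

text \<open>The dual module actions \<open>(a \<cdot> \<phi>)(x) = \<phi>(x \<cdot> a)\<close> and \<open>(\<phi> \<cdot> a)(x) = \<phi>(a \<cdot> x)\<close>.\<close>

definition dual_left ::
  "('x \<Rightarrow> complex) set \<Rightarrow> (('x \<Rightarrow> complex) \<Rightarrow> ('a \<Rightarrow> complex) \<Rightarrow> 'x \<Rightarrow> complex) \<Rightarrow>
   ('a \<Rightarrow> complex) \<Rightarrow> (('x \<Rightarrow> complex) \<Rightarrow> complex) \<Rightarrow> ('x \<Rightarrow> complex) \<Rightarrow> complex" where
  "dual_left X right a \<phi> = (\<lambda>x. if x \<in> X then \<phi> (right x a) else 0)"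

definition dual_right ::
  "('x \<Rightarrow> complex) set \<Rightarrow> (('a \<Rightarrow> complex) \<Rightarrow> ('x \<Rightarrow> complex) \<Rightarrow> 'x \<Rightarrow> complex) \<Rightarrow>
   (('x \<Rightarrow> complex) \<Rightarrow> complex) \<Rightarrow> ('a \<Rightarrow> complex) \<Rightarrow> ('x \<Rightarrow> complex) \<Rightarrow> complex" where
  "dual_right X left \<phi> a = (\<lambda>x. if x \<in> X then \<phi> (left a x) else 0)"

definition cb_derivation_to_dual ::
  "('a \<Rightarrow> complex) set \<Rightarrow> (nat \<Rightarrow> ('a \<Rightarrow> complex) mat \<Rightarrow> real) \<Rightarrow>
   (('a \<Rightarrow> complex) \<Rightarrow> ('a \<Rightarrow> complex) \<Rightarrow> 'a \<Rightarrow> complex) \<Rightarrow>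
   ('x \<Rightarrow> complex) set \<Rightarrow> (nat \<Rightarrow> ('x \<Rightarrow> complex) mat \<Rightarrow> real) \<Rightarrow>
   (('a \<Rightarrow> complex) \<Rightarrow> ('x \<Rightarrow> complex) \<Rightarrow> 'x \<Rightarrow> complex) \<Rightarrow>
   (('x \<Rightarrow> complex) \<Rightarrow> ('a \<Rightarrow> complex) \<Rightarrow> 'x \<Rightarrow> complex) \<Rightarrow>
   (('a \<Rightarrow> complex) \<Rightarrow> ('x \<Rightarrow> complex) \<Rightarrow> complex) \<Rightarrow> bool" where
  "cb_derivation_to_dual A NA amult X NX left right D \<longleftrightarrow>
     completely_bounded A NA (dual_space X NX) (dual_mnorm X NX) D \<and>
     (\<forall>a\<in>A. \<forall>b\<in>A. D (amult a b) = dual_left X right a (D b) + dual_right X left (D a) b)"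

text \<open>Nets in \<open>X\<^sup>*\<close> are expressed by proper filters on \<open>X\<^sup>*\<close>.\<close>

definition approximately_inner ::
  "('a \<Rightarrow> complex) set \<Rightarrow>
   ('x \<Rightarrow> complex) set \<Rightarrow> (nat \<Rightarrow> ('x \<Rightarrow> complex) mat \<Rightarrow> real) \<Rightarrow>
   (('a \<Rightarrow> complex) \<Rightarrow> ('x \<Rightarrow> complex) \<Rightarrow> 'x \<Rightarrow> complex) \<Rightarrow>
   (('x \<Rightarrow> complex) \<Rightarrow> ('a \<Rightarrow> complex) \<Rightarrow> 'x \<Rightarrow> complex) \<Rightarrow>
   (('a \<Rightarrow> complex) \<Rightarrow> ('x \<Rightarrow> complex) \<Rightarrow> complex) \<Rightarrow> bool" where
  "approximately_inner A X NX left right D \<longleftrightarrow>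
     (\<exists>F. F \<noteq> bot \<and> (\<forall>\<^sub>F \<phi> in F. \<phi> \<in> dual_space X NX) \<and>
       (\<forall>a\<in>A. ((\<lambda>\<phi>. dual_mnorm X NX 1
          (\<lambda>_ _. dual_left X right a \<phi> - dual_right X left \<phi> a - D a)) \<longlongrightarrow> 0) F))"

text \<open>
  HOL cannot quantify over all types inside a formula, so the modules range over the subspaces
  of \<open>'x \<Rightarrow> complex\<close> for a given type \<open>'x\<close>. Up to isomorphism these are all the modules of
  dimension at most that of \<open>'x \<Rightarrow> complex\<close>. If \<open>A\<close> is separable, nothing is lost as soon as
  \<open>'x\<close> is infinite: if \<open>D : A \<rightarrow> X\<^sup>*\<close> cannot be approximated within \<open>\<epsilon>\<close> on a finite set by inner
  derivations, then for some separable closed submodule \<open>Y\<close> of \<open>X\<close> the derivation \<open>A \<rightarrow> Y\<^sup>*\<close>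
  obtained by restriction cannot be approximated within \<open>\<epsilon>/2\<close> on that set. (Otherwise the least
  norms of the implementing functionals would be bounded over all such \<open>Y\<close>, and a weak* cluster
  point of norm-preserving extensions would approximate \<open>D\<close>.)
\<close>

definition operator_approximately_amenable ::
  "'x itself \<Rightarrow> ('a \<Rightarrow> complex) set \<Rightarrow> (nat \<Rightarrow> ('a \<Rightarrow> complex) mat \<Rightarrow> real) \<Rightarrow>
   (('a \<Rightarrow> complex) \<Rightarrow> ('a \<Rightarrow> complex) \<Rightarrow> 'a \<Rightarrow> complex) \<Rightarrow> bool" where
  "operator_approximately_amenable (_ :: 'x itself) A NA amult \<longleftrightarrow>
     (\<forall>(X :: ('x \<Rightarrow> complex) set) NX left right.
        quantized_banach_bimodule A NA amult X NX left right \<longrightarrow>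
        (\<forall>D. cb_derivation_to_dual A NA amult X NX left right D \<longrightarrow>
             approximately_inner A X NX left right D))"


section \<open>The group von Neumann algebra and the Fourier algebra\<close>

definition ell2 :: "('g \<Rightarrow> complex) set" where
  "ell2 = {\<xi>. (\<lambda>x. (cmod (\<xi> x))\<^sup>2) summable_on UNIV}"

definition ell2_norm :: "('g \<Rightarrow> complex) \<Rightarrow> real" where
  "ell2_norm \<xi> = sqrt (\<Sum>\<^sub>\<infinity>x. (cmod (\<xi> x))\<^sup>2)"

definition ell2_inner :: "('g \<Rightarrow> complex) \<Rightarrow> ('g \<Rightarrow> complex) \<Rightarrow> complex" where
  "ell2_inner \<xi> \<eta> = (\<Sum>\<^sub>\<infinity>x. \<xi> x * cnj (\<eta> x))"

text \<open>Operators on \<open>\<ell>\<^sup>2\<close> are set to \<open>0\<close> outside \<open>\<ell>\<^sup>2\<close>.\<close>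

type_synonym 'g l2op = "('g \<Rightarrow> complex) \<Rightarrow> 'g \<Rightarrow> complex"

definition bounded_ops :: "'g l2op set" where
  "bounded_ops = {T. clinear_on ell2 ell2 T \<and>
     (\<exists>C. \<forall>\<xi>\<in>ell2. ell2_norm (T \<xi>) \<le> C * ell2_norm \<xi>) \<and>
     (\<forall>\<xi>. \<xi> \<notin> ell2 \<longrightarrow> T \<xi> = 0)}"

definition commutant :: "'g l2op set \<Rightarrow> 'g l2op set" where
  "commutant S = {T \<in> bounded_ops. \<forall>U\<in>S. T \<circ> U = U \<circ> T}"

definition left_reg :: "'g::group_add \<Rightarrow> 'g l2op" where
  "left_reg x = (\<lambda>\<xi>. if \<xi> \<in> ell2 then (\<lambda>y. \<xi> (- x + y)) else 0)"

text \<open>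
  The von Neumann algebra generated by the left regular representation is the bicommutant,
  since the set of left translations is self-adjoint.
\<close>

definition group_vn :: "'g::group_add l2op set" where
  "group_vn = commutant (commutant (range left_reg))"

text \<open>The norm of \<open>M\<^sub>m(B(\<ell>\<^sup>2)) = B((\<ell>\<^sup>2)\<^sup>m)\<close>.\<close>

definition op_mnorm :: "nat \<Rightarrow> 'g l2op mat \<Rightarrow> real" where
  "op_mnorm m T =
     Sup {sqrt (\<Sum>k<m. (ell2_norm (\<Sum>l<m. T k l (\<xi> l)))\<^sup>2) | \<xi>.
            (\<forall>l<m. \<xi> l \<in> ell2) \<and> (\<Sum>l<m. (ell2_norm (\<xi> l))\<^sup>2) \<le> 1}"

text \<open>
  The predual consists of the ultraweakly continuous functionals
  \<open>T \<mapsto> (\<Sum>n. \<langle>T \<xi>\<^sub>n, \<eta>\<^sub>n\<rangle>)\<close>, set to \<open>0\<close> outside \<open>group_vn\<close>. Its matrix norms are those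
  inherited from the dual of \<open>group_vn\<close>.
\<close>

definition vn_predual :: "('g::group_add l2op \<Rightarrow> complex) set" where
  "vn_predual = {(\<lambda>T. if T \<in> group_vn then \<Sum>n. ell2_inner (T (\<xi> n)) (\<eta> n) else 0) | \<xi> \<eta>.
     (\<forall>n::nat. \<xi> n \<in> ell2 \<and> \<eta> n \<in> ell2) \<and>
     summable (\<lambda>n. (ell2_norm (\<xi> n))\<^sup>2) \<and> summable (\<lambda>n. (ell2_norm (\<eta> n))\<^sup>2)}"

text \<open>
  The predual is regarded as a space of functions on the group by identifying \<open>\<phi>\<close> with
  \<open>x \<mapsto> \<phi> (left_reg x)\<close>; this identification is injective because the left translations span an
  ultraweakly dense subspace of \<open>group_vn\<close>.
\<close>

definition fun_of_functional :: "('g::group_add l2op \<Rightarrow> complex) \<Rightarrow> 'g \<Rightarrow> complex" where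
  "fun_of_functional \<phi> = (\<lambda>x. \<phi> (left_reg x))"

definition fourier_algebra :: "('g::group_add \<Rightarrow> complex) set" where
  "fourier_algebra = fun_of_functional ` vn_predual"

definition fourier_mnorm :: "nat \<Rightarrow> ('g::group_add \<Rightarrow> complex) mat \<Rightarrow> real" where
  "fourier_mnorm n u =
     dual_mnorm group_vn op_mnorm n (\<lambda>i j. the_inv_into vn_predual fun_of_functional (u i j))"

end

theory Submission
  imports Defs
begin

text \<open>
  In the free group there are disjoint finite blocks \<open>B\<^sub>r\<close> with \<open>16\<^sup>r\<close> elements whose indicator
  functions have convolution norm at most \<open>2 * 4\<^sup>r\<close> only (Leinert). The module consists of functions
  on the vertices and edges of a bipartite graph: the blocks with even \<open>r\<close> are the vertices in a first
  copy of the group, those with odd \<open>r\<close> the vertices in a second copy, and consecutive blocks are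
  completely joined. An edge \<open>(g, h)\<close> is multiplied by \<open>a h\<close> under \<open>a \<cdot> x\<close> and by \<open>a g\<close> under \<open>x \<cdot> a\<close>;
  the former also sums the edges into their end points of the first copy, the latter, with the opposite
  sign, into those of the second copy.
  The norm is the supremum over the pieces (blocks, and products of consecutive blocks) of \<open>2\<^sup>r\<close>
  times the norm of convolution on the product group.

  The sum \<open>D(a)(x) = \<Sum> a(v) x(v)\<close> over the vertices is a derivation, because in
  \<open>D(b)(x \<cdot> a) + D(a)(b \<cdot> x)\<close> the edge contributions telescope along the blocks and tend to \<open>0\<close> by the
  weights \<open>2\<^sup>r\<close>. With \<open>a'\<close> and \<open>a''\<close> equal to \<open>8\<^sup>-\<^sup>r\<close> on the even and on the odd blocks, there are
  \<open>x'\<close> and \<open>x''\<close> in the module with \<open>x' \<cdot> a' + x'' \<cdot> a'' = a' \<cdot> x' + a'' \<cdot> x''\<close> although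
  \<open>D(a')(x') + D(a'')(x'') = 1\<close>. Every inner derivation gives \<open>0\<close> on the left-hand side of the latter.
\<close>

text \<open>On finitely supported \<open>x\<close> the derivation is inner: it is implemented by the
  sum over the vertices of the first copy, minus the sums over those of the second copy and over the
  edges. That functional is unbounded. The relation between \<open>x'\<close> and \<open>x''\<close>
  describes a unit of mass that enters at block 0 and is handed along the edges from block to block
  to infinity; inner derivations do not see it, and since only two elements of the algebra occur in
  it, neither does a norm limit of inner derivations. Non-amenability enters through the norms: in
  an amenable group, convolution by the indicator of \<open>n\<close> elements has norm
  \<open>n\<close>, and the pieces of \<open>x'\<close> and \<open>x''\<close> would be unbounded; a
  norm of order \<open>sqrt n\<close> keeps them bounded. With blocks of \<open>q^(2r)\<close>
  elements, values \<open>c^(-r)\<close> of \<open>a'\<close> and \<open>a''\<close> and weights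
  \<open>w^r\<close>, the requirements are \<open>c > q\<close> (square summability of
  \<open>a'\<close> and \<open>a''\<close>), \<open>w > 1\<close> (decay of the edge sums) and
  \<open>w * c \<le> q^2\<close> (boundedness of \<open>x'\<close> and \<open>x''\<close>). The
  choice \<open>q = 4\<close>, \<open>c = 8\<close>, \<open>w = 2\<close> meets them, the last one
  with equality.\<close>

section \<open>Bilinear bounds for complex matrices\<close>

text \<open>A bound on operator norms that behaves well for arbitrary index sets; bilinear, so that no
  complex conjugates occur.\<close>

definition bil_bounded :: "'i set \<Rightarrow> 'j set \<Rightarrow> ('i \<Rightarrow> 'j \<Rightarrow> complex) \<Rightarrow> real \<Rightarrow> bool" where
  "bil_bounded I J K C \<longleftrightarrow> (\<forall>w z. cmod (\<Sum>i\<in>I. \<Sum>j\<in>J. w i * K i j * z j)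
      \<le> C * L2_set (\<lambda>i. cmod (w i)) I * L2_set (\<lambda>j. cmod (z j)) J)"

lemma bil_boundedD:
  "bil_bounded I J K C \<Longrightarrow> cmod (\<Sum>i\<in>I. \<Sum>j\<in>J. w i * K i j * z j)
      \<le> C * L2_set (\<lambda>i. cmod (w i)) I * L2_set (\<lambda>j. cmod (z j)) J"
  by (simp add: bil_bounded_def)

lemma bil_bounded_mono: "bil_bounded I J K C \<Longrightarrow> C \<le> C' \<Longrightarrow> bil_bounded I J K C'"
  unfolding bil_bounded_def by (meson L2_set_nonneg mult_right_mono order_trans)

lemma bil_bounded_cong:
  assumes "\<And>i j. i \<in> I \<Longrightarrow> j \<in> J \<Longrightarrow> K i j = K' i j"
  shows "bil_bounded I J K C \<longleftrightarrow> bil_bounded I J K' C"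
proof -
  have "(\<Sum>i\<in>I. \<Sum>j\<in>J. w i * K i j * z j) = (\<Sum>i\<in>I. \<Sum>j\<in>J. w i * K' i j * z j)" for w z
    using assms by (intro sum.cong) auto
  then show ?thesis by (simp add: bil_bounded_def)
qed

lemma L2_set_reindex: "inj_on f A \<Longrightarrow> L2_set g (f ` A) = L2_set (\<lambda>x. g (f x)) A"
  by (simp add: L2_set_def sum.reindex)

lemma bil_bounded_image:
  assumes f: "inj_on f I" and g: "inj_on g J"
  shows "bil_bounded (f ` I) (g ` J) K C \<longleftrightarrow> bil_bounded I J (\<lambda>i j. K (f i) (g j)) C"
proof
  assume *: "bil_bounded (f ` I) (g ` J) K C"
  show "bil_bounded I J (\<lambda>i j. K (f i) (g j)) C"
    unfolding bil_bounded_def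
  proof (intro allI)
    fix w z
    show "cmod (\<Sum>i\<in>I. \<Sum>j\<in>J. w i * K (f i) (g j) * z j)
      \<le> C * L2_set (\<lambda>i. cmod (w i)) I * L2_set (\<lambda>j. cmod (z j)) J"
      using bil_boundedD[OF *, of "\<lambda>i. w (the_inv_into I f i)" "\<lambda>j. z (the_inv_into J g j)"]
      by (simp add: sum.reindex f g L2_set_reindex the_inv_into_f_f cong: sum.cong L2_set_cong_simp)
  qed
next
  assume *: "bil_bounded I J (\<lambda>i j. K (f i) (g j)) C"
  show "bil_bounded (f ` I) (g ` J) K C"
    unfolding bil_bounded_def
  proof (intro allI)
    fix w z
    show "cmod (\<Sum>i\<in>f ` I. \<Sum>j\<in>g ` J. w i * K i j * z j)
      \<le> C * L2_set (\<lambda>i. cmod (w i)) (f ` I) * L2_set (\<lambda>j. cmod (z j)) (g ` J)"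
      using bil_boundedD[OF *, of "\<lambda>i. w (f i)" "\<lambda>j. z (g j)"]
      by (simp add: sum.reindex f g L2_set_reindex)
  qed
qed

text \<open>Vectors on the smaller sets are extended by zero. Finiteness matters here: over an
  infinite index set the sums are 0 by convention and a bound carries no information.\<close>

lemma bil_bounded_subset:
  assumes *: "bil_bounded I J K C" and sub: "I' \<subseteq> I" "J' \<subseteq> J" and fin: "finite I" "finite J"
  shows "bil_bounded I' J' K C"
  unfolding bil_bounded_def
proof (intro allI)
  fix w z :: "_ \<Rightarrow> complex"
  define w' z' where "w' = (\<lambda>i. if i \<in> I' then w i else 0)" and "z' = (\<lambda>j. if j \<in> J' then z j else 0)"
  have "(\<Sum>i\<in>I. \<Sum>j\<in>J. w' i * K i j * z' j) = (\<Sum>i\<in>I'. \<Sum>j\<in>J. w' i * K i j * z' j)"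
    by (rule sum.mono_neutral_right) (use fin sub in \<open>auto simp: w'_def\<close>)
  also have "\<dots> = (\<Sum>i\<in>I'. \<Sum>j\<in>J'. w i * K i j * z j)"
    by (intro sum.cong refl sum.mono_neutral_cong_right) (use fin sub in \<open>auto simp: w'_def z'_def\<close>)
  finally have 1: "(\<Sum>i\<in>I. \<Sum>j\<in>J. w' i * K i j * z' j) = (\<Sum>i\<in>I'. \<Sum>j\<in>J'. w i * K i j * z j)" .
  have 2: "L2_set (\<lambda>i. cmod (w' i)) I = L2_set (\<lambda>i. cmod (w i)) I'"
    unfolding L2_set_def
    by (rule arg_cong[of _ _ sqrt], rule sum.mono_neutral_cong_right) (use fin sub in \<open>auto simp: w'_def\<close>)
  have 3: "L2_set (\<lambda>i. cmod (z' i)) J = L2_set (\<lambda>i. cmod (z i)) J'"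
    unfolding L2_set_def
    by (rule arg_cong[of _ _ sqrt], rule sum.mono_neutral_cong_right) (use fin sub in \<open>auto simp: z'_def\<close>)
  show "cmod (\<Sum>i\<in>I'. \<Sum>j\<in>J'. w i * K i j * z j)
      \<le> C * L2_set (\<lambda>i. cmod (w i)) I' * L2_set (\<lambda>j. cmod (z j)) J'"
    using bil_boundedD[OF *, of w' z'] by (simp add: 1 2 3)
qed

lemma bil_bounded_add:
  assumes "bil_bounded I J K C" "bil_bounded I J K' C'"
  shows "bil_bounded I J (\<lambda>i j. K i j + K' i j) (C + C')"
  unfolding bil_bounded_def
proof (intro allI)
  fix w z
  have "cmod (\<Sum>i\<in>I. \<Sum>j\<in>J. w i * (K i j + K' i j) * z j)
     \<le> cmod (\<Sum>i\<in>I. \<Sum>j\<in>J. w i * K i j * z j) + cmod (\<Sum>i\<in>I. \<Sum>j\<in>J. w i * K' i j * z j)"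
    by (simp add: algebra_simps sum.distrib norm_triangle_ineq)
  also have "\<dots> \<le> (C + C') * L2_set (\<lambda>i. cmod (w i)) I * L2_set (\<lambda>j. cmod (z j)) J"
    using bil_boundedD[OF assms(1), of w z] bil_boundedD[OF assms(2), of w z] by (simp add: algebra_simps)
  finally show "cmod (\<Sum>i\<in>I. \<Sum>j\<in>J. w i * (K i j + K' i j) * z j)
     \<le> (C + C') * L2_set (\<lambda>i. cmod (w i)) I * L2_set (\<lambda>j. cmod (z j)) J" .
qed

lemma bil_bounded_scale:
  assumes "bil_bounded I J K C"
  shows "bil_bounded I J (\<lambda>i j. c * K i j) (cmod c * C)"
  unfolding bil_bounded_def
proof (intro allI)
  fix w z
  have "(\<Sum>i\<in>I. \<Sum>j\<in>J. w i * (c * K i j) * z j) = c * (\<Sum>i\<in>I. \<Sum>j\<in>J. w i * K i j * z j)"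
    by (simp add: sum_distrib_left mult_ac)
  then show "cmod (\<Sum>i\<in>I. \<Sum>j\<in>J. w i * (c * K i j) * z j)
     \<le> (cmod c * C) * L2_set (\<lambda>i. cmod (w i)) I * L2_set (\<lambda>j. cmod (z j)) J"
    using mult_left_mono[OF bil_boundedD[OF assms, of w z], of "cmod c"] by (simp add: norm_mult mult_ac)
qed

lemma bil_bounded_zero: "0 \<le> C \<Longrightarrow> bil_bounded I J (\<lambda>_ _. 0) C"
  by (simp add: bil_bounded_def)

lemma bil_bounded_sum:
  "finite S \<Longrightarrow> (\<And>s. s \<in> S \<Longrightarrow> bil_bounded I J (K s) (C s)) \<Longrightarrow>
   bil_bounded I J (\<lambda>i j. \<Sum>s\<in>S. K s i j) (\<Sum>s\<in>S. C s)"
  by (induction S rule: finite_induct) (auto intro: bil_bounded_zero bil_bounded_add)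

text \<open>Taking for \<open>w\<close> the complex conjugate of the vector \<open>K z\<close>, of
  norm \<open>L\<close>, turns the bilinear bound into \<open>L * L \<le> L * (C * norm z)\<close>;
  the converse is Cauchy-Schwarz. This links the bilinear bounds to the usual operator norm.\<close>

lemma bil_bounded_iff_column:
  assumes "finite I" "finite J" "0 \<le> C"
  shows "bil_bounded I J K C \<longleftrightarrow>
    (\<forall>z. L2_set (\<lambda>i. cmod (\<Sum>j\<in>J. K i j * z j)) I \<le> C * L2_set (\<lambda>j. cmod (z j)) J)"
proof
  assume *: "bil_bounded I J K C"
  show "\<forall>z. L2_set (\<lambda>i. cmod (\<Sum>j\<in>J. K i j * z j)) I \<le> C * L2_set (\<lambda>j. cmod (z j)) J"
  proof
    fix z
    define v where "v = (\<lambda>i. \<Sum>j\<in>J. K i j * z j)"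
    define L where "L = L2_set (\<lambda>i. cmod (v i)) I"
    have L2: "L\<^sup>2 = (\<Sum>i\<in>I. (cmod (v i))\<^sup>2)"
      by (simp add: L_def L2_set_def sum_nonneg)
    have "(\<Sum>i\<in>I. \<Sum>j\<in>J. cnj (v i) * K i j * z j) = (\<Sum>i\<in>I. cnj (v i) * v i)"
      unfolding v_def[symmetric] sum_distrib_left
      by (simp add: v_def sum_distrib_left[symmetric] mult.assoc)
    also have "\<dots> = of_real (L\<^sup>2)"
      unfolding L2 of_real_sum complex_norm_square by (simp add: mult.commute)
    finally have "L\<^sup>2 = cmod (\<Sum>i\<in>I. \<Sum>j\<in>J. cnj (v i) * K i j * z j)"
      by (simp add: norm_power)
    also have "\<dots> \<le> C * L * L2_set (\<lambda>j. cmod (z j)) J"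
      using bil_boundedD[OF *, of "\<lambda>i. cnj (v i)" z] by (simp add: L_def)
    finally have "L * L \<le> L * (C * L2_set (\<lambda>j. cmod (z j)) J)"
      by (simp add: power2_eq_square mult_ac)
    moreover have "L \<ge> 0" by (simp add: L_def)
    ultimately have "L \<le> C * L2_set (\<lambda>j. cmod (z j)) J"
      using assms(3) by (cases "L = 0") (auto simp: mult_le_cancel_left)
    then show "L2_set (\<lambda>i. cmod (\<Sum>j\<in>J. K i j * z j)) I \<le> C * L2_set (\<lambda>j. cmod (z j)) J"
      by (simp add: L_def v_def)
  qed
next
  assume *: "\<forall>z. L2_set (\<lambda>i. cmod (\<Sum>j\<in>J. K i j * z j)) I \<le> C * L2_set (\<lambda>j. cmod (z j)) J"
  show "bil_bounded I J K C"
    unfolding bil_bounded_def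
  proof (intro allI)
    fix w z
    have "cmod (\<Sum>i\<in>I. \<Sum>j\<in>J. w i * K i j * z j) = cmod (\<Sum>i\<in>I. w i * (\<Sum>j\<in>J. K i j * z j))"
      by (simp add: sum_distrib_left mult_ac)
    also have "\<dots> \<le> (\<Sum>i\<in>I. \<bar>cmod (w i)\<bar> * \<bar>cmod (\<Sum>j\<in>J. K i j * z j)\<bar>)"
      by (rule order_trans[OF norm_sum]) (simp add: norm_mult)
    also have "\<dots> \<le> L2_set (\<lambda>i. cmod (w i)) I * L2_set (\<lambda>i. cmod (\<Sum>j\<in>J. K i j * z j)) I"
      by (rule L2_set_mult_ineq)
    also have "\<dots> \<le> L2_set (\<lambda>i. cmod (w i)) I * (C * L2_set (\<lambda>j. cmod (z j)) J)"
      using * by (intro mult_left_mono) auto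
    finally show "cmod (\<Sum>i\<in>I. \<Sum>j\<in>J. w i * K i j * z j)
      \<le> C * L2_set (\<lambda>i. cmod (w i)) I * L2_set (\<lambda>j. cmod (z j)) J"
      by (simp add: mult_ac)
  qed
qed

lemma bil_bounded_column:
  assumes "bil_bounded I J K C" "finite I" "finite J" "0 \<le> C"
  shows "L2_set (\<lambda>i. cmod (\<Sum>j\<in>J. K i j * z j)) I \<le> C * L2_set (\<lambda>j. cmod (z j)) J"
  using assms(1) bil_bounded_iff_column[OF assms(2-4), of K] by simp

lemma bil_bounded_entry:
  assumes *: "bil_bounded I J K C" and "finite I" "finite J" "i \<in> I" "j \<in> J"
  shows "cmod (K i j) \<le> C"
proof -
  have "bil_bounded {i} {j} K C"
    using assms by (intro bil_bounded_subset[OF *]) auto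
  from bil_boundedD[OF this, of "\<lambda>_. 1" "\<lambda>_. 1"] show ?thesis by simp
qed

lemma bil_bounded_matrix_unit:
  assumes "finite I" "finite J" "bil_bounded S T K C" "i0 \<in> I" "j0 \<in> J" "0 \<le> C" "finite S" "finite T"
  shows "bil_bounded (I \<times> S) (J \<times> T) (\<lambda>(i,s) (j,t). if i = i0 \<and> j = j0 then K s t else 0) C"
  unfolding bil_bounded_def
proof (intro allI)
  fix w z :: "_ \<times> _ \<Rightarrow> complex"
  have "(\<Sum>x\<in>I \<times> S. \<Sum>y\<in>J \<times> T. w x * (case x of (i,s) \<Rightarrow> \<lambda>(j,t). if i = i0 \<and> j = j0 then K s t else 0) y * z y)
     = (\<Sum>x\<in>{i0} \<times> S. \<Sum>y\<in>J \<times> T. w x * (case x of (i,s) \<Rightarrow> \<lambda>(j,t). if i = i0 \<and> j = j0 then K s t else 0) y * z y)"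
    using assms by (intro sum.mono_neutral_right ballI sum.neutral) (auto split: if_splits)
  also have "\<dots> = (\<Sum>x\<in>{i0} \<times> S. \<Sum>y\<in>{j0} \<times> T. w x * (case x of (i,s) \<Rightarrow> \<lambda>(j,t). if i = i0 \<and> j = j0 then K s t else 0) y * z y)"
    by (rule sum.cong[OF refl], rule sum.mono_neutral_right) (use assms in \<open>auto split: if_splits\<close>)
  also have "\<dots> = (\<Sum>s\<in>S. \<Sum>t\<in>T. w (i0,s) * K s t * z (j0,t))"
    by (simp add: sum.cartesian_product')
  finally have 1: "(\<Sum>x\<in>I \<times> S. \<Sum>y\<in>J \<times> T. w x * (case x of (i,s) \<Rightarrow> \<lambda>(j,t). if i = i0 \<and> j = j0 then K s t else 0) y * z y)
     = (\<Sum>s\<in>S. \<Sum>t\<in>T. w (i0,s) * K s t * z (j0,t))" .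
  have L: "L2_set (\<lambda>s. cmod (v (k,s))) R \<le> L2_set (\<lambda>x. cmod (v x)) (N \<times> R)"
    if "finite N" "finite R" "k \<in> N" for v :: "'x \<times> 'y \<Rightarrow> complex" and k N R
  proof -
    have "(\<Sum>s\<in>R. (cmod (v (k,s)))\<^sup>2) = (\<Sum>x\<in>{k} \<times> R. (cmod (v x))\<^sup>2)"
      by (simp add: sum.cartesian_product')
    also have "\<dots> \<le> (\<Sum>x\<in>N \<times> R. (cmod (v x))\<^sup>2)"
      using that by (intro sum_mono2) auto
    finally show ?thesis by (simp add: L2_set_def)
  qed
  have "cmod (\<Sum>s\<in>S. \<Sum>t\<in>T. w (i0,s) * K s t * z (j0,t))
     \<le> C * L2_set (\<lambda>s. cmod (w (i0,s))) S * L2_set (\<lambda>t. cmod (z (j0,t))) T"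
    by (rule bil_boundedD[OF assms(3)])
  also have "\<dots> \<le> C * L2_set (\<lambda>x. cmod (w x)) (I \<times> S) * L2_set (\<lambda>x. cmod (z x)) (J \<times> T)"
    using assms by (intro mult_mono mult_left_mono L) auto
  finally show "cmod (\<Sum>x\<in>I \<times> S. \<Sum>y\<in>J \<times> T. w x * (case x of (i,s) \<Rightarrow> \<lambda>(j,t). if i = i0 \<and> j = j0 then K s t else 0) y * z y)
      \<le> C * L2_set (\<lambda>x. cmod (w x)) (I \<times> S) * L2_set (\<lambda>x. cmod (z x)) (J \<times> T)"
    by (simp only: 1)
qed

text \<open>The triangle inequality over matrix units. The constant is crude and serves only where
  some finite bound is wanted, so that a supremum makes sense.\<close>

lemma bil_bounded_blocks:
  assumes "finite I" "finite J" "finite S" "finite T"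
    and "\<And>i j. i \<in> I \<Longrightarrow> j \<in> J \<Longrightarrow> bil_bounded S T (K i j) (C i j)"
    and "\<And>i j. i \<in> I \<Longrightarrow> j \<in> J \<Longrightarrow> 0 \<le> C i j"
  shows "bil_bounded (I \<times> S) (J \<times> T) (\<lambda>(i,s) (j,t). K i j s t) (\<Sum>i\<in>I. \<Sum>j\<in>J. C i j)"
proof -
  have "bil_bounded (I \<times> S) (J \<times> T)
     (\<lambda>x y. \<Sum>p\<in>I \<times> J. (\<lambda>(i,s) (j,t). if i = fst p \<and> j = snd p then K (fst p) (snd p) s t else 0) x y)
     (\<Sum>p\<in>I \<times> J. C (fst p) (snd p))"
    using assms by (intro bil_bounded_sum bil_bounded_matrix_unit) auto
  also have "(\<Sum>p\<in>I \<times> J. C (fst p) (snd p)) = (\<Sum>i\<in>I. \<Sum>j\<in>J. C i j)"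
    by (simp add: sum.cartesian_product case_prod_unfold)
  finally show ?thesis
  proof (rule iffD1[OF bil_bounded_cong, rotated])
    fix x y assume x: "x \<in> I \<times> S" and y: "y \<in> J \<times> T"
    have "(\<Sum>p\<in>I \<times> J. (\<lambda>(i,s) (j,t). if i = fst p \<and> j = snd p then K (fst p) (snd p) s t else 0) x y)
       = (\<Sum>p\<in>{(fst x, fst y)}. K (fst p) (snd p) (snd x) (snd y))"
      by (rule sum.mono_neutral_cong_right) (use assms x y in \<open>auto simp: case_prod_unfold\<close>)
    then show "(\<Sum>p\<in>I \<times> J. (\<lambda>(i,s) (j,t). if i = fst p \<and> j = snd p then K (fst p) (snd p) s t else 0) x y)
       = (case x of (i,s) \<Rightarrow> \<lambda>(j,t). K i j s t) y"
      by (simp add: case_prod_unfold)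
  qed
qed

lemma bil_bounded_exists:
  assumes "finite I" "finite J"
  shows "\<exists>C\<ge>0. bil_bounded I J K C"
proof -
  have "bil_bounded (I \<times> {()}) (J \<times> {()}) (\<lambda>(i,s) (j,t). (\<lambda>i j _ _. K i j) i j s t) (\<Sum>i\<in>I. \<Sum>j\<in>J. cmod (K i j))"
    using assms by (intro bil_bounded_blocks) (auto simp: bil_bounded_def norm_mult)
  moreover have "I \<times> {()} = (\<lambda>i. (i,())) ` I" "J \<times> {()} = (\<lambda>i. (i,())) ` J" by auto
  ultimately have "bil_bounded I J K (\<Sum>i\<in>I. \<Sum>j\<in>J. cmod (K i j))"
    by (simp add: bil_bounded_image inj_on_def)
  then show ?thesis by (meson norm_ge_zero sum_nonneg)
qed

lemma bil_bounded_mult: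
  assumes K: "bil_bounded I J K C" and L: "bil_bounded J M L C'" and fin: "finite I" "finite J" "finite M"
    and "0 \<le> C" "0 \<le> C'"
  shows "bil_bounded I M (\<lambda>i m. \<Sum>j\<in>J. K i j * L j m) (C * C')"
proof -
  have "L2_set (\<lambda>i. cmod (\<Sum>m\<in>M. (\<Sum>j\<in>J. K i j * L j m) * z m)) I \<le> C * C' * L2_set (\<lambda>m. cmod (z m)) M" for z
  proof -
    have eq: "(\<Sum>m\<in>M. (\<Sum>j\<in>J. K i j * L j m) * z m) = (\<Sum>j\<in>J. K i j * (\<Sum>m\<in>M. L j m * z m))" for i
      unfolding sum_distrib_left sum_distrib_right by (subst sum.swap) (simp add: mult_ac)
    have "L2_set (\<lambda>i. cmod (\<Sum>j\<in>J. K i j * (\<Sum>m\<in>M. L j m * z m))) I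
        \<le> C * L2_set (\<lambda>j. cmod (\<Sum>m\<in>M. L j m * z m)) J"
      by (rule bil_bounded_column[OF K]) (use assms in auto)
    also have "\<dots> \<le> C * (C' * L2_set (\<lambda>m. cmod (z m)) M)"
      using assms by (intro mult_left_mono bil_bounded_column[OF L]) auto
    finally show ?thesis by (simp only: eq mult.assoc)
  qed
  then show ?thesis using assms by (simp add: bil_bounded_iff_column)
qed

lemma L2_set_Times:
  "L2_set f (A \<times> B) = L2_set (\<lambda>b. L2_set (\<lambda>a. f (a, b)) A) B"
proof -
  have "(\<Sum>x\<in>A \<times> B. (f x)\<^sup>2) = (\<Sum>b\<in>B. \<Sum>a\<in>A. (f (a,b))\<^sup>2)"
    by (subst sum.swap) (simp add: sum.cartesian_product)
  then show ?thesis by (simp add: L2_set_def sum_nonneg)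
qed

text \<open>The matrix is \<open>K\<close> tensored with the identity on \<open>S\<close>, in other
  words a direct sum of copies of \<open>K\<close> indexed by \<open>s\<close>, and the squares of
  the norms add up over \<open>s\<close>.\<close>

lemma bil_bounded_tensor_id:
  assumes K: "bil_bounded I J K C" and fin: "finite I" "finite J" "finite S" and "0 \<le> C"
  shows "bil_bounded (I \<times> S) (J \<times> S) (\<lambda>(i,s) (j,t). if s = t then K i j else 0) C"
proof -
  have "L2_set (\<lambda>x. cmod (\<Sum>y\<in>J \<times> S. (case x of (i,s) \<Rightarrow> \<lambda>(j,t). if s = t then K i j else 0) y * z y)) (I \<times> S)
     \<le> C * L2_set (\<lambda>y. cmod (z y)) (J \<times> S)" for z
  proof -
    have eq: "(\<Sum>y\<in>J \<times> S. (\<lambda>(j,t). if s = t then K i j else 0) y * z y) = (\<Sum>j\<in>J. K i j * z (j, s))"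
      if "s \<in> S" for i s
    proof -
      have "(\<Sum>y\<in>J \<times> S. (\<lambda>(j,t). if s = t then K i j else 0) y * z y)
         = (\<Sum>y\<in>J \<times> {s}. (\<lambda>(j,t). if s = t then K i j else 0) y * z y)"
        by (rule sum.mono_neutral_right) (use fin that in \<open>auto split: if_splits\<close>)
      then show ?thesis by (simp add: sum.cartesian_product')
    qed
    have "L2_set (\<lambda>x. cmod (\<Sum>y\<in>J \<times> S. (case x of (i,s) \<Rightarrow> \<lambda>(j,t). if s = t then K i j else 0) y * z y)) (I \<times> S)
       = L2_set (\<lambda>s. L2_set (\<lambda>i. cmod (\<Sum>j\<in>J. K i j * z (j, s))) I) S"
      unfolding L2_set_Times by (intro L2_set_cong refl) (simp add: eq cong: L2_set_cong_simp)
    also have "\<dots> \<le> L2_set (\<lambda>s. C * L2_set (\<lambda>j. cmod (z (j,s))) J) S"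
      using assms by (intro L2_set_mono bil_bounded_column[OF K]) auto
    also have "\<dots> = C * L2_set (\<lambda>y. cmod (z y)) (J \<times> S)"
      using assms by (simp add: L2_set_Times L2_set_right_distrib)
    finally show ?thesis .
  qed
  then show ?thesis using assms by (simp add: bil_bounded_iff_column)
qed

text \<open>Uniform bounds on submatrices survive entrywise limits. The completeness of the module
  and the passage from partial sums to the derivation rest on this.\<close>

lemma bil_bounded_limit:
  assumes "\<And>i j. i \<in> I \<Longrightarrow> j \<in> J \<Longrightarrow> ((\<lambda>k. K k i j) \<longlongrightarrow> L i j) F" "F \<noteq> bot"
    and "\<forall>\<^sub>F k in F. bil_bounded I J (K k) C"
  shows "bil_bounded I J L C"
  unfolding bil_bounded_def
proof (intro allI)
  fix w z
  have "((\<lambda>k. cmod (\<Sum>i\<in>I. \<Sum>j\<in>J. w i * K k i j * z j)) \<longlongrightarrow> cmod (\<Sum>i\<in>I. \<Sum>j\<in>J. w i * L i j * z j)) F"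
    using assms(1) by (intro tendsto_intros)
  moreover have "\<forall>\<^sub>F k in F. cmod (\<Sum>i\<in>I. \<Sum>j\<in>J. w i * K k i j * z j)
     \<le> C * L2_set (\<lambda>i. cmod (w i)) I * L2_set (\<lambda>j. cmod (z j)) J"
    using assms(3) by eventually_elim (rule bil_boundedD)
  ultimately show "cmod (\<Sum>i\<in>I. \<Sum>j\<in>J. w i * L i j * z j) \<le> C * L2_set (\<lambda>i. cmod (w i)) I * L2_set (\<lambda>j. cmod (z j)) J"
    using tendsto_upperbound[OF _ _ assms(2)] by blast
qed

section \<open>The operator norm of finite matrices\<close>

lemma opnorm_set_bound:
  fixes m n :: nat
  assumes "bil_bounded {..<m} {..<n} \<alpha> C" "0 \<le> C" "(\<Sum>j<n. (cmod (z j))\<^sup>2) \<le> 1"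
  shows "sqrt (\<Sum>i<m. (cmod (\<Sum>j<n. \<alpha> i j * z j))\<^sup>2) \<le> C"
proof -
  have "L2_set (\<lambda>i. cmod (\<Sum>j<n. \<alpha> i j * z j)) {..<m} \<le> C * L2_set (\<lambda>j. cmod (z j)) {..<n}"
    using assms by (intro bil_bounded_column) auto
  also have "\<dots> \<le> C * 1"
    using assms by (intro mult_left_mono) (auto simp: L2_set_def)
  finally show ?thesis by (simp add: L2_set_def)
qed

text \<open>\<open>Sup\<close> is meaningful only for sets that are bounded above, hence the
  preliminary constant \<open>C\<close>. The passage from the unit ball to all \<open>z\<close> is
  homogeneity, with the zero vector treated separately.\<close>

lemma bil_bounded_opnorm: "bil_bounded {..<m} {..<n} \<alpha> (opnorm m n \<alpha>)"
  and opnorm_nonneg: "0 \<le> opnorm m n \<alpha>"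
proof -
  let ?S = "{sqrt (\<Sum>i<m. (cmod (\<Sum>j<n. \<alpha> i j * z j))\<^sup>2) | z. (\<Sum>j<n. (cmod (z j))\<^sup>2) \<le> 1}"
  obtain C where C: "C \<ge> 0" "bil_bounded {..<m} {..<n} \<alpha> C"
    using bil_bounded_exists[of "{..<m}" "{..<n}" \<alpha>] by auto
  have bdd: "bdd_above ?S"
    using opnorm_set_bound[OF C(2,1)] by (intro bdd_aboveI[of _ C]) auto
  have up: "sqrt (\<Sum>i<m. (cmod (\<Sum>j<n. \<alpha> i j * z j))\<^sup>2) \<le> opnorm m n \<alpha>" if "(\<Sum>j<n. (cmod (z j))\<^sup>2) \<le> 1" for z
    unfolding opnorm_def by (rule cSup_upper[OF _ bdd]) (use that in auto)
  show nn: "0 \<le> opnorm m n \<alpha>"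
    using up[of "\<lambda>_. 0"] by simp
  have "L2_set (\<lambda>i. cmod (\<Sum>j<n. \<alpha> i j * z j)) {..<m} \<le> opnorm m n \<alpha> * L2_set (\<lambda>j. cmod (z j)) {..<n}" for z
  proof (cases "L2_set (\<lambda>j. cmod (z j)) {..<n} = 0")
    case True
    then have "\<forall>j<n. z j = 0" by (auto simp: L2_set_eq_0_iff)
    then show ?thesis using nn by (simp add: L2_set_def)
  next
    case False
    define l where "l = L2_set (\<lambda>j. cmod (z j)) {..<n}"
    have l: "l > 0" using False by (simp add: l_def order_less_le)
    have l2: "l\<^sup>2 = (\<Sum>j<n. (cmod (z j))\<^sup>2)" by (simp add: l_def L2_set_def sum_nonneg)
    have "(\<Sum>j<n. (cmod (z j / l))\<^sup>2) = (\<Sum>j<n. (cmod (z j))\<^sup>2) / l\<^sup>2"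
      using l by (simp add: norm_divide power_divide sum_divide_distrib)
    also have "\<dots> = 1" using l by (simp add: l2[symmetric])
    finally have "sqrt (\<Sum>i<m. (cmod (\<Sum>j<n. \<alpha> i j * (z j / l)))\<^sup>2) \<le> opnorm m n \<alpha>"
      by (intro up) simp
    moreover have "sqrt (\<Sum>i<m. (cmod (\<Sum>j<n. \<alpha> i j * (z j / l)))\<^sup>2)
        = L2_set (\<lambda>i. cmod (\<Sum>j<n. \<alpha> i j * z j)) {..<m} / l"
    proof -
      have "(\<Sum>i<m. (cmod (\<Sum>j<n. \<alpha> i j * (z j / l)))\<^sup>2) = (\<Sum>i<m. (cmod (\<Sum>j<n. \<alpha> i j * z j))\<^sup>2) / l\<^sup>2"
        using l by (simp add: sum_divide_distrib[symmetric] norm_divide power_divide)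
      then show ?thesis using l by (simp add: L2_set_def real_sqrt_divide)
    qed
    ultimately show ?thesis using l by (simp add: l_def[symmetric] pos_divide_le_eq)
  qed
  then show "bil_bounded {..<m} {..<n} \<alpha> (opnorm m n \<alpha>)"
    using nn by (simp add: bil_bounded_iff_column)
qed

lemma opnorm_le_iff:
  assumes "0 \<le> C"
  shows "opnorm m n \<alpha> \<le> C \<longleftrightarrow> bil_bounded {..<m} {..<n} \<alpha> C"
proof
  show "opnorm m n \<alpha> \<le> C \<Longrightarrow> bil_bounded {..<m} {..<n} \<alpha> C"
    using bil_bounded_opnorm bil_bounded_mono by blast
  show "bil_bounded {..<m} {..<n} \<alpha> C \<Longrightarrow> opnorm m n \<alpha> \<le> C"
    unfolding opnorm_def using assms opnorm_set_bound[of m n \<alpha> C]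
    by (intro cSup_least) (auto intro: exI[of _ "\<lambda>_. 0"])
qed

lemma bij_betw_div_mod: "bij_betw (\<lambda>I. (I div m, I mod m)) {..<n * m} ({..<n} \<times> {..<m :: nat})"
proof (rule bij_betwI[of _ _ _ "\<lambda>(i,k). i * m + k"])
  show "(\<lambda>I. (I div m, I mod m)) \<in> {..<n * m} \<rightarrow> {..<n} \<times> {..<m}"
    by (cases "m = 0") (auto simp: less_mult_imp_div_less)
  have "i * m + k < n * m" if "i < n" "k < m" for i k
  proof -
    have "i * m + k < Suc i * m" using that by simp
    also have "\<dots> \<le> n * m" using that by (intro mult_right_mono) auto
    finally show ?thesis .
  qed
  then show "(\<lambda>(i,k). i * m + k) \<in> {..<n} \<times> {..<m} \<rightarrow> {..<n * m}" by auto
qed auto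

lemma bil_bounded_div_mod:
  fixes n m n' m' :: nat
  shows "bil_bounded {..<n * m} {..<n' * m'} (\<lambda>I J. K (I div m, I mod m) (J div m', J mod m')) C \<longleftrightarrow>
   bil_bounded ({..<n} \<times> {..<m}) ({..<n'} \<times> {..<m'}) K C"
  using bil_bounded_image[of "\<lambda>I. (I div m, I mod m)" "{..<n * m}" "\<lambda>I. (I div m', I mod m')" "{..<n' * m'}" K C]
    bij_betw_div_mod[of m n] bij_betw_div_mod[of m' n']
  by (simp add: bij_betw_def)

text \<open>Removes the encoding of index pairs by single numbers. From here on, tensor products of
  matrices are indexed by pairs, and all estimates are made there.\<close>

lemma opnorm_mat_pair_le_iff:
  assumes "0 \<le> C"
  shows "opnorm (n * m) (n * m) (mat_pair B m a b) \<le> C \<longleftrightarrow>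
    bil_bounded ({..<n} \<times> {..<m}) ({..<n} \<times> {..<m}) (\<lambda>(i,k) (j,l). B (a i j) (b k l)) C"
  using bil_bounded_div_mod[of n m n m "\<lambda>(i,k) (j,l). B (a i j) (b k l)" C]
  by (simp add: opnorm_le_iff[OF assms] mat_pair_def)

text \<open>Pythagoras: for a block diagonal matrix the squares of the norms of the two components
  add up in the domain as well as in the range.\<close>

lemma bil_bounded_dsum:
  assumes fin: "finite I" "finite I'" "finite J" "finite J'"
    and disj: "I \<inter> I' = {}" "J \<inter> J' = {}"
    and K: "bil_bounded I J K C" "bil_bounded I' J' K C" and C: "0 \<le> C"
    and off: "\<And>i j. i \<in> I \<Longrightarrow> j \<in> J' \<Longrightarrow> K i j = 0" "\<And>i j. i \<in> I' \<Longrightarrow> j \<in> J \<Longrightarrow> K i j = 0"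
  shows "bil_bounded (I \<union> I') (J \<union> J') K C"
proof -
  have "L2_set (\<lambda>i. cmod (\<Sum>j\<in>J \<union> J'. K i j * z j)) (I \<union> I') \<le> C * L2_set (\<lambda>j. cmod (z j)) (J \<union> J')" for z
  proof -
    have sq: "(L2_set f A)\<^sup>2 = (\<Sum>i\<in>A. (f i)\<^sup>2)" for f and A :: "'x set"
      by (simp add: L2_set_def sum_nonneg)
    have "(L2_set (\<lambda>i. cmod (\<Sum>j\<in>J \<union> J'. K i j * z j)) (I \<union> I'))\<^sup>2
        = (\<Sum>i\<in>I. (cmod (\<Sum>j\<in>J. K i j * z j))\<^sup>2) + (\<Sum>i\<in>I'. (cmod (\<Sum>j\<in>J'. K i j * z j))\<^sup>2)"
      using fin disj off by (simp add: sq sum.union_disjoint)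
    also have "\<dots> \<le> (C * L2_set (\<lambda>j. cmod (z j)) J)\<^sup>2 + (C * L2_set (\<lambda>j. cmod (z j)) J')\<^sup>2"
      unfolding sq[symmetric] using fin C
      by (intro add_mono power_mono bil_bounded_column K) auto
    also have "\<dots> = (C * L2_set (\<lambda>j. cmod (z j)) (J \<union> J'))\<^sup>2"
      using fin disj by (simp add: power_mult_distrib sq sum.union_disjoint algebra_simps)
    finally show ?thesis by (rule power2_le_imp_le) (simp add: C)
  qed
  then show ?thesis using fin C by (subst bil_bounded_iff_column) auto
qed

section \<open>Matrix norms defined by a pairing\<close>

text \<open>Common form of the two matrix norms of the proof, so that Ruan's axioms are verified
  once. For the Fourier algebra \<open>\<Theta>\<close> is the unit ball of matrices over the von
  Neumann algebra; for the module it consists of difference matrices of finitely many group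
  elements, one family for each piece.\<close>

definition pair_norm :: "('u \<Rightarrow> 'v \<Rightarrow> complex) \<Rightarrow> (nat \<times> 'v mat) set \<Rightarrow> nat \<Rightarrow> 'u mat \<Rightarrow> real" where
  "pair_norm B \<Theta> n u = Sup {opnorm (n * m) (n * m) (mat_pair B m u \<tau>) | m \<tau>. (m, \<tau>) \<in> \<Theta>}"

abbreviation pair_bounded ::
  "('u \<Rightarrow> 'v \<Rightarrow> complex) \<Rightarrow> nat \<Rightarrow> 'u mat \<Rightarrow> nat \<Rightarrow> 'v mat \<Rightarrow> real \<Rightarrow> bool" where
  "pair_bounded B n u m \<tau> C \<equiv>
     bil_bounded ({..<n} \<times> {..<m}) ({..<n} \<times> {..<m}) (\<lambda>(i,k) (j,l). B (u i j) (\<tau> k l)) C"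

lemma mat_compress_mats:
  assumes "cfun.subspace V" "x \<in> mats n V"
  shows "mat_compress n \<alpha> x \<beta> \<in> mats m V"
  using assms by (auto simp: mats_def mat_compress_def intro!: cfun.subspace_sum cfun.subspace_scale)

lemma L2_set_lessThan_1: "L2_set f {..<Suc 0} = \<bar>f 0\<bar>"
  by (simp add: L2_set_def)

text \<open>\<open>pair_bdd\<close> makes the suprema finite and \<open>separating\<close> makes the
  norms definite; the remaining axioms of Ruan follow from bilinearity alone. Completeness is a
  matter of the particular space and is proved separately in the two instances.\<close>

locale pairing_space =
  fixes V :: "('i \<Rightarrow> complex) set" and B :: "('i \<Rightarrow> complex) \<Rightarrow> 'v \<Rightarrow> complex"
    and \<Theta> :: "(nat \<times> 'v mat) set"
  assumes subspace_V: "cfun.subspace V"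
    and nonempty: "\<Theta> \<noteq> {}"
    and pair_add: "(m, \<tau>) \<in> \<Theta> \<Longrightarrow> k < m \<Longrightarrow> l < m \<Longrightarrow> u \<in> V \<Longrightarrow> u' \<in> V \<Longrightarrow>
      B (u + u') (\<tau> k l) = B u (\<tau> k l) + B u' (\<tau> k l)"
    and pair_smul: "(m, \<tau>) \<in> \<Theta> \<Longrightarrow> k < m \<Longrightarrow> l < m \<Longrightarrow> u \<in> V \<Longrightarrow>
      B (smul c u) (\<tau> k l) = c * B u (\<tau> k l)"
    and pair_bdd: "u \<in> V \<Longrightarrow>
      \<exists>C\<ge>0. \<forall>(m, \<tau>)\<in>\<Theta>. bil_bounded {..<m} {..<m} (\<lambda>k l. B u (\<tau> k l)) C"
    and separating: "u \<in> V \<Longrightarrow> (\<And>m \<tau> k l. (m, \<tau>) \<in> \<Theta> \<Longrightarrow> k < m \<Longrightarrow> l < m \<Longrightarrow> B u (\<tau> k l) = 0) \<Longrightarrow> u = 0"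
begin

abbreviation "N \<equiv> pair_norm B \<Theta>"

lemma pair_zero: "(m, \<tau>) \<in> \<Theta> \<Longrightarrow> k < m \<Longrightarrow> l < m \<Longrightarrow> B 0 (\<tau> k l) = 0"
  using pair_smul[of m \<tau> k l 0 0] cfun.subspace_0[OF subspace_V] by simp

lemma pair_sum:
  assumes "(m, \<tau>) \<in> \<Theta>" "k < m" "l < m" "\<And>s. s \<in> S \<Longrightarrow> u s \<in> V"
  shows "B (\<Sum>s\<in>S. u s) (\<tau> k l) = (\<Sum>s\<in>S. B (u s) (\<tau> k l))"
  using assms(4)
  by (induction S rule: infinite_finite_induct)
     (auto simp: pair_zero[OF assms(1-3)] pair_add[OF assms(1-3)] cfun.subspace_sum[OF subspace_V])

lemma exists_bound:
  assumes "u \<in> mats n V"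
  shows "\<exists>C\<ge>0. \<forall>(m, \<tau>)\<in>\<Theta>. pair_bounded B n u m \<tau> C"
proof -
  define P where "P = (\<lambda>i j C. C \<ge> 0 \<and> (\<forall>m \<tau>. (m, \<tau>) \<in> \<Theta> \<longrightarrow>
    bil_bounded {..<m} {..<m} (\<lambda>k l. B (u i j) (\<tau> k l)) C))"
  have "\<forall>i<n. \<forall>j<n. \<exists>C. P i j C"
    unfolding P_def using assms pair_bdd by (fastforce simp: mats_def)
  then obtain C where "\<And>i j. i < n \<Longrightarrow> j < n \<Longrightarrow> P i j (C i j)" by metis
  then have C: "\<And>i j. i < n \<Longrightarrow> j < n \<Longrightarrow> C i j \<ge> 0"
    "\<And>i j m \<tau>. i < n \<Longrightarrow> j < n \<Longrightarrow> (m, \<tau>) \<in> \<Theta> \<Longrightarrow> bil_bounded {..<m} {..<m} (\<lambda>k l. B (u i j) (\<tau> k l)) (C i j)"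
    by (auto simp: P_def)
  have "pair_bounded B n u m \<tau> (\<Sum>i<n. \<Sum>j<n. C i j)" if "(m, \<tau>) \<in> \<Theta>" for m \<tau>
    using that C by (intro bil_bounded_blocks) auto
  moreover have "(\<Sum>i<n. \<Sum>j<n. C i j) \<ge> 0" using C by (intro sum_nonneg) auto
  ultimately show ?thesis by auto
qed

lemma pair_norm_le:
  assumes "0 \<le> C" "\<And>m \<tau>. (m, \<tau>) \<in> \<Theta> \<Longrightarrow> pair_bounded B n u m \<tau> C"
  shows "N n u \<le> C"
  unfolding pair_norm_def using assms nonempty
  by (intro cSup_least) (auto simp: opnorm_mat_pair_le_iff)

lemma pair_norm_bound:
  assumes u: "u \<in> mats n V" and "(m, \<tau>) \<in> \<Theta>"
  shows "pair_bounded B n u m \<tau> (N n u)" and pair_norm_nonneg: "0 \<le> N n u"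
proof -
  obtain C where C: "C \<ge> 0" "\<And>m \<tau>. (m, \<tau>) \<in> \<Theta> \<Longrightarrow> pair_bounded B n u m \<tau> C"
    using exists_bound[OF u] by auto
  have "opnorm (n * m) (n * m) (mat_pair B m u \<tau>) \<le> N n u"
    unfolding pair_norm_def
  proof (rule cSup_upper)
    show "bdd_above {opnorm (n * m) (n * m) (mat_pair B m u \<tau>) | m \<tau>. (m, \<tau>) \<in> \<Theta>}"
      using C by (intro bdd_aboveI[of _ C]) (auto simp: opnorm_mat_pair_le_iff)
  qed (use assms in auto)
  moreover from this show "0 \<le> N n u" using opnorm_nonneg by (rule order_trans[rotated])
  ultimately show "pair_bounded B n u m \<tau> (N n u)"
    by (simp add: opnorm_mat_pair_le_iff)
qed

lemma pair_norm_nonneg': "u \<in> mats n V \<Longrightarrow> 0 \<le> N n u"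
  using pair_norm_nonneg nonempty by auto

lemma norm_eq_0_iff:
  assumes x: "x \<in> mats n V"
  shows "N n x = 0 \<longleftrightarrow> (\<forall>i<n. \<forall>j<n. x i j = 0)"
proof
  assume 0: "N n x = 0"
  show "\<forall>i<n. \<forall>j<n. x i j = 0"
  proof (intro allI impI)
    fix i j assume ij: "i < n" "j < n"
    show "x i j = 0"
    proof (rule separating)
      show "x i j \<in> V" using x ij by (simp add: mats_def)
      fix m \<tau> k l assume t: "(m, \<tau>) \<in> \<Theta>" "k < m" "l < m"
      from bil_bounded_entry[OF pair_norm_bound(1)[OF x t(1)], of "(i,k)" "(j,l)"] ij t
      show "B (x i j) (\<tau> k l) = 0" by (simp add: 0)
    qed
  qed
next
  assume *: "\<forall>i<n. \<forall>j<n. x i j = 0"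
  have "N n x \<le> 0"
  proof (rule pair_norm_le)
    fix m \<tau> assume t: "(m, \<tau>) \<in> \<Theta>"
    have "pair_bounded B n x m \<tau> 0 \<longleftrightarrow> bil_bounded ({..<n} \<times> {..<m}) ({..<n} \<times> {..<m}) (\<lambda>_ _. 0) 0"
      using * by (intro bil_bounded_cong) (auto simp: pair_zero[OF t])
    then show "pair_bounded B n x m \<tau> 0" by (simp add: bil_bounded_zero)
  qed simp
  then show "N n x = 0" using pair_norm_nonneg'[OF x] by simp
qed

lemma norm_smul_le:
  assumes x: "x \<in> mats n V"
  shows "N n (\<lambda>i j. smul c (x i j)) \<le> cmod c * N n x"
proof (rule pair_norm_le)
  show "0 \<le> cmod c * N n x" using pair_norm_nonneg'[OF x] by simp
  fix m \<tau> assume t: "(m, \<tau>) \<in> \<Theta>"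
  show "pair_bounded B n (\<lambda>i j. smul c (x i j)) m \<tau> (cmod c * N n x)"
    by (rule iffD2[OF bil_bounded_cong bil_bounded_scale[OF pair_norm_bound(1)[OF x t], of c]])
       (use x in \<open>auto simp: mats_def pair_smul[OF t]\<close>)
qed

lemma norm_smul:
  assumes x: "x \<in> mats n V"
  shows "N n (\<lambda>i j. smul c (x i j)) = cmod c * N n x"
proof (cases "c = 0")
  case True
  have "(\<lambda>i j. smul 0 (x i j)) \<in> mats n V"
    using x by (auto simp: mats_def cfun.subspace_0[OF subspace_V])
  from norm_eq_0_iff[OF this] True show ?thesis by (simp add: cfun.subspace_0[OF subspace_V])
next
  case False
  have "N n (\<lambda>i j. smul (1 / c) (smul c (x i j))) \<le> cmod (1 / c) * N n (\<lambda>i j. smul c (x i j))"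
    using x by (intro norm_smul_le) (auto simp: mats_def intro!: cfun.subspace_scale[OF subspace_V])
  then have "cmod c * N n x \<le> N n (\<lambda>i j. smul c (x i j))"
    using False by (simp add: norm_divide field_simps smul_def del: cfun.scale_scale)
  with norm_smul_le[OF x, of c] show ?thesis by simp
qed

lemma norm_triangle:
  assumes x: "x \<in> mats n V" and y: "y \<in> mats n V"
  shows "N n (x + y) \<le> N n x + N n y"
proof (rule pair_norm_le)
  show "0 \<le> N n x + N n y" using pair_norm_nonneg'[OF x] pair_norm_nonneg'[OF y] by simp
  fix m \<tau> assume t: "(m, \<tau>) \<in> \<Theta>"
  show "pair_bounded B n (x + y) m \<tau> (N n x + N n y)"
    by (rule iffD2[OF bil_bounded_cong bil_bounded_add[OF pair_norm_bound(1)[OF x t] pair_norm_bound(1)[OF y t]]])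
       (use x y in \<open>auto simp: mats_def pair_add[OF t]\<close>)
qed

text \<open>Tested against a matrix \<open>\<tau>\<close>, a direct sum is block diagonal, which
  gives the upper bound. The lower bounds come from restriction to the two diagonal blocks.\<close>

lemma norm_dsum:
  assumes x: "x \<in> mats n V" and y: "y \<in> mats n' V"
  shows "N (n + n') (mat_dsum n x y) = max (N n x) (N n' y)"
proof -
  let ?z = "mat_dsum n x y"
  have z: "?z \<in> mats (n + n') V"
    using x y cfun.subspace_0[OF subspace_V] by (auto simp: mats_def mat_dsum_def)
  have inj: "inj_on (\<lambda>(i,k). (n + i, k)) A" for A :: "(nat \<times> nat) set" by (auto simp: inj_on_def)
  have img: "(\<lambda>(i,k). (n + i, k)) ` ({..<n'} \<times> {..<m}) = {n..<n + n'} \<times> {..<m}" for m :: nat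
  proof -
    have "(a, b) \<in> (\<lambda>(i,k). (n + i, k)) ` ({..<n'} \<times> {..<m})" if "n \<le> a" "a < n + n'" "b < m" for a b
      using that by (intro image_eqI[of _ _ "(a - n, b)"]) auto
    then show ?thesis by auto
  qed
  have lower: "bil_bounded ({n..<n + n'} \<times> {..<m}) ({n..<n + n'} \<times> {..<m}) (\<lambda>(i,k) (j,l). B (?z i j) (\<tau> k l)) C
      \<longleftrightarrow> pair_bounded B n' y m \<tau> C" for m \<tau> C
    unfolding img[symmetric]
    by (subst bil_bounded_image[OF inj inj], rule bil_bounded_cong) (auto simp: mat_dsum_def)
  have upper: "bil_bounded ({..<n} \<times> {..<m}) ({..<n} \<times> {..<m}) (\<lambda>(i,k) (j,l). B (?z i j) (\<tau> k l)) C
      \<longleftrightarrow> pair_bounded B n x m \<tau> C" for m \<tau> C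
    by (rule bil_bounded_cong) (auto simp: mat_dsum_def)
  have "N (n + n') ?z \<le> max (N n x) (N n' y)"
  proof (rule pair_norm_le)
    show C: "0 \<le> max (N n x) (N n' y)" using pair_norm_nonneg'[OF x] by simp
    fix m \<tau> assume t: "(m, \<tau>) \<in> \<Theta>"
    have "{..<n + n'} \<times> {..<m} = {..<n} \<times> {..<m} \<union> {n..<n + n'} \<times> {..<m}" by auto
    moreover have "bil_bounded ({..<n} \<times> {..<m} \<union> {n..<n + n'} \<times> {..<m}) ({..<n} \<times> {..<m} \<union> {n..<n + n'} \<times> {..<m})
        (\<lambda>(i,k) (j,l). B (?z i j) (\<tau> k l)) (max (N n x) (N n' y))"
    proof (rule bil_bounded_dsum[OF _ _ _ _ _ _ _ _ C])
      show "bil_bounded ({..<n} \<times> {..<m}) ({..<n} \<times> {..<m}) (\<lambda>(i,k) (j,l). B (?z i j) (\<tau> k l)) (max (N n x) (N n' y))"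
        unfolding upper by (rule bil_bounded_mono[OF pair_norm_bound(1)[OF x t]]) simp
      show "bil_bounded ({n..<n + n'} \<times> {..<m}) ({n..<n + n'} \<times> {..<m}) (\<lambda>(i,k) (j,l). B (?z i j) (\<tau> k l)) (max (N n x) (N n' y))"
        unfolding lower by (rule bil_bounded_mono[OF pair_norm_bound(1)[OF y t]]) simp
    qed (auto simp: mat_dsum_def pair_zero[OF t])
    ultimately show "pair_bounded B (n + n') ?z m \<tau> (max (N n x) (N n' y))" by simp
  qed
  moreover have "N n x \<le> N (n + n') ?z"
  proof (rule pair_norm_le)
    fix m \<tau> assume t: "(m, \<tau>) \<in> \<Theta>"
    show "pair_bounded B n x m \<tau> (N (n + n') ?z)"
      unfolding upper[symmetric] by (rule bil_bounded_subset[OF pair_norm_bound(1)[OF z t]]) auto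
  qed (rule pair_norm_nonneg'[OF z])
  moreover have "N n' y \<le> N (n + n') ?z"
  proof (rule pair_norm_le)
    fix m \<tau> assume t: "(m, \<tau>) \<in> \<Theta>"
    show "pair_bounded B n' y m \<tau> (N (n + n') ?z)"
      unfolding lower[symmetric] by (rule bil_bounded_subset[OF pair_norm_bound(1)[OF z t]]) auto
  qed (rule pair_norm_nonneg'[OF z])
  ultimately show ?thesis by simp
qed

text \<open>Testing against \<open>\<tau>\<close> turns the compression into a product of three
  matrices: \<open>\<alpha>\<close> tensor the identity, the tested matrix of \<open>x\<close>, and
  \<open>\<beta>\<close> tensor the identity. Tensoring with the identity does not enlarge the
  norm.\<close>

lemma norm_compress:
  assumes x: "x \<in> mats n V"
  shows "N m (mat_compress n \<alpha> x \<beta>) \<le> opnorm m n \<alpha> * N n x * opnorm n m \<beta>"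
proof (rule pair_norm_le)
  show C: "0 \<le> opnorm m n \<alpha> * N n x * opnorm n m \<beta>"
    using pair_norm_nonneg'[OF x] by (simp add: opnorm_nonneg)
  fix d \<tau> assume t: "(d, \<tau>) \<in> \<Theta>"
  let ?S = "{..<d}"
  have a: "bil_bounded ({..<m} \<times> ?S) ({..<n} \<times> ?S) (\<lambda>(i,s) (j,t). if s = t then \<alpha> i j else 0) (opnorm m n \<alpha>)"
    by (intro bil_bounded_tensor_id bil_bounded_opnorm opnorm_nonneg) auto
  have b: "bil_bounded ({..<n} \<times> ?S) ({..<m} \<times> ?S) (\<lambda>(i,s) (j,t). if s = t then \<beta> i j else 0) (opnorm n m \<beta>)"
    by (intro bil_bounded_tensor_id bil_bounded_opnorm opnorm_nonneg) auto
  have "bil_bounded ({..<m} \<times> ?S) ({..<m} \<times> ?S)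
      (\<lambda>p q. \<Sum>r\<in>{..<n} \<times> ?S. (\<Sum>r'\<in>{..<n} \<times> ?S. (\<lambda>(i,s) (j,t). if s = t then \<alpha> i j else 0) p r'
          * (\<lambda>(i,k) (j,l). B (x i j) (\<tau> k l)) r' r) * (\<lambda>(i,s) (j,t). if s = t then \<beta> i j else 0) r q)
      (opnorm m n \<alpha> * N n x * opnorm n m \<beta>)"
    by (intro bil_bounded_mult[OF bil_bounded_mult[OF a pair_norm_bound(1)[OF x t]] b])
       (auto simp: opnorm_nonneg pair_norm_nonneg'[OF x])
  then show "pair_bounded B m (mat_compress n \<alpha> x \<beta>) d \<tau> (opnorm m n \<alpha> * N n x * opnorm n m \<beta>)"
  proof (rule iffD1[OF bil_bounded_cong, rotated])
    fix p q assume pq: "p \<in> {..<m} \<times> ?S" "q \<in> {..<m} \<times> ?S"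
    obtain i s j u where [simp]: "p = (i, s)" "q = (j, u)" by (cases p; cases q)
    have su: "s < d" "u < d" using pq by auto
    have V: "smul c (x k l) \<in> V" if "k < n" "l < n" for c k l
      using x that by (auto simp: mats_def intro!: cfun.subspace_scale[OF subspace_V])
    have VS: "(\<Sum>l<n. smul (c l) (x k l)) \<in> V" if "k < n" for c k
      using V that by (intro cfun.subspace_sum[OF subspace_V]) auto
    have inner: "(\<Sum>k<n. \<Sum>t<d. (if s = t then \<alpha> i k else 0) * B (x k l) (\<tau> t v))
        = (\<Sum>k<n. \<alpha> i k * B (x k l) (\<tau> s v))" for l v
    proof -
      have "(\<Sum>k<n. \<Sum>t<d. (if s = t then \<alpha> i k else 0) * B (x k l) (\<tau> t v))
         = (\<Sum>k<n. \<Sum>t<d. if t = s then \<alpha> i k * B (x k l) (\<tau> t v) else 0)"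
        by (intro sum.cong refl) auto
      also have "\<dots> = (\<Sum>k<n. \<alpha> i k * B (x k l) (\<tau> s v))" using su by simp
      finally show ?thesis .
    qed
    have "(\<Sum>r\<in>{..<n} \<times> ?S. (\<Sum>r'\<in>{..<n} \<times> ?S. (\<lambda>(i,s) (j,t). if s = t then \<alpha> i j else 0) p r'
          * (\<lambda>(i,k) (j,l). B (x i j) (\<tau> k l)) r' r) * (\<lambda>(i,s) (j,t). if s = t then \<beta> i j else 0) r q)
        = (\<Sum>l<n. \<Sum>v<d. (\<Sum>k<n. \<alpha> i k * B (x k l) (\<tau> s v)) * (if v = u then \<beta> l j else 0))"
      unfolding sum.cartesian_product' by (intro sum.cong refl) (simp add: inner)
    also have "\<dots> = (\<Sum>l<n. \<Sum>v<d. if v = u then (\<Sum>k<n. \<alpha> i k * B (x k l) (\<tau> s v)) * \<beta> l j else 0)"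
      by (intro sum.cong refl) auto
    also have "\<dots> = (\<Sum>l<n. (\<Sum>k<n. \<alpha> i k * B (x k l) (\<tau> s u)) * \<beta> l j)" using su by simp
    also have "\<dots> = (\<Sum>k<n. \<Sum>l<n. \<alpha> i k * \<beta> l j * B (x k l) (\<tau> s u))"
      unfolding sum_distrib_right by (subst sum.swap) (simp add: mult_ac)
    also have "\<dots> = (\<Sum>k<n. \<Sum>l<n. B (smul (\<alpha> i k * \<beta> l j) (x k l)) (\<tau> s u))"
      using x by (intro sum.cong refl) (simp add: mats_def pair_smul[OF t su])
    also have "\<dots> = (\<Sum>k<n. B (\<Sum>l<n. smul (\<alpha> i k * \<beta> l j) (x k l)) (\<tau> s u))"
      using V by (intro sum.cong refl pair_sum[OF t su, symmetric]) auto
    also have "\<dots> = B (mat_compress n \<alpha> x \<beta> i j) (\<tau> s u)"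
      unfolding mat_compress_def using VS by (intro pair_sum[OF t su, symmetric]) auto
    finally show "(\<Sum>r\<in>{..<n} \<times> ?S. (\<Sum>r'\<in>{..<n} \<times> ?S. (\<lambda>(i,s) (j,t). if s = t then \<alpha> i j else 0) p r'
          * (\<lambda>(i,k) (j,l). B (x i j) (\<tau> k l)) r' r) * (\<lambda>(i,s) (j,t). if s = t then \<beta> i j else 0) r q)
        = (case p of (i,k) \<Rightarrow> \<lambda>(j,l). B (mat_compress n \<alpha> x \<beta> i j) (\<tau> k l)) q"
      by simp
  qed
qed

lemma operator_spaceI:
  assumes "\<And>s. (\<And>k. s k \<in> V) \<Longrightarrow>
        (\<And>e. e > 0 \<Longrightarrow> \<exists>K. \<forall>k\<ge>K. \<forall>l\<ge>K. N 1 (\<lambda>_ _. s k - s l) < e) \<Longrightarrow>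
        \<exists>v\<in>V. (\<lambda>k. N 1 (\<lambda>_ _. s k - v)) \<longlonglongrightarrow> 0"
  shows "operator_space V N"
  by unfold_locales
     (use subspace_V norm_eq_0_iff norm_smul norm_triangle norm_dsum norm_compress assms in auto)

lemma pair_norm_1_le:
  assumes "0 \<le> C" "\<And>m \<tau>. (m, \<tau>) \<in> \<Theta> \<Longrightarrow> bil_bounded {..<m} {..<m} (\<lambda>k l. B u (\<tau> k l)) C"
  shows "N 1 (\<lambda>_ _. u) \<le> C"
proof (rule pair_norm_le[OF assms(1)])
  fix m \<tau> assume t: "(m, \<tau>) \<in> \<Theta>"
  have "{..<1::nat} \<times> {..<m} = (\<lambda>k. (0, k)) ` {..<m}" by auto
  then show "pair_bounded B 1 (\<lambda>_ _. u) m \<tau> C"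
    using assms(2)[OF t] by (simp add: bil_bounded_image inj_on_def)
qed

lemma pair_norm_1_bound:
  assumes "u \<in> V" "(m, \<tau>) \<in> \<Theta>"
  shows "bil_bounded {..<m} {..<m} (\<lambda>k l. B u (\<tau> k l)) (N 1 (\<lambda>_ _. u))"
proof -
  have "pair_bounded B 1 (\<lambda>_ _. u) m \<tau> (N 1 (\<lambda>_ _. u))"
    using assms by (intro pair_norm_bound(1)) (auto simp: mats_def)
  moreover have "{..<1::nat} \<times> {..<m} = (\<lambda>k. (0, k)) ` {..<m}" by auto
  ultimately show ?thesis by (simp add: bil_bounded_image inj_on_def)
qed

end

section \<open>Consequences of Ruan's axioms\<close>

context operator_space
begin

text \<open>The difference of the two matrices vanishes on the relevant entries and has norm 0, so
  the triangle inequality applies. It allows replacing matrices that are functions on all of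
  \<open>nat\<close> by others with the same entries below \<open>n\<close>.\<close>

lemma norm_le_cong:
  assumes x: "x \<in> mats n V" and y: "y \<in> mats n V" and "\<And>i j. i < n \<Longrightarrow> j < n \<Longrightarrow> x i j = y i j"
  shows "N n x \<le> N n y"
proof -
  let ?d = "\<lambda>i j. x i j - y i j"
  have d: "?d \<in> mats n V"
    using x y by (auto simp: mats_def intro!: cfun.subspace_diff[OF subspace])
  have "N n x = N n (y + ?d)" by (simp add: plus_fun_def)
  also have "\<dots> \<le> N n y + N n ?d" using y d by (rule norm_triangle)
  also have "N n ?d = 0" using d assms(3) by (subst norm_eq_0_iff) auto
  finally show ?thesis by simp
qed

text \<open>Comes from writing 0 as \<open>x + (-1) x\<close> and applying the triangle inequality
  and homogeneity.\<close>

lemma norm_nonneg: "x \<in> mats n V \<Longrightarrow> 0 \<le> N n x"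
proof -
  assume x: "x \<in> mats n V"
  have m: "(\<lambda>i j. smul (-1) (x i j)) \<in> mats n V"
    using x by (auto simp: mats_def intro!: cfun.subspace_neg[OF subspace])
  have "N n (x + (\<lambda>i j. smul (-1) (x i j))) \<le> N n x + N n (\<lambda>i j. smul (-1) (x i j))"
    by (rule norm_triangle[OF x m])
  moreover have "N n (x + (\<lambda>i j. smul (-1) (x i j))) = 0"
  proof -
    have z: "x + (\<lambda>i j. smul (-1) (x i j)) = (\<lambda>i j. 0)" by (auto simp: fun_eq_iff smul_def)
    show ?thesis unfolding z
      by (subst norm_eq_0_iff) (auto simp: mats_def cfun.subspace_0[OF subspace])
  qed
  ultimately show ?thesis using norm_smul[OF x, of "-1"] by simp
qed

text \<open>The bilinear form in \<open>w\<close> and \<open>z\<close> is the value of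
  \<open>\<psi>\<close> at the compression of \<open>x\<close> by the row \<open>w\<close> and the
  column \<open>z\<close>, so a bounded functional is completely bounded with the same constant.
  This keeps the supremum in \<open>dual_mnorm\<close> finite at level one.\<close>

lemma functional_completely_bounded:
  assumes add: "\<And>x y. x \<in> V \<Longrightarrow> y \<in> V \<Longrightarrow> \<psi> (x + y) = \<psi> x + \<psi> y"
    and hom: "\<And>c x. x \<in> V \<Longrightarrow> \<psi> (smul c x) = c * \<psi> x"
    and bd: "\<And>x. x \<in> V \<Longrightarrow> cmod (\<psi> x) \<le> C * N 1 (\<lambda>_ _. x)" and C: "0 \<le> C"
    and x: "x \<in> mats m V"
  shows "bil_bounded {..<m} {..<m} (\<lambda>k l. \<psi> (x k l)) (C * N m x)"
  unfolding bil_bounded_def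
proof (intro allI)
  fix w z :: "nat \<Rightarrow> complex"
  have V0: "0 \<in> V" by (rule cfun.subspace_0[OF subspace])
  have psi0: "\<psi> 0 = 0" using hom[OF V0, of 0] by simp
  have psum: "\<psi> (\<Sum>s\<in>S. u s) = (\<Sum>s\<in>S. \<psi> (u s))" if "\<And>s. s \<in> S \<Longrightarrow> u s \<in> V" for S :: "nat set" and u
    using that by (induction S rule: infinite_finite_induct)
      (auto simp: psi0 add cfun.subspace_sum[OF subspace])
  have xV: "smul c (x k l) \<in> V" if "k < m" "l < m" for c k l
    using x that by (auto simp: mats_def intro!: cfun.subspace_scale[OF subspace])
  define y where "y = (\<Sum>k<m. \<Sum>l<m. smul (w k * z l) (x k l))"
  have yV: "y \<in> V"
    unfolding y_def using xV by (intro cfun.subspace_sum[OF subspace]) auto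
  have "\<psi> y = (\<Sum>k<m. \<Sum>l<m. \<psi> (smul (w k * z l) (x k l)))"
    unfolding y_def using xV by (subst psum) (auto intro!: cfun.subspace_sum[OF subspace] sum.cong psum)
  also have "\<dots> = (\<Sum>k<m. \<Sum>l<m. w k * \<psi> (x k l) * z l)"
    using x by (intro sum.cong refl) (simp add: hom mats_def)
  finally have eq: "\<psi> y = (\<Sum>k<m. \<Sum>l<m. w k * \<psi> (x k l) * z l)" .
  have "N 1 (\<lambda>_ _. y) = N 1 (mat_compress m (\<lambda>_ k. w k) x (\<lambda>l _. z l))"
    by (simp add: y_def mat_compress_def)
  also have "\<dots> \<le> opnorm 1 m (\<lambda>_ k. w k) * N m x * opnorm m 1 (\<lambda>l _. z l)"
    by (rule norm_compress[OF x])
  also have "\<dots> \<le> L2_set (\<lambda>k. cmod (w k)) {..<m} * N m x * L2_set (\<lambda>k. cmod (z k)) {..<m}"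
  proof (intro mult_mono)
    show "opnorm 1 m (\<lambda>_ k. w k) \<le> L2_set (\<lambda>k. cmod (w k)) {..<m}"
    proof (subst opnorm_le_iff, simp, subst bil_bounded_iff_column, safe)
      fix z' :: "nat \<Rightarrow> complex"
      have "cmod (\<Sum>j<m. w j * z' j) \<le> (\<Sum>j<m. \<bar>cmod (w j)\<bar> * \<bar>cmod (z' j)\<bar>)"
        by (rule order_trans[OF norm_sum]) (simp add: norm_mult)
      also have "\<dots> \<le> L2_set (\<lambda>j. cmod (w j)) {..<m} * L2_set (\<lambda>j. cmod (z' j)) {..<m}"
        by (rule L2_set_mult_ineq)
      finally show "L2_set (\<lambda>i. cmod (\<Sum>j<m. w j * z' j)) {..<1::nat}
          \<le> L2_set (\<lambda>j. cmod (w j)) {..<m} * L2_set (\<lambda>j. cmod (z' j)) {..<m}"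
        by (simp add: L2_set_lessThan_1)
    qed auto
    show "opnorm m 1 (\<lambda>l _. z l) \<le> L2_set (\<lambda>k. cmod (z k)) {..<m}"
    proof (subst opnorm_le_iff, simp, subst bil_bounded_iff_column, safe)
      fix z' :: "nat \<Rightarrow> complex"
      show "L2_set (\<lambda>i. cmod (\<Sum>j<1. z i * z' j)) {..<m}
          \<le> L2_set (\<lambda>j. cmod (z j)) {..<m} * L2_set (\<lambda>j. cmod (z' j)) {..<1::nat}"
        by (simp add: L2_set_lessThan_1 norm_mult L2_set_left_distrib)
    qed auto
  qed (use norm_nonneg[OF x] in \<open>auto simp: opnorm_nonneg\<close>)
  finally have "C * N 1 (\<lambda>_ _. y) \<le> C * (L2_set (\<lambda>k. cmod (w k)) {..<m} * N m x * L2_set (\<lambda>k. cmod (z k)) {..<m})"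
    using C by (rule mult_left_mono)
  then show "cmod (\<Sum>k<m. \<Sum>l<m. w k * \<psi> (x k l) * z l)
      \<le> C * N m x * L2_set (\<lambda>k. cmod (w k)) {..<m} * L2_set (\<lambda>k. cmod (z k)) {..<m}"
    using bd[OF yV] by (simp add: eq mult_ac)
qed

end

subsection \<open>Jointly completely bounded bilinear maps\<close>

lemma tensor_space_sum_list:
  assumes V: "cfun.subspace V" and W: "cfun.subspace W" and "x \<in> tensor_space V W"
  shows "\<exists>xs. set xs \<subseteq> V \<times> W \<and> x = sum_list (map (\<lambda>(v, w). tens v w) xs)"
  using assms(3) unfolding tensor_space_def
proof (induction rule: cfun.span_induct_alt)
  case base
  show ?case by (rule exI[of _ "[]"]) simp
next
  case (step c x y)
  then obtain v w xs where *: "x = tens v w" "v \<in> V" "w \<in> W" "set xs \<subseteq> V \<times> W"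
    "y = sum_list (map (\<lambda>(v, w). tens v w) xs)" by auto
  have "smul c x = tens (smul c v) w" by (auto simp: * tens_def smul_def fun_eq_iff)
  then show ?case
    using * cfun.subspace_scale[OF V] by (intro exI[of _ "(smul c v, w) # xs"]) auto
qed

text \<open>The infimum in \<open>proj_mnorm\<close> runs over representations of this kind, and its
  estimate from below needs at least one of them.\<close>

lemma tensor_representation:
  assumes V: "cfun.subspace V" and W: "cfun.subspace W" and u: "u \<in> mats n (tensor_space V W)"
  shows "\<exists>p q \<alpha> v w \<beta>. v \<in> mats p V \<and> w \<in> mats q W \<and>
    (\<forall>i<n. \<forall>j<n. u i j = mat_compress (p * q) \<alpha> (mat_pair tens q v w) \<beta> i j)"
proof -
  have "\<forall>i<n. \<forall>j<n. \<exists>xs. set xs \<subseteq> V \<times> W \<and> u i j = sum_list (map (\<lambda>(v, w). tens v w) xs)"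
    using u tensor_space_sum_list[OF V W] by (auto simp: mats_def)
  then obtain xs where xs: "\<And>i j. i < n \<Longrightarrow> j < n \<Longrightarrow> set (xs i j) \<subseteq> V \<times> W"
    "\<And>i j. i < n \<Longrightarrow> j < n \<Longrightarrow> u i j = sum_list (map (\<lambda>(v, w). tens v w) (xs i j))"
    by metis
  \<comment> \<open>One list of all elementary tensors that occur in any entry, each marked with the
    position \<open>(i, j)\<close> of its entry.\<close>
  define zs where "zs = concat (map (\<lambda>i. concat (map (\<lambda>j. map (\<lambda>y. ((i, j), y)) (xs i j)) [0..<n])) [0..<n])"
  have set_zs: "y \<in> V \<times> W" if "(ij, y) \<in> set zs" for ij y
    using that xs(1) by (auto simp: zs_def) blast+
  have sum_zs: "(\<Sum>x\<leftarrow>zs. if fst x = (i, j) then (case snd x of (v, w) \<Rightarrow> tens v w) else 0) = u i j"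
    if ij: "i < n" "j < n" for i j
  proof -
    have concat: "sum_list (map f (concat (map g ls))) = (\<Sum>k\<leftarrow>ls. sum_list (map f (g k)))"
      for f :: "(nat \<times> nat) \<times> ('a \<Rightarrow> complex) \<times> ('b \<Rightarrow> complex) \<Rightarrow> 'a \<times> 'b \<Rightarrow> complex" and g and ls :: "nat list"
      by (induction ls) auto
    have inner: "(\<Sum>x\<leftarrow>map (\<lambda>y. ((i', j'), y)) (xs i' j'). if fst x = (i, j) then (case snd x of (v, w) \<Rightarrow> tens v w) else 0)
        = (if i' = i \<and> j' = j then \<Sum>(v, w)\<leftarrow>xs i j. tens v w else 0)" for i' j'
      by (auto simp: o_def)
    have "(\<Sum>x\<leftarrow>zs. if fst x = (i, j) then (case snd x of (v, w) \<Rightarrow> tens v w) else 0)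
        = (\<Sum>i'<n. \<Sum>j'<n. if i' = i \<and> j' = j then \<Sum>(v, w)\<leftarrow>xs i j. tens v w else 0)"
      unfolding zs_def concat inner interv_sum_list_conv_sum_set_nat atLeast_upt atLeast0LessThan by simp
    also have "\<dots> = (\<Sum>i'<n. if i' = i then \<Sum>j'<n. if j' = j then \<Sum>(v, w)\<leftarrow>xs i j. tens v w else 0 else 0)"
      by (intro sum.cong refl) auto
    also have "\<dots> = u i j" using ij xs(2) by (simp add: sum.delta)
    finally show ?thesis .
  qed
  define L where "L = length zs"
  define r c v w where "r = (\<lambda>a. fst (fst (zs ! a)))" and "c = (\<lambda>a. snd (fst (zs ! a)))"
    and "v = (\<lambda>a. fst (snd (zs ! a)))" and "w = (\<lambda>a. snd (snd (zs ! a)))"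
  have vw: "v a \<in> V" "w a \<in> W" if "a < L" for a
  proof -
    have "(fst (zs ! a), snd (zs ! a)) \<in> set zs" using that by (simp add: L_def)
    from set_zs[OF this] show "v a \<in> V" "w a \<in> W" by (auto simp: v_def w_def mem_Times_iff)
  qed
  \<comment> \<open>The tensor product of these two diagonal matrices contains
    \<open>tens (v a) (w a)\<close> at the diagonal place with index pair \<open>(a, a)\<close>;
    \<open>\<alpha>\<close> moves it to row \<open>r a\<close>, \<open>\<beta>\<close> to column
    \<open>c a\<close>, and both ignore the index pairs with different components.\<close>
  define vv ww where "vv = (\<lambda>a a'. if a = a' then v a else 0)" and "ww = (\<lambda>a a'. if a = a' then w a else 0)"
  define \<alpha> \<beta> :: "complex mat" where "\<alpha> = (\<lambda>i I. if I div L = I mod L \<and> r (I div L) = i then 1 else 0)"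
    and "\<beta> = (\<lambda>I j. if I div L = I mod L \<and> c (I div L) = j then 1 else 0)"
  have "u i j = mat_compress (L * L) \<alpha> (mat_pair tens L vv ww) \<beta> i j" if ij: "i < n" "j < n" for i j
  proof -
    have re: "(\<Sum>I<L * L. f (I div L) (I mod L)) = (\<Sum>a<L. \<Sum>b<L. f a b)"
      for f :: "nat \<Rightarrow> nat \<Rightarrow> 'a \<times> 'b \<Rightarrow> complex"
      using sum.reindex_bij_betw[OF bij_betw_div_mod[of L L], of "\<lambda>(a,b). f a b"]
      by (simp add: sum.cartesian_product case_prod_unfold)
    have t0: "tens 0 y = 0" "tens x 0 = 0" for x :: "'a \<Rightarrow> complex" and y :: "'b \<Rightarrow> complex"
      by (auto simp: tens_def fun_eq_iff)
    have "mat_compress (L * L) \<alpha> (mat_pair tens L vv ww) \<beta> i j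
      = (\<Sum>a<L. \<Sum>b<L. \<Sum>a'<L. \<Sum>b'<L. smul ((if a = b \<and> r a = i then 1 else 0) * (if a' = b' \<and> c a' = j then 1 else 0))
           (tens (vv a a') (ww b b')))"
      unfolding mat_compress_def mat_pair_def \<alpha>_def \<beta>_def
      by (subst re[symmetric], rule sum.cong[OF refl], subst re[symmetric]) simp
    also have "\<dots> = (\<Sum>a<L. \<Sum>b<L. \<Sum>a'<L. \<Sum>b'<L. if b' = a then if a' = a then if b = a then
         (if r a = i \<and> c a = j then tens (v a) (w a) else 0) else 0 else 0 else 0)"
      by (intro sum.cong refl) (auto simp: vv_def ww_def t0)
    also have "\<dots> = (\<Sum>a<L. if r a = i \<and> c a = j then tens (v a) (w a) else 0)"
      by (intro sum.cong refl) simp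
    also have "\<dots> = (\<Sum>x\<leftarrow>zs. if fst x = (i, j) then (case snd x of (v, w) \<Rightarrow> tens v w) else 0)"
      unfolding sum_list_sum_nth
      by (auto simp: L_def atLeast0LessThan r_def c_def v_def w_def case_prod_unfold prod_eq_iff intro!: sum.cong)
    finally show ?thesis using sum_zs[OF ij] by simp
  qed
  moreover have "vv \<in> mats L V" "ww \<in> mats L W"
    using vw cfun.subspace_0[OF V] cfun.subspace_0[OF W] by (auto simp: mats_def vv_def ww_def)
  ultimately show ?thesis by blast
qed

text \<open>\<open>\<Phi>\<close> is asked to be linear on all functions of two variables, where a
  formula defines it, so that no question of well-definedness on the tensor product arises. A bound
  on \<open>mat_pair m\<close> suffices, since the norm of the target is compatible with the
  multiplication by \<open>\<alpha>\<close> and \<open>\<beta>\<close>.\<close>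

lemma induces_cbI:
  assumes V: "operator_space V NV" and W: "operator_space W NW" and Z: "operator_space Z NZ"
    and add: "\<And>x y. \<Phi> (x + y) = \<Phi> x + \<Phi> y" and hom: "\<And>c x. \<Phi> (smul c x) = smul c (\<Phi> x)"
    and tens: "\<And>v w. v \<in> V \<Longrightarrow> w \<in> W \<Longrightarrow> \<Phi> (tens v w) = m v w"
    and mem: "\<And>v w. v \<in> V \<Longrightarrow> w \<in> W \<Longrightarrow> m v w \<in> Z"
    and C: "0 \<le> C"
    and bound: "\<And>p q v w. v \<in> mats p V \<Longrightarrow> w \<in> mats q W \<Longrightarrow>
      NZ (p * q) (mat_pair m q v w) \<le> C * NV p v * NW q w"
  shows "induces_cb V NV W NW Z NZ m"
proof -
  interpret V: operator_space V NV by fact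
  interpret W: operator_space W NW by fact
  interpret Z: operator_space Z NZ by fact
  have zero: "\<Phi> 0 = 0" using hom[of 0 0] by simp
  have into: "\<Phi> x \<in> Z" if "x \<in> tensor_space V W" for x
    using that unfolding tensor_space_def
  proof (induction rule: cfun.span_induct_alt)
    case base
    show ?case using cfun.subspace_0[OF Z.subspace] zero by (simp add: zero_fun_def)
  next
    case (step c x y)
    then have "\<Phi> (smul c x + y) \<in> Z"
      by (auto simp only: add hom tens intro!: cfun.subspace_add[OF Z.subspace] cfun.subspace_scale[OF Z.subspace] mem)
    then show ?case by (simp add: plus_fun_def)
  qed
  have sums: "\<Phi> (\<Sum>s\<in>S. f s) = (\<Sum>s\<in>S. \<Phi> (f s))" for S :: "nat set" and f
    using sum_comp_morphism[of \<Phi> f S, OF zero add] by (simp add: o_def)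
  \<comment> \<open>The constant \<open>C + 1\<close> is positive even if \<open>C\<close> is 0,
    which permits dividing by it before passing to the infimum.\<close>
  have "NZ n (\<lambda>i j. \<Phi> (u i j)) \<le> (C + 1) * proj_mnorm V NV W NW n u"
    if u: "u \<in> mats n (tensor_space V W)" for n u
  proof -
    let ?S = "{opnorm n (p * q) \<alpha> * NV p v * NW q w * opnorm (p * q) n \<beta> | p q \<alpha> v w \<beta>.
        v \<in> mats p V \<and> w \<in> mats q W \<and>
        (\<forall>i<n. \<forall>j<n. u i j = mat_compress (p * q) \<alpha> (mat_pair tens q v w) \<beta> i j)}"
    have Phiu: "(\<lambda>i j. \<Phi> (u i j)) \<in> mats n Z" using u into by (auto simp: mats_def)
    have "NZ n (\<lambda>i j. \<Phi> (u i j)) / (C + 1) \<le> Inf ?S"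
    proof (rule cInf_greatest)
      show "?S \<noteq> {}" using tensor_representation[OF V.subspace W.subspace u] by blast
      fix r assume "r \<in> ?S"
      then obtain p q \<alpha> v w \<beta> where r: "r = opnorm n (p * q) \<alpha> * NV p v * NW q w * opnorm (p * q) n \<beta>"
        and v: "v \<in> mats p V" and w: "w \<in> mats q W"
        and rep: "\<And>i j. i < n \<Longrightarrow> j < n \<Longrightarrow> u i j = mat_compress (p * q) \<alpha> (mat_pair tens q v w) \<beta> i j"
        by blast
      have dm: "I div q < p \<and> I mod q < q" if "I < p * q" for I
        using that by (cases "q = 0") (auto simp: less_mult_imp_div_less)
      have ent: "v (I div q) (J div q) \<in> V" "w (I mod q) (J mod q) \<in> W" if "I < p * q" "J < p * q" for I J
        using dm that v w by (auto simp: mats_def)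
      have M: "mat_pair m q v w \<in> mats (p * q) Z"
        using ent by (auto simp: mats_def mat_pair_def intro!: mem)
      have "NZ n (\<lambda>i j. \<Phi> (u i j)) \<le> NZ n (mat_compress (p * q) \<alpha> (mat_pair m q v w) \<beta>)"
      proof (rule Z.norm_le_cong[OF Phiu mat_compress_mats[OF Z.subspace M]])
        fix i j assume "i < n" "j < n"
        then show "\<Phi> (u i j) = mat_compress (p * q) \<alpha> (mat_pair m q v w) \<beta> i j"
          unfolding rep[OF \<open>i < n\<close> \<open>j < n\<close>] mat_compress_def sums hom mat_pair_def
          by (intro sum.cong refl arg_cong[of _ _ "smul _"] tens ent) auto
      qed
      also have "\<dots> \<le> opnorm n (p * q) \<alpha> * NZ (p * q) (mat_pair m q v w) * opnorm (p * q) n \<beta>"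
        by (rule Z.norm_compress[OF M])
      also have "\<dots> \<le> opnorm n (p * q) \<alpha> * (C * NV p v * NW q w) * opnorm (p * q) n \<beta>"
        by (intro mult_right_mono mult_left_mono bound v w opnorm_nonneg)
      also have "\<dots> = C * r" by (simp add: r mult_ac)
      also have "\<dots> \<le> (C + 1) * r"
        by (intro mult_right_mono)
           (auto simp: r opnorm_nonneg V.norm_nonneg[OF v] W.norm_nonneg[OF w])
      finally show "NZ n (\<lambda>i j. \<Phi> (u i j)) / (C + 1) \<le> r"
        using C by (simp add: pos_divide_le_eq mult.commute)
    qed
    then show ?thesis using C by (simp add: proj_mnorm_def pos_divide_le_eq mult.commute)
  qed
  then have "completely_bounded (tensor_space V W) (proj_mnorm V NV W NW) Z NZ \<Phi>"
    unfolding completely_bounded_def clinear_on_def using into add hom by auto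
  then show ?thesis unfolding induces_cb_def using tens by blast
qed

lemma sum_fun_eval: "(\<Sum>s\<in>S. f s) x = (\<Sum>s\<in>S. f s x)" for f :: "'s \<Rightarrow> 'a \<Rightarrow> 'b::comm_monoid_add"
  by (induction S rule: infinite_finite_induct) auto

section \<open>The space of square-summable functions\<close>

abbreviation L2c :: "('k \<Rightarrow> complex) \<Rightarrow> 'k set \<Rightarrow> real" where
  "L2c \<xi> F \<equiv> L2_set (\<lambda>x. cmod (\<xi> x)) F"

lemma L2c_power2: "(L2c \<xi> F)\<^sup>2 = (\<Sum>x\<in>F. (cmod (\<xi> x))\<^sup>2)"
  by (simp add: L2_set_def sum_nonneg)

lemma ell2_norm_nonneg [simp]: "0 \<le> ell2_norm \<xi>"
  by (simp add: ell2_norm_def infsum_nonneg)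

lemma ell2_norm_power2: "(ell2_norm \<xi>)\<^sup>2 = (\<Sum>\<^sub>\<infinity>x. (cmod (\<xi> x))\<^sup>2)"
  by (simp add: ell2_norm_def infsum_nonneg)

lemma has_sum_ell2_norm:
  "\<xi> \<in> ell2 \<Longrightarrow> ((\<lambda>x. (cmod (\<xi> x))\<^sup>2) has_sum (ell2_norm \<xi>)\<^sup>2) UNIV"
  by (simp add: ell2_norm_power2 ell2_def)

lemma L2c_le_ell2_norm: "\<xi> \<in> ell2 \<Longrightarrow> finite F \<Longrightarrow> L2c \<xi> F \<le> ell2_norm \<xi>"
  by (rule power2_le_imp_le)
     (auto simp: L2c_power2 intro!: finite_sum_le_has_sum[OF has_sum_ell2_norm])

lemma ell2I:
  assumes "\<And>F. finite F \<Longrightarrow> L2c \<xi> F \<le> C"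
  shows "\<xi> \<in> ell2" and ell2_norm_le: "ell2_norm \<xi> \<le> C"
proof -
  have C: "0 \<le> C" using assms[of "{}"] by simp
  have le: "(\<Sum>x\<in>F. (cmod (\<xi> x))\<^sup>2) \<le> C\<^sup>2" if "finite F" for F
    unfolding L2c_power2[symmetric] by (rule power_mono[OF assms[OF that]]) simp
  show "\<xi> \<in> ell2"
    unfolding ell2_def using le
    by (intro CollectI nonneg_bdd_above_summable_on bdd_aboveI[of _ "C\<^sup>2"]) auto
  from has_sum_le_finite_sums[OF has_sum_ell2_norm[OF this]] le
  have "(ell2_norm \<xi>)\<^sup>2 \<le> C\<^sup>2" by auto
  then show "ell2_norm \<xi> \<le> C" using C by (rule power2_le_imp_le)
qed

lemma cmod_le_ell2_norm: "\<xi> \<in> ell2 \<Longrightarrow> cmod (\<xi> x) \<le> ell2_norm \<xi>"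
  using L2c_le_ell2_norm[of \<xi> "{x}"] by simp

lemma L2c_triangle: "L2c (\<xi> + \<eta>) F \<le> L2c \<xi> F + L2c \<eta> F"
  by (rule order_trans[OF L2_set_mono L2_set_triangle_ineq]) (auto intro: norm_triangle_ineq)

lemma ell2_add: "\<xi> \<in> ell2 \<Longrightarrow> \<eta> \<in> ell2 \<Longrightarrow> \<xi> + \<eta> \<in> ell2"
  and ell2_norm_triangle: "\<xi> \<in> ell2 \<Longrightarrow> \<eta> \<in> ell2 \<Longrightarrow> ell2_norm (\<xi> + \<eta>) \<le> ell2_norm \<xi> + ell2_norm \<eta>"
proof -
  assume *: "\<xi> \<in> ell2" "\<eta> \<in> ell2"
  have **: "L2c (\<xi> + \<eta>) F \<le> ell2_norm \<xi> + ell2_norm \<eta>" if "finite F" for F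
    using L2c_triangle[of \<xi> \<eta> F] L2c_le_ell2_norm[OF *(1) that] L2c_le_ell2_norm[OF *(2) that] by simp
  show "\<xi> + \<eta> \<in> ell2" by (rule ell2I[OF **])
  show "ell2_norm (\<xi> + \<eta>) \<le> ell2_norm \<xi> + ell2_norm \<eta>" by (rule ell2_norm_le[OF **])
qed

lemma L2c_smul: "L2c (smul c \<xi>) F = cmod c * L2c \<xi> F"
  by (simp add: smul_def norm_mult L2_set_right_distrib)

lemma ell2_smul: "\<xi> \<in> ell2 \<Longrightarrow> smul c \<xi> \<in> ell2"
  by (rule ell2I[of _ "cmod c * ell2_norm \<xi>"]) (simp add: L2c_smul L2c_le_ell2_norm mult_left_mono)

lemma ell2_norm_smul: "ell2_norm (smul c \<xi>) = cmod c * ell2_norm \<xi>"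
proof -
  have "(\<Sum>\<^sub>\<infinity>x. (cmod (smul c \<xi> x))\<^sup>2) = (cmod c)\<^sup>2 * (\<Sum>\<^sub>\<infinity>x. (cmod (\<xi> x))\<^sup>2)"
    by (simp add: smul_def norm_mult power_mult_distrib infsum_cmult_right')
  then show ?thesis by (simp add: ell2_norm_def real_sqrt_mult)
qed

lemma ell2_zero [simp]: "0 \<in> ell2" "(\<lambda>_. 0) \<in> ell2"
  by (auto simp: ell2_def)

lemma ell2_norm_zero [simp]: "ell2_norm 0 = 0" "ell2_norm (\<lambda>_. 0) = 0"
  by (auto simp: ell2_norm_def)

lemma subspace_ell2: "cfun.subspace ell2"
  by (auto simp: cfun.subspace_def ell2_add ell2_smul)

lemma ell2_diff: "\<xi> \<in> ell2 \<Longrightarrow> \<eta> \<in> ell2 \<Longrightarrow> \<xi> - \<eta> \<in> ell2"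
  by (rule cfun.subspace_diff[OF subspace_ell2])

lemma ell2_sum: "(\<And>s. s \<in> S \<Longrightarrow> f s \<in> ell2) \<Longrightarrow> (\<Sum>s\<in>S. f s) \<in> ell2"
  by (rule cfun.subspace_sum[OF subspace_ell2])

lemma ell2_norm_minus_commute: "ell2_norm (\<xi> - \<eta>) = ell2_norm (\<eta> - \<xi>)"
  by (simp add: ell2_norm_def norm_minus_commute)

lemma ell2_cnj: "\<xi> \<in> ell2 \<Longrightarrow> (\<lambda>x. cnj (\<xi> x)) \<in> ell2" and ell2_norm_cnj: "ell2_norm (\<lambda>x. cnj (\<xi> x)) = ell2_norm \<xi>"
  by (auto simp: ell2_def ell2_norm_def)

lemma ell2_norm_eq_0: "\<xi> \<in> ell2 \<Longrightarrow> ell2_norm \<xi> = 0 \<Longrightarrow> \<xi> = 0"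
  using cmod_le_ell2_norm by (fastforce simp: fun_eq_iff)

subsection \<open>Inner products\<close>

lemma summable_ell2_mult:
  assumes "\<xi> \<in> ell2" "\<eta> \<in> ell2"
  shows "(\<lambda>x. norm (\<xi> x * \<eta> x)) summable_on UNIV"
    and "(\<Sum>\<^sub>\<infinity>x. norm (\<xi> x * \<eta> x)) \<le> ell2_norm \<xi> * ell2_norm \<eta>"
proof -
  have *: "(\<Sum>x\<in>F. norm (\<xi> x * \<eta> x)) \<le> ell2_norm \<xi> * ell2_norm \<eta>" if "finite F" for F
  proof -
    have "(\<Sum>x\<in>F. norm (\<xi> x * \<eta> x)) = (\<Sum>x\<in>F. \<bar>cmod (\<xi> x)\<bar> * \<bar>cmod (\<eta> x)\<bar>)"
      by (simp add: norm_mult)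
    also have "\<dots> \<le> L2c \<xi> F * L2c \<eta> F" by (rule L2_set_mult_ineq)
    also have "\<dots> \<le> ell2_norm \<xi> * ell2_norm \<eta>"
      using assms that by (intro mult_mono L2c_le_ell2_norm) auto
    finally show ?thesis .
  qed
  show s: "(\<lambda>x. norm (\<xi> x * \<eta> x)) summable_on UNIV"
    by (rule nonneg_bdd_above_summable_on) (use * in \<open>auto intro!: bdd_aboveI\<close>)
  show "(\<Sum>\<^sub>\<infinity>x. norm (\<xi> x * \<eta> x)) \<le> ell2_norm \<xi> * ell2_norm \<eta>"
    by (rule infsum_le_finite_sums[OF s]) (use * in auto)
qed

lemma ell2_inner_summable:
  "\<xi> \<in> ell2 \<Longrightarrow> \<eta> \<in> ell2 \<Longrightarrow> (\<lambda>x. \<xi> x * cnj (\<eta> x)) summable_on UNIV"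
  using summable_ell2_mult(1)[OF _ ell2_cnj] by (rule abs_summable_summable)

lemma ell2_Cauchy_Schwarz:
  assumes "\<xi> \<in> ell2" "\<eta> \<in> ell2"
  shows "cmod (ell2_inner \<xi> \<eta>) \<le> ell2_norm \<xi> * ell2_norm \<eta>"
  using norm_infsum_bound[OF summable_ell2_mult(1)[OF assms(1) ell2_cnj[OF assms(2)]]]
    summable_ell2_mult(2)[OF assms(1) ell2_cnj[OF assms(2)]]
  by (simp add: ell2_inner_def ell2_norm_cnj)

lemma ell2_inner_add_left:
  "\<xi> \<in> ell2 \<Longrightarrow> \<xi>' \<in> ell2 \<Longrightarrow> \<eta> \<in> ell2 \<Longrightarrow> ell2_inner (\<xi> + \<xi>') \<eta> = ell2_inner \<xi> \<eta> + ell2_inner \<xi>' \<eta>"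
  by (simp add: ell2_inner_def distrib_right infsum_add ell2_inner_summable)

lemma ell2_inner_add_right:
  "\<xi> \<in> ell2 \<Longrightarrow> \<eta> \<in> ell2 \<Longrightarrow> \<eta>' \<in> ell2 \<Longrightarrow> ell2_inner \<xi> (\<eta> + \<eta>') = ell2_inner \<xi> \<eta> + ell2_inner \<xi> \<eta>'"
  by (simp add: ell2_inner_def distrib_left infsum_add ell2_inner_summable)

lemma ell2_inner_smul_left: "ell2_inner (smul c \<xi>) \<eta> = c * ell2_inner \<xi> \<eta>"
  by (simp add: ell2_inner_def smul_def mult.assoc infsum_cmult_right')

lemma ell2_inner_smul_right: "ell2_inner \<xi> (smul c \<eta>) = cnj c * ell2_inner \<xi> \<eta>"
  by (simp add: ell2_inner_def smul_def mult.left_commute infsum_cmult_right')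

lemma ell2_inner_zero [simp]: "ell2_inner 0 \<eta> = 0" "ell2_inner \<xi> 0 = 0"
  by (simp_all add: ell2_inner_def)

lemma ell2_inner_commute: "ell2_inner \<eta> \<xi> = cnj (ell2_inner \<xi> \<eta>)"
  unfolding ell2_inner_def by (subst infsum_cnj[symmetric]) (simp add: mult.commute)

lemma ell2_inner_self:
  assumes "\<xi> \<in> ell2"
  shows "ell2_inner \<xi> \<xi> = of_real ((ell2_norm \<xi>)\<^sup>2)"
proof -
  have "ell2_inner \<xi> \<xi> = (\<Sum>\<^sub>\<infinity>x. of_real ((cmod (\<xi> x))\<^sup>2))"
    unfolding ell2_inner_def complex_norm_square ..
  also have "\<dots> = of_real ((ell2_norm \<xi>)\<^sup>2)"
    by (intro infsumI has_sum_of_real has_sum_ell2_norm assms)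
  finally show ?thesis .
qed

definition delta :: "'k \<Rightarrow> 'k \<Rightarrow> complex" where
  "delta x = (\<lambda>y. if y = x then 1 else 0)"

lemma finite_support_ell2:
  assumes "finite F" "\<And>x. x \<notin> F \<Longrightarrow> \<xi> x = 0"
  shows "\<xi> \<in> ell2" "ell2_norm \<xi> = L2c \<xi> F"
proof -
  have "((\<lambda>x. (cmod (\<xi> x))\<^sup>2) has_sum (\<Sum>x\<in>F. (cmod (\<xi> x))\<^sup>2)) UNIV"
    using assms by (intro has_sum_finite_neutralI) auto
  then show "\<xi> \<in> ell2" "ell2_norm \<xi> = L2c \<xi> F"
    by (auto simp: ell2_def ell2_norm_def L2_set_def has_sum_iff)
qed

lemma delta_ell2 [simp]: "delta x \<in> ell2" and ell2_norm_delta [simp]: "ell2_norm (delta x) = 1"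
  using finite_support_ell2[of "{x}" "delta x"] by (auto simp: delta_def)

lemma ell2_inner_delta [simp]: "ell2_inner \<xi> (delta x) = \<xi> x"
proof -
  have "((\<lambda>y. \<xi> y * cnj (delta x y)) has_sum \<xi> x) UNIV"
    by (rule has_sum_finite_neutralI[of "{x}"]) (auto simp: delta_def)
  then show ?thesis by (simp add: ell2_inner_def has_sum_iff)
qed

definition trunc :: "'k set \<Rightarrow> ('k \<Rightarrow> complex) \<Rightarrow> 'k \<Rightarrow> complex" where
  "trunc F \<xi> = (\<lambda>x. if x \<in> F then \<xi> x else 0)"

lemma trunc_eq_sum: "finite F \<Longrightarrow> trunc F \<xi> = (\<Sum>x\<in>F. smul (\<xi> x) (delta x))"
  by (auto simp: fun_eq_iff trunc_def sum_fun_eval smul_def delta_def if_distrib cong: if_cong)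

lemma trunc_ell2: "finite F \<Longrightarrow> trunc F \<xi> \<in> ell2"
  and ell2_norm_trunc: "finite F \<Longrightarrow> ell2_norm (trunc F \<xi>) = L2c \<xi> F"
  using finite_support_ell2[of F "trunc F \<xi>"] by (auto simp: trunc_def cong: L2_set_cong_simp)

lemma tendsto_trunc:
  assumes "\<xi> \<in> ell2"
  shows "((\<lambda>F. ell2_norm (\<xi> - trunc F \<xi>)) \<longlongrightarrow> 0) (finite_subsets_at_top UNIV)"
proof -
  \<comment> \<open>The part of \<open>\<xi>\<close> outside \<open>F\<close> is orthogonal to the
    part inside, so the squared norm of the tail is a difference, and it tends to 0 because the
    partial sums converge.\<close>
  have eq: "(ell2_norm (\<xi> - trunc F \<xi>))\<^sup>2 = (ell2_norm \<xi>)\<^sup>2 - (\<Sum>x\<in>F. (cmod (\<xi> x))\<^sup>2)" if "finite F" for F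
  proof -
    have "((\<lambda>x. (cmod (\<xi> x))\<^sup>2 - (cmod (trunc F \<xi> x))\<^sup>2) has_sum ((ell2_norm \<xi>)\<^sup>2 - (\<Sum>x\<in>F. (cmod (\<xi> x))\<^sup>2))) UNIV"
      unfolding diff_conv_add_uminus using assms that
      by (intro has_sum_add has_sum_uminusI has_sum_ell2_norm has_sum_finite_neutralI) (auto simp: trunc_def)
    also have "(\<lambda>x. (cmod (\<xi> x))\<^sup>2 - (cmod (trunc F \<xi> x))\<^sup>2) = (\<lambda>x. (cmod ((\<xi> - trunc F \<xi>) x))\<^sup>2)"
      by (auto simp: trunc_def)
    finally show ?thesis by (simp add: ell2_norm_power2 has_sum_iff)
  qed
  have "((\<lambda>F. (ell2_norm \<xi>)\<^sup>2 - (\<Sum>x\<in>F. (cmod (\<xi> x))\<^sup>2)) \<longlongrightarrow> (ell2_norm \<xi>)\<^sup>2 - (ell2_norm \<xi>)\<^sup>2) (finite_subsets_at_top UNIV)"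
    using has_sum_ell2_norm[OF assms] by (intro tendsto_intros) (simp add: has_sum_def)
  then have "((\<lambda>F. (ell2_norm \<xi>)\<^sup>2 - (\<Sum>x\<in>F. (cmod (\<xi> x))\<^sup>2)) \<longlongrightarrow> 0) (finite_subsets_at_top UNIV)"
    by simp
  then have "((\<lambda>F. (ell2_norm (\<xi> - trunc F \<xi>))\<^sup>2) \<longlongrightarrow> 0) (finite_subsets_at_top UNIV)"
    by (rule Lim_transform_eventually) (auto intro!: eventually_finite_subsets_at_top_weakI simp: eq)
  from tendsto_real_sqrt[OF this] show ?thesis by simp
qed

subsection \<open>Bounded sesquilinear forms\<close>

text \<open>Such a form is determined by its values at the vectors \<open>delta\<close>. Identities
  between operators, ultraweakly continuous functionals and a functional from Hahn-Banach are all
  proved by comparing these values.\<close>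

locale bounded_sesquilinear =
  fixes Q :: "('k \<Rightarrow> complex) \<Rightarrow> ('k \<Rightarrow> complex) \<Rightarrow> complex" and C :: real
  assumes add_left: "\<zeta> \<in> ell2 \<Longrightarrow> \<zeta>' \<in> ell2 \<Longrightarrow> \<theta> \<in> ell2 \<Longrightarrow> Q (\<zeta> + \<zeta>') \<theta> = Q \<zeta> \<theta> + Q \<zeta>' \<theta>"
    and add_right: "\<zeta> \<in> ell2 \<Longrightarrow> \<theta> \<in> ell2 \<Longrightarrow> \<theta>' \<in> ell2 \<Longrightarrow> Q \<zeta> (\<theta> + \<theta>') = Q \<zeta> \<theta> + Q \<zeta> \<theta>'"
    and smul_left: "\<zeta> \<in> ell2 \<Longrightarrow> \<theta> \<in> ell2 \<Longrightarrow> Q (smul c \<zeta>) \<theta> = c * Q \<zeta> \<theta>"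
    and smul_right: "\<zeta> \<in> ell2 \<Longrightarrow> \<theta> \<in> ell2 \<Longrightarrow> Q \<zeta> (smul c \<theta>) = cnj c * Q \<zeta> \<theta>"
    and bound: "\<zeta> \<in> ell2 \<Longrightarrow> \<theta> \<in> ell2 \<Longrightarrow> cmod (Q \<zeta> \<theta>) \<le> C * ell2_norm \<zeta> * ell2_norm \<theta>"
begin

lemma zero_left: "\<theta> \<in> ell2 \<Longrightarrow> Q 0 \<theta> = 0"
  using smul_left[of 0 \<theta> 0] by simp

lemma zero_right: "\<theta> \<in> ell2 \<Longrightarrow> Q \<theta> 0 = 0"
  using smul_right[of \<theta> 0 0] by simp

lemma sum_left: "finite S \<Longrightarrow> (\<And>s. s \<in> S \<Longrightarrow> f s \<in> ell2) \<Longrightarrow> \<theta> \<in> ell2 \<Longrightarrow> Q (\<Sum>s\<in>S. f s) \<theta> = (\<Sum>s\<in>S. Q (f s) \<theta>)"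
  by (induction S rule: finite_induct) (simp_all add: zero_left add_left ell2_sum del: plus_fun_apply)

lemma sum_right: "finite S \<Longrightarrow> (\<And>s. s \<in> S \<Longrightarrow> f s \<in> ell2) \<Longrightarrow> \<theta> \<in> ell2 \<Longrightarrow> Q \<theta> (\<Sum>s\<in>S. f s) = (\<Sum>s\<in>S. Q \<theta> (f s))"
  by (induction S rule: finite_induct) (simp_all add: zero_right add_right ell2_sum)

lemma nonneg: "0 \<le> C"
  using bound[of "delta undefined" "delta undefined"] by (simp add: order_trans[OF norm_ge_zero])

lemma trunc:
  assumes F: "finite F"
  shows "Q (trunc F \<zeta>) (trunc F \<theta>) = (\<Sum>x\<in>F. \<Sum>y\<in>F. cnj (\<theta> x) * Q (delta y) (delta x) * \<zeta> y)"
proof -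
  have "Q (trunc F \<zeta>) (trunc F \<theta>) = (\<Sum>x\<in>F. Q (trunc F \<zeta>) (smul (\<theta> x) (delta x)))"
    unfolding trunc_eq_sum[OF F, of \<theta>] by (rule sum_right[OF F]) (auto simp: ell2_smul trunc_ell2 F)
  also have "\<dots> = (\<Sum>x\<in>F. \<Sum>y\<in>F. Q (smul (\<zeta> y) (delta y)) (smul (\<theta> x) (delta x)))"
    unfolding trunc_eq_sum[OF F, of \<zeta>] by (intro sum.cong refl sum_left[OF F]) (auto simp: ell2_smul)
  also have "\<dots> = (\<Sum>x\<in>F. \<Sum>y\<in>F. cnj (\<theta> x) * Q (delta y) (delta x) * \<zeta> y)"
    by (intro sum.cong refl) (simp add: smul_left smul_right ell2_smul)
  finally show ?thesis .
qed

lemma tendsto: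
  assumes \<zeta>: "\<zeta> \<in> ell2" and \<theta>: "\<theta> \<in> ell2"
  shows "((\<lambda>F. \<Sum>x\<in>F. \<Sum>y\<in>F. cnj (\<theta> x) * Q (delta y) (delta x) * \<zeta> y) \<longlongrightarrow> Q \<zeta> \<theta>) (finite_subsets_at_top UNIV)"
proof -
  let ?a = "\<lambda>F. C * (ell2_norm (\<zeta> - trunc F \<zeta>) * ell2_norm \<theta> + ell2_norm \<zeta> * ell2_norm (\<theta> - trunc F \<theta>))"
  have "(?a \<longlongrightarrow> C * (0 * ell2_norm \<theta> + ell2_norm \<zeta> * 0)) (finite_subsets_at_top UNIV)"
    by (intro tendsto_intros tendsto_trunc assms)
  then have a: "(?a \<longlongrightarrow> 0) (finite_subsets_at_top UNIV)" by simp
  have le: "norm (Q (trunc F \<zeta>) (trunc F \<theta>) - Q \<zeta> \<theta>) \<le> ?a F" if F: "finite F" for F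
  proof -
    note m = ell2_diff[OF \<zeta> trunc_ell2[OF F, of \<zeta>]] ell2_diff[OF \<theta> trunc_ell2[OF F, of \<theta>]]
      trunc_ell2[OF F, of \<zeta>] trunc_ell2[OF F, of \<theta>]
    \<comment> \<open>The two arguments are truncated one after the other, and each replacement is
      controlled by \<open>bound\<close>.\<close>
    have 1: "Q \<zeta> \<theta> = Q (\<zeta> - trunc F \<zeta>) \<theta> + Q (trunc F \<zeta>) \<theta>"
      using add_left[OF m(1) m(3) \<theta>] by simp
    have 2: "Q (trunc F \<zeta>) \<theta> = Q (trunc F \<zeta>) (\<theta> - trunc F \<theta>) + Q (trunc F \<zeta>) (trunc F \<theta>)"
      using add_right[OF m(3) m(2) m(4)] by simp
    have "norm (Q (trunc F \<zeta>) (trunc F \<theta>) - Q \<zeta> \<theta>) = norm (Q (\<zeta> - trunc F \<zeta>) \<theta> + Q (trunc F \<zeta>) (\<theta> - trunc F \<theta>))"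
      unfolding 1 2 by (subst norm_minus_commute) (simp add: algebra_simps)
    also have "\<dots> \<le> C * ell2_norm (\<zeta> - trunc F \<zeta>) * ell2_norm \<theta> + C * ell2_norm (trunc F \<zeta>) * ell2_norm (\<theta> - trunc F \<theta>)"
      by (rule order_trans[OF norm_triangle_ineq add_mono]) (intro bound m \<theta>)+
    also have "\<dots> \<le> C * ell2_norm (\<zeta> - trunc F \<zeta>) * ell2_norm \<theta> + C * ell2_norm \<zeta> * ell2_norm (\<theta> - trunc F \<theta>)"
      by (intro add_left_mono mult_right_mono mult_left_mono)
         (auto simp: nonneg ell2_norm_trunc[OF F] L2c_le_ell2_norm[OF \<zeta> F])
    finally show ?thesis by (simp add: algebra_simps)
  qed
  have "((\<lambda>F. Q (trunc F \<zeta>) (trunc F \<theta>) - Q \<zeta> \<theta>) \<longlongrightarrow> 0) (finite_subsets_at_top UNIV)"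
    by (rule Lim_null_comparison[OF _ a]) (auto intro!: eventually_finite_subsets_at_top_weakI le)
  then have "((\<lambda>F. Q (trunc F \<zeta>) (trunc F \<theta>)) \<longlongrightarrow> Q \<zeta> \<theta>) (finite_subsets_at_top UNIV)"
    by (simp add: LIM_zero_iff)
  then show ?thesis
    by (rule Lim_transform_eventually) (auto intro!: eventually_finite_subsets_at_top_weakI trunc)
qed

end

lemma bounded_sesquilinear_eqI:
  assumes "bounded_sesquilinear Q C" "bounded_sesquilinear Q' C'"
    and "\<And>x y. Q (delta y) (delta x) = Q' (delta y) (delta x)" and "\<zeta> \<in> ell2" "\<theta> \<in> ell2"
  shows "Q \<zeta> \<theta> = Q' \<zeta> \<theta>"
  using bounded_sesquilinear.tendsto[OF assms(1,4,5)] bounded_sesquilinear.tendsto[OF assms(2,4,5)]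
  by (simp add: assms(3) tendsto_unique[OF finite_subsets_at_top_neq_bot])

subsection \<open>Bounded operators and their matrices\<close>

text \<open>The matrix coefficient of \<open>T\<close> in row \<open>x\<close> and column
  \<open>y\<close>.\<close>

definition mc :: "'g l2op \<Rightarrow> 'g \<Rightarrow> 'g \<Rightarrow> complex" where
  "mc T x y = T (delta y) x"

lemma bounded_opsD:
  assumes "T \<in> bounded_ops"
  shows "\<xi> \<in> ell2 \<Longrightarrow> T \<xi> \<in> ell2"
    and "\<xi> \<in> ell2 \<Longrightarrow> \<eta> \<in> ell2 \<Longrightarrow> T (\<xi> + \<eta>) = T \<xi> + T \<eta>"
    and "\<xi> \<in> ell2 \<Longrightarrow> T (smul c \<xi>) = smul c (T \<xi>)"
    and "\<xi> \<notin> ell2 \<Longrightarrow> T \<xi> = 0"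
    and "\<exists>C\<ge>0. \<forall>\<xi>\<in>ell2. ell2_norm (T \<xi>) \<le> C * ell2_norm \<xi>"
proof -
  show "\<exists>C\<ge>0. \<forall>\<xi>\<in>ell2. ell2_norm (T \<xi>) \<le> C * ell2_norm \<xi>"
  proof -
    obtain C where C: "\<And>\<xi>. \<xi> \<in> ell2 \<Longrightarrow> ell2_norm (T \<xi>) \<le> C * ell2_norm \<xi>"
      using assms by (auto simp: bounded_ops_def)
    have "ell2_norm (T \<xi>) \<le> max C 0 * ell2_norm \<xi>" if "\<xi> \<in> ell2" for \<xi>
      by (rule order_trans[OF C[OF that] mult_right_mono]) auto
    then show ?thesis by (intro exI[of _ "max C 0"]) auto
  qed
qed (use assms in \<open>auto simp: bounded_ops_def clinear_on_def\<close>)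

lemma bounded_sesquilinear_op:
  assumes T: "T \<in> bounded_ops" and C: "\<And>\<xi>. \<xi> \<in> ell2 \<Longrightarrow> ell2_norm (T \<xi>) \<le> C * ell2_norm \<xi>"
  shows "bounded_sesquilinear (\<lambda>\<xi> \<eta>. ell2_inner (T \<xi>) \<eta>) C"
proof
  fix \<zeta> \<theta> :: "'a \<Rightarrow> complex" assume m: "\<zeta> \<in> ell2" "\<theta> \<in> ell2"
  have "cmod (ell2_inner (T \<zeta>) \<theta>) \<le> ell2_norm (T \<zeta>) * ell2_norm \<theta>"
    by (intro ell2_Cauchy_Schwarz bounded_opsD(1)[OF T] m)
  also have "\<dots> \<le> C * ell2_norm \<zeta> * ell2_norm \<theta>"
    by (intro mult_right_mono C m) simp
  finally show "cmod (ell2_inner (T \<zeta>) \<theta>) \<le> C * ell2_norm \<zeta> * ell2_norm \<theta>" .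
qed (simp_all add: bounded_opsD(1-3)[OF T] ell2_inner_add_left ell2_inner_add_right
       ell2_inner_smul_left ell2_inner_smul_right)

lemma bounded_op_truncation:
  assumes T: "T \<in> bounded_ops" and C: "\<And>\<xi>. \<xi> \<in> ell2 \<Longrightarrow> ell2_norm (T \<xi>) \<le> C * ell2_norm \<xi>"
    and fin: "finite F"
  shows "bil_bounded F F (mc T) C"
  unfolding bil_bounded_def
proof (intro allI)
  fix w z :: "'a \<Rightarrow> complex"
  interpret bounded_sesquilinear "\<lambda>\<xi> \<eta>. ell2_inner (T \<xi>) \<eta>" C
    by (rule bounded_sesquilinear_op[OF T C])
  show "cmod (\<Sum>i\<in>F. \<Sum>j\<in>F. w i * mc T i j * z j) \<le> C * L2c w F * L2c z F"
    using bound[OF trunc_ell2[OF fin, of z] trunc_ell2[OF fin, of "\<lambda>x. cnj (w x)"]]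
    unfolding trunc[OF fin] by (simp add: ell2_norm_trunc[OF fin] mc_def mult_ac)
qed

lemma has_sum_mc:
  assumes T: "T \<in> bounded_ops" and \<xi>: "\<xi> \<in> ell2"
  shows "((\<lambda>y. mc T x y * \<xi> y) has_sum T \<xi> x) UNIV"
proof -
  obtain C where C: "C \<ge> 0" "\<And>\<xi>. \<xi> \<in> ell2 \<Longrightarrow> ell2_norm (T \<xi>) \<le> C * ell2_norm \<xi>"
    using bounded_opsD(5)[OF T] by auto
  have Tt: "T (trunc F \<xi>) x = (\<Sum>y\<in>F. mc T x y * \<xi> y)" if F: "finite F" for F
    unfolding trunc_eq_sum[OF F]
    using F
  proof (induction F)
    case empty
    then show ?case using bounded_opsD(3)[OF T, of 0 0] by (simp add: zero_fun_def)
  next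
    case (insert y F)
    have "T (\<Sum>x\<in>insert y F. smul (\<xi> x) (delta x)) = T (smul (\<xi> y) (delta y) + (\<Sum>x\<in>F. smul (\<xi> x) (delta x)))"
      by (simp only: sum.insert insert not_False_eq_True)
    also have "\<dots> = T (smul (\<xi> y) (delta y)) + T (\<Sum>x\<in>F. smul (\<xi> x) (delta x))"
      by (intro bounded_opsD(2)[OF T] ell2_sum ell2_smul delta_ell2)
    also have "T (smul (\<xi> y) (delta y)) = smul (\<xi> y) (T (delta y))"
      by (intro bounded_opsD(3)[OF T] delta_ell2)
    finally have "T (\<Sum>x\<in>insert y F. smul (\<xi> x) (delta x)) x
        = smul (\<xi> y) (T (delta y)) x + T (\<Sum>x\<in>F. smul (\<xi> x) (delta x)) x"
      by (simp only: plus_fun_apply)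
    then show ?case
      by (simp only: insert.IH) (simp add: insert mc_def smul_def mult.commute)
  qed
  have le: "norm (T (trunc F \<xi>) x - T \<xi> x) \<le> C * ell2_norm (\<xi> - trunc F \<xi>)" if F: "finite F" for F
  proof -
    note m = trunc_ell2[OF F, of \<xi>] ell2_diff[OF \<xi> trunc_ell2[OF F, of \<xi>]]
    have "T \<xi> = T (\<xi> - trunc F \<xi>) + T (trunc F \<xi>)"
      using bounded_opsD(2)[OF T m(2) m(1)] unfolding diff_add_cancel .
    then have "T (trunc F \<xi>) x - T \<xi> x = - T (\<xi> - trunc F \<xi>) x"
      by (metis add_diff_cancel_right' minus_diff_eq plus_fun_apply)
    then show ?thesis
      using cmod_le_ell2_norm[OF bounded_opsD(1)[OF T m(2)], of x] C(2)[OF m(2)] by simp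
  qed
  have "((\<lambda>F. C * ell2_norm (\<xi> - trunc F \<xi>)) \<longlongrightarrow> C * 0) (finite_subsets_at_top UNIV)"
    by (intro tendsto_intros tendsto_trunc \<xi>)
  then have lim: "((\<lambda>F. C * ell2_norm (\<xi> - trunc F \<xi>)) \<longlongrightarrow> 0) (finite_subsets_at_top UNIV)"
    by simp
  have "((\<lambda>F. T (trunc F \<xi>) x - T \<xi> x) \<longlongrightarrow> 0) (finite_subsets_at_top UNIV)"
    by (rule Lim_null_comparison[OF eventually_finite_subsets_at_top_weakI[OF le] lim])
  then have "((\<lambda>F. T (trunc F \<xi>) x) \<longlongrightarrow> T \<xi> x) (finite_subsets_at_top UNIV)"
    by (simp add: LIM_zero_iff)
  then show ?thesis unfolding has_sum_def
    by (rule Lim_transform_eventually) (auto intro!: eventually_finite_subsets_at_top_weakI Tt)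
qed

lemma bounded_op_eqI:
  assumes "T \<in> bounded_ops" "U \<in> bounded_ops" "\<And>x y. mc T x y = mc U x y"
  shows "T = U"
proof
  fix \<xi>
  show "T \<xi> = U \<xi>"
  proof (cases "\<xi> \<in> ell2")
    case True
    show ?thesis
    proof
      fix x
      show "T \<xi> x = U \<xi> x"
        using has_sum_mc[OF assms(1) True, of x] unfolding assms(3)
        by (rule has_sum_unique[OF _ has_sum_mc[OF assms(2) True]])
    qed
  qed (simp add: bounded_opsD(4) assms)
qed

definition op_of_kernel :: "('k \<Rightarrow> 'k \<Rightarrow> complex) \<Rightarrow> 'k l2op" where
  "op_of_kernel K = (\<lambda>\<xi>. if \<xi> \<in> ell2 then (\<lambda>x. \<Sum>\<^sub>\<infinity>y. K x y * \<xi> y) else 0)"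

text \<open>An infinite matrix whose finite square submatrices are uniformly bounded defines a
  bounded operator. All operators that are constructed in the proof beyond translations and
  projections arise in this way.\<close>

lemma op_of_kernel:
  assumes K: "\<And>F. finite F \<Longrightarrow> bil_bounded F F K C" and C: "0 \<le> C"
  shows "op_of_kernel K \<in> bounded_ops"
    and "\<xi> \<in> ell2 \<Longrightarrow> ell2_norm (op_of_kernel K \<xi>) \<le> C * ell2_norm \<xi>"
    and "mc (op_of_kernel K) x y = K x y"
proof -
  have row: "(\<lambda>y. K x y) \<in> ell2" for x
  proof (rule ell2I)
    fix F :: "'a set" assume F: "finite F"
    have "bil_bounded {x} F K C"
      by (rule bil_bounded_subset[OF K[of "insert x F"]]) (use F in auto)
    \<comment> \<open>Row \<open>x\<close> is tested against its own complex conjugate. It is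
      therefore square summable with norm at most \<open>C\<close>, and the series that defines the
      operator converges absolutely.\<close>
    from bil_boundedD[OF this, of "\<lambda>_. 1" "\<lambda>y. cnj (K x y)"]
    have "cmod (\<Sum>y\<in>F. K x y * cnj (K x y)) \<le> C * L2c (K x) F" by simp
    also have "(\<Sum>y\<in>F. K x y * cnj (K x y)) = of_real ((L2c (K x) F)\<^sup>2)"
      unfolding L2c_power2 of_real_sum complex_norm_square ..
    finally have "L2c (K x) F * L2c (K x) F \<le> C * L2c (K x) F"
      by (simp add: norm_power power2_eq_square del: of_real_power of_real_mult)
    then show "L2c (K x) F \<le> C"
      using C by (cases "L2c (K x) F = 0") (auto simp: order_less_le)
  qed
  have hs: "((\<lambda>y. K x y * \<xi> y) has_sum op_of_kernel K \<xi> x) UNIV" if "\<xi> \<in> ell2" for \<xi> x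
    using abs_summable_summable[OF summable_ell2_mult(1)[OF row that]] that
    by (simp add: op_of_kernel_def)
  have bd: "L2c (op_of_kernel K \<xi>) F \<le> C * ell2_norm \<xi>" if \<xi>: "\<xi> \<in> ell2" and F: "finite F" for \<xi> F
  proof -
    have "((\<lambda>G. L2_set (\<lambda>x. cmod (\<Sum>y\<in>G. K x y * \<xi> y)) F) \<longlongrightarrow> L2c (op_of_kernel K \<xi>) F) (finite_subsets_at_top UNIV)"
      unfolding L2_set_def using hs[OF \<xi>] by (intro tendsto_intros) (simp add: has_sum_def)
    then show ?thesis
    proof (rule tendsto_upperbound)
      show "\<forall>\<^sub>F G in finite_subsets_at_top UNIV. L2_set (\<lambda>x. cmod (\<Sum>y\<in>G. K x y * \<xi> y)) F \<le> C * ell2_norm \<xi>"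
      proof (rule eventually_finite_subsets_at_top_weakI)
        fix G :: "'a set" assume G: "finite G"
        have "bil_bounded F G K C"
          by (rule bil_bounded_subset[OF K[of "F \<union> G"]]) (use F G in auto)
        from bil_bounded_column[OF this F G C, of \<xi>]
        show "L2_set (\<lambda>x. cmod (\<Sum>y\<in>G. K x y * \<xi> y)) F \<le> C * ell2_norm \<xi>"
          by (rule order_trans) (intro mult_left_mono L2c_le_ell2_norm \<xi> G C)
      qed
    qed simp
  qed
  show nb: "ell2_norm (op_of_kernel K \<xi>) \<le> C * ell2_norm \<xi>" if "\<xi> \<in> ell2" for \<xi>
    by (rule ell2_norm_le[OF bd[OF that]])
  have add: "op_of_kernel K (\<xi> + \<eta>) = op_of_kernel K \<xi> + op_of_kernel K \<eta>" if "\<xi> \<in> ell2" "\<eta> \<in> ell2" for \<xi> \<eta>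
  proof
    fix x
    have "((\<lambda>y. K x y * \<xi> y + K x y * \<eta> y) has_sum (op_of_kernel K \<xi> x + op_of_kernel K \<eta> x)) UNIV"
      by (intro has_sum_add hs that)
    with hs[OF ell2_add[OF that], of x] show "op_of_kernel K (\<xi> + \<eta>) x = (op_of_kernel K \<xi> + op_of_kernel K \<eta>) x"
      by (auto simp: distrib_left intro: has_sum_unique)
  qed
  have sm: "op_of_kernel K (smul c \<xi>) = smul c (op_of_kernel K \<xi>)" if "\<xi> \<in> ell2" for c \<xi>
  proof
    fix x
    have "((\<lambda>y. c * (K x y * \<xi> y)) has_sum (c * op_of_kernel K \<xi> x)) UNIV"
      by (intro has_sum_cmult_right hs that)
    with hs[OF ell2_smul[OF that], of x c] show "op_of_kernel K (smul c \<xi>) x = smul c (op_of_kernel K \<xi>) x"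
      by (auto simp: smul_def mult_ac intro: has_sum_unique)
  qed
  have into: "op_of_kernel K \<xi> \<in> ell2" if "\<xi> \<in> ell2" for \<xi>
    by (rule ell2I[OF bd[OF that]])
  have off: "op_of_kernel K \<xi> = 0" if "\<xi> \<notin> ell2" for \<xi>
    using that by (simp add: op_of_kernel_def)
  show "op_of_kernel K \<in> bounded_ops"
    unfolding bounded_ops_def clinear_on_def using into nb add sm off by blast
  have "((\<lambda>z. K x z * delta y z) has_sum K x y) UNIV"
    by (rule has_sum_finite_neutralI[of "{y}"]) (auto simp: delta_def)
  with hs[of "delta y" x] show "mc (op_of_kernel K) x y = K x y"
    unfolding mc_def by (auto intro: has_sum_unique)
qed

section \<open>Matrices of operators and their finite truncations\<close>

lemma tendsto_L2_set:
  "(\<And>i. i \<in> A \<Longrightarrow> ((\<lambda>k. f k i) \<longlongrightarrow> g i) F) \<Longrightarrow> ((\<lambda>k. L2_set (f k) A) \<longlongrightarrow> L2_set g A) F"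
  unfolding L2_set_def by (intro tendsto_real_sqrt tendsto_sum tendsto_power)

lemma tendsto_L2c:
  assumes "\<xi> \<in> ell2"
  shows "((\<lambda>F. L2c \<xi> F) \<longlongrightarrow> ell2_norm \<xi>) (finite_subsets_at_top UNIV)"
  unfolding L2_set_def ell2_norm_def
  by (rule tendsto_real_sqrt, rule infsum_tendsto) (use assms in \<open>simp add: ell2_def\<close>)

lemma L2c_Times: "L2c v (A \<times> B) = L2_set (\<lambda>a. L2c (\<lambda>b. v (a, b)) B) A"
  by (simp add: L2_set_def sum_nonneg sum.cartesian_product')

text \<open>The norm of a matrix of operators will be the least such \<open>C\<close>. This replaces
  operators by finite scalar matrices, to which reindexing, tensoring and the Schur test apply
  directly.\<close>

abbreviation op_truncations_bounded :: "nat \<Rightarrow> 'g l2op mat \<Rightarrow> real \<Rightarrow> bool" where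
  "op_truncations_bounded m T C \<equiv> (\<forall>F. finite F \<longrightarrow>
     bil_bounded ({..<m} \<times> F) ({..<m} \<times> F) (\<lambda>(k,x) (l,y). mc (T k l) x y) C)"

lemma op_truncations_bounded_exists:
  assumes "T \<in> mats m bounded_ops"
  shows "\<exists>C\<ge>0. op_truncations_bounded m T C"
proof -
  have "\<forall>k<m. \<forall>l<m. \<exists>C\<ge>0. \<forall>\<xi>\<in>ell2. ell2_norm (T k l \<xi>) \<le> C * ell2_norm \<xi>"
    using assms bounded_opsD(5) by (auto simp: mats_def)
  then obtain C where C: "\<And>k l. k < m \<Longrightarrow> l < m \<Longrightarrow> C k l \<ge> 0"
    "\<And>k l \<xi>. k < m \<Longrightarrow> l < m \<Longrightarrow> \<xi> \<in> ell2 \<Longrightarrow> ell2_norm (T k l \<xi>) \<le> C k l * ell2_norm \<xi>"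
    by metis
  have "bil_bounded ({..<m} \<times> F) ({..<m} \<times> F) (\<lambda>(k,x) (l,y). mc (T k l) x y) (\<Sum>k<m. \<Sum>l<m. C k l)"
    if "finite F" for F
    using assms C that by (intro bil_bounded_blocks bounded_op_truncation) (auto simp: mats_def)
  moreover have "(\<Sum>k<m. \<Sum>l<m. C k l) \<ge> 0" using C by (intro sum_nonneg) auto
  ultimately show ?thesis by blast
qed

lemma mats_op_sum_ell2:
  assumes "T \<in> mats m bounded_ops" "k < m" "\<And>l. l < m \<Longrightarrow> \<xi> l \<in> ell2"
  shows "(\<Sum>l<m. T k l (\<xi> l)) \<in> ell2"
proof (rule ell2_sum)
  fix l assume "l \<in> {..<m}"
  then have "T k l \<in> bounded_ops" "\<xi> l \<in> ell2" using assms by (auto simp: mats_def)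
  then show "T k l (\<xi> l) \<in> ell2" by (rule bounded_opsD(1))
qed

text \<open>Two limits: with a finite set \<open>F\<close> of rows fixed, the finite set
  \<open>G\<close> of columns grows first; then \<open>F\<close> grows as well.\<close>

lemma op_truncations_bounded_imp:
  assumes T: "T \<in> mats m bounded_ops" and C: "0 \<le> C" "op_truncations_bounded m T C"
    and \<xi>: "\<And>l. l < m \<Longrightarrow> \<xi> l \<in> ell2"
  shows "L2_set (\<lambda>k. ell2_norm (\<Sum>l<m. T k l (\<xi> l))) {..<m} \<le> C * L2_set (\<lambda>l. ell2_norm (\<xi> l)) {..<m}"
proof -
  let ?v = "\<lambda>k. \<Sum>l<m. T k l (\<xi> l)"
  have v: "?v k \<in> ell2" if "k < m" for k
    by (rule mats_op_sum_ell2[OF T that \<xi>])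
  have *: "L2_set (\<lambda>k. L2c (?v k) F) {..<m} \<le> C * L2_set (\<lambda>l. ell2_norm (\<xi> l)) {..<m}"
    if F: "finite F" for F
  proof -
    let ?w = "\<lambda>G k x. \<Sum>l<m. \<Sum>y\<in>G. mc (T k l) x y * \<xi> l y"
    have lim: "((\<lambda>G. ?w G k x) \<longlongrightarrow> ?v k x) (finite_subsets_at_top UNIV)" if "k < m" for k x
      unfolding sum_fun_eval
    proof (rule tendsto_sum)
      fix l assume "l \<in> {..<m}"
      then have "T k l \<in> bounded_ops" "\<xi> l \<in> ell2" using T \<xi> that by (auto simp: mats_def)
      from has_sum_mc[OF this, of x]
      show "((\<lambda>G. \<Sum>y\<in>G. mc (T k l) x y * \<xi> l y) \<longlongrightarrow> T k l (\<xi> l) x) (finite_subsets_at_top UNIV)"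
        by (simp only: has_sum_def)
    qed
    have "((\<lambda>G. L2_set (\<lambda>k. L2c (?w G k) F) {..<m}) \<longlongrightarrow> L2_set (\<lambda>k. L2c (?v k) F) {..<m}) (finite_subsets_at_top UNIV)"
      by (intro tendsto_L2_set tendsto_norm lim) simp
    then show ?thesis
    proof (rule tendsto_upperbound)
      show "\<forall>\<^sub>F G in finite_subsets_at_top UNIV. L2_set (\<lambda>k. L2c (?w G k) F) {..<m} \<le> C * L2_set (\<lambda>l. ell2_norm (\<xi> l)) {..<m}"
      proof (rule eventually_finite_subsets_at_top_weakI)
        fix G :: "'a set" assume G: "finite G"
        have "bil_bounded ({..<m} \<times> F) ({..<m} \<times> G) (\<lambda>(k,x) (l,y). mc (T k l) x y) C"
          by (rule bil_bounded_subset[OF C(2)[rule_format, of "F \<union> G"]]) (use F G in auto)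
        from bil_bounded_column[OF this _ _ C(1), of "\<lambda>(l,y). \<xi> l y"] F G
        have "L2c (\<lambda>p. \<Sum>q\<in>{..<m} \<times> G. (\<lambda>(k,x) (l,y). mc (T k l) x y) p q * (\<lambda>(l,y). \<xi> l y) q) ({..<m} \<times> F)
            \<le> C * L2c (\<lambda>(l,y). \<xi> l y) ({..<m} \<times> G)" by simp
        then have "L2_set (\<lambda>k. L2c (?w G k) F) {..<m} \<le> C * L2c (\<lambda>(l,y). \<xi> l y) ({..<m} \<times> G)"
          by (simp only: L2c_Times[of _ _ F] sum.cartesian_product' prod.case)
        also have "L2c (\<lambda>(l,y). \<xi> l y) ({..<m} \<times> G) = L2_set (\<lambda>l. L2c (\<xi> l) G) {..<m}"
          by (simp add: L2c_Times)
        also have "C * \<dots> \<le> C * L2_set (\<lambda>l. ell2_norm (\<xi> l)) {..<m}"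
          by (intro mult_left_mono L2_set_mono L2c_le_ell2_norm \<xi> G C(1)) auto
        finally show "L2_set (\<lambda>k. L2c (?w G k) F) {..<m} \<le> C * L2_set (\<lambda>l. ell2_norm (\<xi> l)) {..<m}" .
      qed
    qed simp
  qed
  have "((\<lambda>F. L2_set (\<lambda>k. L2c (?v k) F) {..<m}) \<longlongrightarrow> L2_set (\<lambda>k. ell2_norm (?v k)) {..<m}) (finite_subsets_at_top UNIV)"
    by (intro tendsto_L2_set tendsto_L2c v) simp
  then show ?thesis
    by (rule tendsto_upperbound) (auto intro!: eventually_finite_subsets_at_top_weakI *)
qed

lemma op_mnorm_nonneg: "T \<in> mats m bounded_ops \<Longrightarrow> 0 \<le> op_mnorm m T"
  and op_mnorm_bound: "T \<in> mats m bounded_ops \<Longrightarrow> (\<And>l. l < m \<Longrightarrow> \<xi> l \<in> ell2) \<Longrightarrow>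
     L2_set (\<lambda>k. ell2_norm (\<Sum>l<m. T k l (\<xi> l))) {..<m} \<le> op_mnorm m T * L2_set (\<lambda>l. ell2_norm (\<xi> l)) {..<m}"
proof -
  assume T: "T \<in> mats m bounded_ops"
  let ?S = "{sqrt (\<Sum>k<m. (ell2_norm (\<Sum>l<m. T k l (\<xi> l)))\<^sup>2) | \<xi>.
            (\<forall>l<m. \<xi> l \<in> ell2) \<and> (\<Sum>l<m. (ell2_norm (\<xi> l))\<^sup>2) \<le> 1}"
  obtain C where C: "C \<ge> 0" "op_truncations_bounded m T C"
    using op_truncations_bounded_exists[OF T] by blast
  have bdd: "bdd_above ?S"
  proof (rule bdd_aboveI[of _ C])
    fix r assume "r \<in> ?S"
    then obtain \<xi> where \<xi>: "r = L2_set (\<lambda>k. ell2_norm (\<Sum>l<m. T k l (\<xi> l))) {..<m}"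
      "\<And>l. l < m \<Longrightarrow> \<xi> l \<in> ell2" "(\<Sum>l<m. (ell2_norm (\<xi> l))\<^sup>2) \<le> 1" by (auto simp: L2_set_def)
    have "r \<le> C * L2_set (\<lambda>l. ell2_norm (\<xi> l)) {..<m}"
      unfolding \<xi>(1) by (rule op_truncations_bounded_imp[OF T C \<xi>(2)])
    also have "\<dots> \<le> C * 1" using \<xi>(3) C(1) by (intro mult_left_mono) (auto simp: L2_set_def)
    finally show "r \<le> C" by simp
  qed
  have up: "L2_set (\<lambda>k. ell2_norm (\<Sum>l<m. T k l (\<xi> l))) {..<m} \<le> op_mnorm m T"
    if "\<And>l. l < m \<Longrightarrow> \<xi> l \<in> ell2" "(\<Sum>l<m. (ell2_norm (\<xi> l))\<^sup>2) \<le> 1" for \<xi>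
    unfolding op_mnorm_def by (rule cSup_upper[OF _ bdd]) (use that in \<open>auto simp: L2_set_def\<close>)
  show nn: "0 \<le> op_mnorm m T"
    using up[of "\<lambda>_. 0"] by (simp add: order_trans[OF L2_set_nonneg])
  assume \<xi>: "\<And>l. l < m \<Longrightarrow> \<xi> l \<in> ell2"
  define r where "r = L2_set (\<lambda>l. ell2_norm (\<xi> l)) {..<m}"
  have r2: "r\<^sup>2 = (\<Sum>l<m. (ell2_norm (\<xi> l))\<^sup>2)" by (simp add: r_def L2_set_def sum_nonneg)
  show "L2_set (\<lambda>k. ell2_norm (\<Sum>l<m. T k l (\<xi> l))) {..<m} \<le> op_mnorm m T * L2_set (\<lambda>l. ell2_norm (\<xi> l)) {..<m}"
  \<comment> \<open>The supremum concerns the unit ball. A vector of norm 0 cannot be normalized,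
    but the preliminary constant \<open>C\<close> already gives the value 0.\<close>
  proof (cases "r = 0")
    case True
    have "L2_set (\<lambda>k. ell2_norm (\<Sum>l<m. T k l (\<xi> l))) {..<m} \<le> C * r"
      unfolding r_def by (rule op_truncations_bounded_imp[OF T C \<xi>])
    with True show ?thesis by (simp add: r_def)
  next
    case False
    have r: "r > 0" using False by (simp add: r_def order_less_le)
    define c where "c = complex_of_real (1 / r)"
    have c: "cmod c = 1 / r" using r by (simp add: c_def norm_divide)
    have "L2_set (\<lambda>k. ell2_norm (\<Sum>l<m. T k l (smul c (\<xi> l)))) {..<m} \<le> op_mnorm m T"
    proof (rule up)
      show "smul c (\<xi> l) \<in> ell2" if "l < m" for l using \<xi>[OF that] by (rule ell2_smul)
      have "(\<Sum>l<m. (ell2_norm (smul c (\<xi> l)))\<^sup>2) = (\<Sum>l<m. (1/r)\<^sup>2 * (ell2_norm (\<xi> l))\<^sup>2)"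
        by (simp add: ell2_norm_smul c power_mult_distrib power_divide)
      also have "\<dots> = (1/r)\<^sup>2 * r\<^sup>2" unfolding r2 by (simp add: sum_distrib_left)
      also have "\<dots> = 1" using r by (simp add: power_divide)
      finally show "(\<Sum>l<m. (ell2_norm (smul c (\<xi> l)))\<^sup>2) \<le> 1" by simp
    qed
    also have "L2_set (\<lambda>k. ell2_norm (\<Sum>l<m. T k l (smul c (\<xi> l)))) {..<m}
        = L2_set (\<lambda>k. (1 / r) * ell2_norm (\<Sum>l<m. T k l (\<xi> l))) {..<m}"
    proof (intro L2_set_cong refl)
      fix k assume k: "k \<in> {..<m}"
      have "(\<Sum>l<m. T k l (smul c (\<xi> l))) = (\<Sum>l<m. smul c (T k l (\<xi> l)))"
        using T \<xi> k by (intro sum.cong refl bounded_opsD(3)) (auto simp: mats_def)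
      then show "ell2_norm (\<Sum>l<m. T k l (smul c (\<xi> l))) = (1 / r) * ell2_norm (\<Sum>l<m. T k l (\<xi> l))"
        by (simp add: cfun.scale_sum_right[symmetric] ell2_norm_smul c)
    qed
    also have "\<dots> = (1 / r) * L2_set (\<lambda>k. ell2_norm (\<Sum>l<m. T k l (\<xi> l))) {..<m}"
      using r by (intro L2_set_right_distrib[symmetric]) simp
    finally show ?thesis using r by (simp add: r_def[symmetric] field_simps)
  qed
qed

lemma op_mnorm_truncations:
  assumes T: "T \<in> mats m bounded_ops" shows "op_truncations_bounded m T (op_mnorm m T)"
proof (intro allI impI)
  fix F :: "'a set" assume F: "finite F"
  show "bil_bounded ({..<m} \<times> F) ({..<m} \<times> F) (\<lambda>(k,x) (l,y). mc (T k l) x y) (op_mnorm m T)"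
  proof (subst bil_bounded_iff_column, safe)
    fix z :: "nat \<times> 'a \<Rightarrow> complex"
    define \<xi> where "\<xi> = (\<lambda>l. trunc F (\<lambda>y. z (l, y)))"
    have \<xi>: "\<xi> l \<in> ell2" for l by (simp add: \<xi>_def trunc_ell2 F)
    have v: "(\<Sum>l<m. T k l (\<xi> l)) \<in> ell2" if "k < m" for k
      by (rule mats_op_sum_ell2[OF T that \<xi>])
    have e: "(\<Sum>y\<in>{..<m} \<times> F. (\<lambda>(l,y). mc (T k l) x y) y * z y) = (\<Sum>l<m. T k l (\<xi> l)) x" if "k < m" for k x
    proof -
      have "T k l (\<xi> l) x = (\<Sum>y\<in>F. mc (T k l) x y * z (l, y))" if "l < m" for l
      proof -
        have "T k l \<in> bounded_ops" using T that \<open>k < m\<close> by (simp add: mats_def)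
        from has_sum_mc[OF this \<xi>[of l], of x]
        have "((\<lambda>y. mc (T k l) x y * \<xi> l y) has_sum T k l (\<xi> l) x) UNIV" .
        moreover have "((\<lambda>y. mc (T k l) x y * \<xi> l y) has_sum (\<Sum>y\<in>F. mc (T k l) x y * z (l, y))) UNIV"
          by (rule has_sum_finite_neutralI[OF F]) (auto simp: \<xi>_def trunc_def)
        ultimately show ?thesis by (rule has_sum_unique)
      qed
      then show ?thesis by (simp add: sum.cartesian_product' sum_fun_eval)
    qed
    have "L2_set (\<lambda>i. cmod (\<Sum>j\<in>{..<m} \<times> F. (case i of (k, x) \<Rightarrow> \<lambda>(l, y). mc (T k l) x y) j * z j)) ({..<m} \<times> F)
        = L2_set (\<lambda>k. L2c (\<Sum>l<m. T k l (\<xi> l)) F) {..<m}"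
      unfolding L2c_Times by (intro L2_set_cong refl) (simp only: e lessThan_iff prod.case)
    also have "\<dots> \<le> L2_set (\<lambda>k. ell2_norm (\<Sum>l<m. T k l (\<xi> l))) {..<m}"
      by (intro L2_set_mono L2c_le_ell2_norm v F) auto
    also have "\<dots> \<le> op_mnorm m T * L2_set (\<lambda>l. ell2_norm (\<xi> l)) {..<m}"
      by (rule op_mnorm_bound[OF T \<xi>])
    also have "L2_set (\<lambda>l. ell2_norm (\<xi> l)) {..<m} = L2c z ({..<m} \<times> F)"
      by (simp add: \<xi>_def ell2_norm_trunc[OF F] L2c_Times)
    finally show "L2_set (\<lambda>i. cmod (\<Sum>j\<in>{..<m} \<times> F. (case i of (k, x) \<Rightarrow> \<lambda>(l, y). mc (T k l) x y) j * z j)) ({..<m} \<times> F)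
       \<le> op_mnorm m T * L2c z ({..<m} \<times> F)" .
  qed (use F op_mnorm_nonneg[OF T] in auto)
qed

lemma op_mnorm_le:
  assumes T: "T \<in> mats m bounded_ops" and C: "0 \<le> C" "op_truncations_bounded m T C"
  shows "op_mnorm m T \<le> C"
  unfolding op_mnorm_def
proof (rule cSup_least)
  show "{sqrt (\<Sum>k<m. (ell2_norm (\<Sum>l<m. T k l (\<xi> l)))\<^sup>2) | \<xi>.
            (\<forall>l<m. \<xi> l \<in> ell2) \<and> (\<Sum>l<m. (ell2_norm (\<xi> l))\<^sup>2) \<le> 1} \<noteq> {}"
    by (auto intro!: exI[of _ "\<lambda>_. 0"])
  fix r assume "r \<in> {sqrt (\<Sum>k<m. (ell2_norm (\<Sum>l<m. T k l (\<xi> l)))\<^sup>2) | \<xi>.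
            (\<forall>l<m. \<xi> l \<in> ell2) \<and> (\<Sum>l<m. (ell2_norm (\<xi> l))\<^sup>2) \<le> 1}"
  then obtain \<xi> where \<xi>: "r = L2_set (\<lambda>k. ell2_norm (\<Sum>l<m. T k l (\<xi> l))) {..<m}"
    "\<And>l. l < m \<Longrightarrow> \<xi> l \<in> ell2" "(\<Sum>l<m. (ell2_norm (\<xi> l))\<^sup>2) \<le> 1" by (auto simp: L2_set_def)
  have "r \<le> C * L2_set (\<lambda>l. ell2_norm (\<xi> l)) {..<m}"
    unfolding \<xi>(1) by (rule op_truncations_bounded_imp[OF T C \<xi>(2)])
  also have "\<dots> \<le> C * 1" using \<xi>(3) C(1) by (intro mult_left_mono) (auto simp: L2_set_def)
  finally show "r \<le> C" by simp
qed

section \<open>Translations and the group von Neumann algebra\<close>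

lemma ell2_reindex:
  assumes f: "bij f"
  shows "(\<lambda>x. \<xi> (f x)) \<in> ell2 \<longleftrightarrow> \<xi> \<in> ell2" and "ell2_norm (\<lambda>x. \<xi> (f x)) = ell2_norm \<xi>"
  using summable_on_reindex_bij_betw[OF f, of "\<lambda>x. (cmod (\<xi> x))\<^sup>2"]
    infsum_reindex_bij_betw[OF f, of "\<lambda>x. (cmod (\<xi> x))\<^sup>2"]
  by (simp_all add: ell2_def ell2_norm_def)

lemma bounded_ops_compose:
  assumes T: "T \<in> bounded_ops" and U: "U \<in> bounded_ops"
  shows "T \<circ> U \<in> bounded_ops"
proof -
  obtain C where C: "C \<ge> 0" "\<And>\<xi>. \<xi> \<in> ell2 \<Longrightarrow> ell2_norm (T \<xi>) \<le> C * ell2_norm \<xi>"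
    using bounded_opsD(5)[OF T] by auto
  obtain D where D: "D \<ge> 0" "\<And>\<xi>. \<xi> \<in> ell2 \<Longrightarrow> ell2_norm (U \<xi>) \<le> D * ell2_norm \<xi>"
    using bounded_opsD(5)[OF U] by auto
  have "ell2_norm (T (U \<xi>)) \<le> C * D * ell2_norm \<xi>" if "\<xi> \<in> ell2" for \<xi>
    using C(2)[OF bounded_opsD(1)[OF U that]] mult_left_mono[OF D(2)[OF that] C(1)] by simp
  moreover have "T (U \<xi>) = 0" if "\<xi> \<notin> ell2" for \<xi>
    using bounded_opsD(4)[OF U that] bounded_opsD(3)[OF T, of 0 0] by simp
  ultimately show ?thesis
    unfolding bounded_ops_def clinear_on_def
    using bounded_opsD(1-3)[OF T] bounded_opsD(1-3)[OF U] by auto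
qed

definition translation :: "('g \<Rightarrow> 'g) \<Rightarrow> 'g l2op" where
  "translation f = (\<lambda>\<xi>. if \<xi> \<in> ell2 then (\<lambda>y. \<xi> (f y)) else 0)"

lemma translation_bounded:
  assumes "bij f" shows "translation f \<in> bounded_ops"
  unfolding bounded_ops_def clinear_on_def
  by (auto simp: translation_def ell2_reindex[OF assms] ell2_add ell2_smul smul_def[abs_def] fun_eq_iff
      intro!: exI[of _ 1] dest: ell2_smul)

lemma left_reg_eq: "left_reg x = translation (\<lambda>y. - x + y)"
  by (simp add: left_reg_def translation_def)

lemma bij_left: "bij (\<lambda>y. x + y)" and bij_right: "bij (\<lambda>y. y + x)" for x :: "'g::group_add"
  by (auto intro!: bij_betw_byWitness[where f' = "\<lambda>y. - x + y"] bij_betw_byWitness[where f' = "\<lambda>y. y + - x"]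
      simp: add.assoc simp flip: add.assoc)

lemma left_reg_bounded: "left_reg x \<in> bounded_ops"
  by (simp add: left_reg_eq translation_bounded bij_left)

lemma mc_translation: "mc (translation f) x y = (if f x = y then 1 else 0)"
proof -
  have "mc (translation f) x y = delta y (f x)" by (simp add: mc_def translation_def)
  then show ?thesis by (auto simp: delta_def)
qed

lemma mc_left_reg: "mc (left_reg g) x y = (if x = g + y then 1 else 0)"
proof -
  have "(- g + x = y) = (x = g + y)" by (metis add.assoc add.left_neutral add_minus_cancel left_minus)
  then show ?thesis by (simp add: left_reg_eq mc_translation)
qed

lemma has_sum_mc_compose:
  assumes "T \<in> bounded_ops" "U \<in> bounded_ops"
  shows "((\<lambda>z. mc T x z * mc U z y) has_sum mc (T \<circ> U) x y) UNIV"
  using has_sum_mc[OF assms(1) bounded_opsD(1)[OF assms(2) delta_ell2], of x y] by (simp add: mc_def)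

text \<open>The bicommutant of the left translations is the commutant of the right translations.
  Right translations commute with left ones, whence invariance of the matrix. Conversely, an
  operator in the commutant of the left translations has a left invariant matrix, and left and right
  invariant matrices commute. Membership in the von Neumann algebra thus becomes a condition on
  entries.\<close>

lemma group_vn_iff:
  fixes T :: "'g::group_add l2op"
  shows "T \<in> group_vn \<longleftrightarrow> T \<in> bounded_ops \<and> (\<forall>x y z. mc T (x + z) (y + z) = mc T x y)"
proof
  assume T: "T \<in> group_vn"
  then have Tb: "T \<in> bounded_ops" by (simp add: group_vn_def commutant_def)
  have "mc T (x + z) (y + z) = mc T x y" for x y z
  proof -
    let ?R = "translation (\<lambda>y. y + z)"
    have R: "?R \<in> bounded_ops" by (rule translation_bounded[OF bij_right])
    have "?R \<circ> left_reg g = left_reg g \<circ> ?R" for g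
    proof
      fix \<xi> :: "'g \<Rightarrow> complex"
      show "(?R \<circ> left_reg g) \<xi> = (left_reg g \<circ> ?R) \<xi>"
      proof (cases "\<xi> \<in> ell2")
        case True
        then show ?thesis
          using ell2_reindex(1)[OF bij_right[of z], of \<xi>] ell2_reindex(1)[OF bij_left[of "- g"], of \<xi>]
          by (simp add: left_reg_def translation_def add.assoc)
      next
        case False
        then show ?thesis by (simp add: left_reg_def translation_def zero_fun_def)
      qed
    qed
    then have "?R \<in> commutant (range left_reg)" using R by (auto simp: commutant_def)
    then have "T \<circ> ?R = ?R \<circ> T" using T by (simp add: group_vn_def commutant_def)
    then have eq: "T (?R (delta (y + z))) x = ?R (T (delta (y + z))) x" by (metis comp_apply)
    have "?R (delta (y + z)) = (\<lambda>u. delta (y + z) (u + z))" by (simp add: translation_def)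
    also have "\<dots> = delta y" by (auto simp: delta_def fun_eq_iff)
    finally have "?R (delta (y + z)) = delta y" .
    with eq show ?thesis
      using bounded_opsD(1)[OF Tb delta_ell2] by (simp add: mc_def translation_def)
  qed
  with Tb show "T \<in> bounded_ops \<and> (\<forall>x y z. mc T (x + z) (y + z) = mc T x y)" by blast
next
  assume *: "T \<in> bounded_ops \<and> (\<forall>x y z. mc T (x + z) (y + z) = mc T x y)"
  then have Tb: "T \<in> bounded_ops" and inv: "\<And>x y z. mc T (x + z) (y + z) = mc T x y" by auto
  have "T \<circ> U = U \<circ> T" if U: "U \<in> commutant (range left_reg)" for U
  proof -
    have Ub: "U \<in> bounded_ops" using U by (simp add: commutant_def)
    have Uinv: "mc U (g + x) (g + y) = mc U x y" for g x y
    proof -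
      have "U \<circ> left_reg g = left_reg g \<circ> U" using U by (auto simp: commutant_def)
      then have "U (left_reg g (delta y)) (g + x) = left_reg g (U (delta y)) (g + x)" by (metis comp_apply)
      moreover have "left_reg g (delta y) = delta (g + y)"
        using mc_left_reg[of g _ y] by (auto simp: fun_eq_iff mc_def delta_def)
      ultimately show ?thesis
        using bounded_opsD(1)[OF Ub delta_ell2] by (simp add: mc_def left_reg_def add.assoc[symmetric])
    qed
    show ?thesis
    proof (rule bounded_op_eqI)
      fix x y :: 'g
      \<comment> \<open>This substitution in the sum over the middle index turns the product of the
        matrices of \<open>U\<close> and \<open>T\<close> into the product in the opposite
        order.\<close>
      have bij: "bij (\<lambda>z. x - z + y)"
        by (rule bij_betw_byWitness[where f' = "\<lambda>w. y - w + x"])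
           (auto simp: diff_conv_add_uminus minus_add add.assoc simp del: add_uminus_conv_diff)
      have "((\<lambda>z. mc U x (x - z + y) * mc T (x - z + y) y) has_sum mc (U \<circ> T) x y) UNIV"
        using has_sum_mc_compose[OF Ub Tb, of x y]
        by (simp add: has_sum_reindex_bij_betw[OF bij, of "\<lambda>z. mc U x z * mc T z y"])
      moreover have "mc U x (x - z + y) = mc U z y" for z
        using Uinv[of "x - z" z y] by simp
      \<comment> \<open>By right invariance both sides equal \<open>mc T (x - z) 0\<close>.\<close>
      moreover have "mc T (x - z + y) y = mc T x z" for z
        using inv[of "x - z" "- y + y" 0] inv[of "x - z" y 0] inv[of "x - z" z 0]
          inv[of "x - z" y "0"] inv[where x = "x - z" and y = 0 and z = y] inv[where x = "x - z" and y = 0 and z = z]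
        by simp
      ultimately have "((\<lambda>z. mc T x z * mc U z y) has_sum mc (U \<circ> T) x y) UNIV"
        by (simp add: mult.commute)
      with has_sum_mc_compose[OF Tb Ub, of x y] show "mc (T \<circ> U) x y = mc (U \<circ> T) x y"
        by (rule has_sum_unique)
    qed (intro bounded_ops_compose Tb Ub)+
  qed
  with Tb show "T \<in> group_vn" by (simp add: group_vn_def commutant_def)
qed

lemma group_vn_bounded: "T \<in> group_vn \<Longrightarrow> T \<in> bounded_ops"
  by (simp add: group_vn_iff)

lemma mats_group_vn_bounded: "T \<in> mats m group_vn \<Longrightarrow> T \<in> mats m bounded_ops"
  by (auto simp: mats_def group_vn_bounded)

lemma left_reg_group_vn: "left_reg x \<in> group_vn"
proof -
  have "(a + z = x + (b + z)) = (a = x + b)" for a b z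
    by (metis add.assoc add_right_cancel)
  then show ?thesis by (simp add: group_vn_iff left_reg_bounded mc_left_reg)
qed

lemma op_of_kernel_group_vn:
  assumes "\<And>F. finite F \<Longrightarrow> bil_bounded F F K C" "0 \<le> C" "\<And>x y z. K (x + z) (y + z) = K x y"
  shows "op_of_kernel K \<in> group_vn"
  using op_of_kernel[OF assms(1,2)] assms(3) by (simp add: group_vn_iff)

subsection \<open>Square-summable families of vectors\<close>

abbreviation slice :: "('k \<times> 'g \<Rightarrow> complex) \<Rightarrow> 'k \<Rightarrow> 'g \<Rightarrow> complex" where
  "slice \<xi> n \<equiv> (\<lambda>x. \<xi> (n, x))"

lemma slice_ell2:
  assumes "\<xi> \<in> ell2"
  shows "slice \<xi> n \<in> ell2" and has_sum_slice_norm: "((\<lambda>n. (ell2_norm (slice \<xi> n))\<^sup>2) has_sum (ell2_norm \<xi>)\<^sup>2) UNIV"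
proof -
  have *: "((\<lambda>x. (cmod (\<xi> x))\<^sup>2) has_sum (ell2_norm \<xi>)\<^sup>2) (Sigma UNIV (\<lambda>_. UNIV))"
    using has_sum_ell2_norm[OF assms] by simp
  have s: "(\<lambda>x. (cmod (slice \<xi> n x))\<^sup>2) summable_on UNIV" for n
    using summable_on_SigmaD1[of "\<lambda>n x. (cmod (\<xi> (n, x)))\<^sup>2" UNIV "\<lambda>_. UNIV" n] has_sum_imp_summable[OF *]
    by (simp add: case_prod_unfold)
  then show sl: "slice \<xi> n \<in> ell2" for n by (simp add: ell2_def)
  show "((\<lambda>n. (ell2_norm (slice \<xi> n))\<^sup>2) has_sum (ell2_norm \<xi>)\<^sup>2) UNIV"
    by (rule has_sum_SigmaD[OF *]) (rule has_sum_ell2_norm[OF sl])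
qed

lemma ell2_sliceI:
  assumes sl: "\<And>n. slice \<xi> n \<in> ell2" and s: "((\<lambda>n. (ell2_norm (slice \<xi> n))\<^sup>2) has_sum S) UNIV"
  shows "\<xi> \<in> ell2" and "(ell2_norm \<xi>)\<^sup>2 = S"
proof -
  have "((\<lambda>x. (cmod (\<xi> x))\<^sup>2) has_sum S) (Sigma UNIV (\<lambda>_. UNIV))"
    by (rule has_sum_SigmaI[OF has_sum_ell2_norm[OF sl] s])
       (rule summable_on_SigmaI[OF has_sum_ell2_norm[OF sl] has_sum_imp_summable[OF s]], simp)
  then have "((\<lambda>x. (cmod (\<xi> x))\<^sup>2) has_sum S) UNIV" by simp
  then show "\<xi> \<in> ell2" "(ell2_norm \<xi>)\<^sup>2 = S"
    by (auto simp: ell2_def ell2_norm_power2 has_sum_iff)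
qed

lemma summable_norm_slices:
  fixes \<xi> \<eta> :: "'k \<times> 'g \<Rightarrow> complex"
  assumes "\<xi> \<in> ell2" "\<eta> \<in> ell2"
  shows "(\<lambda>n. ell2_norm (slice \<xi> n) * ell2_norm (slice \<eta> n)) summable_on UNIV"
    and "(\<Sum>\<^sub>\<infinity>n. ell2_norm (slice \<xi> n) * ell2_norm (slice \<eta> n)) \<le> ell2_norm \<xi> * ell2_norm \<eta>"
proof -
  have *: "(\<lambda>n. complex_of_real (ell2_norm (slice \<zeta> n))) \<in> ell2"
    "ell2_norm (\<lambda>n. complex_of_real (ell2_norm (slice \<zeta> n))) = ell2_norm \<zeta>"
    if "\<zeta> \<in> ell2" for \<zeta> :: "'k \<times> 'g \<Rightarrow> complex"
  proof -
    note hs = has_sum_slice_norm[OF that]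
    show "(\<lambda>n. complex_of_real (ell2_norm (slice \<zeta> n))) \<in> ell2"
      using hs by (auto simp: ell2_def has_sum_iff)
    show "ell2_norm (\<lambda>n. complex_of_real (ell2_norm (slice \<zeta> n))) = ell2_norm \<zeta>"
    proof -
      have "(ell2_norm (\<lambda>n. complex_of_real (ell2_norm (slice \<zeta> n))))\<^sup>2 = (ell2_norm \<zeta>)\<^sup>2"
        using hs by (simp add: ell2_norm_power2[of "\<lambda>n. complex_of_real (ell2_norm (slice \<zeta> n))"] has_sum_iff)
      then show ?thesis by (simp add: power2_eq_iff_nonneg)
    qed
  qed
  from summable_ell2_mult[OF *(1)[OF assms(1)] *(1)[OF assms(2)]]
  show "(\<lambda>n. ell2_norm (slice \<xi> n) * ell2_norm (slice \<eta> n)) summable_on UNIV"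
    and "(\<Sum>\<^sub>\<infinity>n. ell2_norm (slice \<xi> n) * ell2_norm (slice \<eta> n)) \<le> ell2_norm \<xi> * ell2_norm \<eta>"
    by (simp_all add: * assms norm_mult)
qed

text \<open>The direct sum of the families \<open>\<xi> i\<close>. The indices \<open>i\<close> and
  \<open>n\<close> are bracketed together so that the group variable stays last and
  \<open>slice\<close> applies.\<close>

definition concat_family :: "('i \<Rightarrow> 'k \<times> 'g \<Rightarrow> complex) \<Rightarrow> ('i \<times> 'k) \<times> 'g \<Rightarrow> complex" where
  "concat_family \<xi> = (\<lambda>((i, n), x). \<xi> i (n, x))"

lemma concat_family_ell2:
  assumes \<xi>: "\<And>i. \<xi> i \<in> ell2" and s: "((\<lambda>i. (ell2_norm (\<xi> i))\<^sup>2) has_sum S) UNIV"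
  shows "concat_family \<xi> \<in> ell2" and "(ell2_norm (concat_family \<xi>))\<^sup>2 = S"
proof -
  define \<zeta> where "\<zeta> = (\<lambda>(i, p). \<xi> i p)"
  have sl: "slice \<zeta> i = \<xi> i" for i by (simp add: \<zeta>_def fun_eq_iff)
  have z: "\<zeta> \<in> ell2" "(ell2_norm \<zeta>)\<^sup>2 = S"
    using ell2_sliceI[of \<zeta> S] by (simp_all add: sl \<xi> s)
  have bij: "bij (\<lambda>((i, n), x). (i, (n, x)))"
    by (rule bij_betw_byWitness[where f' = "\<lambda>(i, (n, x)). ((i, n), x)"]) auto
  have eq: "concat_family \<xi> = (\<lambda>p. \<zeta> ((\<lambda>((i, n), x). (i, (n, x))) p))"
    by (auto simp: concat_family_def \<zeta>_def fun_eq_iff)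
  show "concat_family \<xi> \<in> ell2" "(ell2_norm (concat_family \<xi>))\<^sup>2 = S"
    unfolding eq using ell2_reindex[OF bij, of \<zeta>] z by simp_all
qed

subsection \<open>Ultraweakly continuous functionals\<close>

text \<open>A square-summable family of vectors is stored as one vector on
  \<open>'k \<times> 'g\<close>. The index type is left open because concatenation and twisting
  enlarge it; in the end \<open>vec_functional_countable\<close> returns to
  \<open>nat\<close>.\<close>

definition vec_functional ::
  "('k \<times> 'g::group_add \<Rightarrow> complex) \<Rightarrow> ('k \<times> 'g \<Rightarrow> complex) \<Rightarrow> 'g l2op \<Rightarrow> complex" where
  "vec_functional \<xi> \<eta> T =
     (if T \<in> group_vn then \<Sum>\<^sub>\<infinity>n. ell2_inner (T (slice \<xi> n)) (slice \<eta> n) else 0)"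

lemma abs_summable_slices:
  assumes "T \<in> bounded_ops" "\<xi> \<in> ell2" "\<eta> \<in> ell2"
  shows "(\<lambda>n. norm (ell2_inner (T (slice \<xi> n)) (slice \<eta> n))) summable_on UNIV"
proof -
  obtain C where C: "C \<ge> 0" "\<And>\<xi>. \<xi> \<in> ell2 \<Longrightarrow> ell2_norm (T \<xi>) \<le> C * ell2_norm \<xi>"
    using bounded_opsD(5)[OF assms(1)] by auto
  have le: "norm (ell2_inner (T (slice \<xi> n)) (slice \<eta> n)) \<le> C * (ell2_norm (slice \<xi> n) * ell2_norm (slice \<eta> n))" for n
    using ell2_Cauchy_Schwarz[OF bounded_opsD(1)[OF assms(1) slice_ell2(1)[OF assms(2)]] slice_ell2(1)[OF assms(3)], of n n]
      mult_right_mono[OF C(2)[OF slice_ell2(1)[OF assms(2)]] ell2_norm_nonneg, of n "slice \<eta> n"] by simp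
  have s: "(\<lambda>n. C * (ell2_norm (slice \<xi> n) * ell2_norm (slice \<eta> n))) summable_on UNIV"
    by (intro summable_on_cmult_right summable_norm_slices assms)
  show ?thesis by (rule summable_on_comparison_test[OF s]) (use le in auto)
qed

lemma has_sum_vec_functional:
  assumes "T \<in> group_vn" "\<xi> \<in> ell2" "\<eta> \<in> ell2"
  shows "((\<lambda>n. ell2_inner (T (slice \<xi> n)) (slice \<eta> n)) has_sum vec_functional \<xi> \<eta> T) UNIV"
  using abs_summable_summable[OF abs_summable_slices[OF group_vn_bounded[OF assms(1)] assms(2,3)]] assms(1)
  by (simp add: vec_functional_def)

lemma has_sum_finite_sum:
  fixes f :: "'s \<Rightarrow> 'a \<Rightarrow> 'b::topological_comm_monoid_add"
  shows "(\<And>s. s \<in> S \<Longrightarrow> (f s has_sum g s) A) \<Longrightarrow> ((\<lambda>x. \<Sum>s\<in>S. f s x) has_sum (\<Sum>s\<in>S. g s)) A"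
  by (induction S rule: infinite_finite_induct) (auto intro: has_sum_add)

text \<open>Cauchy-Schwarz twice: for each \<open>n\<close>, between the rows of \<open>T\<close>
  applied to the multiples \<open>z l\<close> of the slice of \<open>\<xi>\<close> and the slice of
  \<open>\<eta>\<close>, and then over \<open>n\<close>. It says that the functional has complete
  bound at most the product of the norms.\<close>

lemma vec_functional_matrix_bound:
  assumes T: "T \<in> mats m group_vn" and \<xi>: "\<xi> \<in> ell2" and \<eta>: "\<eta> \<in> ell2"
  shows "bil_bounded {..<m} {..<m} (\<lambda>k l. vec_functional \<xi> \<eta> (T k l)) (op_mnorm m T * (ell2_norm \<xi> * ell2_norm \<eta>))"
  unfolding bil_bounded_def
proof (intro allI)
  fix w z :: "nat \<Rightarrow> complex"
  note Tb = mats_group_vn_bounded[OF T]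
  let ?q = "\<lambda>n. \<Sum>k<m. \<Sum>l<m. w k * ell2_inner (T k l (slice \<xi> n)) (slice \<eta> n) * z l"
  have hs: "(?q has_sum (\<Sum>k<m. \<Sum>l<m. w k * vec_functional \<xi> \<eta> (T k l) * z l)) UNIV"
    by (intro has_sum_finite_sum has_sum_cmult_left has_sum_cmult_right has_sum_vec_functional)
       (use T \<xi> \<eta> in \<open>auto simp: mats_def\<close>)
  have le: "norm (?q n) \<le> op_mnorm m T * L2c w {..<m} * L2c z {..<m} * (ell2_norm (slice \<xi> n) * ell2_norm (slice \<eta> n))" for n
  proof -
    note sx = slice_ell2(1)[OF \<xi>, of n] and se = slice_ell2(1)[OF \<eta>, of n]
    let ?v = "\<lambda>k. \<Sum>l<m. T k l (smul (z l) (slice \<xi> n))"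
    have v: "?v k \<in> ell2" if "k < m" for k
      by (rule mats_op_sum_ell2[OF Tb that ell2_smul[OF sx]])
    have inner: "ell2_inner (?v k) (slice \<eta> n) = (\<Sum>l<m. ell2_inner (T k l (slice \<xi> n)) (slice \<eta> n) * z l)" if k: "k < m" for k
    proof -
      have B: "T k l \<in> bounded_ops" if "l < m" for l using Tb k that by (simp add: mats_def)
      have m: "T k l (smul (z l) (slice \<xi> n)) \<in> ell2" if "l < m" for l
        by (rule bounded_opsD(1)[OF B[OF that] ell2_smul[OF sx]])
      have "ell2_inner (\<Sum>l\<in>S. T k l (smul (z l) (slice \<xi> n))) (slice \<eta> n)
          = (\<Sum>l\<in>S. ell2_inner (T k l (smul (z l) (slice \<xi> n))) (slice \<eta> n))" if "finite S" "S \<subseteq> {..<m}" for S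
        using that
      proof (induction S)
        case (insert a S)
        have "ell2_inner (T k a (smul (z a) (slice \<xi> n)) + (\<Sum>l\<in>S. T k l (smul (z l) (slice \<xi> n)))) (slice \<eta> n)
            = ell2_inner (T k a (smul (z a) (slice \<xi> n))) (slice \<eta> n)
              + ell2_inner (\<Sum>l\<in>S. T k l (smul (z l) (slice \<xi> n))) (slice \<eta> n)"
          using insert.prems by (intro ell2_inner_add_left se m ell2_sum) auto
        moreover have "S \<subseteq> {..<m}" using insert.prems by simp
        note insert.IH[OF this]
        ultimately show ?case unfolding sum.insert[OF insert.hyps] by (simp only:)
      qed simp
      from this[of "{..<m}"] show ?thesis
        by (simp add: bounded_opsD(3)[OF B sx] ell2_inner_smul_left mult.commute)
    qed
    have "?q n = (\<Sum>k<m. w k * ell2_inner (?v k) (slice \<eta> n))"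
      by (intro sum.cong refl) (simp add: inner sum_distrib_left mult.assoc)
    also have "norm \<dots> \<le> (\<Sum>k<m. \<bar>cmod (w k)\<bar> * \<bar>ell2_norm (?v k)\<bar> * ell2_norm (slice \<eta> n))"
      by (rule order_trans[OF norm_sum]) (auto intro!: sum_mono mult_left_mono ell2_Cauchy_Schwarz v se simp: norm_mult mult.assoc)
    also have "\<dots> \<le> (L2c w {..<m} * L2_set (\<lambda>k. ell2_norm (?v k)) {..<m}) * ell2_norm (slice \<eta> n)"
      unfolding sum_distrib_right[symmetric] by (intro mult_right_mono L2_set_mult_ineq) simp
    also have "\<dots> \<le> (L2c w {..<m} * (op_mnorm m T * L2_set (\<lambda>l. ell2_norm (smul (z l) (slice \<xi> n))) {..<m})) * ell2_norm (slice \<eta> n)"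
      by (intro mult_right_mono mult_left_mono op_mnorm_bound Tb ell2_smul sx) auto
    also have "L2_set (\<lambda>l. ell2_norm (smul (z l) (slice \<xi> n))) {..<m} = L2c z {..<m} * ell2_norm (slice \<xi> n)"
      by (simp add: ell2_norm_smul L2_set_left_distrib)
    finally show ?thesis by (simp add: mult_ac)
  qed
  have nn: "0 \<le> op_mnorm m T * L2c w {..<m} * L2c z {..<m}"
    using op_mnorm_nonneg[OF Tb] by simp
  have s: "(\<lambda>n. op_mnorm m T * L2c w {..<m} * L2c z {..<m} * (ell2_norm (slice \<xi> n) * ell2_norm (slice \<eta> n))) summable_on UNIV"
    by (intro summable_on_cmult_right summable_norm_slices \<xi> \<eta>)
  have as: "(\<lambda>n. norm (?q n)) summable_on UNIV"
    by (rule summable_on_comparison_test[OF s]) (auto intro: le)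
  have "norm (\<Sum>\<^sub>\<infinity>n. ?q n) \<le> (\<Sum>\<^sub>\<infinity>n. norm (?q n))" by (rule norm_infsum_bound[OF as])
  also have "\<dots> \<le> (\<Sum>\<^sub>\<infinity>n. op_mnorm m T * L2c w {..<m} * L2c z {..<m} * (ell2_norm (slice \<xi> n) * ell2_norm (slice \<eta> n)))"
    by (rule infsum_mono[OF as s le])
  also have "\<dots> = op_mnorm m T * L2c w {..<m} * L2c z {..<m} * (\<Sum>\<^sub>\<infinity>n. ell2_norm (slice \<xi> n) * ell2_norm (slice \<eta> n))"
    by (rule infsum_cmult_right')
  also have "\<dots> \<le> op_mnorm m T * L2c w {..<m} * L2c z {..<m} * (ell2_norm \<xi> * ell2_norm \<eta>)"
    by (intro mult_left_mono summable_norm_slices \<xi> \<eta> nn)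
  finally show "cmod (\<Sum>k<m. \<Sum>l<m. w k * vec_functional \<xi> \<eta> (T k l) * z l)
       \<le> op_mnorm m T * (ell2_norm \<xi> * ell2_norm \<eta>) * L2c w {..<m} * L2c z {..<m}"
    using infsumI[OF hs] by (simp add: mult_ac)
qed

lemma op_mnorm_1_le:
  assumes "T \<in> bounded_ops" "0 \<le> C" "\<And>\<xi>. \<xi> \<in> ell2 \<Longrightarrow> ell2_norm (T \<xi>) \<le> C * ell2_norm \<xi>"
  shows "op_mnorm 1 (\<lambda>_ _. T) \<le> C"
  unfolding op_mnorm_def
proof (rule cSup_least)
  show "{sqrt (\<Sum>k<1::nat. (ell2_norm (\<Sum>l<1::nat. T (\<xi> l)))\<^sup>2) | \<xi>. (\<forall>l<1. \<xi> l \<in> ell2) \<and> (\<Sum>l<1. (ell2_norm (\<xi> l))\<^sup>2) \<le> 1} \<noteq> {}"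
    by (auto intro!: exI[of _ "\<lambda>_. 0"])
  fix r assume "r \<in> {sqrt (\<Sum>k<1::nat. (ell2_norm (\<Sum>l<1::nat. T (\<xi> l)))\<^sup>2) | \<xi>. (\<forall>l<1. \<xi> l \<in> ell2) \<and> (\<Sum>l<1. (ell2_norm (\<xi> l))\<^sup>2) \<le> 1}"
  then obtain \<xi> where \<xi>: "r = ell2_norm (T (\<xi> (0::nat)))" "\<xi> 0 \<in> ell2" "(ell2_norm (\<xi> 0))\<^sup>2 \<le> 1" by auto
  have "r \<le> C * ell2_norm (\<xi> 0)" unfolding \<xi>(1) by (rule assms(3)[OF \<xi>(2)])
  also have "\<dots> \<le> C * 1" using \<xi>(3) assms(2) by (intro mult_left_mono) (simp_all add: abs_square_le_1)
  finally show "r \<le> C" by simp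
qed

lemma bounded_sesquilinear_vec_functional:
  assumes T: "T \<in> group_vn" and C: "\<And>\<xi>. \<xi> \<in> ell2 \<Longrightarrow> ell2_norm (T \<xi>) \<le> C * ell2_norm \<xi>" "0 \<le> C"
  shows "bounded_sesquilinear (\<lambda>\<xi> \<eta>. vec_functional \<xi> \<eta> T) C"
proof
  note Tb = group_vn_bounded[OF T]
  have sa: "slice (\<xi> + \<eta>) n = slice \<xi> n + slice \<eta> n" for \<xi> \<eta> :: "'b \<times> 'a \<Rightarrow> complex" and n by auto
  have sm: "slice (smul c \<xi>) n = smul c (slice \<xi> n)" for c and \<xi> :: "'b \<times> 'a \<Rightarrow> complex" and n by (simp add: smul_def)
  fix \<zeta> \<zeta>' \<theta> \<theta>' :: "'b \<times> 'a \<Rightarrow> complex" and c assume m: "\<zeta> \<in> ell2" "\<theta> \<in> ell2"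
  note S = slice_ell2(1)
  note hs = has_sum_vec_functional[OF T]
  show "cmod (vec_functional \<zeta> \<theta> T) \<le> C * ell2_norm \<zeta> * ell2_norm \<theta>"
  proof -
    have "(\<lambda>_ _. T) \<in> mats 1 group_vn" using T by (simp add: mats_def)
    from bil_bounded_entry[OF vec_functional_matrix_bound[OF this m], of 0 0]
    have "cmod (vec_functional \<zeta> \<theta> T) \<le> op_mnorm 1 (\<lambda>_ _. T) * (ell2_norm \<zeta> * ell2_norm \<theta>)" by simp
    also have "\<dots> \<le> C * (ell2_norm \<zeta> * ell2_norm \<theta>)"
      using op_mnorm_1_le[OF Tb C(2) C(1)] by (intro mult_right_mono) auto
    finally show ?thesis by (simp add: mult.assoc)
  qed
  show "vec_functional (smul c \<zeta>) \<theta> T = c * vec_functional \<zeta> \<theta> T"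
  proof (rule has_sum_unique[OF hs[OF ell2_smul[OF m(1)] m(2)]])
    show "((\<lambda>n. ell2_inner (T (slice (smul c \<zeta>) n)) (slice \<theta> n)) has_sum c * vec_functional \<zeta> \<theta> T) UNIV"
      using has_sum_cmult_right[OF hs[OF m], of c]
      by (simp add: sm bounded_opsD(3)[OF Tb S[OF m(1)]] ell2_inner_smul_left)
  qed
  show "vec_functional \<zeta> (smul c \<theta>) T = cnj c * vec_functional \<zeta> \<theta> T"
  proof (rule has_sum_unique[OF hs[OF m(1) ell2_smul[OF m(2)]]])
    show "((\<lambda>n. ell2_inner (T (slice \<zeta> n)) (slice (smul c \<theta>) n)) has_sum cnj c * vec_functional \<zeta> \<theta> T) UNIV"
      using has_sum_cmult_right[OF hs[OF m], of "cnj c"] by (simp add: sm ell2_inner_smul_right)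
  qed
  show "vec_functional (\<zeta> + \<zeta>') \<theta> T = vec_functional \<zeta> \<theta> T + vec_functional \<zeta>' \<theta> T" if m': "\<zeta>' \<in> ell2"
  proof (rule has_sum_unique[OF hs[OF ell2_add[OF m(1) m'] m(2)]])
    have "ell2_inner (T (slice (\<zeta> + \<zeta>') n)) (slice \<theta> n)
        = ell2_inner (T (slice \<zeta> n)) (slice \<theta> n) + ell2_inner (T (slice \<zeta>' n)) (slice \<theta> n)" for n
      unfolding sa bounded_opsD(2)[OF Tb S[OF m(1)] S[OF m']]
      by (intro ell2_inner_add_left bounded_opsD(1)[OF Tb] S m m')
    then show "((\<lambda>n. ell2_inner (T (slice (\<zeta> + \<zeta>') n)) (slice \<theta> n)) has_sum
        vec_functional \<zeta> \<theta> T + vec_functional \<zeta>' \<theta> T) UNIV"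
      using has_sum_add[OF hs[OF m] hs[OF m' m(2)]] by (simp only:)
  qed
  show "vec_functional \<zeta> (\<theta> + \<theta>') T = vec_functional \<zeta> \<theta> T + vec_functional \<zeta> \<theta>' T" if m': "\<theta>' \<in> ell2"
  proof (rule has_sum_unique[OF hs[OF m(1) ell2_add[OF m(2) m']]])
    have "ell2_inner (T (slice \<zeta> n)) (slice (\<theta> + \<theta>') n)
        = ell2_inner (T (slice \<zeta> n)) (slice \<theta> n) + ell2_inner (T (slice \<zeta> n)) (slice \<theta>' n)" for n
      unfolding sa by (intro ell2_inner_add_right bounded_opsD(1)[OF Tb] S m m')
    then show "((\<lambda>n. ell2_inner (T (slice \<zeta> n)) (slice (\<theta> + \<theta>') n)) has_sum
        vec_functional \<zeta> \<theta> T + vec_functional \<zeta> \<theta>' T) UNIV"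
      using has_sum_add[OF hs[OF m] hs[OF m(1) m']] by (simp only:)
  qed
qed

lemma vec_functional_delta:
  assumes "T \<in> group_vn"
  shows "vec_functional (delta (n, y)) (delta (n', x)) T = (if n = n' then mc T x y else 0)"
proof -
  have sl: "slice (delta (n, y)) k = (if k = n then delta y else 0)"
    "slice (delta (n', x)) k = (if k = n' then delta x else 0)" for k
    by (auto simp: delta_def fun_eq_iff)
  have T0: "T 0 = 0" using bounded_opsD(3)[OF group_vn_bounded[OF assms], of 0 0] by simp
  have "((\<lambda>k. ell2_inner (T (slice (delta (n, y)) k)) (slice (delta (n', x)) k)) has_sum (if n = n' then mc T x y else 0)) UNIV"
    unfolding sl by (rule has_sum_finite_neutralI[of "{n}"]) (auto simp: T0 mc_def)
  from has_sum_unique[OF has_sum_vec_functional[OF assms delta_ell2 delta_ell2] this] show ?thesis .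
qed

lemma vn_predual_iff: "\<phi> \<in> vn_predual \<longleftrightarrow> (\<exists>\<xi> \<eta> :: nat \<times> 'g \<Rightarrow> complex. \<xi> \<in> ell2 \<and> \<eta> \<in> ell2 \<and> \<phi> = vec_functional \<xi> \<eta>)"
  for \<phi> :: "'g::group_add l2op \<Rightarrow> complex"
proof
  assume "\<phi> \<in> vn_predual"
  then obtain \<xi> \<eta> :: "nat \<Rightarrow> 'g \<Rightarrow> complex" where \<phi>: "\<phi> = (\<lambda>T. if T \<in> group_vn then \<Sum>n. ell2_inner (T (\<xi> n)) (\<eta> n) else 0)"
    and m: "\<And>n. \<xi> n \<in> ell2" "\<And>n. \<eta> n \<in> ell2"
    and s: "summable (\<lambda>n. (ell2_norm (\<xi> n))\<^sup>2)" "summable (\<lambda>n. (ell2_norm (\<eta> n))\<^sup>2)"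
    unfolding vn_predual_def by blast
  let ?x = "\<lambda>(n, x). \<xi> n x" and ?e = "\<lambda>(n, x). \<eta> n x"
  have x: "?x \<in> ell2" and e: "?e \<in> ell2"
    using s m by (auto intro!: ell2_sliceI(1)[OF _ has_sum_infsum] summable_nonneg_imp_summable_on)
  have "\<phi> T = vec_functional ?x ?e T" for T
  proof (cases "T \<in> group_vn")
    case True
    from has_sum_imp_sums[OF has_sum_vec_functional[OF this x e]] True
    show ?thesis by (simp add: \<phi> sums_iff)
  qed (simp add: \<phi> vec_functional_def)
  with x e show "\<exists>\<xi> \<eta> :: nat \<times> 'g \<Rightarrow> complex. \<xi> \<in> ell2 \<and> \<eta> \<in> ell2 \<and> \<phi> = vec_functional \<xi> \<eta>" by blast
next
  assume "\<exists>\<xi> \<eta> :: nat \<times> 'g \<Rightarrow> complex. \<xi> \<in> ell2 \<and> \<eta> \<in> ell2 \<and> \<phi> = vec_functional \<xi> \<eta>"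
  then obtain \<xi> \<eta> :: "nat \<times> 'g \<Rightarrow> complex" where m: "\<xi> \<in> ell2" "\<eta> \<in> ell2" and \<phi>: "\<phi> = vec_functional \<xi> \<eta>" by blast
  have "\<phi> = (\<lambda>T. if T \<in> group_vn then \<Sum>n. ell2_inner (T (slice \<xi> n)) (slice \<eta> n) else 0)"
  proof
    fix T :: "'g l2op"
    show "\<phi> T = (if T \<in> group_vn then \<Sum>n. ell2_inner (T (slice \<xi> n)) (slice \<eta> n) else 0)"
    proof (cases "T \<in> group_vn")
      case True
      from has_sum_imp_sums[OF has_sum_vec_functional[OF this m]] True show ?thesis by (simp add: \<phi> sums_iff)
    qed (simp add: \<phi> vec_functional_def)
  qed
  moreover have "summable (\<lambda>n. (ell2_norm (slice \<xi> n))\<^sup>2)" "summable (\<lambda>n. (ell2_norm (slice \<eta> n))\<^sup>2)"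
    using has_sum_imp_sums[OF has_sum_slice_norm[OF m(1)]] has_sum_imp_sums[OF has_sum_slice_norm[OF m(2)]]
    by (auto simp: sums_iff)
  ultimately show "\<phi> \<in> vn_predual"
    unfolding vn_predual_def using slice_ell2(1)[OF m(1)] slice_ell2(1)[OF m(2)]
    by (intro CollectI exI[of _ "\<lambda>n. slice \<xi> n"] exI[of _ "\<lambda>n. slice \<eta> n"]) auto
qed

text \<open>The index type is transported along \<open>to_nat\<close>, with zero vectors at the
  numbers that are not hit.\<close>

lemma vec_functional_countable:
  fixes \<xi> \<eta> :: "'k::countable \<times> 'g::group_add \<Rightarrow> complex"
  assumes "\<xi> \<in> ell2" "\<eta> \<in> ell2"
  shows "\<exists>\<xi>' \<eta>' :: nat \<times> 'g \<Rightarrow> complex. \<xi>' \<in> ell2 \<and> \<eta>' \<in> ell2 \<and> ell2_norm \<xi>' = ell2_norm \<xi> \<and> ell2_norm \<eta>' = ell2_norm \<eta> \<and>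
    vec_functional \<xi>' \<eta>' = vec_functional \<xi> \<eta>"
proof -
  define ext where "ext = (\<lambda>(\<zeta> :: 'k \<times> 'g \<Rightarrow> complex) (n :: nat, x). if n \<in> range (to_nat :: 'k \<Rightarrow> nat) then \<zeta> (from_nat n, x) else 0)"
  have sl: "slice (ext \<zeta>) n = (if n \<in> range (to_nat :: 'k \<Rightarrow> nat) then slice \<zeta> (from_nat n) else 0)" for \<zeta> n
    by (auto simp: ext_def fun_eq_iff)
  have hs: "(f has_sum S) UNIV \<longleftrightarrow> ((\<lambda>k. f (to_nat (k :: 'k))) has_sum S) UNIV"
    if "\<And>n. n \<notin> range (to_nat :: 'k \<Rightarrow> nat) \<Longrightarrow> f n = 0" for f :: "nat \<Rightarrow> 'c::{comm_monoid_add,topological_space}" and S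
  proof -
    have "(f has_sum S) UNIV \<longleftrightarrow> (f has_sum S) (range (to_nat :: 'k \<Rightarrow> nat))"
      by (rule has_sum_cong_neutral) (auto simp: that)
    also have "\<dots> \<longleftrightarrow> ((f \<circ> to_nat) has_sum S) (UNIV :: 'k set)"
      by (rule has_sum_reindex) (auto simp: inj_on_def)
    finally show ?thesis by (simp add: o_def)
  qed
  have ext: "ext \<zeta> \<in> ell2" "ell2_norm (ext \<zeta>) = ell2_norm \<zeta>" if z: "\<zeta> \<in> ell2" for \<zeta>
  proof -
    have s: "slice (ext \<zeta>) n \<in> ell2" for n unfolding sl using slice_ell2(1)[OF z] by auto
    have h: "((\<lambda>n. (ell2_norm (slice (ext \<zeta>) n))\<^sup>2) has_sum (ell2_norm \<zeta>)\<^sup>2) UNIV"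
      unfolding sl using has_sum_slice_norm[OF z] by (subst hs) auto
    show "ext \<zeta> \<in> ell2" by (rule ell2_sliceI(1)[OF s h])
    show "ell2_norm (ext \<zeta>) = ell2_norm \<zeta>"
      using ell2_sliceI(2)[OF s h] by simp
  qed
  have "vec_functional (ext \<xi>) (ext \<eta>) T = vec_functional \<xi> \<eta> T" for T
  proof (cases "T \<in> group_vn")
    case True
    have T0: "T 0 = 0" using bounded_opsD(3)[OF group_vn_bounded[OF True], of 0 0] by simp
    have "((\<lambda>n. ell2_inner (T (slice (ext \<xi>) n)) (slice (ext \<eta>) n)) has_sum vec_functional \<xi> \<eta> T) UNIV"
      unfolding sl using has_sum_vec_functional[OF True assms] by (subst hs) (auto simp: T0)
    with has_sum_vec_functional[OF True ext(1)[OF assms(1)] ext(1)[OF assms(2)]] show ?thesis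
      by (rule has_sum_unique)
  qed (simp add: vec_functional_def)
  then show ?thesis
    using ext[OF assms(1)] ext[OF assms(2)] by (intro exI[of _ "ext \<xi>"] exI[of _ "ext \<eta>"]) auto
qed

lemma vec_functional_in_predual:
  fixes \<xi> \<eta> :: "'k::countable \<times> 'g::group_add \<Rightarrow> complex"
  assumes "\<xi> \<in> ell2" "\<eta> \<in> ell2"
  shows "vec_functional \<xi> \<eta> \<in> vn_predual"
  using vec_functional_countable[OF assms] vn_predual_iff by metis

text \<open>Regrouping of a double series. It keeps infinite sums of functionals inside the predual,
  on which both the completeness of the predual and its closure under products depend.\<close>

lemma vec_functional_concat:
  assumes \<xi>: "\<And>i. \<xi> i \<in> ell2" "((\<lambda>i. (ell2_norm (\<xi> i))\<^sup>2) has_sum S) UNIV"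
    and \<eta>: "\<And>i. \<eta> i \<in> ell2" "((\<lambda>i. (ell2_norm (\<eta> i))\<^sup>2) has_sum S') UNIV"
    and T: "T \<in> group_vn"
  shows "((\<lambda>i. vec_functional (\<xi> i) (\<eta> i) T) has_sum vec_functional (concat_family \<xi>) (concat_family \<eta>) T) UNIV"
proof -
  have "((\<lambda>p. ell2_inner (T (slice (concat_family \<xi>) p)) (slice (concat_family \<eta>) p)) has_sum
      vec_functional (concat_family \<xi>) (concat_family \<eta>) T) (Sigma UNIV (\<lambda>_. UNIV))"
    using has_sum_vec_functional[OF T concat_family_ell2(1)[OF \<xi>] concat_family_ell2(1)[OF \<eta>]] by simp
  then show ?thesis
    by (rule has_sum_SigmaD)
       (use has_sum_vec_functional[OF T \<xi>(1) \<eta>(1)] in \<open>simp add: concat_family_def\<close>)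
qed

section \<open>Completeness of \<open>ell2\<close> and orthogonal projections\<close>

lemma ell2_complete:
  assumes s: "\<And>k. s k \<in> ell2" and C: "\<And>e. e > 0 \<Longrightarrow> \<exists>K. \<forall>i\<ge>K. \<forall>j\<ge>K. ell2_norm (s i - s j) < e"
  shows "\<exists>w\<in>ell2. (\<lambda>k. ell2_norm (s k - w)) \<longlonglongrightarrow> 0"
proof -
  have "Cauchy (\<lambda>k. s k x)" for x
  proof (rule CauchyI)
    fix e :: real assume "e > 0"
    then obtain K where K: "\<forall>i\<ge>K. \<forall>j\<ge>K. ell2_norm (s i - s j) < e" using C by blast
    have "norm (s i x - s j x) < e" if "K \<le> i" "K \<le> j" for i j
      using cmod_le_ell2_norm[OF ell2_diff[OF s[of i] s[of j]], of x] K that by fastforce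
    then show "\<exists>M. \<forall>m\<ge>M. \<forall>n\<ge>M. norm (s m x - s n x) < e" by blast
  qed
  then have "\<exists>w. \<forall>x. (\<lambda>k. s k x) \<longlonglongrightarrow> w x"
    by (intro choice allI) (metis Cauchy_convergent_iff convergent_def)
  then obtain w where w: "\<And>x. (\<lambda>k. s k x) \<longlonglongrightarrow> w x" by blast
  have bd: "L2c (s i - w) F \<le> e"
    if K: "\<forall>i\<ge>K. \<forall>j\<ge>K. ell2_norm (s i - s j) < e" and i: "i \<ge> K" and F: "finite F" for e K i F
  proof (rule tendsto_upperbound)
    show "(\<lambda>j. L2c (s i - s j) F) \<longlonglongrightarrow> L2c (s i - w) F"
      by (intro tendsto_L2_set tendsto_norm) (auto intro!: tendsto_intros w)
    show "\<forall>\<^sub>F j in sequentially. L2c (s i - s j) F \<le> e"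
      using eventually_ge_at_top[of K]
    proof eventually_elim
      case (elim j)
      show ?case using L2c_le_ell2_norm[OF ell2_diff[OF s[of i] s[of j]] F] K i elim by fastforce
    qed
  qed simp
  obtain K1 where K1: "\<forall>i\<ge>K1. \<forall>j\<ge>K1. ell2_norm (s i - s j) < 1" using C[of 1] by auto
  have "s K1 - w \<in> ell2" by (rule ell2I[OF bd[OF K1 order_refl]])
  from ell2_diff[OF s[of K1] this] have w2: "w \<in> ell2" by simp
  have "(\<lambda>k. ell2_norm (s k - w)) \<longlonglongrightarrow> 0"
  proof (rule LIMSEQ_I)
    fix e :: real assume e: "e > 0"
    then obtain K where K: "\<forall>i\<ge>K. \<forall>j\<ge>K. ell2_norm (s i - s j) < e / 2" using C[of "e/2"] by auto
    have "ell2_norm (s i - w) \<le> e / 2" if "i \<ge> K" for i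
      by (rule ell2_norm_le[OF bd[OF K that]])
    then have "\<forall>i\<ge>K. norm (ell2_norm (s i - w) - 0) < e" using e by fastforce
    then show "\<exists>K. \<forall>i\<ge>K. norm (ell2_norm (s i - w) - 0) < e" by blast
  qed
  with w2 show ?thesis by blast
qed

lemma ell2_inner_diff_right:
  assumes "u \<in> ell2" "a \<in> ell2" "b \<in> ell2"
  shows "ell2_inner u (a - b) = ell2_inner u a - ell2_inner u b"
  using ell2_inner_add_right[OF assms(1) ell2_diff[OF assms(2,3)] assms(3)] by simp

lemma ell2_inner_diff_left:
  assumes "u \<in> ell2" "a \<in> ell2" "b \<in> ell2"
  shows "ell2_inner (a - b) u = ell2_inner a u - ell2_inner b u"
  using ell2_inner_add_left[OF ell2_diff[OF assms(2,3)] assms(3) assms(1)] by simp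

lemma ell2_norm_power2_diff:
  assumes "\<xi> \<in> ell2" "\<eta> \<in> ell2"
  shows "(ell2_norm (\<xi> - \<eta>))\<^sup>2 = (ell2_norm \<xi>)\<^sup>2 + (ell2_norm \<eta>)\<^sup>2 - 2 * Re (ell2_inner \<xi> \<eta>)"
proof -
  have "ell2_inner (\<xi> - \<eta>) (\<xi> - \<eta>) = ell2_inner \<xi> \<xi> - ell2_inner \<xi> \<eta> - ell2_inner \<eta> \<xi> + ell2_inner \<eta> \<eta>"
    unfolding ell2_inner_diff_right[OF ell2_diff[OF assms] assms]
      ell2_inner_diff_left[OF assms(1) assms] ell2_inner_diff_left[OF assms(2) assms] by simp
  then have "Re (ell2_inner (\<xi> - \<eta>) (\<xi> - \<eta>)) = Re (ell2_inner \<xi> \<xi> - ell2_inner \<xi> \<eta> - ell2_inner \<eta> \<xi> + ell2_inner \<eta> \<eta>)"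
    by (rule arg_cong)
  then show ?thesis
    using ell2_inner_commute[of \<eta> \<xi>] by (simp add: ell2_inner_self assms ell2_diff)
qed

lemma ell2_parallelogram:
  assumes "a \<in> ell2" "b \<in> ell2"
  shows "(ell2_norm (a - b))\<^sup>2 + (ell2_norm (a + b))\<^sup>2 = 2 * (ell2_norm a)\<^sup>2 + 2 * (ell2_norm b)\<^sup>2"
proof -
  have m: "smul (-1) b \<in> ell2" by (rule ell2_smul[OF assms(2)])
  have "a + b = a - smul (-1) b" by (auto simp: smul_def)
  then show ?thesis
    using ell2_norm_power2_diff[OF assms] ell2_norm_power2_diff[OF assms(1) m]
    by (simp only: ell2_norm_smul ell2_inner_smul_right) (simp)
qed

definition ell2_closure :: "('k \<Rightarrow> complex) set \<Rightarrow> ('k \<Rightarrow> complex) set" where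
  "ell2_closure K = {w \<in> ell2. \<forall>e>0. \<exists>k\<in>K. ell2_norm (w - k) < e}"

definition ell2_perp :: "('k \<Rightarrow> complex) set \<Rightarrow> ('k \<Rightarrow> complex) set" where
  "ell2_perp K = {u \<in> ell2. \<forall>k\<in>K. ell2_inner u k = 0}"

text \<open>A minimizing sequence for the distance from \<open>v\<close> to \<open>K\<close> is
  Cauchy by the parallelogram law, and its limit has the orthogonality by a variational argument. As
  \<open>K\<close> need not be closed, the limit is only found in the closure.\<close>

lemma ell2_projection_exists:
  assumes K: "cfun.subspace K" "K \<subseteq> ell2" and v: "v \<in> ell2"
  shows "\<exists>w\<in>ell2_closure K. v - w \<in> ell2_perp K"
proof -
  define d where "d = Inf ((\<lambda>k. (ell2_norm (v - k))\<^sup>2) ` K)"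
  have bdd: "bdd_below ((\<lambda>k. (ell2_norm (v - k))\<^sup>2) ` K)" by (rule bdd_belowI[of _ 0]) auto
  have d_le: "d \<le> (ell2_norm (v - k))\<^sup>2" if "k \<in> K" for k
    unfolding d_def by (rule cInf_lower[OF _ bdd]) (use that in auto)
  have "\<exists>k\<in>K. (ell2_norm (v - k))\<^sup>2 < d + 1 / real (Suc j)" for j
  proof -
    have "(\<lambda>k. (ell2_norm (v - k))\<^sup>2) ` K \<noteq> {}" using cfun.subspace_0[OF K(1)] by auto
    from cInf_lessD[OF this, of "d + 1 / real (Suc j)"] show ?thesis by (auto simp: d_def)
  qed
  then obtain s where s: "\<And>j. s j \<in> K" "\<And>j. (ell2_norm (v - s j))\<^sup>2 < d + 1 / real (Suc j)" by metis
  have sl: "s j \<in> ell2" for j using s K by auto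
  have near: "(ell2_norm (s i - s j))\<^sup>2 \<le> 2 / real (Suc i) + 2 / real (Suc j)" for i j
  proof -
    \<comment> \<open>The midpoint of \<open>s i\<close> and \<open>s j\<close> lies in
      \<open>K\<close> and has squared distance at least \<open>d\<close> from \<open>v\<close>; the
      parallelogram law then bounds the distance of \<open>s i\<close> and
      \<open>s j\<close>.\<close>
    let ?m = "smul (1/2) (s i + s j)"
    have mK: "?m \<in> K" using s(1) K(1) by (intro cfun.subspace_scale cfun.subspace_add)
    have e1: "(v - s j) - (v - s i) = s i - s j" by simp
    have e2: "(v - s j) + (v - s i) = smul 2 (v - ?m)" by (auto simp: smul_def fun_eq_iff field_simps)
    have "(ell2_norm (s i - s j))\<^sup>2 + (ell2_norm (smul 2 (v - ?m)))\<^sup>2 = 2 * (ell2_norm (v - s j))\<^sup>2 + 2 * (ell2_norm (v - s i))\<^sup>2"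
      using ell2_parallelogram[OF ell2_diff[OF v sl[of j]] ell2_diff[OF v sl[of i]]] unfolding e1 e2 .
    then have "(ell2_norm (s i - s j))\<^sup>2 = 2 * (ell2_norm (v - s j))\<^sup>2 + 2 * (ell2_norm (v - s i))\<^sup>2 - 4 * (ell2_norm (v - ?m))\<^sup>2"
      by (simp add: ell2_norm_smul power_mult_distrib)
    then show ?thesis using d_le[OF mK] s(2)[of i] s(2)[of j] by simp
  qed
  have "\<exists>w\<in>ell2. (\<lambda>k. ell2_norm (s k - w)) \<longlonglongrightarrow> 0"
  proof (rule ell2_complete[OF sl])
    fix e :: real assume e: "e > 0"
    obtain M where M: "4 / e\<^sup>2 < real M" using reals_Archimedean2 by blast
    have "ell2_norm (s i - s j) < e" if "i \<ge> M" "j \<ge> M" for i j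
    proof (rule power2_less_imp_less)
      have r: "2 / real (Suc n) < e\<^sup>2 / 2" if "n \<ge> M" for n
      proof -
        have "4 / e\<^sup>2 < real (Suc n)" using M that by linarith
        then show ?thesis using e by (simp add: field_simps)
      qed
      show "(ell2_norm (s i - s j))\<^sup>2 < e\<^sup>2"
        using near[of i j] r[OF that(1)] r[OF that(2)] by linarith
    qed (use e in simp)
    then show "\<exists>K. \<forall>i\<ge>K. \<forall>j\<ge>K. ell2_norm (s i - s j) < e" by blast
  qed
  then obtain w where w: "w \<in> ell2" "(\<lambda>k. ell2_norm (s k - w)) \<longlonglongrightarrow> 0" by blast
  have "w \<in> ell2_closure K"
    unfolding ell2_closure_def
  proof (intro CollectI conjI allI impI w(1))
    fix e :: real assume "e > 0"
    from order_tendstoD(2)[OF w(2) this] obtain j where "ell2_norm (s j - w) < e"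
      by (auto simp: eventually_sequentially)
    then show "\<exists>k\<in>K. ell2_norm (w - k) < e" using s(1)[of j] ell2_norm_minus_commute by metis
  qed
  moreover have "ell2_inner (v - w) k = 0" if k: "k \<in> K" for k
  proof -
    have k2: "k \<in> ell2" using k K by auto
    have small: "(cmod (ell2_inner (v - s j) k))\<^sup>2 \<le> (ell2_norm k)\<^sup>2 * (1 / real (Suc j))" for j
    proof (cases "ell2_norm k = 0")
      case True
      then have "k = 0" by (rule ell2_norm_eq_0[OF k2])
      then show ?thesis by simp
    next
      case False
      define c where "c = ell2_inner (v - s j) k"
      define r where "r = (ell2_norm k)\<^sup>2"
      have r: "r > 0" using False by (simp add: r_def)
      \<comment> \<open>The minimizer of the squared norm of \<open>(v - s j) - smul t k\<close>, a
        quadratic function of \<open>t\<close>. The infimum can be undercut by at most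
        \<open>1 / (j + 1)\<close>, which bounds the inner product \<open>c\<close>.\<close>
      define t where "t = c / of_real r"
      have "s j + smul t k \<in> K" using s(1) k K(1) by (intro cfun.subspace_scale cfun.subspace_add)
      from d_le[OF this] have "d \<le> (ell2_norm ((v - s j) - smul t k))\<^sup>2"
        by (simp add: diff_diff_eq)
      also have "\<dots> = (ell2_norm (v - s j))\<^sup>2 + (cmod t)\<^sup>2 * r - 2 * Re (cnj t * c)"
        by (subst ell2_norm_power2_diff[OF ell2_diff[OF v sl] ell2_smul[OF k2]])
           (simp add: ell2_norm_smul power_mult_distrib r_def ell2_inner_smul_right c_def)
      also have "cnj t * c = of_real ((cmod c)\<^sup>2 / r)"
        using complex_norm_square[of c] by (simp add: t_def mult.commute)
      also have "(cmod t)\<^sup>2 * r = (cmod c)\<^sup>2 / r"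
        using r by (simp add: t_def norm_divide power_divide power2_eq_square)
      finally have "(cmod c)\<^sup>2 / r \<le> 1 / real (Suc j)"
        unfolding Re_complex_of_real using s(2)[of j] by linarith
      then show ?thesis using r by (simp add: c_def r_def[symmetric] field_simps)
    qed
    have "(\<lambda>j. (ell2_norm k)\<^sup>2 * (1 / real (Suc j))) \<longlonglongrightarrow> (ell2_norm k)\<^sup>2 * 0"
      by (intro tendsto_intros lim_1_over_n[THEN LIMSEQ_Suc])
    then have l0: "(\<lambda>j. (ell2_norm k)\<^sup>2 * (1 / real (Suc j))) \<longlonglongrightarrow> 0" by simp
    have "(\<lambda>j. (cmod (ell2_inner (v - s j) k))\<^sup>2) \<longlonglongrightarrow> 0"
      by (rule tendsto_sandwich[OF always_eventually always_eventually tendsto_const l0]) (use small in auto)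
    from tendsto_real_sqrt[OF this] have l1: "(\<lambda>j. cmod (ell2_inner (v - s j) k)) \<longlonglongrightarrow> 0" by simp
    have "cmod (ell2_inner (v - w) k) \<le> cmod (ell2_inner (v - s j) k) + ell2_norm (s j - w) * ell2_norm k" for j
    proof -
      have "ell2_inner (v - w) k = ell2_inner ((v - s j) + (s j - w)) k" by simp
      also have "\<dots> = ell2_inner (v - s j) k + ell2_inner (s j - w) k"
        by (intro ell2_inner_add_left ell2_diff v sl w k2)
      finally have "cmod (ell2_inner (v - w) k) \<le> cmod (ell2_inner (v - s j) k) + cmod (ell2_inner (s j - w) k)"
        by (simp add: norm_triangle_ineq)
      with ell2_Cauchy_Schwarz[OF ell2_diff[OF sl[of j] w(1)] k2] show ?thesis by linarith
    qed
    moreover have "(\<lambda>j. cmod (ell2_inner (v - s j) k) + ell2_norm (s j - w) * ell2_norm k) \<longlonglongrightarrow> 0 + 0 * ell2_norm k"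
      by (intro tendsto_intros l1 w(2))
    ultimately have "cmod (ell2_inner (v - w) k) \<le> 0 + 0 * ell2_norm k"
      by (intro tendsto_lowerbound[OF _ always_eventually]) auto
    then show ?thesis by simp
  qed
  ultimately show ?thesis
    using ell2_diff[OF v w(1)] by (auto simp: ell2_perp_def)
qed

lemma ell2_perp_closure:
  assumes K: "K \<subseteq> ell2" and u: "u \<in> ell2_perp K" and w: "w \<in> ell2_closure K"
  shows "ell2_inner u w = 0"
proof (rule ccontr)
  assume n: "ell2_inner u w \<noteq> 0"
  have u2: "u \<in> ell2" and w2: "w \<in> ell2" using u w by (auto simp: ell2_perp_def ell2_closure_def)
  define e where "e = cmod (ell2_inner u w) / (ell2_norm u + 1)"
  have pos: "ell2_norm u + 1 > 0" using ell2_norm_nonneg[of u] by linarith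
  have "e > 0" using n pos by (simp add: e_def)
  then obtain k where k: "k \<in> K" "ell2_norm (w - k) < e" using w by (auto simp: ell2_closure_def)
  have k2: "k \<in> ell2" using k K by auto
  have "ell2_inner u w = ell2_inner u (w - k)"
    using u k(1) by (simp add: ell2_inner_diff_right[OF u2 w2 k2] ell2_perp_def)
  then have "cmod (ell2_inner u w) \<le> ell2_norm u * ell2_norm (w - k)"
    using ell2_Cauchy_Schwarz[OF u2 ell2_diff[OF w2 k2]] by simp
  also have "\<dots> \<le> ell2_norm u * e" using k(2) by (intro mult_left_mono) auto
  also have "\<dots> < (ell2_norm u + 1) * e" using \<open>e > 0\<close> by (simp add: distrib_right)
  also have "\<dots> = cmod (ell2_inner u w)" using pos by (simp add: e_def)
  finally show False by simp
qed

lemma subspace_ell2_closure: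
  assumes K: "cfun.subspace K" "K \<subseteq> ell2"
  shows "cfun.subspace (ell2_closure K)"
proof (rule cfun.subspaceI)
  show "0 \<in> ell2_closure K"
    using cfun.subspace_0[OF K(1)] by (auto simp: ell2_closure_def intro!: bexI[of _ 0])
next
  fix x y assume xy: "x \<in> ell2_closure K" "y \<in> ell2_closure K"
  then have x2: "x \<in> ell2" and y2: "y \<in> ell2" by (auto simp: ell2_closure_def)
  have "\<exists>k\<in>K. ell2_norm (x + y - k) < e" if e: "e > 0" for e
  proof -
    have "e / 2 > 0" using e by simp
    then obtain k k' where k: "k \<in> K" "ell2_norm (x - k) < e/2" "k' \<in> K" "ell2_norm (y - k') < e/2"
      using xy unfolding ell2_closure_def by blast
    then have kl: "k \<in> ell2" "k' \<in> ell2" using K by auto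
    have e: "x + y - (k + k') = (x - k) + (y - k')" by simp
    have "ell2_norm (x + y - (k + k')) \<le> ell2_norm (x - k) + ell2_norm (y - k')"
      unfolding e by (rule ell2_norm_triangle[OF ell2_diff[OF x2 kl(1)] ell2_diff[OF y2 kl(2)]])
    then show ?thesis using k cfun.subspace_add[OF K(1) k(1,3)] by (intro bexI[of _ "k + k'"]) auto
  qed
  then show "x + y \<in> ell2_closure K" using ell2_add[OF x2 y2] by (simp add: ell2_closure_def)
next
  fix c x assume x: "x \<in> ell2_closure K"
  then have x2: "x \<in> ell2" by (auto simp: ell2_closure_def)
  have "\<exists>k\<in>K. ell2_norm (smul c x - k) < e" if e: "e > 0" for e
  proof -
    have p: "cmod c + 1 > 0" using norm_ge_zero[of c] by linarith
    then have "e / (cmod c + 1) > 0" using e by simp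
    then obtain k where k: "k \<in> K" "ell2_norm (x - k) < e / (cmod c + 1)"
      using x unfolding ell2_closure_def by blast
    have "smul c x - smul c k = smul c (x - k)" by (auto simp: smul_def algebra_simps)
    then have "ell2_norm (smul c x - smul c k) = cmod c * ell2_norm (x - k)" by (simp add: ell2_norm_smul)
    also have "\<dots> \<le> (cmod c + 1) * ell2_norm (x - k)" by (intro mult_right_mono) auto
    also have "\<dots> < e" using k(2) p by (simp add: pos_less_divide_eq mult.commute)
    finally show ?thesis using cfun.subspace_scale[OF K(1) k(1)] by blast
  qed
  then show "smul c x \<in> ell2_closure K" using ell2_smul[OF x2] by (simp add: ell2_closure_def)
qed

lemma subspace_ell2_perp:
  assumes "K \<subseteq> ell2" shows "cfun.subspace (ell2_perp K)"
  using assms by (auto simp: cfun.subspace_def ell2_perp_def ell2_add ell2_smul ell2_inner_smul_left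
      ell2_inner_add_left[OF _ _ subsetD[OF assms]] simp del: plus_fun_apply)

text \<open>The orthogonal projection onto the closure of \<open>K\<close>, for a subspace
  \<open>K\<close> of \<open>ell2\<close>; \<open>proj_eqI\<close> shows that the choice is
  unique.\<close>

definition proj :: "('k \<Rightarrow> complex) set \<Rightarrow> 'k l2op" where
  "proj K v = (if v \<in> ell2 then SOME w. w \<in> ell2_closure K \<and> v - w \<in> ell2_perp K else 0)"

lemma proj_props:
  assumes "cfun.subspace K" "K \<subseteq> ell2" "v \<in> ell2"
  shows "proj K v \<in> ell2_closure K" "v - proj K v \<in> ell2_perp K"
proof -
  have "\<exists>w. w \<in> ell2_closure K \<and> v - w \<in> ell2_perp K" using ell2_projection_exists[OF assms] by blast
  from someI_ex[OF this] show "proj K v \<in> ell2_closure K" "v - proj K v \<in> ell2_perp K"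
    by (simp_all add: proj_def assms(3))
qed

lemma proj_eqI:
  assumes K: "cfun.subspace K" "K \<subseteq> ell2" and v: "v \<in> ell2" and w: "w \<in> ell2_closure K" "v - w \<in> ell2_perp K"
  shows "proj K v = w"
proof -
  note p = proj_props[OF K v]
  have 1: "proj K v - w \<in> ell2_closure K"
    by (rule cfun.subspace_diff[OF subspace_ell2_closure[OF K] p(1) w(1)])
  have "(v - w) - (v - proj K v) \<in> ell2_perp K"
    by (rule cfun.subspace_diff[OF subspace_ell2_perp[OF K(2)] w(2) p(2)])
  moreover have "(v - w) - (v - proj K v) = proj K v - w" by simp
  ultimately have "ell2_inner (proj K v - w) (proj K v - w) = 0"
    using ell2_perp_closure[OF K(2) _ 1] by metis
  moreover have e: "proj K v - w \<in> ell2" using 1 by (simp add: ell2_closure_def)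
  ultimately have "ell2_norm (proj K v - w) = 0" by (simp add: ell2_inner_self)
  from ell2_norm_eq_0[OF e this] show ?thesis by simp
qed

lemma proj_bounded:
  assumes K: "cfun.subspace K" "K \<subseteq> ell2"
  shows "proj K \<in> bounded_ops"
proof -
  note p = proj_props[OF K]
  have in2: "proj K v \<in> ell2" if "v \<in> ell2" for v using p(1)[OF that] by (simp add: ell2_closure_def)
  have "proj K (x + y) = proj K x + proj K y" if "x \<in> ell2" "y \<in> ell2" for x y
  proof (rule proj_eqI[OF K ell2_add[OF that]])
    show "proj K x + proj K y \<in> ell2_closure K"
      by (rule cfun.subspace_add[OF subspace_ell2_closure[OF K] p(1)[OF that(1)] p(1)[OF that(2)]])
    have "(x - proj K x) + (y - proj K y) \<in> ell2_perp K"
      by (rule cfun.subspace_add[OF subspace_ell2_perp[OF K(2)] p(2)[OF that(1)] p(2)[OF that(2)]])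
    moreover have "(x - proj K x) + (y - proj K y) = x + y - (proj K x + proj K y)" by simp
    ultimately show "x + y - (proj K x + proj K y) \<in> ell2_perp K" by simp
  qed
  moreover have "proj K (smul c x) = smul c (proj K x)" if "x \<in> ell2" for c x
  proof (rule proj_eqI[OF K ell2_smul[OF that]])
    show "smul c (proj K x) \<in> ell2_closure K"
      by (rule cfun.subspace_scale[OF subspace_ell2_closure[OF K] p(1)[OF that]])
    have "smul c (x - proj K x) \<in> ell2_perp K"
      by (rule cfun.subspace_scale[OF subspace_ell2_perp[OF K(2)] p(2)[OF that]])
    moreover have "smul c (x - proj K x) = smul c x - smul c (proj K x)" by (auto simp: smul_def algebra_simps)
    ultimately show "smul c x - smul c (proj K x) \<in> ell2_perp K" by simp
  qed
  moreover have "ell2_norm (proj K v) \<le> 1 * ell2_norm v" if v: "v \<in> ell2" for v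
  proof -
    have d: "v - proj K v \<in> ell2" by (rule ell2_diff[OF v in2[OF v]])
    have "ell2_inner (v - proj K v) (proj K v) = 0"
      by (rule ell2_perp_closure[OF K(2) p(2)[OF v] p(1)[OF v]])
    then have "ell2_inner v (proj K v) = of_real ((ell2_norm (proj K v))\<^sup>2)"
      using ell2_inner_diff_left[OF in2[OF v] v in2[OF v]] by (simp add: ell2_inner_self in2[OF v])
    then have "(ell2_norm (proj K v))\<^sup>2 \<le> ell2_norm v * ell2_norm (proj K v)"
      using ell2_Cauchy_Schwarz[OF v in2[OF v]] by (simp add: norm_power)
    then have "ell2_norm (proj K v) * ell2_norm (proj K v) \<le> ell2_norm v * ell2_norm (proj K v)"
      by (simp add: power2_eq_square)
    then show ?thesis
      using ell2_norm_nonneg[of "proj K v"] ell2_norm_nonneg[of v]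
      by (auto simp: mult_le_cancel_right order_less_le)
  qed
  ultimately show ?thesis
    unfolding bounded_ops_def clinear_on_def using in2
    by (intro CollectI conjI ballI allI impI exI[of _ 1]) (auto simp: proj_def[of K])
qed

subsection \<open>Amplifications and the bicommutant argument\<close>

text \<open>The amplification 1 tensor \<open>T\<close>, acting separately on each slice.\<close>

definition amp :: "'g l2op \<Rightarrow> ('k \<times> 'g) l2op" where
  "amp T = (\<lambda>\<zeta>. if \<zeta> \<in> ell2 then (\<lambda>(n, x). T (slice \<zeta> n) x) else 0)"

lemma amp_bounded:
  assumes T: "T \<in> bounded_ops"
  shows "(amp T :: ('k \<times> 'g) l2op) \<in> bounded_ops"
proof -
  obtain C where C: "C \<ge> 0" "\<And>\<xi>. \<xi> \<in> ell2 \<Longrightarrow> ell2_norm (T \<xi>) \<le> C * ell2_norm \<xi>"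
    using bounded_opsD(5)[OF T] by auto
  have b: "amp T \<zeta> \<in> ell2" "ell2_norm (amp T \<zeta>) \<le> C * ell2_norm \<zeta>" if z: "\<zeta> \<in> ell2" for \<zeta> :: "'k \<times> 'g \<Rightarrow> complex"
  proof -
    have sl: "slice (amp T \<zeta>) n = T (slice \<zeta> n)" for n by (simp add: amp_def z)
    have s1: "slice (amp T \<zeta>) n \<in> ell2" for n
      unfolding sl by (rule bounded_opsD(1)[OF T slice_ell2(1)[OF z]])
    have le: "(ell2_norm (slice (amp T \<zeta>) n))\<^sup>2 \<le> C\<^sup>2 * (ell2_norm (slice \<zeta> n))\<^sup>2" for n
      unfolding sl power_mult_distrib[symmetric] by (rule power_mono[OF C(2)[OF slice_ell2(1)[OF z]]]) simp
    have hs: "((\<lambda>n. C\<^sup>2 * (ell2_norm (slice \<zeta> n))\<^sup>2) has_sum C\<^sup>2 * (ell2_norm \<zeta>)\<^sup>2) UNIV"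
      by (rule has_sum_cmult_right[OF has_sum_slice_norm[OF z]])
    have sm: "(\<lambda>n. (ell2_norm (slice (amp T \<zeta>) n))\<^sup>2) summable_on UNIV"
      by (rule summable_on_comparison_test[OF has_sum_imp_summable[OF hs]]) (use le in auto)
    note I = ell2_sliceI[OF s1 has_sum_infsum[OF sm]]
    show "amp T \<zeta> \<in> ell2" by (rule I(1))
    have "(ell2_norm (amp T \<zeta>))\<^sup>2 \<le> (C * ell2_norm \<zeta>)\<^sup>2"
      unfolding I(2) power_mult_distrib by (rule has_sum_mono[OF has_sum_infsum[OF sm] hs]) (rule le)
    then show "ell2_norm (amp T \<zeta>) \<le> C * ell2_norm \<zeta>"
      by (rule power2_le_imp_le) (simp add: C(1))
  qed
  have sl: "slice (x + y) n = slice x n + slice y n" "slice (smul c x) n = smul c (slice x n)"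
    for x y :: "'k \<times> 'g \<Rightarrow> complex" and n c by (auto simp: smul_def)
  have "amp T (x + y) = amp T x + amp T y" if "x \<in> ell2" "y \<in> ell2" for x y :: "'k \<times> 'g \<Rightarrow> complex"
  proof
    fix p :: "'k \<times> 'g"
    show "amp T (x + y) p = (amp T x + amp T y) p"
      using bounded_opsD(2)[OF T slice_ell2(1)[OF that(1)] slice_ell2(1)[OF that(2)], of "fst p" "fst p"]
        ell2_add[OF that]
      by (cases p) (simp add: amp_def that plus_fun_def)
  qed
  moreover have "amp T (smul c x) = smul c (amp T x)" if "x \<in> ell2" for c and x :: "'k \<times> 'g \<Rightarrow> complex"
  proof
    fix p :: "'k \<times> 'g"
    show "amp T (smul c x) p = smul c (amp T x) p"
      using bounded_opsD(3)[OF T slice_ell2(1)[OF that], of c "fst p"] ell2_smul[OF that, of c]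
      by (cases p) (simp add: amp_def that smul_def)
  qed
  moreover have "amp T \<zeta> = 0" if "\<zeta> \<notin> ell2" for \<zeta> :: "'k \<times> 'g \<Rightarrow> complex"
    using that by (simp add: amp_def)
  ultimately show ?thesis
    unfolding bounded_ops_def clinear_on_def using b by blast
qed

lemma vec_functional_eq_inner:
  assumes T: "T \<in> group_vn" and "\<xi> \<in> ell2" "\<eta> \<in> ell2"
  shows "vec_functional \<xi> \<eta> T = ell2_inner (amp T \<xi>) \<eta>"
proof -
  have m: "amp T \<xi> \<in> ell2" by (rule bounded_opsD(1)[OF amp_bounded[OF group_vn_bounded[OF T]] assms(2)])
  have "((\<lambda>p. amp T \<xi> p * cnj (\<eta> p)) has_sum ell2_inner (amp T \<xi>) \<eta>) (Sigma UNIV (\<lambda>_. UNIV))"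
    using ell2_inner_summable[OF m assms(3)] by (simp add: ell2_inner_def)
  moreover have "((\<lambda>x. amp T \<xi> (n, x) * cnj (\<eta> (n, x))) has_sum ell2_inner (T (slice \<xi> n)) (slice \<eta> n)) UNIV" for n
    using ell2_inner_summable[OF bounded_opsD(1)[OF group_vn_bounded[OF T] slice_ell2(1)[OF assms(2)]] slice_ell2(1)[OF assms(3)], of n n]
    by (simp add: ell2_inner_def amp_def assms)
  ultimately have "((\<lambda>n. ell2_inner (T (slice \<xi> n)) (slice \<eta> n)) has_sum ell2_inner (amp T \<xi>) \<eta>) UNIV"
    by (rule has_sum_SigmaD)
  with has_sum_vec_functional[OF assms] show ?thesis by (rule has_sum_unique)
qed

definition emb :: "'k \<Rightarrow> ('g \<Rightarrow> complex) \<Rightarrow> 'k \<times> 'g \<Rightarrow> complex" where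
  "emb n \<zeta> = (\<lambda>(k, x). if k = n then \<zeta> x else 0)"

lemma emb_ell2:
  assumes "\<zeta> \<in> ell2" shows "emb n \<zeta> \<in> ell2" "ell2_norm (emb n \<zeta>) = ell2_norm \<zeta>"
proof -
  have sl: "slice (emb n \<zeta>) k = (if k = n then \<zeta> else 0)" for k by (auto simp: emb_def)
  have s: "slice (emb n \<zeta>) k \<in> ell2" for k unfolding sl using assms by simp
  have h: "((\<lambda>k. (ell2_norm (slice (emb n \<zeta>) k))\<^sup>2) has_sum (ell2_norm \<zeta>)\<^sup>2) UNIV"
    unfolding sl by (rule has_sum_finite_neutralI[of "{n}"]) auto
  show "emb n \<zeta> \<in> ell2" by (rule ell2_sliceI(1)[OF s h])
  show "ell2_norm (emb n \<zeta>) = ell2_norm \<zeta>" using ell2_sliceI(2)[OF s h] by simp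
qed

lemma ell2_norm_slice_le:
  assumes "\<zeta> \<in> ell2" shows "ell2_norm (slice \<zeta> m) \<le> ell2_norm \<zeta>"
proof (rule power2_le_imp_le)
  show "(ell2_norm (slice \<zeta> m))\<^sup>2 \<le> (ell2_norm \<zeta>)\<^sup>2"
    using finite_sum_le_has_sum[OF has_sum_slice_norm[OF assms], of "{m}"] by simp
qed simp

text \<open>The entry in row \<open>m\<close> and column \<open>n\<close> of \<open>P\<close>, read
  as a matrix indexed by \<open>'k\<close> of operators on \<open>ell2\<close> over
  \<open>'g\<close>.\<close>

definition corner :: "'k \<Rightarrow> 'k \<Rightarrow> ('k \<times> 'g) l2op \<Rightarrow> 'g l2op" where
  "corner m n P = (\<lambda>\<zeta>. if \<zeta> \<in> ell2 then slice (P (emb n \<zeta>)) m else 0)"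

lemma corner_bounded:
  assumes P: "P \<in> bounded_ops" shows "corner m n P \<in> bounded_ops"
proof -
  obtain C where C: "C \<ge> 0" "\<And>\<xi>. \<xi> \<in> ell2 \<Longrightarrow> ell2_norm (P \<xi>) \<le> C * ell2_norm \<xi>"
    using bounded_opsD(5)[OF P] by auto
  have e: "emb n (x + y) = emb n x + emb n y" "emb n (smul c x) = smul c (emb n x)" for x y :: "'b \<Rightarrow> complex" and c
    by (auto simp: emb_def smul_def fun_eq_iff)
  have "corner m n P x \<in> ell2" if "x \<in> ell2" for x
    using slice_ell2(1)[OF bounded_opsD(1)[OF P emb_ell2(1)[OF that]]] that by (simp add: corner_def)
  moreover have "corner m n P (x + y) = corner m n P x + corner m n P y" if "x \<in> ell2" "y \<in> ell2" for x y
    using that bounded_opsD(2)[OF P emb_ell2(1)[OF that(1)] emb_ell2(1)[OF that(2)], of n n]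
    by (simp add: corner_def ell2_add e) (simp add: fun_eq_iff)
  moreover have "corner m n P (smul c x) = smul c (corner m n P x)" if "x \<in> ell2" for c x
    using that bounded_opsD(3)[OF P emb_ell2(1)[OF that], of c n]
    by (simp add: corner_def ell2_smul e) (simp add: smul_def)
  moreover have "ell2_norm (corner m n P x) \<le> C * ell2_norm x" if "x \<in> ell2" for x
    using ell2_norm_slice_le[OF bounded_opsD(1)[OF P emb_ell2(1)[OF that]]] C(2)[OF emb_ell2(1)[OF that]] that
    by (simp add: corner_def emb_ell2(2)[OF that]) (meson order_trans)
  moreover have "corner m n P x = 0" if "x \<notin> ell2" for x using that by (simp add: corner_def)
  ultimately show ?thesis
    unfolding bounded_ops_def clinear_on_def by blast
qed

text \<open>An amplification is a scalar diagonal matrix with operator entry \<open>T\<close>; it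
  commutes with \<open>P\<close> as soon as \<open>T\<close> commutes with every entry of
  \<open>P\<close>. Equality is checked on matrix coefficients.\<close>

lemma amp_commutes:
  fixes P :: "('k \<times> 'g) l2op"
  assumes T: "T \<in> bounded_ops" and P: "P \<in> bounded_ops"
    and comm: "\<And>m n. T \<circ> corner m n P = corner m n P \<circ> T"
  shows "amp T \<circ> P = P \<circ> amp T"
proof (rule bounded_op_eqI)
  fix p q :: "'k \<times> 'g"
  obtain m x n y where [simp]: "p = (m, x)" "q = (n, y)" by (cases p; cases q)
  have d: "delta (n, y) = emb n (delta y)" by (auto simp: delta_def emb_def)
  have T0: "T 0 = 0" using bounded_opsD(3)[OF T, of 0 0] by simp
  have a: "amp T (emb n (delta y)) = emb n (T (delta y))"
  proof
    fix r :: "'k \<times> 'g"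
    have sl: "slice (emb n (delta y)) k = (if k = n then delta y else 0)" for k by (auto simp: emb_def)
    show "amp T (emb n (delta y)) r = emb n (T (delta y)) r"
      using T0 by (cases r) (simp add: amp_def emb_ell2(1)[OF delta_ell2] sl, simp add: emb_def zero_fun_def)
  qed
  have "mc (amp T \<circ> P) p q = T (corner m n P (delta y)) x"
    using bounded_opsD(1)[OF P emb_ell2(1)[OF delta_ell2[of y]], of n] by (simp add: mc_def d amp_def corner_def)
  also have "\<dots> = corner m n P (T (delta y)) x" using comm[of m n] by (metis comp_apply)
  also have "\<dots> = mc (P \<circ> amp T) p q"
    using bounded_opsD(1)[OF T delta_ell2] by (simp add: mc_def d a corner_def)
  finally show "mc (amp T \<circ> P) p q = mc (P \<circ> amp T) p q" .
qed (intro bounded_ops_compose amp_bounded P T)+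

text \<open>The density half of the bicommutant theorem. Let \<open>K\<close> be spanned by the
  translates of \<open>\<xi>\<close> under the amplified left translations. The projection onto its
  closure commutes with these, so its entries lie in the commutant and it commutes with
  \<open>amp T\<close>. Hence \<open>amp T \<xi>\<close> stays in the closure of \<open>K\<close>,
  while the hypothesis makes \<open>\<eta>\<close> orthogonal to \<open>K\<close>. This yields the
  injectivity of the passage from functionals to functions on the group.\<close>

lemma vec_functional_zero:
  fixes \<xi> \<eta> :: "'k \<times> 'g::group_add \<Rightarrow> complex"
  assumes \<xi>: "\<xi> \<in> ell2" and \<eta>: "\<eta> \<in> ell2" and zero: "\<And>g. vec_functional \<xi> \<eta> (left_reg g) = 0" and T: "T \<in> group_vn"
  shows "vec_functional \<xi> \<eta> T = 0"
proof -
  \<comment> \<open>The amplified left translation, written as a reindexing so that it is defined on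
    all functions and its algebra is immediate.\<close>
  define sh where "sh = (\<lambda>g :: 'g. \<lambda>\<zeta> :: 'k \<times> 'g \<Rightarrow> complex. \<lambda>p. \<zeta> (fst p, - g + snd p))"
  have bij: "bij (\<lambda>p :: 'k \<times> 'g. (fst p, - g + snd p))" for g
    by (rule bij_betw_byWitness[where f' = "\<lambda>p. (fst p, g + snd p)"]) (auto simp: add.assoc[symmetric])
  have sh2: "sh g \<zeta> \<in> ell2 \<longleftrightarrow> \<zeta> \<in> ell2" and shn: "ell2_norm (sh g \<zeta>) = ell2_norm \<zeta>" for g \<zeta>
    unfolding sh_def using ell2_reindex[OF bij, of \<zeta> g] by auto
  have shsh: "sh g (sh h \<zeta>) = sh (g + h) \<zeta>" for g h \<zeta> by (simp add: sh_def minus_add add.assoc diff_conv_add_uminus del: add_uminus_conv_diff)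
  have sh0: "sh 0 \<zeta> = \<zeta>" for \<zeta> by (simp add: sh_def)
  have shi: "ell2_inner (sh g \<zeta>) \<theta> = ell2_inner \<zeta> (sh (- g) \<theta>)" for g \<zeta> \<theta>
  proof -
    have "ell2_inner (sh g \<zeta>) (sh g \<theta>') = ell2_inner \<zeta> \<theta>'" for \<theta>'
      unfolding ell2_inner_def sh_def using infsum_reindex_bij_betw[OF bij[of g], of "\<lambda>p. \<zeta> p * cnj (\<theta>' p)"] by simp
    from this[of "sh (- g) \<theta>"] show ?thesis by (simp add: shsh sh0)
  qed
  have shadd: "sh g (x + y) = sh g x + sh g y" "sh g (x - y) = sh g x - sh g y" "sh g (smul c x) = smul c (sh g x)" "sh g 0 = 0" for g x y c
    by (auto simp: sh_def smul_def fun_eq_iff)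
  define K where "K = cfun.span (range (\<lambda>g. sh g \<xi>))"
  have Ks: "cfun.subspace K" unfolding K_def by (rule cfun.subspace_span)
  have K2: "K \<subseteq> ell2"
    unfolding K_def by (rule cfun.span_minimal[OF _ subspace_ell2]) (auto simp: sh2 \<xi>)
  have shK: "sh g k \<in> K" if "k \<in> K" for g k
    using that unfolding K_def
  proof (induction rule: cfun.span_induct)
    case base
    show ?case
      by (auto simp: cfun.subspace_def shadd cfun.span_zero intro: cfun.span_add cfun.span_scale)
  next
    case (step x)
    then obtain h where "x = sh h \<xi>" by auto
    then show ?case by (auto simp: shsh intro: cfun.span_base)
  qed
  have shcl: "sh g w \<in> ell2_closure K" if "w \<in> ell2_closure K" for g w
  proof -
    have "\<exists>k\<in>K. ell2_norm (sh g w - k) < e" if "e > 0" for e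
    proof -
      have "\<exists>k\<in>K. ell2_norm (w - k) < e"
        using \<open>w \<in> ell2_closure K\<close> that by (simp add: ell2_closure_def)
      then obtain k where k: "k \<in> K" "ell2_norm (w - k) < e" by blast
      then show ?thesis using shK[OF k(1), of g] shn[of g "w - k"]
        by (intro bexI[of _ "sh g k"]) (auto simp: shadd)
    qed
    then show ?thesis using that by (auto simp: ell2_closure_def sh2)
  qed
  have shpp: "sh g u \<in> ell2_perp K" if "u \<in> ell2_perp K" for g u
    using that shK by (auto simp: ell2_perp_def sh2 shi)
  define P where "P = proj K"
  have Pb: "P \<in> bounded_ops" unfolding P_def by (rule proj_bounded[OF Ks K2])
  have Psh: "P (sh g v) = sh g (P v)" if v: "v \<in> ell2" for g v
    unfolding P_def
  proof (rule proj_eqI[OF Ks K2])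
    show "sh g v \<in> ell2" using v by (simp add: sh2)
    show "sh g (proj K v) \<in> ell2_closure K" by (rule shcl[OF proj_props(1)[OF Ks K2 v]])
    show "sh g v - sh g (proj K v) \<in> ell2_perp K"
      using shpp[OF proj_props(2)[OF Ks K2 v], of g] by (simp add: shadd)
  qed
  have "corner m n P \<in> commutant (range left_reg)" for m n
  proof -
    have "corner m n P \<circ> left_reg g = left_reg g \<circ> corner m n P" for g
    proof
      fix \<zeta> :: "'g \<Rightarrow> complex"
      show "(corner m n P \<circ> left_reg g) \<zeta> = (left_reg g \<circ> corner m n P) \<zeta>"
      proof (cases "\<zeta> \<in> ell2")
        case True
        have l: "left_reg g \<zeta> \<in> ell2" by (rule bounded_opsD(1)[OF left_reg_bounded True])
        have e: "emb n (left_reg g \<zeta>) = sh g (emb n \<zeta>)"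
          by (auto simp: emb_def left_reg_def True sh_def fun_eq_iff)
        have c: "corner m n P \<zeta> \<in> ell2" by (rule bounded_opsD(1)[OF corner_bounded[OF Pb] True])
        have "corner m n P (left_reg g \<zeta>) = slice (sh g (P (emb n \<zeta>))) m"
          by (simp add: corner_def l e Psh emb_ell2(1)[OF True])
        also have "\<dots> = left_reg g (corner m n P \<zeta>)"
          using c True by (simp add: left_reg_def corner_def sh_def)
        finally show ?thesis by simp
      next
        case False
        have "corner m n P 0 = 0" using bounded_opsD(3)[OF corner_bounded[OF Pb, of m n], of 0 0] by simp
        moreover have "left_reg g (0 :: 'g \<Rightarrow> complex) = 0"
          using bounded_opsD(3)[OF left_reg_bounded[of g], of 0 0] by simp
        moreover have "left_reg g \<zeta> = 0" "corner m n P \<zeta> = 0"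
          using False by (simp_all add: left_reg_def corner_def)
        ultimately show ?thesis by simp
      qed
    qed
    then show ?thesis using corner_bounded[OF Pb] by (auto simp: commutant_def)
  qed
  \<comment> \<open>The only place where \<open>T\<close> is used as an element of the
    bicommutant.\<close>
  then have c: "T \<circ> corner m n P = corner m n P \<circ> T" for m n
    using T unfolding group_vn_def commutant_def[of "commutant (range left_reg)"] by blast
  have eq: "amp T \<circ> P = P \<circ> amp T" by (rule amp_commutes[OF group_vn_bounded[OF T] Pb c])
  have comm: "amp T (P \<xi>) = P (amp T \<xi>)" using fun_cong[OF eq, of \<xi>] unfolding comp_apply .
  have xK: "\<xi> \<in> K" unfolding K_def using cfun.span_base[OF rangeI[of "\<lambda>g. sh g \<xi>" 0]] unfolding sh0 .
  have "P \<xi> = \<xi>" unfolding P_def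
  proof (rule proj_eqI[OF Ks K2 \<xi>])
    show "\<xi> \<in> ell2_closure K" using xK \<xi> by (auto simp: ell2_closure_def intro!: bexI[of _ \<xi>])
    show "\<xi> - \<xi> \<in> ell2_perp K" by (simp add: ell2_perp_def)
  qed
  with comm have fixed: "P (amp T \<xi>) = amp T \<xi>" by simp
  have aT: "amp T \<xi> \<in> ell2" by (rule bounded_opsD(1)[OF amp_bounded[OF group_vn_bounded[OF T]] \<xi>])
  have cl: "amp T \<xi> \<in> ell2_closure K"
    using proj_props(1)[OF Ks K2 aT] fixed by (simp add: P_def)
  have "ell2_inner \<eta> (sh g \<xi>) = 0" for g
  proof -
    have "amp (left_reg g) \<xi> = sh g \<xi>"
      by (auto simp: amp_def \<xi> left_reg_def slice_ell2(1)[OF \<xi>] sh_def fun_eq_iff)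
    then have "ell2_inner (sh g \<xi>) \<eta> = 0"
      using zero[of g] vec_functional_eq_inner[OF left_reg_group_vn \<xi> \<eta>, of g] by simp
    then show ?thesis using ell2_inner_commute[of \<eta> "sh g \<xi>"] by simp
  qed
  then have "K \<subseteq> {k \<in> ell2. ell2_inner \<eta> k = 0}"
    unfolding K_def using \<xi> \<eta>
    by (intro cfun.span_minimal)
       (auto simp: sh2 cfun.subspace_def ell2_add ell2_smul ell2_inner_add_right ell2_inner_smul_right simp del: plus_fun_apply)
  then have "\<eta> \<in> ell2_perp K" using \<eta> by (auto simp: ell2_perp_def)
  from ell2_perp_closure[OF K2 this cl] have "ell2_inner \<eta> (amp T \<xi>) = 0" .
  then have "ell2_inner (amp T \<xi>) \<eta> = 0" using ell2_inner_commute[of "amp T \<xi>" \<eta>] by simp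
  then show ?thesis by (simp add: vec_functional_eq_inner[OF T \<xi> \<eta>])
qed

subsection \<open>Hahn--Banach\<close>

abbreviation rsmul :: "real \<Rightarrow> ('i \<Rightarrow> complex) \<Rightarrow> 'i \<Rightarrow> complex" where
  "rsmul r x \<equiv> smul (of_real r) x"

definition sublinear_on :: "('i \<Rightarrow> complex) set \<Rightarrow> (('i \<Rightarrow> complex) \<Rightarrow> real) \<Rightarrow> bool" where
  "sublinear_on W q \<longleftrightarrow> (\<forall>x\<in>W. \<forall>y\<in>W. q (x + y) \<le> q x + q y) \<and> (\<forall>r\<ge>0. \<forall>x\<in>W. q (rsmul r x) = r * q x)"

lemma sublinear_onD:
  assumes "sublinear_on W q"
  shows "x \<in> W \<Longrightarrow> y \<in> W \<Longrightarrow> q (x + y) \<le> q x + q y" and "0 \<le> r \<Longrightarrow> x \<in> W \<Longrightarrow> q (rsmul r x) = r * q x"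
  using assms by (auto simp: sublinear_on_def)

lemma sublinear_on_zero: "cfun.subspace W \<Longrightarrow> sublinear_on W q \<Longrightarrow> q 0 = 0"
  using sublinear_onD(2)[of W q 0 0] cfun.subspace_0[of W] by simp

lemma sublinear_on_neg:
  assumes W: "cfun.subspace W" and q: "sublinear_on W q" and x: "x \<in> W"
  shows "- q (- x) \<le> q x"
  using sublinear_onD(1)[OF q x cfun.subspace_neg[OF W x]] sublinear_on_zero[OF W q] by simp

lemma cInf_add_mono:
  fixes f :: "'a \<Rightarrow> real" and g :: "'b \<Rightarrow> real"
  assumes "A \<noteq> {}" "B \<noteq> {}" "\<And>a b. a \<in> A \<Longrightarrow> b \<in> B \<Longrightarrow> c \<le> f a + g b"
  shows "c \<le> Inf (f ` A) + Inf (g ` B)"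
proof -
  have "c - f a \<le> Inf (g ` B)" if "a \<in> A" for a
    using assms that by (intro cInf_greatest) (auto simp: algebra_simps)
  then have "c - Inf (g ` B) \<le> Inf (f ` A)"
    using assms by (intro cInf_greatest) (auto simp: algebra_simps)
  then show ?thesis by simp
qed

text \<open>The usual device for Hahn-Banach: it lowers \<open>q\<close> to a sublinear functional
  whose value at \<open>- x\<close> is at most \<open>- q x\<close>, as \<open>t = 1\<close> shows,
  so that it becomes linear in the direction \<open>x\<close>.\<close>

definition straighten ::
  "('i \<Rightarrow> complex) set \<Rightarrow> (('i \<Rightarrow> complex) \<Rightarrow> real) \<Rightarrow> ('i \<Rightarrow> complex) \<Rightarrow> ('i \<Rightarrow> complex) \<Rightarrow> real" where
  "straighten W q x v = (if v \<in> W then Inf ((\<lambda>t. q (v + rsmul t x) - t * q x) ` {0..}) else 0)"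

lemma rsmul_eqs:
  "rsmul r (v + w) = rsmul r v + rsmul r w" "rsmul (r * t) x = rsmul r (rsmul t x)" "rsmul (r + t) x = rsmul r x + rsmul t x"
  by (auto simp: smul_def algebra_simps)

lemma straighten:
  assumes W: "cfun.subspace W" and q: "sublinear_on W q" and x: "x \<in> W"
  shows "sublinear_on W (straighten W q x)"
    and "v \<in> W \<Longrightarrow> 0 \<le> t \<Longrightarrow> straighten W q x v \<le> q (v + rsmul t x) - t * q x"
proof -
  let ?s = "straighten W q x"
  let ?f = "\<lambda>v t. q (v + rsmul t x) - t * q x"
  have inW: "v + rsmul t x \<in> W" if "v \<in> W" for v t
    using that x W by (intro cfun.subspace_add cfun.subspace_scale)
  have bdd: "bdd_below (?f v ` {0..})" if v: "v \<in> W" for v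
  proof (rule bdd_belowI2)
    fix t :: real assume t: "t \<in> {0..}"
    have "q (rsmul t x) \<le> q (v + rsmul t x) + q (- v)"
      using sublinear_onD(1)[OF q inW[OF v, of t] cfun.subspace_neg[OF W v]] by simp
    then show "- q (- v) \<le> ?f v t" using sublinear_onD(2)[OF q _ x, of t] t by simp
  qed
  show le: "?s v \<le> ?f v t" if "v \<in> W" "0 \<le> t" for v t
    using that cInf_lower[OF _ bdd[OF that(1)], of "?f v t"] by (simp add: straighten_def)
  have add: "?s (v + w) \<le> ?s v + ?s w" if v: "v \<in> W" and w: "w \<in> W" for v w
  proof -
    have "?s (v + w) \<le> ?f v t + ?f w t'" if t: "t \<in> {0..}" "t' \<in> {0..}" for t t'
    proof -
      have "?s (v + w) \<le> ?f (v + w) (t + t')"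
        using v w t W by (intro le cfun.subspace_add) auto
      also have "v + w + rsmul (t + t') x = (v + rsmul t x) + (w + rsmul t' x)"
        by (simp only: rsmul_eqs ac_simps)
      also have "q ((v + rsmul t x) + (w + rsmul t' x)) \<le> q (v + rsmul t x) + q (w + rsmul t' x)"
        by (rule sublinear_onD(1)[OF q inW[OF v] inW[OF w]])
      finally show ?thesis using distrib_right[of t t' "q x"] by linarith
    qed
    then have "?s (v + w) \<le> Inf (?f v ` {0..}) + Inf (?f w ` {0..})"
      by (intro cInf_add_mono) auto
    then show ?thesis using v w by (simp add: straighten_def)
  qed
  have scale_le: "?s (rsmul r v) \<le> r * ?s v" if r: "r > 0" and v: "v \<in> W" for r v
  proof -
    have "?s (rsmul r v) / r \<le> ?f v t" if t: "t \<in> {0..}" for t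
    proof -
      have "?s (rsmul r v) \<le> ?f (rsmul r v) (r * t)"
        using r v t W by (intro le cfun.subspace_scale) auto
      also have "rsmul r v + rsmul (r * t) x = rsmul r (v + rsmul t x)" by (simp only: rsmul_eqs)
      also have "q (rsmul r (v + rsmul t x)) = r * q (v + rsmul t x)"
        using r by (intro sublinear_onD(2)[OF q] inW v) simp
      finally have "?s (rsmul r v) \<le> ?f v t * r" by (simp add: algebra_simps)
      then show ?thesis by (simp only: pos_divide_le_eq[OF r])
    qed
    then have "?s (rsmul r v) / r \<le> Inf (?f v ` {0..})" by (intro cInf_greatest) auto
    then show ?thesis using r v by (simp add: straighten_def divide_le_eq mult.commute)
  qed
  have zero: "?s 0 = 0"
  proof -
    have W0: "0 \<in> W" by (rule cfun.subspace_0[OF W])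
    have "?f 0 t = 0" if "t \<in> {0..}" for t
      using sublinear_onD(2)[OF q _ x, of t] that by simp
    then have "?f 0 ` {0..} = {0}" by (auto simp: image_iff)
    then show ?thesis using W0 by (simp add: straighten_def)
  qed
  have "?s (rsmul r v) = r * ?s v" if r: "r \<ge> 0" and v: "v \<in> W" for r v
  proof (cases "r = 0")
    case True
    then show ?thesis by (simp add: zero)
  next
    case False
    then have r: "r > 0" using r by simp
    have "rsmul (1 / r) (rsmul r v) = v" using r by (auto simp: smul_def)
    then have "?s v \<le> (1 / r) * ?s (rsmul r v)"
      using scale_le[of "1 / r" "rsmul r v"] r cfun.subspace_scale[OF W v] by simp
    then have "r * ?s v \<le> ?s (rsmul r v)" using r by (simp add: field_simps)
    with scale_le[OF r v] show ?thesis by simp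
  qed
  with add show "sublinear_on W ?s" by (simp add: sublinear_on_def)
qed

text \<open>Zorn's lemma gives a minimal sublinear functional below \<open>p\<close>. Straightening
  it in a direction \<open>y\<close> cannot lower it further, and this forces additivity in that
  direction. The functionals are set to 0 outside \<open>W\<close> so that the order of functions
  compares values on \<open>W\<close> only.\<close>

lemma minimal_sublinear_exists:
  assumes W: "cfun.subspace W" and p: "sublinear_on W p"
  shows "\<exists>q. sublinear_on W q \<and> (\<forall>x\<in>W. q x \<le> p x) \<and> (\<forall>x\<in>W. \<forall>y\<in>W. q (x + y) = q x + q y)"
proof -
  define S where "S = {q. sublinear_on W q \<and> (\<forall>x\<in>W. q x \<le> p x) \<and> (\<forall>x. x \<notin> W \<longrightarrow> q x = 0)}"
  \<comment> \<open>The reversed order, so that maximal elements in Zorn's lemma are minimal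
    functionals.\<close>
  define P where "P = (\<lambda>a b :: ('a \<Rightarrow> complex) \<Rightarrow> real. b \<le> a)"
  have low: "- p (- x) \<le> q x" if "q \<in> S" "x \<in> W" for q x
  proof -
    have "- q (- x) \<le> q x" using that by (intro sublinear_on_neg[OF W]) (auto simp: S_def)
    moreover have "q (- x) \<le> p (- x)" using that cfun.subspace_neg[OF W that(2)] by (auto simp: S_def)
    ultimately show ?thesis by simp
  qed
  define p0 where "p0 = (\<lambda>x. if x \<in> W then p x else 0)"
  have p0: "p0 \<in> S"
    using p cfun.subspace_add[OF W] cfun.subspace_scale[OF W] by (auto simp: S_def p0_def sublinear_on_def)
  have "\<exists>m\<in>S. \<forall>a\<in>S. P m a \<longrightarrow> a = m"
  proof (rule predicate_Zorn)
    show "partial_order_on S (relation_of P S)"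
      by (rule partial_order_on_relation_ofI) (auto simp: P_def)
    fix C assume C: "C \<in> Chains (relation_of P S)"
    have CS: "C \<subseteq> S" and tot: "\<And>a b. a \<in> C \<Longrightarrow> b \<in> C \<Longrightarrow> a \<le> b \<or> b \<le> a"
      using C by (auto simp: Chains_def relation_of_def P_def)
    show "\<exists>u\<in>S. \<forall>a\<in>C. P a u"
    proof (cases "C = {}")
      case True
      then show ?thesis using p0 by auto
    next
      case False
      define u where "u = (\<lambda>x. if x \<in> W then Inf ((\<lambda>q. q x) ` C) else 0)"
      have bdd: "bdd_below ((\<lambda>q. q x) ` C)" if "x \<in> W" for x
        using low CS that by (intro bdd_belowI2[of _ "- p (- x)"]) auto
      have ule: "u x \<le> q x" if "q \<in> C" for q x
      proof (cases "x \<in> W")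
        case True
        then show ?thesis using cInf_lower[OF _ bdd[OF True], of "q x"] that by (simp add: u_def)
      next
        case False
        then show ?thesis using that CS by (auto simp: u_def S_def)
      qed
      have "u (x + y) \<le> u x + u y" if x: "x \<in> W" and y: "y \<in> W" for x y
      proof -
        have "u (x + y) \<le> a x + b y" if ab: "a \<in> C" "b \<in> C" for a b
        proof -
          obtain c where c: "c \<in> C" "c \<le> a" "c \<le> b" using tot[OF ab] ab by auto
          have "u (x + y) \<le> c (x + y)" by (rule ule[OF c(1)])
          also have "\<dots> \<le> c x + c y" using c(1) CS x y by (auto simp: S_def sublinear_on_def)
          also have "\<dots> \<le> a x + b y" using c(2,3) by (intro add_mono) (auto simp: le_fun_def)
          finally show ?thesis .
        qed
        then have "u (x + y) \<le> Inf ((\<lambda>q. q x) ` C) + Inf ((\<lambda>q. q y) ` C)"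
          using False by (intro cInf_add_mono) auto
        then show ?thesis using x y by (simp add: u_def)
      qed
      moreover have "u (rsmul r x) = r * u x" if r: "r \<ge> 0" and x: "x \<in> W" for r x
      proof -
        have rx: "rsmul r x \<in> W" by (rule cfun.subspace_scale[OF W x])
        have "(\<lambda>q. q (rsmul r x)) ` C = (\<lambda>q. r * q x) ` C"
          using CS r x by (intro image_cong refl) (auto simp: S_def sublinear_on_def)
        also have "Inf \<dots> = r * Inf ((\<lambda>q. q x) ` C)"
        proof (cases "r = 0")
          case True
          then have "(\<lambda>q. r * q x) ` C = {0}" using False by auto
          then show ?thesis using True by simp
        next
          case rne: False
          have rp: "r > 0" using r rne by simp
          show ?thesis
          proof (rule antisym)
            have "Inf ((\<lambda>q. r * q x) ` C) / r \<le> Inf ((\<lambda>q. q x) ` C)"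
            proof (rule cInf_greatest)
              show "(\<lambda>q. q x) ` C \<noteq> {}" using False by simp
              fix z assume "z \<in> (\<lambda>q. q x) ` C"
              then obtain a where a: "a \<in> C" "z = a x" by auto
              have "bdd_below ((\<lambda>q. r * q x) ` C)"
                using low CS x rp by (intro bdd_belowI2[of _ "r * - p (- x)"] mult_left_mono) auto
              from cInf_lower[OF _ this, of "r * a x"] a rp
              show "Inf ((\<lambda>q. r * q x) ` C) / r \<le> z" by (simp add: divide_le_eq mult.commute)
            qed
            then show "Inf ((\<lambda>q. r * q x) ` C) \<le> r * Inf ((\<lambda>q. q x) ` C)"
              using rp by (simp add: divide_le_eq mult.commute)
            show "r * Inf ((\<lambda>q. q x) ` C) \<le> Inf ((\<lambda>q. r * q x) ` C)"
              using False rp cInf_lower[OF _ bdd[OF x]]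
              by (intro cInf_greatest) (auto intro!: mult_left_mono)
          qed
        qed
        finally show ?thesis using x rx by (simp add: u_def)
      qed
      moreover have "u x \<le> p x" if "x \<in> W" for x
      proof -
        obtain a where "a \<in> C" using False by auto
        then show ?thesis using ule[of a x] CS that by (fastforce simp: S_def)
      qed
      ultimately have "u \<in> S" by (auto simp: S_def sublinear_on_def u_def)
      then show ?thesis using ule by (auto simp: P_def le_fun_def)
    qed
  qed
  then obtain m where m: "m \<in> S" and min: "\<And>a. a \<in> S \<Longrightarrow> a \<le> m \<Longrightarrow> a = m" by (auto simp: P_def)
  have msub: "sublinear_on W m" using m by (simp add: S_def)
  have "m (x + y) = m x + m y" if x: "x \<in> W" and y: "y \<in> W" for x y
  proof -
    \<comment> \<open>By minimality this straightening equals \<open>m\<close>; the bound at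
      \<open>t = 1\<close> then reads \<open>m x \<le> m (x + y) - m y\<close>, the inequality that
      is missing for additivity.\<close>
    note st = straighten[OF W msub y]
    have le: "straighten W m y v \<le> m v" for v
    proof (cases "v \<in> W")
      case True
      show ?thesis using st(2)[OF True, of 0] by simp
    next
      case False
      then show ?thesis using m by (simp add: straighten_def S_def)
    qed
    have "straighten W m y v \<le> p v" if "v \<in> W" for v
      using le[of v] m that by (fastforce simp: S_def)
    moreover have "straighten W m y v = 0" if "v \<notin> W" for v
      using that by (simp add: straighten_def)
    ultimately have "straighten W m y \<in> S"
      using st(1) by (simp add: S_def)
    from min[OF this] le have "straighten W m y = m" by (auto simp: le_fun_def)
    then have "m x \<le> m (x + y) - m y" using st(2)[OF x, of 1] by simp
    with sublinear_onD(1)[OF msub x y] show ?thesis by simp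
  qed
  then show ?thesis using m by (auto simp: S_def)
qed

text \<open>Straightening \<open>p\<close> in the direction \<open>x0\<close> before minimizing pins
  the value at \<open>- x0\<close> and thereby makes the bound sharp at \<open>x0\<close>.\<close>

theorem Hahn_Banach_attained:
  assumes W: "cfun.subspace W" and p: "sublinear_on W p" and x0: "x0 \<in> W"
  shows "\<exists>L. (\<forall>x\<in>W. \<forall>y\<in>W. L (x + y) = L x + L y) \<and> (\<forall>r. \<forall>x\<in>W. L (rsmul r x) = r * L x) \<and>
    (\<forall>x\<in>W. L x \<le> p x) \<and> L x0 = p x0"
proof -
  note st = straighten[OF W p x0]
  obtain q where q: "sublinear_on W q" "\<And>x. x \<in> W \<Longrightarrow> q x \<le> straighten W p x0 x"
    "\<And>x y. x \<in> W \<Longrightarrow> y \<in> W \<Longrightarrow> q (x + y) = q x + q y"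
    using minimal_sublinear_exists[OF W st(1)] by blast
  have neg: "q (- x) = - q x" if "x \<in> W" for x
    using q(3)[OF that cfun.subspace_neg[OF W that]] sublinear_on_zero[OF W q(1)] by simp
  have "q (rsmul r x) = r * q x" if x: "x \<in> W" for r x
  proof (cases "r \<ge> 0")
    case True
    then show ?thesis using sublinear_onD(2)[OF q(1) _ x] by simp
  next
    case False
    have "rsmul r x = - rsmul (- r) x" by (auto simp: smul_def)
    then have "q (rsmul r x) = - q (rsmul (- r) x)" using neg[OF cfun.subspace_scale[OF W x]] by metis
    then show ?thesis using sublinear_onD(2)[OF q(1) _ x, of "- r"] False by simp
  qed
  moreover have le: "q x \<le> p x" if "x \<in> W" for x
    using q(2)[OF that] st(2)[OF that, of 0] by simp
  moreover have "q x0 = p x0"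
  proof -
    have "q (- x0) \<le> p (- x0 + rsmul 1 x0) - 1 * p x0"
      using q(2)[OF cfun.subspace_neg[OF W x0]] st(2)[OF cfun.subspace_neg[OF W x0], of 1] by linarith
    then have "q (- x0) \<le> - p x0" using sublinear_on_zero[OF W p] by simp
    with neg[OF x0] le[OF x0] show ?thesis by simp
  qed
  ultimately show ?thesis using q(3) by blast
qed

subsection \<open>The predual norm\<close>

lemma (in bounded_sesquilinear) truncation_bounded:
  assumes fin: "finite F"
  shows "bil_bounded F F (\<lambda>x y. Q (delta y) (delta x)) C"
  unfolding bil_bounded_def
proof (intro allI)
  fix w z :: "'k \<Rightarrow> complex"
  show "cmod (\<Sum>i\<in>F. \<Sum>j\<in>F. w i * Q (delta j) (delta i) * z j) \<le> C * L2c w F * L2c z F"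
    using bound[OF trunc_ell2[OF fin, of z] trunc_ell2[OF fin, of "\<lambda>x. cnj (w x)"]]
    unfolding trunc[OF fin] by (simp add: ell2_norm_trunc[OF fin] mult_ac)
qed

lemma vec_functional_linear:
  fixes \<xi> \<eta> :: "'k \<times> 'g::group_add \<Rightarrow> complex"
  assumes "\<xi> \<in> ell2" "\<eta> \<in> ell2"
  shows "\<xi>' \<in> ell2 \<Longrightarrow> vec_functional (\<xi> + \<xi>') \<eta> = vec_functional \<xi> \<eta> + vec_functional \<xi>' \<eta>"
    and "\<eta>' \<in> ell2 \<Longrightarrow> vec_functional \<xi> (\<eta> + \<eta>') = vec_functional \<xi> \<eta> + vec_functional \<xi> \<eta>'"
    and "vec_functional (smul c \<xi>) \<eta> = smul c (vec_functional \<xi> \<eta>)"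
    and "vec_functional \<xi> (smul c \<eta>) = smul (cnj c) (vec_functional \<xi> \<eta>)"
proof -
  have B: "\<exists>C. bounded_sesquilinear (\<lambda>\<xi> \<eta> :: 'k \<times> 'g \<Rightarrow> complex. vec_functional \<xi> \<eta> T) C" if "T \<in> group_vn" for T
    using bounded_opsD(5)[OF group_vn_bounded[OF that]] bounded_sesquilinear_vec_functional[OF that] by blast
  have off: "vec_functional \<xi> \<eta> T = 0" if "T \<notin> group_vn" for \<xi> \<eta> :: "'k \<times> 'g \<Rightarrow> complex" and T
    using that by (simp add: vec_functional_def)
  show "vec_functional (\<xi> + \<xi>') \<eta> = vec_functional \<xi> \<eta> + vec_functional \<xi>' \<eta>" if "\<xi>' \<in> ell2"
  proof
    fix T show "vec_functional (\<xi> + \<xi>') \<eta> T = (vec_functional \<xi> \<eta> + vec_functional \<xi>' \<eta>) T"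
      using B[of T] bounded_sesquilinear.add_left[OF _ assms(1) that assms(2)] off[of T]
      by (cases "T \<in> group_vn") (auto simp del: plus_fun_apply simp: plus_fun_apply[of "vec_functional _ _"])
  qed
  show "vec_functional \<xi> (\<eta> + \<eta>') = vec_functional \<xi> \<eta> + vec_functional \<xi> \<eta>'" if "\<eta>' \<in> ell2"
  proof
    fix T show "vec_functional \<xi> (\<eta> + \<eta>') T = (vec_functional \<xi> \<eta> + vec_functional \<xi> \<eta>') T"
      using B[of T] bounded_sesquilinear.add_right[OF _ assms that] off[of T]
      by (cases "T \<in> group_vn") (auto simp del: plus_fun_apply simp: plus_fun_apply[of "vec_functional _ _"])
  qed
  show "vec_functional (smul c \<xi>) \<eta> = smul c (vec_functional \<xi> \<eta>)"
  proof
    fix T show "vec_functional (smul c \<xi>) \<eta> T = smul c (vec_functional \<xi> \<eta>) T"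
      using B[of T] bounded_sesquilinear.smul_left[OF _ assms, of _ _ c] off[of T]
      by (cases "T \<in> group_vn") (auto simp: smul_def[of c "vec_functional \<xi> \<eta>"])
  qed
  show "vec_functional \<xi> (smul c \<eta>) = smul (cnj c) (vec_functional \<xi> \<eta>)"
  proof
    fix T show "vec_functional \<xi> (smul c \<eta>) T = smul (cnj c) (vec_functional \<xi> \<eta>) T"
      using B[of T] bounded_sesquilinear.smul_right[OF _ assms, of _ _ c] off[of T]
      by (cases "T \<in> group_vn") (auto simp: smul_def[of _ "vec_functional \<xi> \<eta>"])
  qed
qed

text \<open>The two pairs of families are concatenated over the index type \<open>bool\<close>. The
  squared norms add exactly, which is why \<open>vec_norm\<close> is defined through
  squares.\<close>

lemma vec_functional_add:
  fixes \<xi> \<eta> \<xi>' \<eta>' :: "nat \<times> 'g::group_add \<Rightarrow> complex"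
  assumes "\<xi> \<in> ell2" "\<eta> \<in> ell2" "\<xi>' \<in> ell2" "\<eta>' \<in> ell2"
  shows "\<exists>\<xi>'' \<eta>'' :: nat \<times> 'g \<Rightarrow> complex. \<xi>'' \<in> ell2 \<and> \<eta>'' \<in> ell2 \<and>
    vec_functional \<xi> \<eta> + vec_functional \<xi>' \<eta>' = vec_functional \<xi>'' \<eta>'' \<and>
    (ell2_norm \<xi>'')\<^sup>2 = (ell2_norm \<xi>)\<^sup>2 + (ell2_norm \<xi>')\<^sup>2 \<and>
    (ell2_norm \<eta>'')\<^sup>2 = (ell2_norm \<eta>)\<^sup>2 + (ell2_norm \<eta>')\<^sup>2"
proof -
  define x where "x = (\<lambda>b. if b then \<xi> else \<xi>')"
  define e where "e = (\<lambda>b. if b then \<eta> else \<eta>')"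
  have hs: "(f has_sum f True + f False) UNIV" for f :: "bool \<Rightarrow> 'x::{comm_monoid_add,topological_space}"
    by (rule has_sum_finiteI) (auto simp: UNIV_bool add.commute)
  have x: "\<And>b. x b \<in> ell2" "((\<lambda>b. (ell2_norm (x b))\<^sup>2) has_sum (ell2_norm \<xi>)\<^sup>2 + (ell2_norm \<xi>')\<^sup>2) UNIV"
    using assms hs[of "\<lambda>b. (ell2_norm (x b))\<^sup>2"] by (auto simp: x_def)
  have e: "\<And>b. e b \<in> ell2" "((\<lambda>b. (ell2_norm (e b))\<^sup>2) has_sum (ell2_norm \<eta>)\<^sup>2 + (ell2_norm \<eta>')\<^sup>2) UNIV"
    using assms hs[of "\<lambda>b. (ell2_norm (e b))\<^sup>2"] by (auto simp: e_def)
  note cx = concat_family_ell2[OF x] and ce = concat_family_ell2[OF e]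
  have "vec_functional (concat_family x) (concat_family e) = vec_functional \<xi> \<eta> + vec_functional \<xi>' \<eta>'"
  proof
    fix T :: "'g l2op"
    show "vec_functional (concat_family x) (concat_family e) T = (vec_functional \<xi> \<eta> + vec_functional \<xi>' \<eta>') T"
    proof (cases "T \<in> group_vn")
      case True
      from has_sum_unique[OF vec_functional_concat[OF x e True] hs[of "\<lambda>b. vec_functional (x b) (e b) T"]]
      show ?thesis by (simp add: x_def e_def)
    qed (simp add: vec_functional_def)
  qed
  then show ?thesis using vec_functional_countable[OF cx(1) ce(1)] cx(2) ce(2) by metis
qed

lemma subspace_vn_predual: "cfun.subspace vn_predual"
proof (rule cfun.subspaceI)
  have "(0 :: 'a l2op \<Rightarrow> complex) = vec_functional (0 :: nat \<times> 'a \<Rightarrow> complex) 0"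
    using vec_functional_linear(3)[of "0 :: nat \<times> 'a \<Rightarrow> complex" 0 0] by simp
  then show "(0 :: 'a l2op \<Rightarrow> complex) \<in> vn_predual" by (metis vn_predual_iff ell2_zero(1))
next
  fix x y :: "'a l2op \<Rightarrow> complex" assume "x \<in> vn_predual" "y \<in> vn_predual"
  then show "x + y \<in> vn_predual" using vec_functional_add unfolding vn_predual_iff by metis
next
  fix c and x :: "'a l2op \<Rightarrow> complex" assume "x \<in> vn_predual"
  then show "smul c x \<in> vn_predual" unfolding vn_predual_iff by (metis vec_functional_linear(3) ell2_smul)
qed

text \<open>By rescaling, the same as the infimum of the products of the two norms. In the form with
  squares the triangle inequality follows from concatenation at once.\<close>

definition vec_norm :: "('g::group_add l2op \<Rightarrow> complex) \<Rightarrow> real" where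
  "vec_norm \<phi> = Inf {((ell2_norm \<xi>)\<^sup>2 + (ell2_norm \<eta>)\<^sup>2) / 2 | \<xi> \<eta> :: nat \<times> 'g \<Rightarrow> complex.
     \<xi> \<in> ell2 \<and> \<eta> \<in> ell2 \<and> \<phi> = vec_functional \<xi> \<eta>}"

lemma vec_norm_le:
  fixes \<xi> \<eta> :: "nat \<times> 'g::group_add \<Rightarrow> complex"
  assumes "\<xi> \<in> ell2" "\<eta> \<in> ell2"
  shows "vec_norm (vec_functional \<xi> \<eta>) \<le> ((ell2_norm \<xi>)\<^sup>2 + (ell2_norm \<eta>)\<^sup>2) / 2"
  unfolding vec_norm_def
proof (rule cInf_lower)
  show "bdd_below {((ell2_norm \<xi>')\<^sup>2 + (ell2_norm \<eta>')\<^sup>2) / 2 | \<xi>' \<eta>' :: nat \<times> 'g \<Rightarrow> complex.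
     \<xi>' \<in> ell2 \<and> \<eta>' \<in> ell2 \<and> vec_functional \<xi> \<eta> = vec_functional \<xi>' \<eta>'}"
    by (rule bdd_belowI[of _ 0], elim CollectE exE conjE, hypsubst, simp)
qed (use assms in blast)

lemma vec_norm_ge:
  fixes \<phi> :: "'g::group_add l2op \<Rightarrow> complex"
  assumes "\<phi> \<in> vn_predual"
    and "\<And>\<xi> \<eta> :: nat \<times> 'g \<Rightarrow> complex. \<xi> \<in> ell2 \<Longrightarrow> \<eta> \<in> ell2 \<Longrightarrow> \<phi> = vec_functional \<xi> \<eta> \<Longrightarrow>
      c \<le> ((ell2_norm \<xi>)\<^sup>2 + (ell2_norm \<eta>)\<^sup>2) / 2"
  shows "c \<le> vec_norm \<phi>"
  unfolding vec_norm_def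
proof (rule cInf_greatest)
  show "{((ell2_norm \<xi>)\<^sup>2 + (ell2_norm \<eta>)\<^sup>2) / 2 | \<xi> \<eta> :: nat \<times> 'g \<Rightarrow> complex.
     \<xi> \<in> ell2 \<and> \<eta> \<in> ell2 \<and> \<phi> = vec_functional \<xi> \<eta>} \<noteq> {}"
    using assms(1) unfolding vn_predual_iff by blast
qed (use assms(2) in blast)

lemma vec_norm_lessD:
  fixes \<phi> :: "'g::group_add l2op \<Rightarrow> complex"
  assumes "\<phi> \<in> vn_predual" "vec_norm \<phi> < d"
  obtains \<xi> \<eta> :: "nat \<times> 'g \<Rightarrow> complex" where "\<xi> \<in> ell2" "\<eta> \<in> ell2" "\<phi> = vec_functional \<xi> \<eta>"
    "(ell2_norm \<xi>)\<^sup>2 + (ell2_norm \<eta>)\<^sup>2 < 2 * d"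
proof -
  have "\<exists>\<xi> \<eta> :: nat \<times> 'g \<Rightarrow> complex. \<xi> \<in> ell2 \<and> \<eta> \<in> ell2 \<and> \<phi> = vec_functional \<xi> \<eta> \<and> ((ell2_norm \<xi>)\<^sup>2 + (ell2_norm \<eta>)\<^sup>2) / 2 < d"
    using vec_norm_ge[OF assms(1), of d] assms(2) by (meson not_less)
  then show ?thesis using that by (metis mult.commute pos_divide_less_eq zero_less_numeral)
qed

lemma vec_norm_nonneg: "\<phi> \<in> vn_predual \<Longrightarrow> 0 \<le> vec_norm \<phi>"
  by (rule vec_norm_ge) auto

lemma vec_norm_smul_le:
  fixes \<phi> :: "'g::group_add l2op \<Rightarrow> complex"
  assumes "\<phi> \<in> vn_predual"
  shows "vec_norm (smul c \<phi>) \<le> cmod c * vec_norm \<phi>"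
proof (cases "c = 0")
  case True
  have "(0 :: 'g l2op \<Rightarrow> complex) = vec_functional (0 :: nat \<times> 'g \<Rightarrow> complex) 0"
    using vec_functional_linear(3)[of "0 :: nat \<times> 'g \<Rightarrow> complex" 0 0] by simp
  then show ?thesis using vec_norm_le[of "0 :: nat \<times> 'g \<Rightarrow> complex" 0] True by simp
next
  case False
  have "vec_norm (smul c \<phi>) / cmod c \<le> vec_norm \<phi>"
  proof (rule vec_norm_ge[OF assms])
    fix \<xi> \<eta> :: "nat \<times> 'g \<Rightarrow> complex" assume m: "\<xi> \<in> ell2" "\<eta> \<in> ell2" and \<phi>: "\<phi> = vec_functional \<xi> \<eta>"
    \<comment> \<open>The scalar \<open>c\<close> is distributed over the two vectors as
      \<open>c / r\<close> and \<open>r\<close>, both of modulus \<open>sqrt (cmod c)\<close>, so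
      that both squared norms are multiplied by \<open>cmod c\<close>.\<close>
    define r where "r = complex_of_real (sqrt (cmod c))"
    have r: "cmod r = sqrt (cmod c)" "r \<noteq> 0" using False by (simp_all add: r_def)
    have rr: "cnj r * (c / r) = c" using r by (simp add: r_def)
    have "vec_functional (smul (c / r) \<xi>) (smul r \<eta>) = smul (cnj r) (smul (c / r) (vec_functional \<xi> \<eta>))"
      by (simp add: vec_functional_linear(3,4) m ell2_smul)
    also have "\<dots> = smul c \<phi>" using rr by (simp add: \<phi>)
    finally have "vec_norm (smul c \<phi>) \<le> ((ell2_norm (smul (c / r) \<xi>))\<^sup>2 + (ell2_norm (smul r \<eta>))\<^sup>2) / 2"
      using vec_norm_le[OF ell2_smul[OF m(1)] ell2_smul[OF m(2)]] by metis
    also have "(ell2_norm (smul (c / r) \<xi>))\<^sup>2 = cmod c * (ell2_norm \<xi>)\<^sup>2"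
      using False by (simp add: ell2_norm_smul power_mult_distrib norm_divide r power_divide) (simp add: power2_eq_square)
    also have "(ell2_norm (smul r \<eta>))\<^sup>2 = cmod c * (ell2_norm \<eta>)\<^sup>2"
      by (simp add: ell2_norm_smul power_mult_distrib r)
    finally show "vec_norm (smul c \<phi>) / cmod c \<le> ((ell2_norm \<xi>)\<^sup>2 + (ell2_norm \<eta>)\<^sup>2) / 2"
      using False by (simp add: divide_le_eq algebra_simps)
  qed
  then show ?thesis using False by (simp add: divide_le_eq mult.commute)
qed

lemma sublinear_vec_norm: "sublinear_on (vn_predual :: ('g::group_add l2op \<Rightarrow> complex) set) vec_norm"
  unfolding sublinear_on_def
proof (intro conjI ballI allI impI)
  fix x y :: "'g l2op \<Rightarrow> complex" assume x: "x \<in> vn_predual" and y: "y \<in> vn_predual"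
  show "vec_norm (x + y) \<le> vec_norm x + vec_norm y"
  proof (rule field_le_epsilon)
    fix e :: real assume e: "e > 0"
    obtain \<xi> \<eta> :: "nat \<times> 'g \<Rightarrow> complex" where a: "\<xi> \<in> ell2" "\<eta> \<in> ell2" "x = vec_functional \<xi> \<eta>"
      "(ell2_norm \<xi>)\<^sup>2 + (ell2_norm \<eta>)\<^sup>2 < 2 * (vec_norm x + e / 2)"
      using vec_norm_lessD[OF x, of "vec_norm x + e / 2"] e by auto
    obtain \<xi>' \<eta>' :: "nat \<times> 'g \<Rightarrow> complex" where b: "\<xi>' \<in> ell2" "\<eta>' \<in> ell2" "y = vec_functional \<xi>' \<eta>'"
      "(ell2_norm \<xi>')\<^sup>2 + (ell2_norm \<eta>')\<^sup>2 < 2 * (vec_norm y + e / 2)"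
      using vec_norm_lessD[OF y, of "vec_norm y + e / 2"] e by auto
    obtain \<xi>'' \<eta>'' :: "nat \<times> 'g \<Rightarrow> complex" where c: "\<xi>'' \<in> ell2" "\<eta>'' \<in> ell2" "x + y = vec_functional \<xi>'' \<eta>''"
      "(ell2_norm \<xi>'')\<^sup>2 = (ell2_norm \<xi>)\<^sup>2 + (ell2_norm \<xi>')\<^sup>2"
      "(ell2_norm \<eta>'')\<^sup>2 = (ell2_norm \<eta>)\<^sup>2 + (ell2_norm \<eta>')\<^sup>2"
      using vec_functional_add[OF a(1,2) b(1,2)] unfolding a(3) b(3) by blast
    show "vec_norm (x + y) \<le> vec_norm x + vec_norm y + e"
      using vec_norm_le[OF c(1,2)] a(4) b(4) unfolding c(3)[symmetric] c(4,5) by (simp add: field_simps)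
  qed
next
  fix r :: real and x :: "'g l2op \<Rightarrow> complex" assume r: "0 \<le> r" and x: "x \<in> vn_predual"
  show "vec_norm (rsmul r x) = r * vec_norm x"
  proof (cases "r = 0")
    case True
    have "0 \<le> vec_norm (rsmul r x)" by (rule vec_norm_nonneg[OF cfun.subspace_scale[OF subspace_vn_predual x]])
    then show ?thesis using vec_norm_smul_le[OF x, of "of_real r"] True by simp
  next
    case False
    have "rsmul (1 / r) (rsmul r x) = x" using False by (auto simp: smul_def)
    then have "vec_norm x \<le> (1 / r) * vec_norm (rsmul r x)"
      using vec_norm_smul_le[OF cfun.subspace_scale[OF subspace_vn_predual x], of "of_real (1 / r)" "of_real r"] r
      by (simp add: norm_divide)
    then have "r * vec_norm x \<le> vec_norm (rsmul r x)" using False r by (simp add: field_simps)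
    with vec_norm_smul_le[OF x, of "of_real r"] r show ?thesis by simp
  qed
qed

lemma vec_norm_le_mult:
  fixes \<xi> \<eta> :: "nat \<times> 'g::group_add \<Rightarrow> complex"
  assumes m: "\<xi> \<in> ell2" "\<eta> \<in> ell2"
  shows "vec_norm (vec_functional \<xi> \<eta>) \<le> ell2_norm \<xi> * ell2_norm \<eta>"
proof (cases "ell2_norm \<xi> = 0 \<or> ell2_norm \<eta> = 0")
  case True
  then have "\<xi> = 0 \<or> \<eta> = 0" using ell2_norm_eq_0 m by blast
  then have "vec_functional \<xi> \<eta> = smul 0 (vec_functional \<xi> \<eta>)"
    using vec_functional_linear(3,4)[OF m, of 0] by auto
  then have "vec_norm (vec_functional \<xi> \<eta>) \<le> 0"
    using vec_norm_smul_le[OF vec_functional_in_predual[OF m], of 0] by simp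
  also have "0 \<le> ell2_norm \<xi> * ell2_norm \<eta>" by simp
  finally show ?thesis .
next
  case False
  then have p: "ell2_norm \<xi> > 0" "ell2_norm \<eta> > 0" using ell2_norm_nonneg by (auto simp: order_less_le)
  \<comment> \<open>The scaling that makes the two norms equal, where arithmetic and geometric mean
    agree.\<close>
  define t where "t = sqrt (ell2_norm \<eta> / ell2_norm \<xi>)"
  have t: "t > 0" "t\<^sup>2 = ell2_norm \<eta> / ell2_norm \<xi>" using p by (simp_all add: t_def)
  have "vec_functional (rsmul t \<xi>) (rsmul (1 / t) \<eta>) = smul (cnj (of_real (1 / t))) (rsmul t (vec_functional \<xi> \<eta>))"
    by (simp only: vec_functional_linear(3,4) m ell2_smul)
  also have "\<dots> = vec_functional \<xi> \<eta>" using t(1) by (auto simp: smul_def)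
  finally have "vec_norm (vec_functional \<xi> \<eta>) \<le> ((ell2_norm (rsmul t \<xi>))\<^sup>2 + (ell2_norm (rsmul (1 / t) \<eta>))\<^sup>2) / 2"
    using vec_norm_le[OF ell2_smul[OF m(1)] ell2_smul[OF m(2)]] by metis
  also have "(ell2_norm (rsmul t \<xi>))\<^sup>2 = ell2_norm \<xi> * ell2_norm \<eta>"
    using p t by (simp add: ell2_norm_smul power_mult_distrib) (simp add: power2_eq_square)
  also have "(ell2_norm (rsmul (1 / t) \<eta>))\<^sup>2 = ell2_norm \<xi> * ell2_norm \<eta>"
    using p t by (simp add: ell2_norm_smul power_mult_distrib norm_divide power_divide) (simp add: power2_eq_square)
  finally show ?thesis by (simp add: mult.commute[of "ell2_norm \<eta>"])
qed

text \<open>Duality of the predual with the von Neumann algebra. A norming functional for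
  \<open>vec_norm\<close> at \<open>\<phi>\<close>, composed with \<open>vec_functional\<close>, is
  a bounded sesquilinear form; its matrix is right invariant and defines an operator
  \<open>T\<close> of norm at most 1 in the algebra, at which \<open>\<phi>\<close> takes the value
  \<open>vec_norm \<phi>\<close>.\<close>

lemma vec_norm_le_functional_norm:
  fixes \<phi> :: "'g::group_add l2op \<Rightarrow> complex"
  assumes \<phi>: "\<phi> \<in> vn_predual" and c: "\<And>T. T \<in> group_vn \<Longrightarrow> op_mnorm 1 (\<lambda>_ _. T) \<le> 1 \<Longrightarrow> cmod (\<phi> T) \<le> c"
  shows "vec_norm \<phi> \<le> c"
proof -
  let ?W = "vn_predual :: ('g l2op \<Rightarrow> complex) set"
  note Ws = subspace_vn_predual[where 'a = 'g]
  obtain L where L: "\<And>x y. x \<in> ?W \<Longrightarrow> y \<in> ?W \<Longrightarrow> L (x + y) = L x + L y"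
    "\<And>r x. x \<in> ?W \<Longrightarrow> L (rsmul r x) = r * L x" "\<And>x. x \<in> ?W \<Longrightarrow> L x \<le> vec_norm x" "L \<phi> = vec_norm \<phi>"
    using Hahn_Banach_attained[OF Ws sublinear_vec_norm \<phi>] by blast
  \<comment> \<open>The complex linear functional whose real part is \<open>L\<close>.\<close>
  define M where "M = (\<lambda>x. Complex (L x) (- L (smul \<i> x)))"
  note sc = cfun.subspace_scale[OF Ws]
  have Madd: "M (x + y) = M x + M y" if "x \<in> ?W" "y \<in> ?W" for x y
    using L(1)[OF that] L(1)[OF sc[OF that(1)] sc[OF that(2)], of \<i> \<i>]
    by (simp add: M_def cfun.scale_right_distrib complex_eq_iff)
  have Mr: "M (rsmul r x) = of_real r * M x" if "x \<in> ?W" for r x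
  proof -
    have "smul \<i> (rsmul r x) = rsmul r (smul \<i> x)" by (auto simp: smul_def)
    then show ?thesis using L(2)[OF that] L(2)[OF sc[OF that]] by (simp add: M_def complex_eq_iff del: cfun.scale_scale)
  qed
  have Mi: "M (smul \<i> x) = \<i> * M x" if "x \<in> ?W" for x
  proof -
    have "smul \<i> (smul \<i> x) = rsmul (- 1) x" by (auto simp: smul_def)
    then show ?thesis using L(2)[OF that, of "- 1"] by (simp add: M_def complex_eq_iff del: cfun.scale_scale)
  qed
  have Msmul: "M (smul c x) = c * M x" if x: "x \<in> ?W" for c x
  proof -
    have "smul c x = rsmul (Re c) x + rsmul (Im c) (smul \<i> x)"
      by (auto simp: smul_def algebra_simps complex_eq_iff)
    then have "M (smul c x) = of_real (Re c) * M x + of_real (Im c) * (\<i> * M x)"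
      using Madd[OF sc[OF x] sc[OF sc[OF x]]] Mr[OF x] Mr[OF sc[OF x]] Mi[OF x] by metis
    then show ?thesis by (simp add: complex_eq_iff algebra_simps)
  qed
  have Mle: "cmod (M x) \<le> vec_norm x" if x: "x \<in> ?W" for x
  proof (cases "M x = 0")
    case True
    then show ?thesis using vec_norm_nonneg[OF x] by simp
  next
    case False
    \<comment> \<open>A rotation by a number of modulus 1 that makes the value of \<open>M\<close>
      real and nonnegative, so that the bound on the real part applies.\<close>
    define u where "u = cnj (M x) / cmod (M x)"
    have u: "cmod u = 1" using False by (simp add: u_def norm_divide)
    have "u * M x = of_real (cmod (M x))"
    proof -
      have "u * M x = (M x * cnj (M x)) / of_real (cmod (M x))" by (simp add: u_def mult.commute)
      also have "M x * cnj (M x) = of_real (cmod (M x)) * of_real (cmod (M x))"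
        using complex_norm_square[of "M x"] by (simp add: power2_eq_square)
      finally show ?thesis using False by simp
    qed
    then have "cmod (M x) = Re (M (smul u x))" by (simp add: Msmul[OF x])
    also have "\<dots> = L (smul u x)" by (simp add: M_def)
    also have "\<dots> \<le> vec_norm (smul u x)" by (rule L(3)[OF sc[OF x]])
    also have "\<dots> \<le> vec_norm x" using vec_norm_smul_le[OF x, of u] u by simp
    finally show ?thesis .
  qed
  have Q: "bounded_sesquilinear (\<lambda>\<xi> \<eta> :: nat \<times> 'g \<Rightarrow> complex. M (vec_functional \<xi> \<eta>)) 1"
  proof
    fix \<zeta> \<zeta>' \<theta> \<theta>' :: "nat \<times> 'g \<Rightarrow> complex" and c assume m: "\<zeta> \<in> ell2" "\<theta> \<in> ell2"
    note P = vec_functional_in_predual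
    show "M (vec_functional (\<zeta> + \<zeta>') \<theta>) = M (vec_functional \<zeta> \<theta>) + M (vec_functional \<zeta>' \<theta>)" if "\<zeta>' \<in> ell2"
      unfolding vec_functional_linear(1)[OF m that] by (rule Madd[OF P[OF m] P[OF that m(2)]])
    show "M (vec_functional \<zeta> (\<theta> + \<theta>')) = M (vec_functional \<zeta> \<theta>) + M (vec_functional \<zeta> \<theta>')" if "\<theta>' \<in> ell2"
      unfolding vec_functional_linear(2)[OF m that] by (rule Madd[OF P[OF m] P[OF m(1) that]])
    show "M (vec_functional (smul c \<zeta>) \<theta>) = c * M (vec_functional \<zeta> \<theta>)"
      unfolding vec_functional_linear(3)[OF m] by (rule Msmul[OF P[OF m]])
    show "M (vec_functional \<zeta> (smul c \<theta>)) = cnj c * M (vec_functional \<zeta> \<theta>)"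
      unfolding vec_functional_linear(4)[OF m] by (rule Msmul[OF P[OF m]])
    show "cmod (M (vec_functional \<zeta> \<theta>)) \<le> 1 * ell2_norm \<zeta> * ell2_norm \<theta>"
      using Mle[OF P[OF m]] vec_norm_le_mult[OF m] by simp
  qed
  \<comment> \<open>The functional inside \<open>M\<close> reads off the coefficient
    \<open>mc T x y\<close>; thus \<open>K\<close> is the matrix that an operator representing
    \<open>M\<close> must have.\<close>
  define K where "K = (\<lambda>x y :: 'g. M (vec_functional (delta (0::nat, y)) (delta (0, x))))"
  have Kb: "bil_bounded F F K 1" if F: "finite F" for F
  proof -
    have "bil_bounded (Pair (0::nat) ` F) (Pair (0::nat) ` F) (\<lambda>x y. M (vec_functional (delta y) (delta x))) 1"
      by (rule bounded_sesquilinear.truncation_bounded[OF Q]) (use F in simp)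
    then show ?thesis by (simp add: bil_bounded_image inj_on_def K_def)
  qed
  \<comment> \<open>On the von Neumann algebra a pair of \<open>delta\<close> vectors is seen only
    through one matrix coefficient. This gives the right invariance of \<open>K\<close> and the
    reduction from arbitrary indices \<open>n\<close> to the index 0.\<close>
  have dd: "vec_functional (delta (n, y)) (delta (m, x)) = (if n = m then vec_functional (delta (0::nat, y')) (delta (0, x')) else 0)"
    if "\<And>T. T \<in> group_vn \<Longrightarrow> mc T x y = mc T x' y'" for n m :: nat and x y x' y' :: 'g
  proof
    fix T :: "'g l2op"
    show "vec_functional (delta (n, y)) (delta (m, x)) T = (if n = m then vec_functional (delta (0::nat, y')) (delta (0, x')) else 0) T"
    proof (cases "T \<in> group_vn")
      case True
      then show ?thesis using that[OF True] by (simp add: vec_functional_delta[OF True])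
    next
      case False
      then show ?thesis by (simp add: vec_functional_def)
    qed
  qed
  have Kinv: "K (x + z) (y + z) = K x y" for x y z
    unfolding K_def using dd[of "x + z" "y + z" x y 0 0] by (simp add: group_vn_iff)
  define T where "T = op_of_kernel K"
  have T: "T \<in> group_vn" unfolding T_def by (rule op_of_kernel_group_vn[OF Kb _ Kinv]) auto
  have Tle: "ell2_norm (T \<xi>) \<le> 1 * ell2_norm \<xi>" if "\<xi> \<in> ell2" for \<xi>
    unfolding T_def by (rule op_of_kernel(2)[OF Kb _ that]) auto
  have T1: "op_mnorm 1 (\<lambda>_ _. T) \<le> 1"
    by (rule op_mnorm_1_le[OF group_vn_bounded[OF T] _ Tle]) auto
  have MT: "M (vec_functional \<xi> \<eta>) = vec_functional \<xi> \<eta> T" if "\<xi> \<in> ell2" "\<eta> \<in> ell2" for \<xi> \<eta> :: "nat \<times> 'g \<Rightarrow> complex"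
  proof (rule bounded_sesquilinear_eqI[OF Q bounded_sesquilinear_vec_functional[OF T Tle] _ that])
    fix p q :: "nat \<times> 'g"
    obtain m x n y where [simp]: "p = (m, x)" "q = (n, y)" by (cases p; cases q)
    have mcT: "mc T x y = K x y" unfolding T_def by (rule op_of_kernel(3)[OF Kb]) auto
    have M0: "M 0 = 0" using Msmul[OF \<phi>, of 0] by simp
    show "M (vec_functional (delta q) (delta p)) = vec_functional (delta q) (delta p) T"
      using dd[of x y x y n m] by (simp add: vec_functional_delta[OF T] mcT M0 K_def)
  qed auto
  obtain \<xi> \<eta> :: "nat \<times> 'g \<Rightarrow> complex" where r: "\<xi> \<in> ell2" "\<eta> \<in> ell2" "\<phi> = vec_functional \<xi> \<eta>"
    using \<phi> unfolding vn_predual_iff by blast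
  have "vec_norm \<phi> = Re (M \<phi>)" by (simp add: M_def L(4))
  also have "\<dots> = Re (\<phi> T)" using MT[OF r(1,2)] by (simp add: r(3))
  also have "\<dots> \<le> cmod (\<phi> T)" by (rule complex_Re_le_cmod)
  also have "\<dots> \<le> c" by (rule c[OF T T1])
  finally show ?thesis .
qed

text \<open>Along a rapidly convergent subsequence the successive differences are represented by
  vectors with summable squared norms; their concatenation represents the sum of all the
  differences, so the limit is again ultraweakly continuous.\<close>

lemma predual_complete:
  fixes \<phi> :: "nat \<Rightarrow> 'g::group_add l2op \<Rightarrow> complex"
  assumes \<phi>: "\<And>k. \<phi> k \<in> vn_predual"
    and C: "\<And>e. e > 0 \<Longrightarrow> \<exists>K. \<forall>k\<ge>K. \<forall>l\<ge>K. \<forall>T\<in>group_vn. op_mnorm 1 (\<lambda>_ _. T) \<le> 1 \<longrightarrow> cmod (\<phi> k T - \<phi> l T) \<le> e"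
  shows "\<exists>\<psi>\<in>vn_predual. \<forall>e>0. \<exists>K. \<forall>k\<ge>K. vec_norm (\<phi> k - \<psi>) \<le> e"
proof -
  let ?ball = "{T :: 'g l2op. T \<in> group_vn \<and> op_mnorm 1 (\<lambda>_ _. T) \<le> 1}"
  note diff = cfun.subspace_diff[OF subspace_vn_predual]
  have "\<forall>j. \<exists>K. \<forall>k\<ge>K. \<forall>l\<ge>K. \<forall>T\<in>?ball. cmod (\<phi> k T - \<phi> l T) \<le> (1 / 2) ^ Suc j"
  proof
    fix j
    show "\<exists>K. \<forall>k\<ge>K. \<forall>l\<ge>K. \<forall>T\<in>?ball. cmod (\<phi> k T - \<phi> l T) \<le> (1 / 2) ^ Suc j"
      using C[of "(1 / 2) ^ Suc j"] by auto
  qed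
  from choice[OF this] obtain R where
    R0: "\<forall>j. \<forall>k\<ge>R j. \<forall>l\<ge>R j. \<forall>T\<in>?ball. cmod (\<phi> k T - \<phi> l T) \<le> (1 / 2) ^ Suc j" ..
  have R: "cmod (\<phi> k T - \<phi> l T) \<le> (1 / 2) ^ Suc j" if "k \<ge> R j" "l \<ge> R j" "T \<in> ?ball" for j k l T
    using R0 that by blast
  \<comment> \<open>Partial sums of \<open>R\<close> exceed each of their terms, so
    \<open>r n \<ge> R j\<close> holds for all \<open>n \<ge> j\<close>.\<close>
  define r where "r = (\<lambda>j. \<Sum>i\<le>j. R i)"
  have r: "r j \<ge> R j" "r (Suc j) \<ge> R j" for j
  proof -
    show "r j \<ge> R j" unfolding r_def by (rule member_le_sum) auto
    show "r (Suc j) \<ge> R j" unfolding r_def by (rule member_le_sum) auto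
  qed
  define d where "d = (\<lambda>j. \<phi> (r (Suc j)) - \<phi> (r j))"
  have d: "d j \<in> vn_predual" "vec_norm (d j) < (1 / 2) ^ j" for j
  proof -
    show dj: "d j \<in> vn_predual" unfolding d_def by (intro diff \<phi>)
    have "vec_norm (d j) \<le> (1 / 2) ^ Suc j"
      by (rule vec_norm_le_functional_norm[OF dj]) (use R r in \<open>auto simp: d_def\<close>)
    also have "\<dots> < (1 / 2) ^ j" by simp
    finally show "vec_norm (d j) < (1 / 2) ^ j" .
  qed
  have "\<forall>j. \<exists>\<xi> \<eta> :: nat \<times> 'g \<Rightarrow> complex. \<xi> \<in> ell2 \<and> \<eta> \<in> ell2 \<and> d j = vec_functional \<xi> \<eta> \<and>
      (ell2_norm \<xi>)\<^sup>2 + (ell2_norm \<eta>)\<^sup>2 < 2 * (1 / 2) ^ j"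
    using vec_norm_lessD[OF d] by metis
  then obtain \<xi> \<eta> :: "nat \<Rightarrow> nat \<times> 'g \<Rightarrow> complex" where
    m: "\<And>j. \<xi> j \<in> ell2" "\<And>j. \<eta> j \<in> ell2" and dv: "\<And>j. d j = vec_functional (\<xi> j) (\<eta> j)"
    and nm: "\<And>j. (ell2_norm (\<xi> j))\<^sup>2 + (ell2_norm (\<eta> j))\<^sup>2 < 2 * (1 / 2) ^ j" by metis
  have geo: "summable (\<lambda>j. 2 * (1 / 2 :: real) ^ j)" by (intro summable_mult summable_geometric) simp
  have "summable (\<lambda>j. (ell2_norm (\<xi> j))\<^sup>2)"
  proof (rule summable_comparison_test'[OF geo])
    fix j :: nat show "norm ((ell2_norm (\<xi> j))\<^sup>2) \<le> 2 * (1 / 2) ^ j"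
      using nm[of j] zero_le_power2[of "ell2_norm (\<eta> j)"] unfolding real_norm_def abs_power2 by linarith
  qed
  then have sx: "((\<lambda>j. (ell2_norm (\<xi> j))\<^sup>2) has_sum infsum (\<lambda>j. (ell2_norm (\<xi> j))\<^sup>2) UNIV) UNIV"
    by (intro has_sum_infsum summable_nonneg_imp_summable_on) auto
  have "summable (\<lambda>j. (ell2_norm (\<eta> j))\<^sup>2)"
  proof (rule summable_comparison_test'[OF geo])
    fix j :: nat show "norm ((ell2_norm (\<eta> j))\<^sup>2) \<le> 2 * (1 / 2) ^ j"
      using nm[of j] zero_le_power2[of "ell2_norm (\<xi> j)"] unfolding real_norm_def abs_power2 by linarith
  qed
  then have se: "((\<lambda>j. (ell2_norm (\<eta> j))\<^sup>2) has_sum infsum (\<lambda>j. (ell2_norm (\<eta> j))\<^sup>2) UNIV) UNIV"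
    by (intro has_sum_infsum summable_nonneg_imp_summable_on) auto
  \<comment> \<open>The telescoping series of the differences, started at the first member of the
    subsequence.\<close>
  define \<psi> where "\<psi> = \<phi> (r 0) + vec_functional (concat_family \<xi>) (concat_family \<eta>)"
  have \<psi>: "\<psi> \<in> vn_predual"
    unfolding \<psi>_def
    by (intro cfun.subspace_add[OF subspace_vn_predual] \<phi> vec_functional_in_predual
          concat_family_ell2(1)[OF m(1) sx] concat_family_ell2(1)[OF m(2) se])
  have lim: "(\<lambda>j. \<phi> (r j) T) \<longlonglongrightarrow> \<psi> T" if T: "T \<in> group_vn" for T
  proof -
    have "(\<lambda>j. d j T) sums vec_functional (concat_family \<xi>) (concat_family \<eta>) T"
      using has_sum_imp_sums[OF vec_functional_concat[OF m(1) sx m(2) se T]] by (simp add: dv)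
    then have "(\<lambda>n. \<Sum>j<n. d j T) \<longlonglongrightarrow> vec_functional (concat_family \<xi>) (concat_family \<eta>) T"
      by (simp add: sums_def)
    moreover have "(\<Sum>j<n. d j T) = \<phi> (r n) T - \<phi> (r 0) T" for n
      by (induction n) (auto simp: d_def)
    ultimately have "(\<lambda>n. (\<phi> (r n) T - \<phi> (r 0) T) + \<phi> (r 0) T) \<longlonglongrightarrow> vec_functional (concat_family \<xi>) (concat_family \<eta>) T + \<phi> (r 0) T"
      by (intro tendsto_add tendsto_const) simp
    then show ?thesis by (simp add: \<psi>_def add.commute)
  qed
  have "\<exists>K. \<forall>k\<ge>K. vec_norm (\<phi> k - \<psi>) \<le> e" if e: "e > 0" for e
  proof -
    obtain j where j: "(1 / 2 :: real) ^ Suc j \<le> e"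
    proof -
      obtain n where "(1 / 2 :: real) ^ n < e" using real_arch_pow_inv[OF e, of "1/2"] by auto
      moreover have "(1 / 2 :: real) ^ Suc n \<le> (1 / 2) ^ n" by simp
      ultimately show ?thesis using that by (meson less_imp_le order_trans)
    qed
    have "vec_norm (\<phi> k - \<psi>) \<le> e" if k: "k \<ge> R j" for k
    proof (rule vec_norm_le_functional_norm[OF diff[OF \<phi> \<psi>]])
      fix T :: "'g l2op" assume T: "T \<in> group_vn" "op_mnorm 1 (\<lambda>_ _. T) \<le> 1"
      have "(\<lambda>n. cmod (\<phi> k T - \<phi> (r n) T)) \<longlonglongrightarrow> cmod (\<phi> k T - \<psi> T)"
        by (intro tendsto_intros lim T)
      moreover have "\<forall>\<^sub>F n in sequentially. cmod (\<phi> k T - \<phi> (r n) T) \<le> e"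
        using eventually_ge_at_top[of j]
      proof eventually_elim
        case (elim n)
        have "r n \<ge> R j" unfolding r_def by (rule member_le_sum) (use elim in auto)
        then have "cmod (\<phi> k T - \<phi> (r n) T) \<le> (1 / 2) ^ Suc j"
          by (rule R[OF k]) (simp only: T mem_Collect_eq simp_thms)
        then show ?case using j by (rule order_trans)
      qed
      ultimately have "cmod (\<phi> k T - \<psi> T) \<le> e" by (rule tendsto_upperbound) simp
      then show "cmod ((\<phi> k - \<psi>) T) \<le> e" by simp
    qed
    then show ?thesis by blast
  qed
  with \<psi> show ?thesis by blast
qed

subsection \<open>Linear structure of the group von Neumann algebra\<close>

text \<open>\<open>smul\<close> scales complex valued functions and does not apply to operators,
  whose values are vectors.\<close>

definition op_scale :: "complex \<Rightarrow> 'g l2op \<Rightarrow> 'g l2op" where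
  "op_scale c T = (\<lambda>\<xi>. smul c (T \<xi>))"

lemma mc_add: "mc (T + U) x y = mc T x y + mc U x y"
  and mc_op_scale: "mc (op_scale c T) x y = c * mc T x y"
  by (simp_all add: mc_def op_scale_def smul_def)

lemma bounded_ops_add:
  assumes T: "T \<in> bounded_ops" and U: "U \<in> bounded_ops"
  shows "T + U \<in> bounded_ops"
proof -
  obtain C where C: "C \<ge> 0" "\<And>\<xi>. \<xi> \<in> ell2 \<Longrightarrow> ell2_norm (T \<xi>) \<le> C * ell2_norm \<xi>"
    using bounded_opsD(5)[OF T] by auto
  obtain D where D: "D \<ge> 0" "\<And>\<xi>. \<xi> \<in> ell2 \<Longrightarrow> ell2_norm (U \<xi>) \<le> D * ell2_norm \<xi>"
    using bounded_opsD(5)[OF U] by auto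
  have e: "(T + U) \<xi> = T \<xi> + U \<xi>" for \<xi> by simp
  have "ell2_norm ((T + U) \<xi>) \<le> (C + D) * ell2_norm \<xi>" if "\<xi> \<in> ell2" for \<xi>
    using ell2_norm_triangle[OF bounded_opsD(1)[OF T that] bounded_opsD(1)[OF U that]] C(2)[OF that] D(2)[OF that]
    unfolding e distrib_right by linarith
  moreover have "(T + U) \<xi> \<in> ell2" if "\<xi> \<in> ell2" for \<xi>
    unfolding e by (rule ell2_add[OF bounded_opsD(1)[OF T that] bounded_opsD(1)[OF U that]])
  moreover have "(T + U) (\<xi> + \<eta>) = (T + U) \<xi> + (T + U) \<eta>" if "\<xi> \<in> ell2" "\<eta> \<in> ell2" for \<xi> \<eta>
    unfolding e bounded_opsD(2)[OF T that] bounded_opsD(2)[OF U that] by (simp only: ac_simps)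
  moreover have "(T + U) (smul c \<xi>) = smul c ((T + U) \<xi>)" if "\<xi> \<in> ell2" for c \<xi>
    unfolding e bounded_opsD(3)[OF T that] bounded_opsD(3)[OF U that] by (simp only: cfun.scale_right_distrib)
  moreover have "(T + U) \<xi> = 0" if "\<xi> \<notin> ell2" for \<xi>
    unfolding e bounded_opsD(4)[OF T that] bounded_opsD(4)[OF U that] by simp
  ultimately show ?thesis unfolding bounded_ops_def clinear_on_def by blast
qed

lemma bounded_ops_scale:
  assumes T: "T \<in> bounded_ops"
  shows "op_scale c T \<in> bounded_ops"
proof -
  obtain C where C: "C \<ge> 0" "\<And>\<xi>. \<xi> \<in> ell2 \<Longrightarrow> ell2_norm (T \<xi>) \<le> C * ell2_norm \<xi>"
    using bounded_opsD(5)[OF T] by auto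
  have e: "op_scale c T \<xi> = smul c (T \<xi>)" for \<xi> by (simp add: op_scale_def)
  have "ell2_norm (op_scale c T \<xi>) \<le> (cmod c * C) * ell2_norm \<xi>" if "\<xi> \<in> ell2" for \<xi>
    using mult_left_mono[OF C(2)[OF that], of "cmod c"] by (simp add: e ell2_norm_smul mult.assoc)
  moreover have "op_scale c T \<xi> \<in> ell2" if "\<xi> \<in> ell2" for \<xi>
    unfolding e by (rule ell2_smul[OF bounded_opsD(1)[OF T that]])
  moreover have "op_scale c T (\<xi> + \<eta>) = op_scale c T \<xi> + op_scale c T \<eta>" if "\<xi> \<in> ell2" "\<eta> \<in> ell2" for \<xi> \<eta>
    unfolding e bounded_opsD(2)[OF T that] by (simp only: cfun.scale_right_distrib)
  moreover have "op_scale c T (smul d \<xi>) = smul d (op_scale c T \<xi>)" if "\<xi> \<in> ell2" for d \<xi>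
    unfolding e bounded_opsD(3)[OF T that] by (simp add: mult.commute)
  moreover have "op_scale c T \<xi> = 0" if "\<xi> \<notin> ell2" for \<xi>
    unfolding e bounded_opsD(4)[OF T that] by simp
  ultimately show ?thesis unfolding bounded_ops_def clinear_on_def by blast
qed

lemma group_vn_add: "T \<in> group_vn \<Longrightarrow> U \<in> group_vn \<Longrightarrow> T + U \<in> group_vn"
  by (simp add: group_vn_iff bounded_ops_add mc_add)

lemma group_vn_scale: "T \<in> group_vn \<Longrightarrow> op_scale c T \<in> group_vn"
  by (simp add: group_vn_iff bounded_ops_scale mc_op_scale)

lemma group_vn_zero: "(0 :: 'g::group_add l2op) \<in> group_vn"
proof -
  have "op_scale 0 (left_reg (0 :: 'g)) \<in> group_vn" by (intro group_vn_scale left_reg_group_vn)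
  moreover have "op_scale 0 (left_reg (0 :: 'g)) = 0" by (simp add: op_scale_def fun_eq_iff)
  ultimately show ?thesis by simp
qed

lemma group_vn_sum: "(\<And>h. h \<in> H \<Longrightarrow> T h \<in> group_vn) \<Longrightarrow> (\<Sum>h\<in>H. T h) \<in> group_vn"
  by (induction H rule: infinite_finite_induct) (auto simp: group_vn_zero group_vn_add simp del: plus_fun_apply)

lemma mc_sum: "mc (\<Sum>h\<in>H. T h) x y = (\<Sum>h\<in>H. mc (T h) x y)"
  by (simp add: mc_def sum_fun_eval)

lemma predual_op_add:
  assumes \<phi>: "\<phi> \<in> vn_predual" and T: "T \<in> group_vn" and U: "U \<in> group_vn"
  shows "\<phi> (T + U) = \<phi> T + \<phi> U"
proof -
  obtain \<xi> \<eta> :: "nat \<times> 'a \<Rightarrow> complex" where r: "\<xi> \<in> ell2" "\<eta> \<in> ell2" "\<phi> = vec_functional \<xi> \<eta>"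
    using \<phi> unfolding vn_predual_iff by blast
  have i: "ell2_inner ((T + U) (slice \<xi> n)) (slice \<eta> n) = ell2_inner (T (slice \<xi> n)) (slice \<eta> n) + ell2_inner (U (slice \<xi> n)) (slice \<eta> n)" for n
    unfolding plus_fun_apply[of T U]
    by (rule ell2_inner_add_left[OF bounded_opsD(1)[OF group_vn_bounded[OF T] slice_ell2(1)[OF r(1)]]
          bounded_opsD(1)[OF group_vn_bounded[OF U] slice_ell2(1)[OF r(1)]] slice_ell2(1)[OF r(2)]])
  have "((\<lambda>n. ell2_inner ((T + U) (slice \<xi> n)) (slice \<eta> n)) has_sum \<phi> T + \<phi> U) UNIV"
    unfolding i r(3) by (intro has_sum_add has_sum_vec_functional T U r(1,2))
  with has_sum_vec_functional[OF group_vn_add[OF T U] r(1,2)] show ?thesis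
    unfolding r(3) by (rule has_sum_unique)
qed

lemma predual_op_scale:
  assumes \<phi>: "\<phi> \<in> vn_predual" and T: "T \<in> group_vn"
  shows "\<phi> (op_scale c T) = c * \<phi> T"
proof -
  obtain \<xi> \<eta> :: "nat \<times> 'a \<Rightarrow> complex" where r: "\<xi> \<in> ell2" "\<eta> \<in> ell2" "\<phi> = vec_functional \<xi> \<eta>"
    using \<phi> unfolding vn_predual_iff by blast
  have "((\<lambda>n. ell2_inner (op_scale c T (slice \<xi> n)) (slice \<eta> n)) has_sum c * \<phi> T) UNIV"
    unfolding r(3) op_scale_def ell2_inner_smul_left by (intro has_sum_cmult_right has_sum_vec_functional T r(1,2))
  with has_sum_vec_functional[OF group_vn_scale[OF T] r(1,2)] show ?thesis
    unfolding r(3) by (rule has_sum_unique)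
qed

lemma predual_op_sum:
  assumes \<phi>: "\<phi> \<in> vn_predual" and T: "\<And>h. h \<in> H \<Longrightarrow> T h \<in> group_vn"
  shows "\<phi> (\<Sum>h\<in>H. T h) = (\<Sum>h\<in>H. \<phi> (T h))"
proof -
  have z: "\<phi> 0 = 0"
    using predual_op_scale[OF \<phi> group_vn_zero, of 0] by (simp add: op_scale_def zero_fun_def)
  show ?thesis using T
  proof (induction H rule: infinite_finite_induct)
    case (insert h H)
    have "\<phi> (T h + (\<Sum>h\<in>H. T h)) = \<phi> (T h) + \<phi> (\<Sum>h\<in>H. T h)"
      using insert by (intro predual_op_add[OF \<phi>] group_vn_sum) auto
    then show ?case using insert by (simp only: sum.insert insert_iff simp_thms)
  qed (simp_all add: z)
qed

subsection \<open>The Fourier algebra as an operator space\<close>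

lemma inj_on_fun_of_functional: "inj_on fun_of_functional vn_predual"
proof (rule inj_onI)
  fix \<phi> \<psi> :: "'a::group_add l2op \<Rightarrow> complex"
  assume m: "\<phi> \<in> vn_predual" "\<psi> \<in> vn_predual" and eq: "fun_of_functional \<phi> = fun_of_functional \<psi>"
  have "\<phi> - \<psi> \<in> vn_predual" by (rule cfun.subspace_diff[OF subspace_vn_predual m])
  then obtain \<xi> \<eta> :: "nat \<times> 'a \<Rightarrow> complex" where r: "\<xi> \<in> ell2" "\<eta> \<in> ell2" "\<phi> - \<psi> = vec_functional \<xi> \<eta>"
    unfolding vn_predual_iff by blast
  have z: "vec_functional \<xi> \<eta> (left_reg g) = 0" for g
    using fun_cong[OF eq, of g] unfolding r(3)[symmetric] by (simp add: fun_of_functional_def)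
  have "(\<phi> - \<psi>) T = 0" for T
    using vec_functional_zero[OF r(1,2) z, of T] unfolding r(3) by (cases "T \<in> group_vn") (auto simp: vec_functional_def)
  then show "\<phi> = \<psi>" by (auto simp: fun_eq_iff)
qed

definition fourier_functional :: "('g::group_add \<Rightarrow> complex) \<Rightarrow> 'g l2op \<Rightarrow> complex" where
  "fourier_functional = the_inv_into vn_predual fun_of_functional"

lemma fourier_functional:
  assumes "f \<in> fourier_algebra"
  shows "fourier_functional f \<in> vn_predual" "fourier_functional f (left_reg x) = f x"
proof -
  have f: "f \<in> fun_of_functional ` vn_predual" using assms by (simp add: fourier_algebra_def)
  show "fourier_functional f \<in> vn_predual"
    unfolding fourier_functional_def by (rule the_inv_into_into[OF inj_on_fun_of_functional f order_refl])
  have "fun_of_functional (fourier_functional f) = f"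
    unfolding fourier_functional_def by (rule f_the_inv_into_f[OF inj_on_fun_of_functional f])
  then show "fourier_functional f (left_reg x) = f x"
    unfolding fun_of_functional_def by (rule fun_cong)
qed

lemma fourier_functional_eqI:
  assumes "\<phi> \<in> vn_predual" "\<And>x. \<phi> (left_reg x) = f x"
  shows "f \<in> fourier_algebra" "fourier_functional f = \<phi>"
proof -
  have f: "f = fun_of_functional \<phi>" using assms(2) by (auto simp: fun_of_functional_def)
  show "f \<in> fourier_algebra" unfolding f fourier_algebra_def using assms(1) by blast
  show "fourier_functional f = \<phi>"
    unfolding f fourier_functional_def by (rule the_inv_into_f_f[OF inj_on_fun_of_functional assms(1)])
qed

lemma fourier_algebra_add:
  assumes "f \<in> fourier_algebra" "g \<in> fourier_algebra"
  shows "f + g \<in> fourier_algebra" "fourier_functional (f + g) = fourier_functional f + fourier_functional g"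
proof -
  note I = fourier_functional_eqI[OF cfun.subspace_add[OF subspace_vn_predual
        fourier_functional(1)[OF assms(1)] fourier_functional(1)[OF assms(2)]], of "f + g"]
  show "f + g \<in> fourier_algebra" by (rule I(1)) (simp add: fourier_functional(2) assms)
  show "fourier_functional (f + g) = fourier_functional f + fourier_functional g"
    by (rule I(2)) (simp add: fourier_functional(2) assms)
qed

lemma fourier_algebra_smul:
  assumes "f \<in> fourier_algebra"
  shows "smul c f \<in> fourier_algebra" "fourier_functional (smul c f) = smul c (fourier_functional f)"
proof -
  note I = fourier_functional_eqI[OF cfun.subspace_scale[OF subspace_vn_predual fourier_functional(1)[OF assms]], of c "smul c f"]
  show "smul c f \<in> fourier_algebra" by (rule I(1)) (simp add: fourier_functional(2) assms smul_def)
  show "fourier_functional (smul c f) = smul c (fourier_functional f)"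
    by (rule I(2)) (simp add: fourier_functional(2) assms smul_def)
qed

lemma subspace_fourier_algebra: "cfun.subspace fourier_algebra"
proof (rule cfun.subspaceI)
  show "(0 :: 'a \<Rightarrow> complex) \<in> fourier_algebra"
    by (rule fourier_functional_eqI(1)[OF cfun.subspace_0[OF subspace_vn_predual]]) simp
qed (auto intro: fourier_algebra_add fourier_algebra_smul)

definition vn_ball :: "(nat \<times> 'g::group_add l2op mat) set" where
  "vn_ball = {(m, T). T \<in> mats m group_vn \<and> op_mnorm m T \<le> 1}"

lemma fourier_mnorm_eq_pair_norm: "fourier_mnorm = pair_norm fourier_functional vn_ball"
  by (simp add: fun_eq_iff fourier_mnorm_def dual_mnorm_def pair_norm_def vn_ball_def mat_pair_def fourier_functional_def)

lemma left_reg_vn_ball: "(1, \<lambda>_ _. left_reg x) \<in> vn_ball"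
proof -
  have "op_mnorm 1 (\<lambda>_ _. left_reg x) \<le> 1"
    by (rule op_mnorm_1_le[OF left_reg_bounded]) (simp_all add: left_reg_def ell2_reindex[OF bij_left])
  then show ?thesis by (simp add: vn_ball_def mats_def left_reg_group_vn)
qed

text \<open>The boundedness is that of functionals given by vectors, with the product of their norms
  as the constant; for separation the translations, as test matrices of size 1, are enough.\<close>

interpretation A: pairing_space "fourier_algebra :: ('g::group_add \<Rightarrow> complex) set" fourier_functional vn_ball
proof
  show "cfun.subspace (fourier_algebra :: ('g \<Rightarrow> complex) set)" by (rule subspace_fourier_algebra)
  show "(vn_ball :: (nat \<times> 'g l2op mat) set) \<noteq> {}" using left_reg_vn_ball by auto
  fix m k l :: nat and \<tau> :: "'g l2op mat" and u u' :: "'g \<Rightarrow> complex" and c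
  show "fourier_functional (u + u') (\<tau> k l) = fourier_functional u (\<tau> k l) + fourier_functional u' (\<tau> k l)"
    if "u \<in> fourier_algebra" "u' \<in> fourier_algebra"
    by (simp add: fourier_algebra_add(2) that)
  show "fourier_functional (smul c u) (\<tau> k l) = c * fourier_functional u (\<tau> k l)" if "u \<in> fourier_algebra"
    by (simp add: fourier_algebra_smul(2) that) (simp add: smul_def)
  show "\<exists>C\<ge>0. \<forall>(m, \<tau>)\<in>vn_ball. bil_bounded {..<m} {..<m} (\<lambda>k l. fourier_functional u (\<tau> k l)) C"
    if u: "u \<in> fourier_algebra"
  proof -
    obtain \<xi> \<eta> :: "nat \<times> 'g \<Rightarrow> complex" where r: "\<xi> \<in> ell2" "\<eta> \<in> ell2" "fourier_functional u = vec_functional \<xi> \<eta>"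
      using fourier_functional(1)[OF u] unfolding vn_predual_iff by blast
    have "bil_bounded {..<m} {..<m} (\<lambda>k l. fourier_functional u (\<tau> k l)) (ell2_norm \<xi> * ell2_norm \<eta>)"
      if t: "(m, \<tau>) \<in> vn_ball" for m \<tau>
    proof -
      have t': "\<tau> \<in> mats m group_vn" "op_mnorm m \<tau> \<le> 1" using t by (auto simp: vn_ball_def)
      show ?thesis unfolding r(3)
        by (rule bil_bounded_mono[OF vec_functional_matrix_bound[OF t'(1) r(1,2)] mult_left_le_one_le])
           (use t' op_mnorm_nonneg[OF mats_group_vn_bounded[OF t'(1)]] in auto)
    qed
    then show ?thesis by (intro exI[of _ "ell2_norm \<xi> * ell2_norm \<eta>"]) auto
  qed
  show "u = 0" if u: "u \<in> fourier_algebra"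
    and z: "\<And>m \<tau> k l. (m, \<tau>) \<in> vn_ball \<Longrightarrow> k < m \<Longrightarrow> l < m \<Longrightarrow> fourier_functional u (\<tau> k l) = 0"
    using z[OF left_reg_vn_ball, of 0 0] by (auto simp: fourier_functional[OF u] fun_eq_iff)
qed

lemma op_scale_truncations:
  assumes "op_truncations_bounded m T C"
  shows "op_truncations_bounded m (\<lambda>k l. op_scale c (T k l)) (cmod c * C)"
proof (intro allI impI)
  fix F :: "'a set" assume F: "finite F"
  show "bil_bounded ({..<m} \<times> F) ({..<m} \<times> F) (\<lambda>(k,x) (l,y). mc (op_scale c (T k l)) x y) (cmod c * C)"
    using bil_bounded_scale[OF assms[rule_format, OF F], of c]
    by (simp add: mc_op_scale case_prod_unfold)
qed

lemma bil_bounded_epsilon: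
  assumes "\<And>e. e > 0 \<Longrightarrow> bil_bounded I J K (C + e)"
  shows "bil_bounded I J K C"
  unfolding bil_bounded_def
proof (intro allI)
  fix w z
  let ?R = "L2_set (\<lambda>i. cmod (w i)) I * L2_set (\<lambda>j. cmod (z j)) J"
  have "cmod (\<Sum>i\<in>I. \<Sum>j\<in>J. w i * K i j * z j) \<le> C * ?R"
  proof (rule field_le_epsilon)
    fix e :: real assume e: "e > 0"
    have R: "?R \<ge> 0" by simp
    then have "?R + 1 > 0" by linarith
    then have "e / (?R + 1) > 0" using e by (rule divide_pos_pos[rotated])
    from bil_boundedD[OF assms[OF this], of w z]
    have "cmod (\<Sum>i\<in>I. \<Sum>j\<in>J. w i * K i j * z j) \<le> C * ?R + e / (?R + 1) * ?R"
      by (simp add: algebra_simps)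
    also have "e / (?R + 1) * ?R \<le> e / (?R + 1) * (?R + 1)"
      using e R by (intro mult_left_mono) auto
    also have "e / (?R + 1) * (?R + 1) = e" using R by (simp add: add_nonneg_eq_0_iff)
    finally show "cmod (\<Sum>i\<in>I. \<Sum>j\<in>J. w i * K i j * z j) \<le> C * ?R + e" by simp
  qed
  then show "cmod (\<Sum>i\<in>I. \<Sum>j\<in>J. w i * K i j * z j) \<le> C * L2_set (\<lambda>i. cmod (w i)) I * L2_set (\<lambda>j. cmod (z j)) J"
    by (simp add: mult.assoc)
qed

text \<open>Extends the defining estimate from the unit ball to test matrices of any norm by
  scaling.\<close>

lemma fourier_apply_nat:
  assumes a: "a \<in> mats n fourier_algebra" and Y: "Y \<in> mats m group_vn"
    and C: "0 \<le> C" "op_truncations_bounded m Y C"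
  shows "pair_bounded fourier_functional n a m Y (fourier_mnorm n a * C)"
proof (rule bil_bounded_epsilon)
  fix e :: real assume e: "e > 0"
  let ?N = "fourier_mnorm n a"
  have N: "?N \<ge> 0" unfolding fourier_mnorm_eq_pair_norm by (rule A.pair_norm_nonneg'[OF a])
  \<comment> \<open>Slightly above \<open>C\<close>, hence positive even if \<open>C\<close> is 0;
    the surplus costs at most \<open>e\<close> after multiplication by the norm of
    \<open>a\<close>.\<close>
  define d where "d = C + e / (?N + 1)"
  have d: "d > 0" "C \<le> d" using e N C by (simp_all add: d_def add_nonneg_pos)
  define Z where "Z = (\<lambda>k l. op_scale (of_real (1 / d)) (Y k l))"
  have Z: "Z \<in> mats m group_vn" using Y by (auto simp: Z_def mats_def group_vn_scale)
  have "op_mnorm m Z \<le> cmod (of_real (1 / d)) * C"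
    unfolding Z_def by (rule op_mnorm_le[OF mats_group_vn_bounded[OF Z[unfolded Z_def]] _ op_scale_truncations[OF C(2)]])
      (use C in simp)
  also have "\<dots> \<le> 1" using d by (simp add: norm_divide)
  finally have "(m, Z) \<in> vn_ball" using Z by (simp add: vn_ball_def)
  from bil_bounded_scale[OF A.pair_norm_bound(1)[OF a this], of "of_real d"]
  have "bil_bounded ({..<n} \<times> {..<m}) ({..<n} \<times> {..<m})
      (\<lambda>p q. of_real d * (\<lambda>(i,k) (j,l). fourier_functional (a i j) (Z k l)) p q) (d * ?N)"
    using d by (simp add: fourier_mnorm_eq_pair_norm)
  then have "pair_bounded fourier_functional n a m Y (d * ?N)"
  proof (rule iffD1[OF bil_bounded_cong, rotated])
    fix p q assume "p \<in> {..<n} \<times> {..<m}" "q \<in> {..<n} \<times> {..<m}"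
    then obtain i k j l where [simp]: "p = (i,k)" "q = (j,l)" and b: "i < n" "j < n" "k < m" "l < m" by auto
    have "a i j \<in> fourier_algebra" "Y k l \<in> group_vn" using a Y b by (auto simp: mats_def)
    then show "of_real d * (\<lambda>(i,k) (j,l). fourier_functional (a i j) (Z k l)) p q
        = (\<lambda>(i,k) (j,l). fourier_functional (a i j) (Y k l)) p q"
      using d by (simp add: Z_def predual_op_scale[OF fourier_functional(1)])
  qed
  moreover have "d * ?N \<le> ?N * C + e"
  proof -
    have "e / (?N + 1) * ?N \<le> e / (?N + 1) * (?N + 1)" using e N by (intro mult_left_mono) auto
    also have "\<dots> = e" using N by (simp add: add_nonneg_eq_0_iff)
    finally show ?thesis by (simp add: d_def algebra_simps)
  qed
  ultimately show "pair_bounded fourier_functional n a m Y (?N * C + e)" by (rule bil_bounded_mono)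
qed

text \<open>The form in which the norm is used from here on: test matrices over any finite index
  set, with their norm controlled by finite truncations.\<close>

lemma fourier_apply:
  fixes Y :: "'i \<Rightarrow> 'i \<Rightarrow> 'g::group_add l2op"
  assumes a: "a \<in> mats n fourier_algebra" and I: "finite I" and Y: "\<And>i j. i \<in> I \<Longrightarrow> j \<in> I \<Longrightarrow> Y i j \<in> group_vn"
    and C: "0 \<le> C" "\<And>F. finite F \<Longrightarrow> bil_bounded (I \<times> F) (I \<times> F) (\<lambda>(i,x) (j,y). mc (Y i j) x y) C"
  shows "bil_bounded ({..<n} \<times> I) ({..<n} \<times> I) (\<lambda>(i,k) (j,l). fourier_functional (a i j) (Y k l)) (fourier_mnorm n a * C)"
proof -
  obtain f where f: "bij_betw f {..<card I} I"
    using ex_bij_betw_nat_finite[OF I] by (auto simp: atLeast0LessThan)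
  then have inj: "inj_on f {..<card I}" and im: "f ` {..<card I} = I" by (auto simp: bij_betw_def)
  have fI: "f k \<in> I" if "k < card I" for k using im that by auto
  have mp: "inj_on (map_prod f id) ({..<card I} \<times> F)" "map_prod f id ` ({..<card I} \<times> F) = I \<times> F" for F :: "'g set"
    using inj im by (auto simp: inj_on_def map_prod_surj_on)
  have mp': "inj_on (map_prod id f) ({..<n} \<times> {..<card I})" "map_prod id f ` ({..<n} \<times> {..<card I}) = {..<n} \<times> I"
    using inj im by (auto simp: inj_on_def map_prod_surj_on)
  have "pair_bounded fourier_functional n a (card I) (\<lambda>k l. Y (f k) (f l)) (fourier_mnorm n a * C)"
  proof (rule fourier_apply_nat[OF a _ C(1)])
    show "(\<lambda>k l. Y (f k) (f l)) \<in> mats (card I) group_vn" using Y fI by (auto simp: mats_def)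
    show "op_truncations_bounded (card I) (\<lambda>k l. Y (f k) (f l)) C"
    proof (intro allI impI)
      fix F :: "'g set" assume F: "finite F"
      have "bil_bounded (map_prod f id ` ({..<card I} \<times> F)) (map_prod f id ` ({..<card I} \<times> F)) (\<lambda>(i,x) (j,y). mc (Y i j) x y) C"
        unfolding mp(2) by (rule C(2)[OF F])
      then show "bil_bounded ({..<card I} \<times> F) ({..<card I} \<times> F) (\<lambda>(k, x) (l, y). mc (Y (f k) (f l)) x y) C"
        by (simp add: bil_bounded_image[OF mp(1) mp(1)] case_prod_unfold)
    qed
  qed
  then have "bil_bounded (map_prod id f ` ({..<n} \<times> {..<card I})) (map_prod id f ` ({..<n} \<times> {..<card I}))
      (\<lambda>(i,k) (j,l). fourier_functional (a i j) (Y k l)) (fourier_mnorm n a * C)"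
    by (simp add: bil_bounded_image[OF mp'(1) mp'(1)] case_prod_unfold)
  then show ?thesis unfolding mp'(2) .
qed

text \<open>The matrix \<open>[M\<^sub>s\<^sub>t \<lambda>(z\<^sub>s - z\<^sub>t)]\<close> has the norm of \<open>M\<close>: conjugate by the diagonal unitary
  with entries \<open>\<lambda>(z\<^sub>s)\<close>.\<close>

lemma fourier_schur:
  fixes z :: "'i \<Rightarrow> 'g::group_add"
  assumes a: "a \<in> mats n fourier_algebra" and I: "finite I" and M: "bil_bounded I I M C" and C: "0 \<le> C"
  shows "bil_bounded ({..<n} \<times> I) ({..<n} \<times> I) (\<lambda>(i,s) (j,t). a i j (z s - z t) * M s t) (fourier_mnorm n a * C)"
proof -
  define Y where "Y = (\<lambda>s t. op_scale (M s t) (left_reg (z s - z t)))"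
  have "bil_bounded ({..<n} \<times> I) ({..<n} \<times> I) (\<lambda>(i,k) (j,l). fourier_functional (a i j) (Y k l)) (fourier_mnorm n a * C)"
  proof (rule fourier_apply[OF a I _ C])
    show "Y s t \<in> group_vn" for s t by (simp add: Y_def group_vn_scale left_reg_group_vn)
    fix F :: "'g set" assume F: "finite F"
    \<comment> \<open>The conjugation by the diagonal unitary, carried out on indices. The set
      \<open>S\<close> collects the shifted group elements, so that \<open>f\<close> maps into the
      rectangle \<open>I \<times> S\<close> on which \<open>M\<close> tensor the identity is
      bounded.\<close>
    define f where "f = (\<lambda>(s, x). (s, - z s + x))"
    define S where "S = snd ` f ` (I \<times> F)"
    have S: "finite S" "f ` (I \<times> F) \<subseteq> I \<times> S" using I F by (auto simp: S_def f_def image_iff) force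
    have inj: "inj_on f (I \<times> F)" by (auto simp: inj_on_def f_def)
    have "bil_bounded (I \<times> S) (I \<times> S) (\<lambda>(i,s) (j,t). if s = t then M i j else 0) C"
      by (rule bil_bounded_tensor_id[OF M I I S(1) C])
    then have "bil_bounded (f ` (I \<times> F)) (f ` (I \<times> F)) (\<lambda>(i,s) (j,t). if s = t then M i j else 0) C"
      by (rule bil_bounded_subset[OF _ S(2) S(2)]) (use I S in auto)
    then have "bil_bounded (I \<times> F) (I \<times> F) (\<lambda>p q. (\<lambda>(i,s) (j,t). if s = t then M i j else 0) (f p) (f q)) C"
      by (simp add: bil_bounded_image[OF inj inj])
    then show "bil_bounded (I \<times> F) (I \<times> F) (\<lambda>(i,x) (j,y). mc (Y i j) x y) C"
    proof (rule iffD1[OF bil_bounded_cong, rotated])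
      fix p q :: "'i \<times> 'g"
      obtain s x t y where [simp]: "p = (s, x)" "q = (t, y)" by (cases p; cases q)
      have "(- z s + x = - z t + y) = (x = z s - z t + y)"
        by (metis add.assoc add_minus_cancel diff_conv_add_uminus minus_add_cancel)
      then show "(\<lambda>(i,s) (j,t). if s = t then M i j else 0) (f p) (f q) = (\<lambda>(i,x) (j,y). mc (Y i j) x y) p q"
        by (simp add: f_def Y_def mc_op_scale mc_left_reg)
    qed
  qed
  then show ?thesis
  proof (rule iffD1[OF bil_bounded_cong, rotated])
    fix p q assume "p \<in> {..<n} \<times> I" "q \<in> {..<n} \<times> I"
    then obtain i s j t where [simp]: "p = (i,s)" "q = (j,t)" and b: "i < n" "j < n" by auto
    have "a i j \<in> fourier_algebra" using a b by (auto simp: mats_def)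
    then show "(\<lambda>(i,k) (j,l). fourier_functional (a i j) (Y k l)) p q = (\<lambda>(i,s) (j,t). a i j (z s - z t) * M s t) p q"
      by (simp add: Y_def predual_op_scale[OF fourier_functional(1) left_reg_group_vn] fourier_functional(2) mult.commute)
  qed
qed

text \<open>The test matrix consists of the convolution operators by the functions
  \<open>k s t\<close>. Being finitely supported, these are finite combinations of left
  translations, and the functional is evaluated term by term. It bounds the operation of summing out
  one group variable against elements of the Fourier algebra.\<close>

lemma fourier_slice:
  fixes k :: "'i \<Rightarrow> 'i \<Rightarrow> 'g::group_add \<Rightarrow> complex"
  assumes a: "a \<in> mats n fourier_algebra" and I: "finite I" and H: "finite H"
    and supp: "\<And>s t h. s \<in> I \<Longrightarrow> t \<in> I \<Longrightarrow> h \<notin> H \<Longrightarrow> k s t h = 0" and C: "0 \<le> C"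
    and bd: "\<And>F. finite F \<Longrightarrow> bil_bounded (I \<times> F) (I \<times> F) (\<lambda>(s,x) (t,y). k s t (x - y)) C"
  shows "bil_bounded ({..<n} \<times> I) ({..<n} \<times> I) (\<lambda>(i,s) (j,t). \<Sum>h\<in>H. a i j h * k s t h) (fourier_mnorm n a * C)"
proof -
  define Y where "Y = (\<lambda>s t. \<Sum>h\<in>H. op_scale (k s t h) (left_reg h))"
  have "bil_bounded ({..<n} \<times> I) ({..<n} \<times> I) (\<lambda>(i,k) (j,l). fourier_functional (a i j) (Y k l)) (fourier_mnorm n a * C)"
  proof (rule fourier_apply[OF a I _ C])
    show "Y s t \<in> group_vn" for s t unfolding Y_def by (intro group_vn_sum group_vn_scale left_reg_group_vn)
    fix F :: "'g set" assume F: "finite F"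
    show "bil_bounded (I \<times> F) (I \<times> F) (\<lambda>(i,x) (j,y). mc (Y i j) x y) C"
    proof (rule iffD1[OF bil_bounded_cong bd[OF F]])
      fix p q assume "p \<in> I \<times> F" "q \<in> I \<times> F"
      then obtain s x t y where [simp]: "p = (s, x)" "q = (t, y)" and st: "s \<in> I" "t \<in> I" by auto
      have "mc (Y s t) x y = (\<Sum>h\<in>H. if h = x - y then k s t h else 0)"
        unfolding Y_def mc_sum mc_op_scale mc_left_reg by (intro sum.cong refl) (auto simp: diff_eq_eq eq_diff_eq)
      also have "\<dots> = k s t (x - y)" using H supp[OF st, of "x - y"] by auto
      finally show "(\<lambda>(s,x) (t,y). k s t (x - y)) p q = (\<lambda>(i,x) (j,y). mc (Y i j) x y) p q" by simp
    qed
  qed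
  then show ?thesis
  proof (rule iffD1[OF bil_bounded_cong, rotated])
    fix p q assume "p \<in> {..<n} \<times> I" "q \<in> {..<n} \<times> I"
    then obtain i s j t where [simp]: "p = (i,s)" "q = (j,t)" and b: "i < n" "j < n" by auto
    have aij: "a i j \<in> fourier_algebra" using a b by (auto simp: mats_def)
    have "fourier_functional (a i j) (Y s t) = (\<Sum>h\<in>H. fourier_functional (a i j) (op_scale (k s t h) (left_reg h)))"
      unfolding Y_def by (intro predual_op_sum fourier_functional(1)[OF aij] group_vn_scale left_reg_group_vn)
    also have "\<dots> = (\<Sum>h\<in>H. a i j h * k s t h)"
      by (simp add: predual_op_scale[OF fourier_functional(1)[OF aij] left_reg_group_vn] fourier_functional(2)[OF aij] mult.commute)
    finally show "(\<lambda>(i,k) (j,l). fourier_functional (a i j) (Y k l)) p q = (\<lambda>(i,s) (j,t). \<Sum>h\<in>H. a i j h * k s t h) p q"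
      by simp
  qed
qed

text \<open>Follows from the complete bound of functionals given by vectors. It brings the
  convergence from \<open>predual_complete\<close>, which is in \<open>vec_norm\<close>, back to the
  norm of the algebra.\<close>

lemma fourier_norm_1_le_vec_norm:
  assumes "f \<in> fourier_algebra"
  shows "fourier_mnorm 1 (\<lambda>_ _. f) \<le> vec_norm (fourier_functional f)"
proof (rule field_le_epsilon)
  fix e :: real assume e: "e > 0"
  obtain \<xi> \<eta> :: "nat \<times> 'a \<Rightarrow> complex" where r: "\<xi> \<in> ell2" "\<eta> \<in> ell2" "fourier_functional f = vec_functional \<xi> \<eta>"
    "(ell2_norm \<xi>)\<^sup>2 + (ell2_norm \<eta>)\<^sup>2 < 2 * (vec_norm (fourier_functional f) + e)"
    using vec_norm_lessD[OF fourier_functional(1)[OF assms], of "vec_norm (fourier_functional f) + e"] e by auto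
  have "ell2_norm \<xi> * ell2_norm \<eta> \<le> vec_norm (fourier_functional f) + e"
    using r(4) sum_squares_bound[of "ell2_norm \<xi>" "ell2_norm \<eta>"] by simp
  moreover have "fourier_mnorm 1 (\<lambda>_ _. f) \<le> ell2_norm \<xi> * ell2_norm \<eta>"
    unfolding fourier_mnorm_eq_pair_norm
  proof (rule A.pair_norm_1_le)
    fix m and \<tau> :: "'a l2op mat" assume "(m, \<tau>) \<in> vn_ball"
    then have t: "\<tau> \<in> mats m group_vn" "op_mnorm m \<tau> \<le> 1" by (auto simp: vn_ball_def)
    show "bil_bounded {..<m} {..<m} (\<lambda>k l. fourier_functional f (\<tau> k l)) (ell2_norm \<xi> * ell2_norm \<eta>)"
      unfolding r(3)
      by (rule bil_bounded_mono[OF vec_functional_matrix_bound[OF t(1) r(1,2)] mult_left_le_one_le])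
         (use t op_mnorm_nonneg[OF mats_group_vn_bounded[OF t(1)]] in auto)
  qed simp
  ultimately show "fourier_mnorm 1 (\<lambda>_ _. f) \<le> vec_norm (fourier_functional f) + e" by simp
qed

lemma fourier_operator_space: "operator_space (fourier_algebra :: ('g::group_add \<Rightarrow> complex) set) fourier_mnorm"
  unfolding fourier_mnorm_eq_pair_norm
proof (rule A.operator_spaceI)
  fix s :: "nat \<Rightarrow> 'g \<Rightarrow> complex"
  assume s: "\<And>k. s k \<in> fourier_algebra"
    and C: "\<And>e. e > 0 \<Longrightarrow> \<exists>K. \<forall>k\<ge>K. \<forall>l\<ge>K. A.N 1 (\<lambda>_ _. s k - s l) < e"
  note sub = subspace_fourier_algebra[where 'a = 'g]
  have fdiff: "fourier_functional (f - g) = fourier_functional f - fourier_functional g"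
    if "f \<in> fourier_algebra" "g \<in> fourier_algebra" for f g :: "'g \<Rightarrow> complex"
  proof -
    have "f - g = f + smul (-1) g" by (auto simp: smul_def)
    then have "fourier_functional (f - g) = fourier_functional f + smul (-1) (fourier_functional g)"
      using fourier_algebra_add(2)[OF that(1) fourier_algebra_smul(1)[OF that(2)], of "-1"] fourier_algebra_smul(2)[OF that(2), of "-1"]
      by metis
    then show ?thesis by (auto simp: smul_def fun_eq_iff)
  qed
  have "\<exists>\<psi>\<in>vn_predual. \<forall>e>0. \<exists>K. \<forall>k\<ge>K. vec_norm (fourier_functional (s k) - \<psi>) \<le> e"
  proof (rule predual_complete)
    show "fourier_functional (s k) \<in> vn_predual" for k by (rule fourier_functional(1)[OF s])
    fix e :: real assume "e > 0"
    then obtain K where K: "\<forall>k\<ge>K. \<forall>l\<ge>K. A.N 1 (\<lambda>_ _. s k - s l) < e" using C by blast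
    have "cmod (fourier_functional (s k) T - fourier_functional (s l) T) \<le> e"
      if kl: "k \<ge> K" "l \<ge> K" and T: "T \<in> group_vn" "op_mnorm 1 (\<lambda>_ _. T) \<le> 1" for k l and T :: "'g l2op"
    proof -
      have "(1, \<lambda>_ _. T) \<in> vn_ball" using T by (simp add: vn_ball_def mats_def)
      from bil_bounded_entry[OF A.pair_norm_1_bound[OF cfun.subspace_diff[OF sub s[of k] s[of l]] this], of 0 0]
      have "cmod (fourier_functional (s k - s l) T) \<le> A.N 1 (\<lambda>_ _. s k - s l)" by simp
      also have "\<dots> < e" using K kl by blast
      finally show ?thesis by (simp add: fdiff s)
    qed
    then show "\<exists>K. \<forall>k\<ge>K. \<forall>l\<ge>K. \<forall>T\<in>group_vn. op_mnorm 1 (\<lambda>_ _. T) \<le> 1 \<longrightarrow>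
        cmod (fourier_functional (s k) T - fourier_functional (s l) T) \<le> e" by blast
  qed
  then obtain \<psi> :: "'g l2op \<Rightarrow> complex" where \<psi>: "\<psi> \<in> vn_predual"
    "\<And>e. e > 0 \<Longrightarrow> \<exists>K. \<forall>k\<ge>K. vec_norm (fourier_functional (s k) - \<psi>) \<le> e" by blast
  define v where "v = fun_of_functional \<psi>"
  have v: "v \<in> fourier_algebra" "fourier_functional v = \<psi>"
    by (rule fourier_functional_eqI[OF \<psi>(1)]; simp add: v_def fun_of_functional_def)+
  have "(\<lambda>k. A.N 1 (\<lambda>_ _. s k - v)) \<longlonglongrightarrow> 0"
  proof (rule LIMSEQ_I)
    fix e :: real assume e: "e > 0"
    then obtain K where K: "\<forall>k\<ge>K. vec_norm (fourier_functional (s k) - \<psi>) \<le> e / 2" using \<psi>(2)[of "e/2"] by auto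
    have "norm (A.N 1 (\<lambda>_ _. s k - v) - 0) < e" if "k \<ge> K" for k
    proof -
      have m: "s k - v \<in> fourier_algebra" by (rule cfun.subspace_diff[OF sub s v(1)])
      have "A.N 1 (\<lambda>_ _. s k - v) \<le> vec_norm (fourier_functional (s k - v))"
        using fourier_norm_1_le_vec_norm[OF m] by (simp add: fourier_mnorm_eq_pair_norm)
      also have "\<dots> \<le> e / 2" using K that by (simp add: fdiff[OF s v(1)] v(2))
      finally have "A.N 1 (\<lambda>_ _. s k - v) < e" using e by simp
      moreover have "0 \<le> A.N 1 (\<lambda>_ _. s k - v)" by (rule A.pair_norm_nonneg') (use m in \<open>simp add: mats_def\<close>)
      ultimately show ?thesis by simp
    qed
    then show "\<exists>K. \<forall>k\<ge>K. norm (A.N 1 (\<lambda>_ _. s k - v) - 0) < e" by blast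
  qed
  with v(1) show "\<exists>v\<in>fourier_algebra. (\<lambda>k. A.N 1 (\<lambda>_ _. s k - v)) \<longlonglongrightarrow> 0" by blast
qed

lemma fourier_mnorm_nonneg: "a \<in> mats n fourier_algebra \<Longrightarrow> 0 \<le> fourier_mnorm n a"
  by (rule operator_space.norm_nonneg[OF fourier_operator_space])

text \<open>The value \<open>f g\<close> is the inner product of the translate of
  \<open>delta 0\<close> by \<open>g\<close> with the complex conjugate of \<open>f\<close>.\<close>

lemma ell2_in_fourier_algebra:
  assumes "f \<in> ell2" shows "f \<in> fourier_algebra"
proof -
  let ?x = "emb (0::nat) (delta (0 :: 'a))" and ?e = "emb (0::nat) (\<lambda>x. cnj (f x))"
  have m: "?x \<in> ell2" "?e \<in> ell2" by (intro emb_ell2 delta_ell2 ell2_cnj assms)+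
  have "vec_functional ?x ?e (left_reg g) = f g" for g
  proof -
    have sl: "slice (emb (0::nat) \<zeta>) n = (if n = 0 then \<zeta> else 0)" for \<zeta> :: "'a \<Rightarrow> complex" and n by (auto simp: emb_def)
    have l: "left_reg g (delta 0) = delta g"
      using mc_left_reg[of g _ 0] by (auto simp: fun_eq_iff mc_def delta_def)
    have "ell2_inner (delta g) (\<lambda>x. cnj (f x)) = f g"
      using ell2_inner_commute[of "delta g" "\<lambda>x. cnj (f x)"] by simp
    then have "((\<lambda>n. ell2_inner (left_reg g (slice ?x n)) (slice ?e n)) has_sum f g) UNIV"
      unfolding sl by (intro has_sum_finite_neutralI[of "{0}"]) (auto simp: l)
    with has_sum_vec_functional[OF left_reg_group_vn m] show ?thesis by (rule has_sum_unique)
  qed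
  then show ?thesis by (rule fourier_functional_eqI(1)[OF vec_functional_in_predual[OF m]])
qed

subsection \<open>Pointwise multiplication\<close>

lemma tensor_ell2:
  assumes "\<zeta> \<in> ell2" "\<xi> \<in> ell2"
  shows "(\<lambda>(a, b). \<zeta> a * \<xi> b) \<in> ell2" "ell2_norm (\<lambda>(a, b). \<zeta> a * \<xi> b) = ell2_norm \<zeta> * ell2_norm \<xi>"
proof -
  let ?t = "\<lambda>(a, b). \<zeta> a * \<xi> b"
  have sl: "slice ?t a = smul (\<zeta> a) \<xi>" for a by (simp add: smul_def)
  have s: "slice ?t a \<in> ell2" for a unfolding sl by (rule ell2_smul[OF assms(2)])
  have h: "((\<lambda>a. (ell2_norm (slice ?t a))\<^sup>2) has_sum (ell2_norm \<zeta>)\<^sup>2 * (ell2_norm \<xi>)\<^sup>2) UNIV"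
    unfolding sl ell2_norm_smul power_mult_distrib
    by (rule has_sum_cmult_left[OF has_sum_ell2_norm[OF assms(1)]])
  show "?t \<in> ell2" by (rule ell2_sliceI(1)[OF s h])
  have "(ell2_norm ?t)\<^sup>2 = (ell2_norm \<zeta> * ell2_norm \<xi>)\<^sup>2"
    using ell2_sliceI(2)[OF s h] by (simp add: power_mult_distrib)
  then show "ell2_norm ?t = ell2_norm \<zeta> * ell2_norm \<xi>" by (simp add: power2_eq_iff_nonneg)
qed

text \<open>The vector \<open>\<zeta> \<otimes> \<xi>\<close> after the unitary that turns \<open>\<lambda> \<otimes> \<lambda>\<close> into a multiple of \<open>\<lambda>\<close>.\<close>

definition twist :: "('k \<times> 'g::group_add \<Rightarrow> complex) \<Rightarrow> ('g \<Rightarrow> complex) \<Rightarrow> ('k \<times> 'g) \<times> 'g \<Rightarrow> complex" where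
  "twist \<xi> \<zeta> = (\<lambda>((m, y), z). \<zeta> z * \<xi> (m, z + y))"

lemma twist_ell2:
  fixes \<xi> :: "'k \<times> 'g::group_add \<Rightarrow> complex"
  assumes "\<xi> \<in> ell2" "\<zeta> \<in> ell2"
  shows "twist \<xi> \<zeta> \<in> ell2" "ell2_norm (twist \<xi> \<zeta>) = ell2_norm \<zeta> * ell2_norm \<xi>"
proof -
  have bij: "bij (\<lambda>((m :: 'k, y), z :: 'g). (z, (m, z + y)))"
    by (rule bij_betw_byWitness[where f' = "\<lambda>(z, (m, u)). ((m, - z + u), z)"]) (auto simp: add.assoc[symmetric])
  have e: "twist \<xi> \<zeta> = (\<lambda>p. (\<lambda>(a, b). \<zeta> a * \<xi> b) ((\<lambda>((m, y), z). (z, (m, z + y))) p))"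
    by (auto simp: twist_def fun_eq_iff)
  show "twist \<xi> \<zeta> \<in> ell2" "ell2_norm (twist \<xi> \<zeta>) = ell2_norm \<zeta> * ell2_norm \<xi>"
    unfolding e using ell2_reindex[OF bij, of "\<lambda>(a, b). \<zeta> a * \<xi> b"] tensor_ell2[OF assms(2,1)] by simp_all
qed

text \<open>Both sides are bounded sesquilinear in \<open>\<zeta>\<close> and
  \<open>\<theta>\<close>, so vectors \<open>delta\<close> suffice. There the substitution of
  \<open>x + u\<close> for the group variable identifies the sum over \<open>u\<close> with the
  functional of \<open>\<xi>\<close> and \<open>\<eta>\<close> at
  \<open>left_reg (x - y)\<close>.\<close>

lemma vec_functional_twist:
  fixes \<xi> \<eta> :: "'k \<times> 'g::group_add \<Rightarrow> complex"
  assumes \<xi>: "\<xi> \<in> ell2" and \<eta>: "\<eta> \<in> ell2" and T: "T \<in> group_vn" and S: "S \<in> group_vn"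
    and mcS: "\<And>x y. mc S x y = vec_functional \<xi> \<eta> (left_reg (x - y)) * mc T x y"
    and \<zeta>: "\<zeta> \<in> ell2" and \<theta>: "\<theta> \<in> ell2"
  shows "vec_functional (twist \<xi> \<zeta>) (twist \<eta> \<theta>) T = ell2_inner (S \<zeta>) \<theta>"
proof -
  obtain C where C: "C \<ge> 0" "\<And>\<xi>. \<xi> \<in> ell2 \<Longrightarrow> ell2_norm (T \<xi>) \<le> C * ell2_norm \<xi>"
    using bounded_opsD(5)[OF group_vn_bounded[OF T]] by auto
  obtain D where D: "D \<ge> 0" "\<And>\<xi>. \<xi> \<in> ell2 \<Longrightarrow> ell2_norm (S \<xi>) \<le> D * ell2_norm \<xi>"
    using bounded_opsD(5)[OF group_vn_bounded[OF S]] by auto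
  interpret V: bounded_sesquilinear "\<lambda>\<xi> \<eta> :: ('k \<times> 'g) \<times> 'g \<Rightarrow> complex. vec_functional \<xi> \<eta> T" C
    by (rule bounded_sesquilinear_vec_functional[OF T C(2,1)])
  have tw: "twist \<xi> (x + y) = twist \<xi> x + twist \<xi> y" "twist \<xi> (smul c x) = smul c (twist \<xi> x)"
    for \<xi> :: "'k \<times> 'g \<Rightarrow> complex" and x y c
    by (auto simp: twist_def smul_def fun_eq_iff algebra_simps)
  have Q: "bounded_sesquilinear (\<lambda>\<zeta> \<theta>. vec_functional (twist \<xi> \<zeta>) (twist \<eta> \<theta>) T) (C * ell2_norm \<xi> * ell2_norm \<eta>)"
  proof
    fix x x' y y' :: "'g \<Rightarrow> complex" and c assume m: "x \<in> ell2" "y \<in> ell2"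
    note t = twist_ell2(1)[OF \<xi>] twist_ell2(1)[OF \<eta>]
    show "vec_functional (twist \<xi> (x + x')) (twist \<eta> y) T = vec_functional (twist \<xi> x) (twist \<eta> y) T + vec_functional (twist \<xi> x') (twist \<eta> y) T"
      if "x' \<in> ell2" unfolding tw by (intro V.add_left t m that)
    show "vec_functional (twist \<xi> x) (twist \<eta> (y + y')) T = vec_functional (twist \<xi> x) (twist \<eta> y) T + vec_functional (twist \<xi> x) (twist \<eta> y') T"
      if "y' \<in> ell2" unfolding tw by (intro V.add_right t m that)
    show "vec_functional (twist \<xi> (smul c x)) (twist \<eta> y) T = c * vec_functional (twist \<xi> x) (twist \<eta> y) T"
      unfolding tw by (intro V.smul_left t m)
    show "vec_functional (twist \<xi> x) (twist \<eta> (smul c y)) T = cnj c * vec_functional (twist \<xi> x) (twist \<eta> y) T"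
      unfolding tw by (intro V.smul_right t m)
    show "cmod (vec_functional (twist \<xi> x) (twist \<eta> y) T) \<le> C * ell2_norm \<xi> * ell2_norm \<eta> * ell2_norm x * ell2_norm y"
      using V.bound[OF t(1)[OF m(1)] t(2)[OF m(2)]]
      by (simp add: twist_ell2(2)[OF \<xi> m(1)] twist_ell2(2)[OF \<eta> m(2)] mult_ac)
  qed
  show ?thesis
  proof (rule bounded_sesquilinear_eqI[OF Q bounded_sesquilinear_op[OF group_vn_bounded[OF S] D(2)] _ \<zeta> \<theta>])
    fix x y :: 'g
    let ?g = "x - y"
    have am: "amp (left_reg ?g) \<xi> \<in> ell2"
      by (rule bounded_opsD(1)[OF amp_bounded[OF left_reg_bounded] \<xi>])
    have ae: "amp (left_reg ?g) \<xi> (m, u) = \<xi> (m, - ?g + u)" for m u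
      by (simp add: amp_def \<xi> left_reg_def slice_ell2(1)[OF \<xi>])
    have bij: "bij (\<lambda>(m :: 'k, u). (m, x + u))"
      by (rule bij_betw_byWitness[where f' = "\<lambda>(m, u). (m, - x + u)"]) (auto simp: add.assoc[symmetric])
    have "((\<lambda>p. amp (left_reg ?g) \<xi> p * cnj (\<eta> p)) has_sum vec_functional \<xi> \<eta> (left_reg ?g)) UNIV"
      using ell2_inner_summable[OF am \<eta>]
      by (simp add: vec_functional_eq_inner[OF left_reg_group_vn \<xi> \<eta>] ell2_inner_def)
    then have "((\<lambda>p. amp (left_reg ?g) \<xi> ((\<lambda>(m, u). (m, x + u)) p) * cnj (\<eta> ((\<lambda>(m, u). (m, x + u)) p)))
        has_sum vec_functional \<xi> \<eta> (left_reg ?g)) UNIV"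
      by (subst has_sum_reindex_bij_betw[OF bij])
    also have "(\<lambda>p. amp (left_reg ?g) \<xi> ((\<lambda>(m, u). (m, x + u)) p) * cnj (\<eta> ((\<lambda>(m, u). (m, x + u)) p)))
        = (\<lambda>(m, u). \<xi> (m, y + u) * cnj (\<eta> (m, x + u)))"
    proof -
      have "- ?g + (x + u) = y + u" for u by (simp add: minus_diff_eq add.assoc[symmetric])
      then show ?thesis by (auto simp: fun_eq_iff ae)
    qed
    finally have hs: "((\<lambda>(m, u). \<xi> (m, y + u) * cnj (\<eta> (m, x + u))) has_sum vec_functional \<xi> \<eta> (left_reg ?g)) UNIV" .
    have sl: "slice (twist \<xi>' (delta y)) (m, u) = smul (\<xi>' (m, y + u)) (delta y)"
      for \<xi>' :: "'k \<times> 'g \<Rightarrow> complex" and y m u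
      by (auto simp: twist_def smul_def delta_def fun_eq_iff)
    have "ell2_inner (T (slice (twist \<xi> (delta y)) p)) (slice (twist \<eta> (delta x)) p)
        = (\<lambda>(m, u). \<xi> (m, y + u) * cnj (\<eta> (m, x + u))) p * mc T x y" for p
      by (cases p) (simp only: sl prod.case, simp add: bounded_opsD(3)[OF group_vn_bounded[OF T] delta_ell2]
          ell2_inner_smul_left ell2_inner_smul_right mc_def, simp add: smul_def)
    then have "((\<lambda>p. ell2_inner (T (slice (twist \<xi> (delta y)) p)) (slice (twist \<eta> (delta x)) p))
        has_sum vec_functional \<xi> \<eta> (left_reg ?g) * mc T x y) UNIV"
      using has_sum_cmult_left[OF hs, of "mc T x y"] by (simp only:)
    with has_sum_vec_functional[OF T twist_ell2(1)[OF \<xi> delta_ell2] twist_ell2(1)[OF \<eta> delta_ell2], of y x]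
    have "vec_functional (twist \<xi> (delta y)) (twist \<eta> (delta x)) T = vec_functional \<xi> \<eta> (left_reg ?g) * mc T x y"
      by (rule has_sum_unique)
    then show "vec_functional (twist \<xi> (delta y)) (twist \<eta> (delta x)) T = ell2_inner (S (delta y)) (delta x)"
      using mcS[of x y] by (simp add: mc_def)
  qed
qed

text \<open>The adjoint of multiplication by \<open>b\<close> on the Fourier algebra: Schur
  multiplication of the matrix, which takes \<open>left_reg g\<close> to its multiple by
  \<open>b g\<close>.\<close>

definition multiplier :: "('g::group_add \<Rightarrow> complex) \<Rightarrow> 'g l2op \<Rightarrow> 'g l2op" where
  "multiplier b T = op_of_kernel (\<lambda>x y. b (x - y) * mc T x y)"

lemma multiplier_matrix_bound:
  assumes b: "b \<in> mats q fourier_algebra" and T: "T \<in> mats m group_vn" and F: "finite F"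
  shows "bil_bounded (({..<q} \<times> {..<m}) \<times> F) (({..<q} \<times> {..<m}) \<times> F)
    (\<lambda>((k,s),x) ((l,t),y). b k l (x - y) * mc (T s t) x y) (fourier_mnorm q b * op_mnorm m T)"
proof -
  note Tb = mats_group_vn_bounded[OF T]
  let ?f = "\<lambda>((k :: nat, s :: nat), x :: 'a). (k, (s, x))"
  have inj: "inj_on ?f A" for A by (auto simp: inj_on_def)
  have im: "?f ` (({..<q} \<times> {..<m}) \<times> F) = {..<q} \<times> ({..<m} \<times> F)" by force
  have "bil_bounded ({..<q} \<times> ({..<m} \<times> F)) ({..<q} \<times> ({..<m} \<times> F))
      (\<lambda>(i,s) (j,t). b i j (snd s - snd t) * (\<lambda>(k,x) (l,y). mc (T k l) x y) s t) (fourier_mnorm q b * op_mnorm m T)"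
    by (rule fourier_schur[OF b _ op_mnorm_truncations[OF Tb, rule_format, OF F] op_mnorm_nonneg[OF Tb]]) (use F in simp)
  then show ?thesis
    unfolding im[symmetric] bil_bounded_image[OF inj inj] by (simp add: case_prod_unfold)
qed

lemma multiplier_group_vn:
  assumes b: "b \<in> fourier_algebra" and T: "T \<in> group_vn"
  shows "multiplier b T \<in> group_vn" and mc_multiplier: "mc (multiplier b T) x y = b (x - y) * mc T x y"
proof -
  define C where "C = fourier_mnorm 1 (\<lambda>_ _. b) * op_mnorm 1 (\<lambda>_ _. T)"
  have b1: "(\<lambda>_ _. b) \<in> mats 1 fourier_algebra" and T1: "(\<lambda>_ _. T) \<in> mats 1 group_vn"
    using b T by (simp_all add: mats_def)
  have C: "C \<ge> 0" unfolding C_def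
    by (intro mult_nonneg_nonneg fourier_mnorm_nonneg[OF b1] op_mnorm_nonneg[OF mats_group_vn_bounded[OF T1]])
  have K: "bil_bounded F F (\<lambda>x y. b (x - y) * mc T x y) C" if F: "finite F" for F
  proof -
    have im: "Pair (0::nat, 0::nat) ` F = ({..<1} \<times> {..<1}) \<times> F" by force
    have inj: "inj_on (Pair (0::nat, 0::nat)) F" by (simp add: inj_on_def)
    show ?thesis
      using multiplier_matrix_bound[OF b1 T1 F, folded C_def]
      unfolding im[symmetric] bil_bounded_image[OF inj inj] by simp
  qed
  have "(x + z) - (y + z) = x - y" for x y z :: 'a
    by (simp add: diff_conv_add_uminus minus_add add.assoc del: add_uminus_conv_diff)
  then show "multiplier b T \<in> group_vn"
    unfolding multiplier_def by (intro op_of_kernel_group_vn[OF K C]) (use T in \<open>simp_all add: group_vn_iff\<close>)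
  show "mc (multiplier b T) x y = b (x - y) * mc T x y"
    unfolding multiplier_def by (rule op_of_kernel(3)[OF K C])
qed

text \<open>The composition of the functional of \<open>a\<close> with the multiplier by
  \<open>b\<close> is ultraweakly continuous: vectors for it are the twists of the vectors of
  \<open>b\<close> by the slices of the vectors of \<open>a\<close>. These are indexed by
  \<open>nat\<close> together with pairs that contain a group element, which is where the
  countability of the group enters.\<close>

lemma fourier_functional_mult:
  fixes a b :: "'g::{group_add,countable} \<Rightarrow> complex"
  assumes a: "a \<in> fourier_algebra" and b: "b \<in> fourier_algebra"
  shows "(\<lambda>x. a x * b x) \<in> fourier_algebra"
    and "T \<in> group_vn \<Longrightarrow> fourier_functional (\<lambda>x. a x * b x) T = fourier_functional a (multiplier b T)"
proof -
  obtain \<xi> \<eta> :: "nat \<times> 'g \<Rightarrow> complex" where r: "\<xi> \<in> ell2" "\<eta> \<in> ell2" "fourier_functional a = vec_functional \<xi> \<eta>"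
    using fourier_functional(1)[OF a] unfolding vn_predual_iff by blast
  obtain \<xi>' \<eta>' :: "nat \<times> 'g \<Rightarrow> complex" where r': "\<xi>' \<in> ell2" "\<eta>' \<in> ell2" "fourier_functional b = vec_functional \<xi>' \<eta>'"
    using fourier_functional(1)[OF b] unfolding vn_predual_iff by blast
  define x e where "x = (\<lambda>n. twist \<xi>' (slice \<xi> n))" and "e = (\<lambda>n. twist \<eta>' (slice \<eta> n))"
  have x: "x n \<in> ell2" "((\<lambda>n. (ell2_norm (x n))\<^sup>2) has_sum (ell2_norm \<xi>)\<^sup>2 * (ell2_norm \<xi>')\<^sup>2) UNIV" for n
    unfolding x_def using twist_ell2[OF r'(1) slice_ell2(1)[OF r(1)]] has_sum_cmult_left[OF has_sum_slice_norm[OF r(1)], of "(ell2_norm \<xi>')\<^sup>2"]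
    by (simp_all add: power_mult_distrib)
  have e: "e n \<in> ell2" "((\<lambda>n. (ell2_norm (e n))\<^sup>2) has_sum (ell2_norm \<eta>)\<^sup>2 * (ell2_norm \<eta>')\<^sup>2) UNIV" for n
    unfolding e_def using twist_ell2[OF r'(2) slice_ell2(1)[OF r(2)]] has_sum_cmult_left[OF has_sum_slice_norm[OF r(2)], of "(ell2_norm \<eta>')\<^sup>2"]
    by (simp_all add: power_mult_distrib)
  define \<phi> where "\<phi> = vec_functional (concat_family x) (concat_family e)"
  have \<phi>: "\<phi> \<in> vn_predual"
    unfolding \<phi>_def by (intro vec_functional_in_predual concat_family_ell2(1)[OF x] concat_family_ell2(1)[OF e])
  have main: "\<phi> T = fourier_functional a (multiplier b T)" if T: "T \<in> group_vn" for T
  proof -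
    note S = multiplier_group_vn[OF b T]
    have "vec_functional (x n) (e n) T = ell2_inner (multiplier b T (slice \<xi> n)) (slice \<eta> n)" for n
      unfolding x_def e_def
      by (rule vec_functional_twist[OF r'(1,2) T S(1) _ slice_ell2(1)[OF r(1)] slice_ell2(1)[OF r(2)]])
         (simp add: S(2) r'(3)[symmetric] fourier_functional(2)[OF b])
    then have "((\<lambda>n. ell2_inner (multiplier b T (slice \<xi> n)) (slice \<eta> n)) has_sum \<phi> T) UNIV"
      using vec_functional_concat[OF x e T] by (simp add: \<phi>_def)
    from has_sum_unique[OF this has_sum_vec_functional[OF S(1) r(1,2)]] show ?thesis by (simp add: r(3))
  qed
  have "\<phi> (left_reg g) = a g * b g" for g
  proof -
    have "multiplier b (left_reg g) = op_scale (b g) (left_reg g)"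
    proof (rule bounded_op_eqI)
      fix u v :: 'g
      show "mc (multiplier b (left_reg g)) u v = mc (op_scale (b g) (left_reg g)) u v"
        by (simp add: mc_multiplier[OF b left_reg_group_vn] mc_op_scale mc_left_reg)
    qed (intro group_vn_bounded multiplier_group_vn b group_vn_scale left_reg_group_vn)+
    then show ?thesis
      using main[OF left_reg_group_vn[of g]]
      by (simp add: predual_op_scale[OF fourier_functional(1)[OF a] left_reg_group_vn] fourier_functional(2)[OF a])
  qed
  note I = fourier_functional_eqI[OF \<phi> this]
  show "(\<lambda>x. a x * b x) \<in> fourier_algebra" by (rule I(1))
  show "T \<in> group_vn \<Longrightarrow> fourier_functional (\<lambda>x. a x * b x) T = fourier_functional a (multiplier b T)"
    unfolding I(2) by (rule main)
qed

text \<open>The factor \<open>b\<close> is moved onto the test matrix by Schur multiplication, which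
  enlarges its norm by at most that of \<open>b\<close>; the result is a test matrix for
  \<open>a\<close>.\<close>

lemma fourier_mult_bound:
  fixes a b :: "('g::{group_add,countable} \<Rightarrow> complex) mat"
  assumes a: "a \<in> mats p fourier_algebra" and b: "b \<in> mats q fourier_algebra"
  shows "fourier_mnorm (p * q) (mat_pair (\<lambda>f g x. f x * g x) q a b) \<le> fourier_mnorm p a * fourier_mnorm q b"
proof -
  let ?C = "fourier_mnorm p a * fourier_mnorm q b"
  have C: "0 \<le> ?C" by (intro mult_nonneg_nonneg fourier_mnorm_nonneg a b)
  have "A.N (p * q) (mat_pair (\<lambda>f g x. f x * g x) q a b) \<le> ?C"
  proof (rule A.pair_norm_le[OF C])
    fix m and T :: "'g l2op mat" assume "(m, T) \<in> vn_ball"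
    then have T: "T \<in> mats m group_vn" "op_mnorm m T \<le> 1" by (auto simp: vn_ball_def)
    define I where "I = {..<q} \<times> {..<m}"
    define Y where "Y = (\<lambda>p p'. multiplier (b (fst p) (fst p')) (T (snd p) (snd p')))"
    have bT: "b (fst p) (fst p') \<in> fourier_algebra" "T (snd p) (snd p') \<in> group_vn" if "p \<in> I" "p' \<in> I" for p p'
      using that b T by (auto simp: I_def mats_def)
    have "bil_bounded ({..<p} \<times> I) ({..<p} \<times> I) (\<lambda>(i,k) (j,l). fourier_functional (a i j) (Y k l)) (fourier_mnorm p a * fourier_mnorm q b)"
    proof (rule fourier_apply[OF a])
      show "finite I" by (simp add: I_def)
      show "Y i j \<in> group_vn" if "i \<in> I" "j \<in> I" for i j
        unfolding Y_def by (intro multiplier_group_vn bT that)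
      show "0 \<le> fourier_mnorm q b" by (rule fourier_mnorm_nonneg[OF b])
      fix F :: "'g set" assume F: "finite F"
      have "bil_bounded (I \<times> F) (I \<times> F) (\<lambda>((k,s),x) ((l,t),y). b k l (x - y) * mc (T s t) x y) (fourier_mnorm q b)"
        using bil_bounded_mono[OF multiplier_matrix_bound[OF b T(1) F] mult_left_le[OF T(2) fourier_mnorm_nonneg[OF b]]]
        by (simp only: I_def)
      then show "bil_bounded (I \<times> F) (I \<times> F) (\<lambda>(i,x) (j,y). mc (Y i j) x y) (fourier_mnorm q b)"
      proof (rule iffD1[OF bil_bounded_cong, rotated])
        fix u v assume "u \<in> I \<times> F" "v \<in> I \<times> F"
        then obtain i x j y where [simp]: "u = (i, x)" "v = (j, y)" and ij: "i \<in> I" "j \<in> I" by auto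
        show "(\<lambda>((k,s),x) ((l,t),y). b k l (x - y) * mc (T s t) x y) u v = (\<lambda>(i,x) (j,y). mc (Y i j) x y) u v"
          by (simp add: Y_def mc_multiplier[OF bT[OF ij]] case_prod_unfold)
      qed
    qed
    then have *: "bil_bounded ({..<p} \<times> I) ({..<p} \<times> I) (\<lambda>(i,k) (j,l). fourier_functional (\<lambda>x. a i j x * b (fst k) (fst l) x) (T (snd k) (snd l))) ?C"
    proof (rule iffD1[OF bil_bounded_cong, rotated])
      fix u v assume "u \<in> {..<p} \<times> I" "v \<in> {..<p} \<times> I"
      then obtain i k j l where [simp]: "u = (i, k)" "v = (j, l)" and ij: "i < p" "j < p" and kl: "k \<in> I" "l \<in> I" by auto
      have aij: "a i j \<in> fourier_algebra" using a ij by (simp add: mats_def)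
      show "(\<lambda>(i,k) (j,l). fourier_functional (a i j) (Y k l)) u v
          = (\<lambda>(i,k) (j,l). fourier_functional (\<lambda>x. a i j x * b (fst k) (fst l) x) (T (snd k) (snd l))) u v"
        by (simp add: Y_def fourier_functional_mult(2)[OF aij bT[OF kl]])
    qed
    let ?f = "\<lambda>(P, s). (P div q, (P mod q, s))"
    have bij: "bij_betw (\<lambda>P. (P div q, P mod q)) {..<p * q} ({..<p} \<times> {..<q})" by (rule bij_betw_div_mod)
    have inj: "inj_on ?f ({..<p * q} \<times> {..<m})"
      using bij by (auto simp: inj_on_def bij_betw_def)
    have im: "?f ` ({..<p * q} \<times> {..<m}) = {..<p} \<times> I"
    proof -
      have "?f ` ({..<p * q} \<times> {..<m}) = (\<lambda>((i, k), s). (i, (k, s))) ` (((\<lambda>P. (P div q, P mod q)) ` {..<p * q}) \<times> {..<m})"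
        by force
      also have "\<dots> = (\<lambda>((i, k), s). (i, (k, s))) ` (({..<p} \<times> {..<q}) \<times> {..<m})"
        by (simp only: bij_betw_imp_surj_on[OF bij])
      also have "\<dots> = {..<p} \<times> I" unfolding I_def by force
      finally show ?thesis .
    qed
    show "pair_bounded fourier_functional (p * q) (mat_pair (\<lambda>f g x. f x * g x) q a b) m T ?C"
      using * unfolding im[symmetric] bil_bounded_image[OF inj inj]
      by (simp add: mat_pair_def case_prod_unfold)
  qed
  then show ?thesis by (simp add: fourier_mnorm_eq_pair_norm)
qed

lemma quantized_banach_algebra_fourier:
  "quantized_banach_algebra (fourier_algebra :: ('g::{group_add,countable} \<Rightarrow> complex) set) fourier_mnorm (\<lambda>f g x. f x * g x)"
proof -
  interpret O: operator_space "fourier_algebra :: ('g \<Rightarrow> complex) set" fourier_mnorm by (rule fourier_operator_space)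
  show ?thesis
  proof
    show "induces_cb (fourier_algebra :: ('g \<Rightarrow> complex) set) fourier_mnorm fourier_algebra fourier_mnorm fourier_algebra fourier_mnorm (\<lambda>f g x. f x * g x)"
    proof (rule induces_cbI[OF fourier_operator_space fourier_operator_space fourier_operator_space, where \<Phi> = "\<lambda>u x. u (x, x)" and C = 1])
      show "fourier_mnorm (p * q) (mat_pair (\<lambda>f g x. f x * g x) q v w) \<le> 1 * fourier_mnorm p v * fourier_mnorm q w"
        if "v \<in> mats p fourier_algebra" "w \<in> mats q fourier_algebra" for p q and v w :: "('g \<Rightarrow> complex) mat"
        using fourier_mult_bound[OF that] by simp
    qed (auto simp: smul_def tens_def fun_eq_iff fourier_functional_mult(1))
  qed (simp add: mult.assoc)
qed

subsection \<open>A Leinert set in the free group\<close>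

text \<open>Cauchy-Schwarz after the modulus of each entry is split into two square roots, one for
  the row vector and one for the column vector.\<close>

lemma bil_bounded_schur_test:
  assumes fin: "finite I" "finite J" and R: "\<And>i. i \<in> I \<Longrightarrow> (\<Sum>j\<in>J. cmod (K i j)) \<le> R" "0 \<le> R"
    and S: "\<And>j. j \<in> J \<Longrightarrow> (\<Sum>i\<in>I. cmod (K i j)) \<le> S" "0 \<le> S"
  shows "bil_bounded I J K (sqrt (R * S))"
  unfolding bil_bounded_def
proof (intro allI)
  fix w z
  let ?a = "\<lambda>(i, j). sqrt (cmod (K i j)) * cmod (w i)" and ?b = "\<lambda>(i, j). sqrt (cmod (K i j)) * cmod (z j)"
  have a: "L2_set ?a (I \<times> J) \<le> sqrt R * L2_set (\<lambda>i. cmod (w i)) I"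
  proof -
    have "(\<Sum>p\<in>I \<times> J. (?a p)\<^sup>2) = (\<Sum>i\<in>I. (\<Sum>j\<in>J. cmod (K i j)) * (cmod (w i))\<^sup>2)"
      by (simp add: sum.cartesian_product' power_mult_distrib sum_distrib_right)
    also have "\<dots> \<le> (\<Sum>i\<in>I. R * (cmod (w i))\<^sup>2)"
      by (intro sum_mono mult_right_mono R) auto
    finally have "L2_set ?a (I \<times> J) \<le> sqrt (\<Sum>i\<in>I. R * (cmod (w i))\<^sup>2)"
      by (simp add: L2_set_def)
    then show ?thesis by (simp add: L2_set_def sum_distrib_left[symmetric] real_sqrt_mult)
  qed
  have b: "L2_set ?b (I \<times> J) \<le> sqrt S * L2_set (\<lambda>j. cmod (z j)) J"
  proof -
    have "(\<Sum>p\<in>I \<times> J. (?b p)\<^sup>2) = (\<Sum>j\<in>J. \<Sum>i\<in>I. cmod (K i j) * (cmod (z j))\<^sup>2)"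
      by (subst sum.swap) (simp add: sum.cartesian_product' power_mult_distrib)
    also have "\<dots> = (\<Sum>j\<in>J. (\<Sum>i\<in>I. cmod (K i j)) * (cmod (z j))\<^sup>2)"
      by (simp add: sum_distrib_right)
    also have "\<dots> \<le> (\<Sum>j\<in>J. S * (cmod (z j))\<^sup>2)"
      by (intro sum_mono mult_right_mono S) auto
    finally have "L2_set ?b (I \<times> J) \<le> sqrt (\<Sum>j\<in>J. S * (cmod (z j))\<^sup>2)"
      by (simp add: L2_set_def)
    then show ?thesis by (simp add: L2_set_def sum_distrib_left[symmetric] real_sqrt_mult)
  qed
  have "cmod (\<Sum>i\<in>I. \<Sum>j\<in>J. w i * K i j * z j) \<le> (\<Sum>i\<in>I. \<Sum>j\<in>J. cmod (w i * K i j * z j))"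
    by (rule order_trans[OF norm_sum sum_mono[OF norm_sum]])
  also have "\<dots> = (\<Sum>p\<in>I \<times> J. \<bar>?a p\<bar> * \<bar>?b p\<bar>)"
  proof -
    have "cmod (w i * K i j * z j) = \<bar>?a (i,j)\<bar> * \<bar>?b (i,j)\<bar>" for i j
    proof -
      have "cmod (K i j) = sqrt (cmod (K i j)) * sqrt (cmod (K i j))" by simp
      then show ?thesis by (simp add: norm_mult abs_mult mult_ac)
    qed
    then show ?thesis by (simp only: sum.cartesian_product')
  qed
  also have "\<dots> \<le> L2_set ?a (I \<times> J) * L2_set ?b (I \<times> J)" by (rule L2_set_mult_ineq)
  also have "\<dots> \<le> (sqrt R * L2_set (\<lambda>i. cmod (w i)) I) * (sqrt S * L2_set (\<lambda>j. cmod (z j)) J)"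
    using R(2) by (intro mult_mono a b) auto
  finally show "cmod (\<Sum>i\<in>I. \<Sum>j\<in>J. w i * K i j * z j)
      \<le> sqrt (R * S) * L2_set (\<lambda>i. cmod (w i)) I * L2_set (\<lambda>j. cmod (z j)) J"
    by (simp add: real_sqrt_mult mult_ac)
qed

lemma sum_if_card: "finite A \<Longrightarrow> (\<Sum>x\<in>A. cmod (if P x then 1 else 0)) = real (card {x \<in> A. P x})"
  by (simp add: if_distrib[of cmod] sum.If_cases Int_def cong: if_cong)

text \<open>Each \<open>x k\<close> maps the complement of \<open>R k\<close> into \<open>Q k\<close>, so that \<open>\<Sum>k. \<lambda>(x k)\<close> splits into an
  operator whose matrix has at most one entry per row and one with at most one entry per column.\<close>

lemma leinert_bound:
  fixes x :: "nat \<Rightarrow> 'g::group_add"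
  assumes I: "finite I" and Q: "\<And>k l. k \<in> I \<Longrightarrow> l \<in> I \<Longrightarrow> k \<noteq> l \<Longrightarrow> Q k \<inter> Q l = {}"
    and R: "\<And>k l. k \<in> I \<Longrightarrow> l \<in> I \<Longrightarrow> k \<noteq> l \<Longrightarrow> R k \<inter> R l = {}"
    and map: "\<And>k y. k \<in> I \<Longrightarrow> y \<notin> R k \<Longrightarrow> x k + y \<in> Q k" and F: "finite F"
  shows "bil_bounded F F (\<lambda>g h. if g - h \<in> x ` I then 1 else 0) (2 * sqrt (real (card I)))"
proof -
  define P1 where "P1 = (\<lambda>g h. \<exists>k\<in>I. g = x k + h \<and> g \<in> Q k)"
  define P2 where "P2 = (\<lambda>g h. g - h \<in> x ` I \<and> \<not> P1 g h)"
  \<comment> \<open>If \<open>h\<close> lay outside \<open>R k\<close>, then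
    \<open>g = x k + h\<close> would be in \<open>Q k\<close> and the entry would belong to
    \<open>P1\<close>.\<close>
  have P2: "\<exists>k\<in>I. g = x k + h \<and> h \<in> R k" if p: "P2 g h" for g h
  proof -
    obtain k where k: "k \<in> I" "g - h = x k" using p by (auto simp: P2_def)
    then have g: "g = x k + h" by (simp add: diff_eq_eq)
    then have "h \<in> R k" using map[OF k(1), of h] k(1) p by (auto simp: P2_def P1_def)
    with g k show ?thesis by blast
  qed
  have one: "card A \<le> 1" if "finite A" "\<And>a b. a \<in> A \<Longrightarrow> b \<in> A \<Longrightarrow> a = b" for A :: "'g set"
    using card_le_Suc0_iff_eq[OF that(1)] that(2) by simp
  have many: "card A \<le> card I" if "A \<subseteq> f ` I" for A :: "'g set" and f
    using card_mono[OF finite_imageI[OF I] that] card_image_le[OF I, of f] by (rule order_trans)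
  have 1: "bil_bounded F F (\<lambda>g h. if P1 g h then 1 else 0) (sqrt (1 * real (card I)))"
  proof (rule bil_bounded_schur_test[OF F F])
    fix g
    have "card {h \<in> F. P1 g h} \<le> 1"
    proof (rule one)
      fix a b assume ab: "a \<in> {h \<in> F. P1 g h}" "b \<in> {h \<in> F. P1 g h}"
      then obtain k l where kl: "k \<in> I" "g = x k + a" "g \<in> Q k" "l \<in> I" "g = x l + b" "g \<in> Q l"
        by (auto simp: P1_def)
      have "k = l"
      proof (rule ccontr)
        assume "k \<noteq> l"
        from Q[OF kl(1,4) this] kl(3,6) show False by blast
      qed
      then have "x k + a = x k + b" using kl(2,5) by simp
      then show "a = b" by simp
    qed (use F in simp)
    then show "(\<Sum>h\<in>F. cmod (if P1 g h then 1 else 0)) \<le> 1" unfolding sum_if_card[OF F] by simp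
  next
    fix h
    have "card {g \<in> F. P1 g h} \<le> card I" by (rule many[of _ "\<lambda>k. x k + h"]) (auto simp: P1_def)
    then show "(\<Sum>g\<in>F. cmod (if P1 g h then 1 else 0)) \<le> real (card I)" unfolding sum_if_card[OF F] by simp
  qed auto
  have 2: "bil_bounded F F (\<lambda>g h. if P2 g h then 1 else 0) (sqrt (real (card I) * 1))"
  proof (rule bil_bounded_schur_test[OF F F])
    fix h
    have "card {g \<in> F. P2 g h} \<le> 1"
    proof (rule one)
      fix a b assume ab: "a \<in> {g \<in> F. P2 g h}" "b \<in> {g \<in> F. P2 g h}"
      then obtain k l where kl: "k \<in> I" "a = x k + h" "h \<in> R k" "l \<in> I" "b = x l + h" "h \<in> R l"
        using P2[of a h] P2[of b h] by blast
      have "k = l"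
      proof (rule ccontr)
        assume "k \<noteq> l"
        from R[OF kl(1,4) this] kl(3,6) show False by blast
      qed
      then show "a = b" using kl(2,5) by simp
    qed (use F in simp)
    then show "(\<Sum>g\<in>F. cmod (if P2 g h then 1 else 0)) \<le> 1" unfolding sum_if_card[OF F] by simp
  next
    fix g
    have "card {h \<in> F. P2 g h} \<le> card I"
    proof (rule many[of _ "\<lambda>k. - x k + g"])
      show "{h \<in> F. P2 g h} \<subseteq> (\<lambda>k. - x k + g) ` I"
        using P2 by (auto simp: image_iff add.assoc[symmetric]) (metis add_minus_cancel minus_add_cancel)
    qed
    then show "(\<Sum>h\<in>F. cmod (if P2 g h then 1 else 0)) \<le> real (card I)" unfolding sum_if_card[OF F] by simp
  qed auto
  have split: "(if g - h \<in> x ` I then 1 else 0) = (if P1 g h then 1 else 0) + (if P2 g h then 1 else (0::complex))" for g h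
  proof -
    have "P1 g h \<Longrightarrow> g - h \<in> x ` I" by (auto simp: P1_def)
    then show ?thesis by (auto simp: P2_def)
  qed
  show ?thesis unfolding split
    using bil_bounded_add[OF 1 2] by simp
qed

section \<open>Words in the free group and the blocks\<close>

instance free_group :: (countable) countable
  by (rule countable_classI[of "\<lambda>x. to_nat (Rep_free_group x)"]) (simp add: Rep_free_group_inject)

definition gen_a :: F2 where "gen_a = Abs_free_group [(True, True)]"
definition gen_b :: F2 where "gen_b = Abs_free_group [(False, True)]"

lemma Rep_gen: "Rep_free_group gen_a = [(True, True)]" "Rep_free_group gen_b = [(False, True)]"
  by (simp_all add: gen_a_def gen_b_def Abs_free_group_inverse)

fun a_pow :: "nat \<Rightarrow> F2" where
  "a_pow 0 = 0"
| "a_pow (Suc k) = gen_a + a_pow k"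

definition starts_b :: "bool \<Rightarrow> F2 set" where
  "starts_b s = {g. Rep_free_group g \<noteq> [] \<and> hd (Rep_free_group g) = (False, s)}"

lemma Rep_a_pow_plus:
  assumes "g \<in> starts_b s"
  shows "Rep_free_group (a_pow k + g) = replicate k (True, True) @ Rep_free_group g"
proof (induction k)
  case (Suc k)
  obtain w where w: "Rep_free_group g = (False, s) # w"
    using assms by (cases "Rep_free_group g") (auto simp: starts_b_def)
  have "Rep_free_group (a_pow (Suc k) + g) = cons_cancel (True, True) (Rep_free_group (a_pow k + g))"
    by (simp add: add.assoc Rep_free_group_plus[of gen_a] Rep_gen word_mult_def)
  also have "\<dots> = (True, True) # Rep_free_group (a_pow k + g)"
    unfolding Suc by (cases k) (auto simp: w inv_letter_def)
  finally show ?case by (simp add: Suc)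
qed simp

lemma a_pow_plus_notin:
  assumes "g \<in> starts_b s" "k > 0"
  shows "a_pow k + g \<notin> starts_b s'"
  using Rep_a_pow_plus[OF assms(1), of k] assms(2) by (cases k) (auto simp: starts_b_def)

lemma a_pow_add: "a_pow (k + l) = a_pow k + a_pow l"
  by (induction k) (auto simp: add.assoc)

text \<open>Elements of such a set are reduced words with exactly \<open>k\<close> letters
  \<open>gen_a\<close> in front of a letter \<open>gen_b\<close> or its inverse, so \<open>k\<close>
  can be read off from the word.\<close>

lemma a_pow_starts_b_disjoint:
  assumes "k \<noteq> l"
  shows "(\<lambda>g. a_pow k + g) ` starts_b s \<inter> (\<lambda>g. a_pow l + g) ` starts_b s = {}"
proof -
  have *: False if kl: "k < l" and g: "g \<in> starts_b s" "h \<in> starts_b s" "a_pow k + g = a_pow l + h" for k l g h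
  proof -
    have "a_pow l = a_pow k + a_pow (l - k)" using kl by (simp flip: a_pow_add)
    then have "g = a_pow (l - k) + h" using g(3) by (simp add: add.assoc)
    with a_pow_plus_notin[OF g(2), of "l - k" s] kl g(1) show False by simp
  qed
  show ?thesis using assms *[of k l] *[of l k] by (cases k l rule: linorder_cases) (auto simp: eq_commute)
qed

lemma minus_a_pow_notin: "- a_pow k \<notin> starts_b s"
proof
  assume "- a_pow k \<in> starts_b s"
  from Rep_a_pow_plus[OF this, of k] this show False by (simp add: Rep_free_group_zero starts_b_def)
qed

lemma gen_b_plus:
  assumes "y \<notin> starts_b False"
  shows "gen_b + y \<in> starts_b True"
proof (cases "Rep_free_group y")
  case Nil
  then show ?thesis by (simp add: starts_b_def Rep_free_group_plus Rep_gen word_mult_def)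
next
  case (Cons l w)
  then have "l \<noteq> (False, False)" using assms by (auto simp: starts_b_def)
  with Cons show ?thesis by (simp add: starts_b_def Rep_free_group_plus Rep_gen word_mult_def inv_letter_def)
qed

text \<open>The conjugates of \<open>gen_b\<close> by powers of \<open>gen_a\<close>, the classical
  free generators of an infinitely generated free subgroup. Of this only the ping-pong sets are
  needed: words starting with \<open>gen_b\<close>, or with its inverse, translated by
  \<open>a_pow k\<close>.\<close>

definition conj_b :: "nat \<Rightarrow> F2" where
  "conj_b k = a_pow k + (gen_b + - a_pow k)"

lemma conj_b_in: "conj_b k \<in> (\<lambda>g. a_pow k + g) ` starts_b True"
  unfolding conj_b_def using gen_b_plus[OF minus_a_pow_notin] by blast

lemma inj_conj_b: "inj conj_b"
proof (rule injI)
  fix k l assume "conj_b k = conj_b l"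
  then show "k = l" using conj_b_in[of k] conj_b_in[of l] a_pow_starts_b_disjoint[of k l True] by auto
qed

lemma conj_b_nonzero: "conj_b k \<noteq> 0"
proof
  assume "conj_b k = 0"
  then obtain g where g: "g \<in> starts_b True" "a_pow k + g = 0" using conj_b_in[of k] by auto
  from Rep_a_pow_plus[OF g(1), of k] g show False by (simp add: Rep_free_group_zero starts_b_def)
qed

lemma conj_b_leinert:
  assumes "finite I" "finite F"
  shows "bil_bounded F F (\<lambda>g h. if g - h \<in> conj_b ` I then 1 else 0) (2 * sqrt (real (card I)))"
proof (rule leinert_bound[OF assms(1) _ _ _ assms(2)])
  fix k l :: nat assume "k \<noteq> l"
  then show "(\<lambda>g. a_pow k + g) ` starts_b True \<inter> (\<lambda>g. a_pow l + g) ` starts_b True = {}"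
    and "(\<lambda>g. a_pow k + g) ` starts_b False \<inter> (\<lambda>g. a_pow l + g) ` starts_b False = {}"
    by (rule a_pow_starts_b_disjoint)+
next
  fix k y assume y: "y \<notin> (\<lambda>g. a_pow k + g) ` starts_b False"
  have "- a_pow k + y \<notin> starts_b False"
  proof
    assume "- a_pow k + y \<in> starts_b False"
    then have "a_pow k + (- a_pow k + y) \<in> (\<lambda>g. a_pow k + g) ` starts_b False" by (rule imageI)
    with y show False by simp
  qed
  from imageI[OF gen_b_plus[OF this], of "\<lambda>g. a_pow k + g"]
  show "conj_b k + y \<in> (\<lambda>g. a_pow k + g) ` starts_b True" by (simp add: conj_b_def add.assoc del: add_uminus_conv_diff)
qed

text \<open>The pairing function supplies disjoint sets of indices for different \<open>r\<close>.
  The size is a square, so that the norm of the indicator comes out as the power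
  \<open>4 ^ r\<close> up to the factor 2.\<close>

definition block :: "nat \<Rightarrow> F2 set" where
  "block r = conj_b ` ((\<lambda>j. prod_encode (r, j)) ` {..<16 ^ r})"

lemma block_props:
  shows "finite (block r)" "card (block r) = 16 ^ r" "0 \<notin> block r" "r \<noteq> s \<Longrightarrow> block r \<inter> block s = {}"
    and "finite F \<Longrightarrow> bil_bounded F F (\<lambda>g h. if g - h \<in> block r then 1 else 0) (2 * 4 ^ r)"
proof -
  have c: "card ((\<lambda>j. prod_encode (r, j)) ` {..<16 ^ r}) = 16 ^ r"
    by (subst card_image) (auto simp: inj_on_def)
  show "finite (block r)" by (simp add: block_def)
  show "card (block r) = 16 ^ r"
    unfolding block_def using c by (subst card_image) (auto intro: inj_on_subset[OF inj_conj_b])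
  show "0 \<notin> block r" using conj_b_nonzero by (auto simp: block_def)
  show "block r \<inter> block s = {}" if "r \<noteq> s"
    using that inj_conj_b by (auto simp: block_def inj_eq)
  have "sqrt (real (16 ^ r)) = 4 ^ r"
    by (rule real_sqrt_unique) (simp_all add: power2_eq_square flip: power_mult_distrib)
  then show "bil_bounded F F (\<lambda>g h. if g - h \<in> block r then 1 else 0) (2 * 4 ^ r)" if "finite F"
    unfolding block_def using conj_b_leinert[OF _ that, of "(\<lambda>j. prod_encode (r, j)) ` {..<16 ^ r}"] c by simp
qed

subsection \<open>Norms of matrices of functions on a product group\<close>

text \<open>\<open>fun_bounded A y C\<close>: the matrix, indexed by \<open>A\<close>, of left convolution operators by the
  functions \<open>y i j\<close> has norm at most \<open>C\<close>.\<close>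

definition fun_bounded :: "'k set \<Rightarrow> ('k \<Rightarrow> 'k \<Rightarrow> 'h::group_add \<Rightarrow> complex) \<Rightarrow> real \<Rightarrow> bool" where
  "fun_bounded A y C \<longleftrightarrow> (\<forall>F. finite F \<longrightarrow> bil_bounded (A \<times> F) (A \<times> F) (\<lambda>(i,s) (j,t). y i j (s - t)) C)"

lemma fun_boundedD:
  "fun_bounded A y C \<Longrightarrow> finite F \<Longrightarrow> bil_bounded (A \<times> F) (A \<times> F) (\<lambda>(i,s) (j,t). y i j (s - t)) C"
  by (simp add: fun_bounded_def)

lemma fun_bounded_mono: "fun_bounded A y C \<Longrightarrow> C \<le> C' \<Longrightarrow> fun_bounded A y C'"
  unfolding fun_bounded_def by (blast intro: bil_bounded_mono)

lemma fun_bounded_cong: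
  assumes "\<And>i j h. i \<in> A \<Longrightarrow> j \<in> A \<Longrightarrow> y i j h = y' i j h"
  shows "fun_bounded A y C \<longleftrightarrow> fun_bounded A y' C"
proof -
  have "bil_bounded (A \<times> F) (A \<times> F) (\<lambda>(i,s) (j,t). y i j (s - t)) C
      \<longleftrightarrow> bil_bounded (A \<times> F) (A \<times> F) (\<lambda>(i,s) (j,t). y' i j (s - t)) C" for F
    by (rule bil_bounded_cong) (use assms in auto)
  then show ?thesis by (simp add: fun_bounded_def)
qed

lemma fun_bounded_image:
  fixes f :: "'l \<Rightarrow> 'k" and y :: "'k \<Rightarrow> 'k \<Rightarrow> 'h::group_add \<Rightarrow> complex"
  assumes f: "inj_on f A"
  shows "fun_bounded (f ` A) y C \<longleftrightarrow> fun_bounded A (\<lambda>i j. y (f i) (f j)) C"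
proof -
  have inj: "inj_on (map_prod f id) (A \<times> F)" for F :: "'h set" using f by (auto simp: inj_on_def)
  have im: "map_prod f id ` (A \<times> F) = f ` A \<times> F" for F :: "'h set" by (auto simp: map_prod_surj_on)
  show ?thesis
    unfolding fun_bounded_def im[symmetric] bil_bounded_image[OF inj inj] by (simp add: case_prod_unfold)
qed

lemma fun_bounded_add:
  assumes "fun_bounded A y C" "fun_bounded A y' C'"
  shows "fun_bounded A (\<lambda>i j h. y i j h + y' i j h) (C + C')"
  unfolding fun_bounded_def
proof (intro allI impI)
  fix F :: "'b set" assume F: "finite F"
  show "bil_bounded (A \<times> F) (A \<times> F) (\<lambda>(i,s) (j,t). y i j (s - t) + y' i j (s - t)) (C + C')"
    using bil_bounded_add[OF fun_boundedD[OF assms(1) F] fun_boundedD[OF assms(2) F]]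
    by (simp add: case_prod_unfold)
qed

lemma fun_bounded_scale:
  assumes "fun_bounded A y C"
  shows "fun_bounded A (\<lambda>i j h. c * y i j h) (cmod c * C)"
  unfolding fun_bounded_def
proof (intro allI impI)
  fix F :: "'b set" assume F: "finite F"
  show "bil_bounded (A \<times> F) (A \<times> F) (\<lambda>(i,s) (j,t). c * y i j (s - t)) (cmod c * C)"
    using bil_bounded_scale[OF fun_boundedD[OF assms F], of c] by (simp add: case_prod_unfold)
qed

lemma fun_bounded_zero: "0 \<le> C \<Longrightarrow> fun_bounded A (\<lambda>_ _ _. 0) C"
  by (simp add: fun_bounded_def case_prod_unfold bil_bounded_zero)

lemma fun_bounded_reindex_hom:
  fixes f :: "'g::group_add \<Rightarrow> 'h::group_add" and y :: "'k \<Rightarrow> 'k \<Rightarrow> 'h \<Rightarrow> complex"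
  assumes inj: "inj f" and hom: "\<And>s t. f (s - t) = f s - f t" and y: "fun_bounded A y C"
  shows "fun_bounded A (\<lambda>i j h. y i j (f h)) C"
  unfolding fun_bounded_def
proof (intro allI impI)
  fix F :: "'g set" assume F: "finite F"
  have i: "inj_on (map_prod id f) (A \<times> F)" using inj by (auto simp: inj_on_def)
  have im: "map_prod id f ` (A \<times> F) = A \<times> f ` F" by (auto simp: map_prod_surj_on)
  from fun_boundedD[OF y finite_imageI[OF F, of f]]
  show "bil_bounded (A \<times> F) (A \<times> F) (\<lambda>(i,s) (j,t). y i j (f (s - t))) C"
    unfolding im[symmetric] bil_bounded_image[OF i i] by (simp add: case_prod_unfold hom)
qed

lemma fun_bounded_value:
  assumes y: "fun_bounded A y C" and A: "finite A" and C: "0 \<le> C"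
  shows "bil_bounded A A (\<lambda>i j. y i j h) C"
proof -
  have inj: "inj_on (\<lambda>i. (i, h)) A" "inj_on (\<lambda>i. (i, 0)) A" by (auto simp: inj_on_def)
  have "bil_bounded ((\<lambda>i. (i, h)) ` A) ((\<lambda>i. (i, 0)) ` A) (\<lambda>(i,s) (j,t). y i j (s - t)) C"
    by (rule bil_bounded_subset[OF fun_boundedD[OF y, of "{h, 0}"]]) (use A in auto)
  then show ?thesis by (simp add: bil_bounded_image[OF inj])
qed

text \<open>An instance of \<open>fourier_schur\<close>, because \<open>\<pi>\<close> turns
  differences into differences. With the two coordinate projections for \<open>\<pi>\<close> it
  handles the action on edges, and the half of the vertices on which an action is
  multiplication.\<close>

lemma fun_bounded_mult_hom:
  fixes y :: "'k \<Rightarrow> 'k \<Rightarrow> 'h::group_add \<Rightarrow> complex" and \<pi> :: "'h \<Rightarrow> 'g::group_add"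
  assumes a: "a \<in> mats p fourier_algebra" and A: "finite A" and y: "fun_bounded A y C" and C: "0 \<le> C"
    and \<pi>: "\<And>s t. \<pi> (s - t) = \<pi> s - \<pi> t"
  shows "fun_bounded ({..<p} \<times> A) (\<lambda>(i,k) (j,l) h. a i j (\<pi> h) * y k l h) (fourier_mnorm p a * C)"
  unfolding fun_bounded_def
proof (intro allI impI)
  fix F :: "'h set" assume F: "finite F"
  let ?f = "\<lambda>((i :: nat, k :: 'k), s :: 'h). (i, (k, s))"
  have inj: "inj_on ?f S" for S by (auto simp: inj_on_def)
  have im: "?f ` (({..<p} \<times> A) \<times> F) = {..<p} \<times> (A \<times> F)" by force
  have "bil_bounded ({..<p} \<times> (A \<times> F)) ({..<p} \<times> (A \<times> F))
      (\<lambda>(i,s) (j,t). a i j (\<pi> (snd s) - \<pi> (snd t)) * (\<lambda>(i,s) (j,t). y i j (s - t)) s t) (fourier_mnorm p a * C)"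
    by (rule fourier_schur[OF a _ fun_boundedD[OF y F] C]) (use A F in simp)
  then show "bil_bounded (({..<p} \<times> A) \<times> F) (({..<p} \<times> A) \<times> F)
     (\<lambda>(i,s) (j,t). (\<lambda>(i,k) (j,l) h. a i j (\<pi> h) * y k l h) i j (s - t)) (fourier_mnorm p a * C)"
    unfolding im[symmetric] bil_bounded_image[OF inj inj] by (simp add: case_prod_unfold \<pi>)
qed

text \<open>The second coordinate is paired with \<open>a\<close> by \<open>fourier_slice\<close>,
  while the first is absorbed into the index set. The result is placed at \<open>h = 0\<close>,
  which means convolution in the first coordinate tensored with the identity in the second.\<close>

lemma fun_bounded_slice_snd:
  fixes y :: "'k \<Rightarrow> 'k \<Rightarrow> 'f::group_add \<times> 'g::group_add \<Rightarrow> complex"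
  assumes a: "a \<in> mats p fourier_algebra" and A: "finite A" and y: "fun_bounded A y C" and C: "0 \<le> C"
    and H: "finite H" and supp: "\<And>k l g h. k \<in> A \<Longrightarrow> l \<in> A \<Longrightarrow> h \<notin> H \<Longrightarrow> y k l (g, h) = 0"
  shows "fun_bounded ({..<p} \<times> A) (\<lambda>(i,k) (j,l) (g,h). if h = (0 :: 'g) then \<Sum>h'\<in>H. a i j h' * y k l (g, h') else 0)
    (fourier_mnorm p a * C)"
  unfolding fun_bounded_def
proof (intro allI impI)
  fix F :: "('f \<times> 'g) set" assume F: "finite F"
  define S T where "S = fst ` F" and "T = snd ` F"
  have fin: "finite S" "finite T" using F by (auto simp: S_def T_def)
  have FST: "F \<subseteq> S \<times> T" by (force simp: S_def T_def)
  let ?I = "A \<times> S"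
  have "bil_bounded ({..<p} \<times> ?I) ({..<p} \<times> ?I)
      (\<lambda>(i,s) (j,t). \<Sum>h\<in>H. a i j h * (\<lambda>s t h. y (fst s) (fst t) (snd s - snd t, h)) s t h) (fourier_mnorm p a * C)"
  proof (rule fourier_slice[OF a _ H _ C])
    show "finite ?I" using A fin by simp
    show "y (fst s) (fst t) (snd s - snd t, h) = 0" if "s \<in> ?I" "t \<in> ?I" "h \<notin> H" for s t h
      using that by (intro supp) auto
    fix F' :: "'g set" assume F': "finite F'"
    let ?f = "\<lambda>((k :: 'k, g :: 'f), x :: 'g). (k, (g, x))"
    have inj: "inj_on ?f X" for X by (auto simp: inj_on_def)
    have im: "?f ` ((A \<times> S) \<times> F') = A \<times> (S \<times> F')" by force
    have "finite (S \<times> F')" using fin F' by simp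
    from fun_boundedD[OF y this]
    show "bil_bounded (?I \<times> F') (?I \<times> F') (\<lambda>(s,x) (t,y'). y (fst s) (fst t) (snd s - snd t, x - y')) C"
      unfolding im[symmetric] bil_bounded_image[OF inj inj] by (simp add: case_prod_unfold)
  qed
  \<comment> \<open>The second coordinate is restored by tensoring with the identity; equality of
    these coordinates is the condition that their difference is 0.\<close>
  then have "bil_bounded (({..<p} \<times> ?I) \<times> T) (({..<p} \<times> ?I) \<times> T)
     (\<lambda>(i,s) (j,t). if s = t then (\<lambda>(i,s) (j,t). \<Sum>h\<in>H. a i j h * (\<lambda>s t h. y (fst s) (fst t) (snd s - snd t, h)) s t h) i j else 0) (fourier_mnorm p a * C)"
    by (rule bil_bounded_tensor_id) (use A fin fourier_mnorm_nonneg[OF a] C in auto)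
  note * = this
  let ?f = "\<lambda>((i :: nat, k :: 'k), g :: 'f, h :: 'g). ((i, (k, g)), h)"
  have inj: "inj_on ?f X" for X by (auto simp: inj_on_def)
  have im: "?f ` (({..<p} \<times> A) \<times> F) \<subseteq> ({..<p} \<times> ?I) \<times> T" using FST by auto
  have fin': "finite (({..<p} \<times> ?I) \<times> T)" using A fin by simp
  from bil_bounded_subset[OF * im im fin' fin']
  show "bil_bounded (({..<p} \<times> A) \<times> F) (({..<p} \<times> A) \<times> F)
     (\<lambda>(i,s) (j,t). (\<lambda>(i,k) (j,l) (g,h). if h = (0 :: 'g) then \<Sum>h'\<in>H. a i j h' * y k l (g, h') else 0) i j (s - t)) (fourier_mnorm p a * C)"
    unfolding bil_bounded_image[OF inj inj] by (simp add: case_prod_unfold cong: if_cong)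
qed

lemma fun_bounded_slice_fst:
  fixes y :: "'k \<Rightarrow> 'k \<Rightarrow> 'g::group_add \<times> 'f::group_add \<Rightarrow> complex"
  assumes a: "a \<in> mats p fourier_algebra" and A: "finite A" and y: "fun_bounded A y C" and C: "0 \<le> C"
    and H: "finite H" and supp: "\<And>k l g h. k \<in> A \<Longrightarrow> l \<in> A \<Longrightarrow> g \<notin> H \<Longrightarrow> y k l (g, h) = 0"
  shows "fun_bounded ({..<p} \<times> A) (\<lambda>(i,k) (j,l) (g,h). if g = (0 :: 'g) then \<Sum>g'\<in>H. a i j g' * y k l (g', h) else 0)
    (fourier_mnorm p a * C)"
proof -
  have sw1: "fun_bounded A (\<lambda>i j h. y i j (prod.swap h)) C"
    by (rule fun_bounded_reindex_hom[OF _ _ y]) (auto simp: prod_eq_iff)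
  note s = fun_bounded_slice_snd[OF a A sw1 C H]
  have "fun_bounded ({..<p} \<times> A) (\<lambda>(i,k) (j,l) (g,h). if h = (0 :: 'g) then \<Sum>h'\<in>H. a i j h' * y k l (prod.swap (g, h')) else 0) (fourier_mnorm p a * C)"
    by (rule s) (simp add: supp)
  from fun_bounded_reindex_hom[OF _ _ this, of prod.swap]
  show ?thesis by (simp add: case_prod_unfold prod_eq_iff cong: if_cong)
qed

subsection \<open>The bimodule\<close>

text \<open>Exactly one of \<open>r\<close> and \<open>r + 1\<close> is even. Edges between the two
  blocks are always written with the vertex of the even block first.\<close>

definition fst_index :: "nat \<Rightarrow> nat" where "fst_index r = (if even r then r else Suc r)"
definition snd_index :: "nat \<Rightarrow> nat" where "snd_index r = (if even r then Suc r else r)"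

text \<open>\<open>piece (False, r)\<close> are the vertices in the block \<open>r\<close>, which lie in the first copy of the group
  for even and in the second one for odd \<open>r\<close>; \<open>piece (True, r)\<close> are the edges between the blocks
  \<open>r\<close> and \<open>r + 1\<close>.\<close>

fun piece :: "bool \<times> nat \<Rightarrow> (F2 \<times> F2) set" where
  "piece (False, r) = (if even r then block r \<times> {0} else {0} \<times> block r)"
| "piece (True, r) = block (fst_index r) \<times> block (snd_index r)"

lemma block_unique: "g \<in> block r \<Longrightarrow> g \<in> block s \<Longrightarrow> r = s"
  using block_props(4)[of r s] by auto

lemma index_inj: "fst_index r = fst_index s \<Longrightarrow> snd_index r = snd_index s \<Longrightarrow> r = s"
  by (auto simp: fst_index_def snd_index_def split: if_splits)

lemma piece_unique: "h \<in> piece b \<Longrightarrow> h \<in> piece b' \<Longrightarrow> b = b'"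
proof -
  assume *: "h \<in> piece b" "h \<in> piece b'"
  obtain c r c' r' where [simp]: "b = (c, r)" "b' = (c', r')" by (cases b; cases b')
  show "b = b'"
    using * block_props(3) block_unique index_inj[of r r']
    by (cases c; cases c') (auto split: if_splits)
qed

lemma zero_notin_piece: "0 \<notin> piece b"
  using block_props(3) by (cases b; cases "fst b") (auto simp: zero_prod_def split: if_splits)

text \<open>The group \<open>F2 \<times> F2\<close> is embedded into \<open>nat \<Rightarrow> complex\<close>, on which the functions in the module
  have to be defined.\<close>

definition enc :: "F2 \<times> F2 \<Rightarrow> nat \<Rightarrow> complex" where
  "enc h = (\<lambda>_. of_nat (to_nat h))"

lemma inj_enc: "inj enc"
  by (auto simp: inj_def enc_def fun_eq_iff)

definition ext :: "(F2 \<times> F2 \<Rightarrow> complex) \<Rightarrow> (nat \<Rightarrow> complex) \<Rightarrow> complex" where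
  "ext y = (\<lambda>i. if i \<in> range enc then y (inv enc i) else 0)"

lemma ext_enc [simp]: "ext y (enc h) = y h"
  by (simp add: ext_def inv_f_f[OF inj_enc])

definition restr :: "bool \<times> nat \<Rightarrow> ((nat \<Rightarrow> complex) \<Rightarrow> complex) \<Rightarrow> F2 \<times> F2 \<Rightarrow> complex" where
  "restr b x = (\<lambda>h. if h \<in> piece b then x (enc h) else 0)"

definition weight :: "bool \<times> nat \<Rightarrow> complex" where "weight b = 2 ^ snd b"

lemma cmod_weight: "cmod (weight b) = 2 ^ snd b"
  by (simp add: weight_def norm_power)

definition piece_pairing :: "((nat \<Rightarrow> complex) \<Rightarrow> complex) \<Rightarrow> (bool \<times> nat) \<times> (F2 \<times> F2) \<Rightarrow> complex" where
  "piece_pairing x = (\<lambda>(b, h). weight b * restr b x h)"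

text \<open>An injective \<open>F\<close> enumerates a finite set of group elements. Testing a
  function against the differences gives the finite truncation of its left convolution operator on
  that set, so the pairing norm is the weighted convolution norm of a piece.\<close>

definition piece_tests :: "(nat \<times> ((bool \<times> nat) \<times> (F2 \<times> F2)) mat) set" where
  "piece_tests = {(m, \<lambda>k l. (b, F k - F l)) | m b F. inj_on F {..<m}}"

lemma piece_testsI: "inj_on F {..<m} \<Longrightarrow> (m, \<lambda>k l. (b, F k - F l)) \<in> piece_tests"
  unfolding piece_tests_def mem_Collect_eq by (rule exI[of _ m], rule exI[of _ b], rule exI[of _ F]) (rule conjI[OF refl])

abbreviation xnorm :: "nat \<Rightarrow> ((nat \<Rightarrow> complex) \<Rightarrow> complex) mat \<Rightarrow> real" where
  "xnorm \<equiv> pair_norm piece_pairing piece_tests"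

abbreviation pieces_bounded :: "nat \<Rightarrow> ((nat \<Rightarrow> complex) \<Rightarrow> complex) mat \<Rightarrow> real \<Rightarrow> bool" where
  "pieces_bounded n x C \<equiv> (\<forall>b. fun_bounded {..<n} (\<lambda>i j h. weight b * restr b (x i j) h) C)"

text \<open>A common bound for all pieces is required but no decay. This admits
  \<open>piecewise even_coeff\<close> and \<open>piecewise odd_coeff\<close>, which have infinitely
  many nonzero pieces and norms that the estimates only keep bounded.\<close>

definition xspace :: "((nat \<Rightarrow> complex) \<Rightarrow> complex) set" where
  "xspace = {x. (\<forall>i. i \<notin> enc ` (\<Union>b. piece b) \<longrightarrow> x i = 0) \<and> (\<exists>C\<ge>0. pieces_bounded 1 (\<lambda>_ _. x) C)}"

lemma restr_linear: "restr b (x + y) h = restr b x h + restr b y h" "restr b (smul c x) h = c * restr b x h"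
  by (auto simp: restr_def smul_def)

lemma pair_bounded_iff_pieces:
  "(\<forall>(m, \<tau>)\<in>piece_tests. pair_bounded piece_pairing n x m \<tau> C) \<longleftrightarrow> pieces_bounded n x C"
proof
  assume *: "\<forall>(m, \<tau>)\<in>piece_tests. pair_bounded piece_pairing n x m \<tau> C"
  show "pieces_bounded n x C"
    unfolding fun_bounded_def
  proof (intro allI impI)
    fix b :: "bool \<times> nat" and F :: "(F2 \<times> F2) set" assume F: "finite F"
    obtain f where f: "bij_betw f {..<card F} F"
      using ex_bij_betw_nat_finite[OF F] by (auto simp: atLeast0LessThan)
    then have inj: "inj_on f {..<card F}" and im: "f ` {..<card F} = F" by (auto simp: bij_betw_def)
    have "(card F, \<lambda>k l. (b, f k - f l)) \<in> piece_tests" by (rule piece_testsI[OF inj])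
    with * have "pair_bounded piece_pairing n x (card F) (\<lambda>k l. (b, f k - f l)) C" by auto
    moreover have "inj_on (map_prod id f) ({..<n} \<times> {..<card F})" using inj by (auto simp: inj_on_def)
    moreover have "map_prod id f ` ({..<n} \<times> {..<card F}) = {..<n} \<times> F" using im by (auto simp: map_prod_surj_on)
    ultimately show "bil_bounded ({..<n} \<times> F) ({..<n} \<times> F) (\<lambda>(i,s) (j,t). weight b * restr b (x i j) (s - t)) C"
      using bil_bounded_image[of "map_prod id f" "{..<n} \<times> {..<card F}" "map_prod id f" "{..<n} \<times> {..<card F}"
          "\<lambda>(i,s) (j,t). weight b * restr b (x i j) (s - t)" C]
      by (simp add: case_prod_unfold piece_pairing_def)
  qed
next
  assume *: "pieces_bounded n x C"
  show "\<forall>(m, \<tau>)\<in>piece_tests. pair_bounded piece_pairing n x m \<tau> C"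
  proof safe
    fix m \<tau> assume "(m, \<tau>) \<in> piece_tests"
    then obtain b F where inj: "inj_on F {..<m}" and t: "\<tau> = (\<lambda>k l. (b, F k - F l))" by (auto simp: piece_tests_def)
    have "bil_bounded ({..<n} \<times> F ` {..<m}) ({..<n} \<times> F ` {..<m}) (\<lambda>(i,s) (j,t). weight b * restr b (x i j) (s - t)) C"
      by (rule fun_boundedD[OF *[rule_format]]) simp
    moreover have "inj_on (map_prod id F) ({..<n} \<times> {..<m})" using inj by (auto simp: inj_on_def)
    moreover have "map_prod id F ` ({..<n} \<times> {..<m}) = {..<n} \<times> F ` {..<m}" by (auto simp: map_prod_surj_on)
    ultimately show "pair_bounded piece_pairing n x m \<tau> C"
      using bil_bounded_image[of "map_prod id F" "{..<n} \<times> {..<m}" "map_prod id F" "{..<n} \<times> {..<m}"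
          "\<lambda>(i,s) (j,t). weight b * restr b (x i j) (s - t)" C]
      by (simp add: case_prod_unfold piece_pairing_def t)
  qed
qed

lemma pair_bounded_1_iff: "pair_bounded B 1 (\<lambda>_ _. u) m \<tau> C \<longleftrightarrow> bil_bounded {..<m} {..<m} (\<lambda>k l. B u (\<tau> k l)) C"
proof -
  have "{..<1::nat} \<times> {..<m} = (\<lambda>k. (0, k)) ` {..<m}" by auto
  then show ?thesis by (simp add: bil_bounded_image inj_on_def)
qed

interpretation X: pairing_space xspace piece_pairing piece_tests
proof
  show "cfun.subspace xspace"
  proof (rule cfun.subspaceI)
    have "restr b 0 h = 0" for b h by (simp add: restr_def)
    then have "\<exists>C\<ge>0. pieces_bounded 1 (\<lambda>_ _. 0) C" using fun_bounded_zero[of 0] by (intro exI[of _ 0]) simp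
    then show "0 \<in> xspace" by (simp only: xspace_def mem_Collect_eq zero_fun_apply simp_thms)
  next
    fix x y assume x: "x \<in> xspace" and y: "y \<in> xspace"
    then obtain C D where C: "C \<ge> 0" "pieces_bounded 1 (\<lambda>_ _. x) C" and D: "D \<ge> 0" "pieces_bounded 1 (\<lambda>_ _. y) D"
      by (auto simp: xspace_def)
    have "pieces_bounded 1 (\<lambda>_ _. x + y) (C + D)"
      unfolding restr_linear distrib_left by (intro allI fun_bounded_add C(2)[rule_format] D(2)[rule_format])
    moreover have "C + D \<ge> 0" using C D by simp
    ultimately have "\<exists>C\<ge>0. pieces_bounded 1 (\<lambda>_ _. x + y) C" by blast
    then show "x + y \<in> xspace" using x y by (simp add: xspace_def)
  next
    fix c x assume x: "x \<in> xspace"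
    then obtain C where C: "C \<ge> 0" "pieces_bounded 1 (\<lambda>_ _. x) C" by (auto simp: xspace_def)
    have "pieces_bounded 1 (\<lambda>_ _. smul c x) (cmod c * C)"
      unfolding restr_linear mult.left_commute[of _ c] by (intro allI fun_bounded_scale C(2)[rule_format])
    moreover have "cmod c * C \<ge> 0" using C by simp
    ultimately have "\<exists>C\<ge>0. pieces_bounded 1 (\<lambda>_ _. smul c x) C" by blast
    then show "smul c x \<in> xspace" using x by (simp add: xspace_def smul_def)
  qed
  show "piece_tests \<noteq> {}" using piece_testsI[of _ 0] by fastforce
  fix m k l :: nat and \<tau> :: "((bool \<times> nat) \<times> (F2 \<times> F2)) mat" and u u' :: "(nat \<Rightarrow> complex) \<Rightarrow> complex" and c
  show "piece_pairing (u + u') (\<tau> k l) = piece_pairing u (\<tau> k l) + piece_pairing u' (\<tau> k l)"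
    by (simp add: piece_pairing_def case_prod_unfold restr_linear(1) distrib_left)
  show "piece_pairing (smul c u) (\<tau> k l) = c * piece_pairing u (\<tau> k l)"
    by (simp add: piece_pairing_def case_prod_unfold restr_linear(2))
  show "\<exists>C\<ge>0. \<forall>(m, \<tau>)\<in>piece_tests. bil_bounded {..<m} {..<m} (\<lambda>k l. piece_pairing u (\<tau> k l)) C" if "u \<in> xspace"
    using that unfolding xspace_def pair_bounded_iff_pieces[symmetric] pair_bounded_1_iff by blast
next
  fix u :: "(nat \<Rightarrow> complex) \<Rightarrow> complex"
  assume u: "u \<in> xspace" and z: "\<And>m \<tau> k l. (m, \<tau>) \<in> piece_tests \<Longrightarrow> k < m \<Longrightarrow> l < m \<Longrightarrow> piece_pairing u (\<tau> k l) = 0"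
  show "u = 0"
  proof
    fix i
    show "u i = 0 i"
    proof (cases "i \<in> enc ` (\<Union>b. piece b)")
      case True
      then obtain h b where h: "i = enc h" "h \<in> piece b" by blast
      \<comment> \<open>Two points with difference \<open>h\<close>. They are distinct since no
        piece contains 0, so the value at \<open>h\<close> occurs as an entry of a test
        matrix.\<close>
      let ?F = "\<lambda>k :: nat. if k = 0 then h else 0"
      have "h \<noteq> 0" using h(2) zero_notin_piece[of b] by blast
      then have "inj_on ?F {..<2}" by (auto simp: inj_on_def)
      from z[OF piece_testsI[OF this, of b], of 0 1] h show ?thesis by (simp add: piece_pairing_def restr_def weight_def)
    next
      case False
      then show ?thesis using u by (simp add: xspace_def)
    qed
  qed
qed

lemma xnorm_le:
  assumes "0 \<le> C" "pieces_bounded n x C"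
  shows "xnorm n x \<le> C"
  using assms(2) unfolding pair_bounded_iff_pieces[symmetric] by (intro X.pair_norm_le[OF assms(1)]) auto

lemma xnorm_bound:
  assumes "x \<in> mats n xspace"
  shows "pieces_bounded n x (xnorm n x)"
  unfolding pair_bounded_iff_pieces[symmetric] using X.pair_norm_bound(1)[OF assms] by auto

lemma xspace_eval_le:
  assumes "x \<in> xspace"
  shows "cmod (x i) \<le> xnorm 1 (\<lambda>_ _. x)"
proof (cases "i \<in> enc ` (\<Union>b. piece b)")
  case True
  then obtain h b where h: "i = enc h" "h \<in> piece b" by blast
  have m: "(\<lambda>_ _. x) \<in> mats 1 xspace" using assms by (simp add: mats_def)
  from bil_bounded_entry[OF fun_bounded_value[OF xnorm_bound[OF m, rule_format, of b] _ X.pair_norm_nonneg'[OF m], of h], of 0 0] h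
  have "2 ^ snd b * cmod (x i) \<le> xnorm 1 (\<lambda>_ _. x)" by (simp add: norm_mult cmod_weight restr_def)
  moreover have "1 * cmod (x i) \<le> 2 ^ snd b * cmod (x i)" by (intro mult_right_mono) auto
  ultimately show ?thesis by simp
next
  case False
  have m: "(\<lambda>_ _. x) \<in> mats 1 xspace" using assms by (simp add: mats_def)
  show ?thesis using False assms X.pair_norm_nonneg'[OF m] by (simp add: xspace_def)
qed

text \<open>The weights are at least 1, so the norm dominates every value of the function. A Cauchy
  sequence converges pointwise, and the bounds on finite truncations pass to the pointwise
  limit.\<close>

lemma xspace_operator_space: "operator_space xspace xnorm"
proof (rule X.operator_spaceI)
  fix s :: "nat \<Rightarrow> (nat \<Rightarrow> complex) \<Rightarrow> complex"
  assume s: "\<And>k. s k \<in> xspace" and C: "\<And>e. e > 0 \<Longrightarrow> \<exists>K. \<forall>k\<ge>K. \<forall>l\<ge>K. xnorm 1 (\<lambda>_ _. s k - s l) < e"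
  note diff = cfun.subspace_diff[OF X.subspace_V]
  have "Cauchy (\<lambda>k. s k i)" for i
  proof (rule CauchyI)
    fix e :: real assume "e > 0"
    then obtain K where K: "\<forall>k\<ge>K. \<forall>l\<ge>K. xnorm 1 (\<lambda>_ _. s k - s l) < e" using C by blast
    have "norm (s k i - s l i) < e" if "K \<le> k" "K \<le> l" for k l
      using xspace_eval_le[OF diff[OF s[of k] s[of l]], of i] K that by fastforce
    then show "\<exists>M. \<forall>m\<ge>M. \<forall>n\<ge>M. norm (s m i - s n i) < e" by blast
  qed
  then have "\<forall>i. \<exists>w. (\<lambda>k. s k i) \<longlonglongrightarrow> w" by (metis Cauchy_convergent_iff convergent_def)
  from choice[OF this] obtain w where w: "\<And>i. (\<lambda>k. s k i) \<longlonglongrightarrow> w i" by blast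
  have bd: "pieces_bounded 1 (\<lambda>_ _. s k - w) e"
    if K: "\<forall>k\<ge>K. \<forall>l\<ge>K. xnorm 1 (\<lambda>_ _. s k - s l) < e" and k: "k \<ge> K" for e K k
    unfolding fun_bounded_def
  proof (intro allI impI)
    fix b and F :: "(F2 \<times> F2) set" assume F: "finite F"
    show "bil_bounded ({..<1::nat} \<times> F) ({..<1::nat} \<times> F) (\<lambda>(i,u) (j,t). weight b * restr b (s k - w) (u - t)) e"
    proof (rule bil_bounded_limit[where F = sequentially])
      fix p q :: "nat \<times> F2 \<times> F2"
      have "(\<lambda>l. weight b * restr b (s k - s l) h) \<longlonglongrightarrow> weight b * restr b (s k - w) h" for h
        unfolding restr_def by (auto intro!: tendsto_intros w)
      then show "(\<lambda>l. (\<lambda>(i,u) (j,t). weight b * restr b (s k - s l) (u - t)) p q)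
         \<longlonglongrightarrow> (\<lambda>(i,u) (j,t). weight b * restr b (s k - w) (u - t)) p q"
        by (simp add: case_prod_unfold)
      show "\<forall>\<^sub>F l in sequentially. bil_bounded ({..<1::nat} \<times> F) ({..<1::nat} \<times> F) (\<lambda>(i,u) (j,t). weight b * restr b (s k - s l) (u - t)) e"
        using eventually_ge_at_top[of K]
      proof eventually_elim
        case (elim l)
        have m: "(\<lambda>_ _. s k - s l) \<in> mats 1 xspace" using diff[OF s s] by (simp add: mats_def)
        have "xnorm 1 (\<lambda>_ _. s k - s l) \<le> e" using K k elim by (simp add: less_imp_le)
        from fun_boundedD[OF fun_bounded_mono[OF xnorm_bound[OF m, rule_format] this] F] show ?case .
      qed
    qed simp
  qed
  have mem: "s k - w \<in> xspace" if K: "\<forall>k\<ge>K. \<forall>l\<ge>K. xnorm 1 (\<lambda>_ _. s k - s l) < e" and k: "k \<ge> K" and e: "e > 0" for e K k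
  proof -
    have "w i = 0" if i: "i \<notin> enc ` (\<Union>b. piece b)" for i
    proof -
      have "(\<lambda>k. s k i) = (\<lambda>_. 0)" using s i by (auto simp: xspace_def)
      with w[of i] show ?thesis by (simp add: LIMSEQ_const_iff)
    qed
    moreover have "\<exists>C\<ge>0. pieces_bounded 1 (\<lambda>_ _. s k - w) C" using bd[OF K k] e less_imp_le by blast
    ultimately show ?thesis using s[of k] by (simp add: xspace_def)
  qed
  obtain K1 where K1: "\<forall>k\<ge>K1. \<forall>l\<ge>K1. xnorm 1 (\<lambda>_ _. s k - s l) < 1" using C[of 1] by auto
  have wX: "w \<in> xspace" using diff[OF s[of K1] mem[OF K1 order_refl zero_less_one]] by simp
  have "(\<lambda>k. xnorm 1 (\<lambda>_ _. s k - w)) \<longlonglongrightarrow> 0"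
  proof (rule LIMSEQ_I)
    fix e :: real assume e: "e > 0"
    then obtain K where K: "\<forall>k\<ge>K. \<forall>l\<ge>K. xnorm 1 (\<lambda>_ _. s k - s l) < e / 2" using C[of "e/2"] by auto
    have "norm (xnorm 1 (\<lambda>_ _. s k - w) - 0) < e" if k: "k \<ge> K" for k
    proof -
      have "xnorm 1 (\<lambda>_ _. s k - w) \<le> e / 2" by (rule xnorm_le[OF _ bd[OF K k]]) (use e in simp)
      moreover have "0 \<le> xnorm 1 (\<lambda>_ _. s k - w)"
        by (rule X.pair_norm_nonneg') (use mem[OF K k] e in \<open>simp add: mats_def\<close>)
      ultimately show ?thesis using e by simp
    qed
    then show "\<exists>K. \<forall>k\<ge>K. norm (xnorm 1 (\<lambda>_ _. s k - w) - 0) < e" by blast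
  qed
  with wX show "\<exists>v\<in>xspace. (\<lambda>k. xnorm 1 (\<lambda>_ _. s k - v)) \<longlonglongrightarrow> 0" by blast
qed

subsection \<open>The module actions\<close>

text \<open>The case \<open>r = 0\<close> is set apart because truncated subtraction would make
  block 0 its own neighbour.\<close>

definition nbr_blocks :: "nat \<Rightarrow> F2 set" where
  "nbr_blocks r = block (Suc r) \<union> (if r = 0 then {} else block (r - 1))"

definition nbrs :: "F2 \<Rightarrow> F2 set" where
  "nbrs g = (\<Union>r\<in>{r. g \<in> block r}. nbr_blocks r)"

lemma nbrs_block: "g \<in> block r \<Longrightarrow> nbrs g = nbr_blocks r"
  using block_unique by (auto simp: nbrs_def)

lemma finite_nbr_blocks: "finite (nbr_blocks r)" and zero_notin_nbr_blocks: "0 \<notin> nbr_blocks r"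
  using block_props(1,3) by (auto simp: nbr_blocks_def)

lemma nbrs_zero: "nbrs 0 = {}" and zero_notin_nbrs: "0 \<notin> nbrs g"
  using block_props(3) zero_notin_nbr_blocks by (auto simp: nbrs_def)

text \<open>The value at a vertex of the side that gets summed into is discarded. As \<open>0\<close> lies in no block,
  a second coordinate \<open>0\<close> marks a vertex of the first copy, and vice versa.\<close>

definition left_fun :: "(F2 \<Rightarrow> complex) \<Rightarrow> (F2 \<times> F2 \<Rightarrow> complex) \<Rightarrow> F2 \<times> F2 \<Rightarrow> complex" where
  "left_fun a y = (\<lambda>(g, h). if h = 0 then \<Sum>h'\<in>nbrs g. a h' * y (g, h') else a h * y (g, h))"

definition right_fun :: "(F2 \<times> F2 \<Rightarrow> complex) \<Rightarrow> (F2 \<Rightarrow> complex) \<Rightarrow> F2 \<times> F2 \<Rightarrow> complex" where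
  "right_fun y a = (\<lambda>(g, h). if g = 0 then - (\<Sum>g'\<in>nbrs h. a g' * y (g', h)) else a g * y (g, h))"

definition left_act :: "(F2 \<Rightarrow> complex) \<Rightarrow> ((nat \<Rightarrow> complex) \<Rightarrow> complex) \<Rightarrow> (nat \<Rightarrow> complex) \<Rightarrow> complex" where
  "left_act a x = ext (left_fun a (\<lambda>h. x (enc h)))"

definition right_act :: "((nat \<Rightarrow> complex) \<Rightarrow> complex) \<Rightarrow> (F2 \<Rightarrow> complex) \<Rightarrow> (nat \<Rightarrow> complex) \<Rightarrow> complex" where
  "right_act x a = ext (right_fun (\<lambda>h. x (enc h)) a)"

lemma piece_notin_zero:
  assumes "(g, h) \<in> piece b"
  shows "h = 0 \<Longrightarrow> \<exists>r. even r \<and> b = (False, r)"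
    and "g = 0 \<Longrightarrow> \<exists>r. odd r \<and> b = (False, r)"
  using assms block_props(3) by (cases b; cases "fst b"; auto split: if_splits)+

lemma even_fst_index: "even (fst_index r)" and odd_snd_index: "odd (snd_index r)"
  by (auto simp: fst_index_def snd_index_def)

definition edge_part :: "nat \<Rightarrow> ((nat \<Rightarrow> complex) \<Rightarrow> complex) \<Rightarrow> F2 \<times> F2 \<Rightarrow> complex" where
  "edge_part r x h = restr (True, r) x h + (if r = 0 then 0 else restr (True, r - 1) x h)"

text \<open>The weight of the vertices in block \<open>r\<close> equals that of the edge piece
  \<open>r\<close> and is twice that of the edge piece \<open>r - 1\<close>; this accounts for the
  constant as 1 + 2.\<close>

lemma edge_part_bounded:
  assumes x: "pieces_bounded q x C" and C: "0 \<le> C"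
  shows "fun_bounded {..<q} (\<lambda>k l h. weight (False, r) * edge_part r (x k l) h) (3 * C)"
proof (cases "r = 0")
  case True
  then show ?thesis
    using fun_bounded_mono[OF x[rule_format, of "(True, 0)"], of "3 * C"] C by (simp add: edge_part_def weight_def)
next
  case False
  then obtain s where s: "r = Suc s" by (cases r) auto
  have "fun_bounded {..<q} (\<lambda>k l h. weight (True, r) * restr (True, r) (x k l) h
      + 2 * (weight (True, s) * restr (True, s) (x k l) h)) (C + cmod 2 * C)"
    by (intro fun_bounded_add fun_bounded_scale x[rule_format])
  then show ?thesis by (simp add: edge_part_def weight_def s algebra_simps)
qed

lemma edge_part_even:
  assumes r: "even r"
  shows "g \<in> block r \<Longrightarrow> h \<in> nbr_blocks r \<Longrightarrow> edge_part r x (g, h) = x (enc (g, h))"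
    and "g \<notin> block r \<Longrightarrow> edge_part r x (g, h) = 0" and "h \<notin> nbr_blocks r \<Longrightarrow> edge_part r x (g, h) = 0"
proof -
  have 1: "(g, h) \<in> piece (True, r) \<longleftrightarrow> g \<in> block r \<and> h \<in> block (Suc r)"
    using r by (simp add: fst_index_def snd_index_def)
  have 2: "(g, h) \<in> piece (True, r - 1) \<longleftrightarrow> g \<in> block r \<and> h \<in> block (r - 1)" if "r \<noteq> 0"
    using r that by (simp add: fst_index_def snd_index_def)
  have 3: "\<not> (h \<in> block (Suc r) \<and> h \<in> block (r - 1))" using block_unique[of h "Suc r" "r - 1"] by auto
  show "g \<in> block r \<Longrightarrow> h \<in> nbr_blocks r \<Longrightarrow> edge_part r x (g, h) = x (enc (g, h))"
    using 1 2 3 by (auto simp: edge_part_def restr_def nbr_blocks_def split: if_splits simp del: piece.simps)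
  show "g \<notin> block r \<Longrightarrow> edge_part r x (g, h) = 0" "h \<notin> nbr_blocks r \<Longrightarrow> edge_part r x (g, h) = 0"
    using 1 2 by (auto simp: edge_part_def restr_def nbr_blocks_def split: if_splits simp del: piece.simps)
qed

lemma edge_part_odd:
  assumes r: "odd r"
  shows "h \<in> block r \<Longrightarrow> g \<in> nbr_blocks r \<Longrightarrow> edge_part r x (g, h) = x (enc (g, h))"
    and "h \<notin> block r \<Longrightarrow> edge_part r x (g, h) = 0" and "g \<notin> nbr_blocks r \<Longrightarrow> edge_part r x (g, h) = 0"
proof -
  have 1: "(g, h) \<in> piece (True, r) \<longleftrightarrow> h \<in> block r \<and> g \<in> block (Suc r)"
    using r by (auto simp add: fst_index_def snd_index_def)
  have 2: "(g, h) \<in> piece (True, r - 1) \<longleftrightarrow> h \<in> block r \<and> g \<in> block (r - 1)"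
    using r by (auto simp add: fst_index_def snd_index_def elim!: oddE)
  have 3: "\<not> (g \<in> block (Suc r) \<and> g \<in> block (r - 1))" using block_unique[of g "Suc r" "r - 1"] by auto
  have 4: "r \<noteq> 0" using r by (cases r) auto
  show "h \<in> block r \<Longrightarrow> g \<in> nbr_blocks r \<Longrightarrow> edge_part r x (g, h) = x (enc (g, h))"
    using 1 2 3 4 by (auto simp: edge_part_def restr_def nbr_blocks_def split: if_splits simp del: piece.simps)
  show "h \<notin> block r \<Longrightarrow> edge_part r x (g, h) = 0" "g \<notin> nbr_blocks r \<Longrightarrow> edge_part r x (g, h) = 0"
    using 1 2 4 by (auto simp: edge_part_def restr_def nbr_blocks_def split: if_splits simp del: piece.simps)
qed

lemma restr_left_act:
  "fst b \<or> odd (snd b) \<Longrightarrow> restr b (left_act a x) z = a (snd z) * restr b x z"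
  "even r \<Longrightarrow> restr (False, r) (left_act a x) (g, h') = (if h' = 0 then \<Sum>h\<in>nbr_blocks r. a h * edge_part r x (g, h) else 0)"
proof -
  assume b: "fst b \<or> odd (snd b)"
  have "snd z \<noteq> 0" if "z \<in> piece b"
    using b piece_notin_zero(1)[of "fst z" "snd z" b] that unfolding prod.collapse by auto
  then show "restr b (left_act a x) z = a (snd z) * restr b x z"
    by (auto simp: restr_def left_act_def left_fun_def case_prod_unfold)
next
  assume r: "even r"
  show "restr (False, r) (left_act a x) (g, h') = (if h' = 0 then \<Sum>h\<in>nbr_blocks r. a h * edge_part r x (g, h) else 0)"
    using r by (auto simp: restr_def left_act_def left_fun_def nbrs_block edge_part_even intro!: sum.cong sum.neutral)
qed

lemma restr_right_act:
  "fst b \<or> even (snd b) \<Longrightarrow> restr b (right_act x a) z = a (fst z) * restr b x z"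
  "odd r \<Longrightarrow> restr (False, r) (right_act x a) (g', h) = (if g' = 0 then \<Sum>g\<in>nbr_blocks r. a g * (- edge_part r x (g, h)) else 0)"
proof -
  assume b: "fst b \<or> even (snd b)"
  have "fst z \<noteq> 0" if "z \<in> piece b"
    using b piece_notin_zero(2)[of "fst z" "snd z" b] that unfolding prod.collapse by auto
  then show "restr b (right_act x a) z = a (fst z) * restr b x z"
    by (auto simp: restr_def right_act_def right_fun_def case_prod_unfold)
next
  assume r: "odd r"
  show "restr (False, r) (right_act x a) (g', h) = (if g' = 0 then \<Sum>g\<in>nbr_blocks r. a g * (- edge_part r x (g, h)) else 0)"
    using r by (auto simp: restr_def right_act_def right_fun_def nbrs_block edge_part_odd sum_negf intro!: sum.cong sum.neutral)
qed

text \<open>On edges and on the vertices of the second copy the action is multiplication by a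
  function of the second coordinate. On the vertices of the first copy it sums out the second
  coordinate of the edges, so \<open>fun_bounded_slice_snd\<close> applies; the constant 3 is only
  required in this case.\<close>

lemma left_act_tensor_bound:
  assumes a: "a \<in> mats p fourier_algebra" and x: "pieces_bounded q x C" and C: "0 \<le> C"
  shows "fun_bounded ({..<p} \<times> {..<q}) (\<lambda>(i,k) (j,l) h. weight b * restr b (left_act (a i j) (x k l)) h) (fourier_mnorm p a * (3 * C))"
proof (cases "fst b \<or> odd (snd b)")
  case True
  have "fun_bounded ({..<p} \<times> {..<q}) (\<lambda>(i,k) (j,l) h. a i j (snd h) * (weight b * restr b (x k l) h)) (fourier_mnorm p a * (3 * C))"
    by (rule fun_bounded_mult_hom[OF a _ fun_bounded_mono[OF x[rule_format]]]) (use C in auto)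
  then show ?thesis by (simp add: restr_left_act(1)[OF True] case_prod_unfold mult_ac)
next
  case False
  then obtain r where b: "b = (False, r)" and r: "even r" by (cases b) auto
  have "fun_bounded ({..<p} \<times> {..<q}) (\<lambda>(i,k) (j,l) (g,h). if h = (0 :: F2) then \<Sum>h'\<in>nbr_blocks r. a i j h' * (weight (False, r) * edge_part r (x k l) (g, h')) else 0)
     (fourier_mnorm p a * (3 * C))"
    using fun_bounded_slice_snd[OF a finite_lessThan edge_part_bounded[OF x C, of r] _ finite_nbr_blocks[of r]] C edge_part_even(3)[OF r]
    by simp
  then show ?thesis
    unfolding b by (subst fun_bounded_cong[where y' = "\<lambda>(i,k) (j,l) (g,h). if h = (0 :: F2) then \<Sum>h'\<in>nbr_blocks r. a i j h' * (weight (False, r) * edge_part r (x k l) (g, h')) else 0"])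
      (auto simp: restr_left_act(2)[OF r] sum_distrib_left mult_ac)
qed

lemma right_act_tensor_bound:
  assumes a: "a \<in> mats p fourier_algebra" and x: "pieces_bounded q x C" and C: "0 \<le> C"
  shows "fun_bounded ({..<p} \<times> {..<q}) (\<lambda>(i,k) (j,l) h. weight b * restr b (right_act (x k l) (a i j)) h) (fourier_mnorm p a * (3 * C))"
proof (cases "fst b \<or> even (snd b)")
  case True
  have "fun_bounded ({..<p} \<times> {..<q}) (\<lambda>(i,k) (j,l) h. a i j (fst h) * (weight b * restr b (x k l) h)) (fourier_mnorm p a * (3 * C))"
    by (rule fun_bounded_mult_hom[OF a _ fun_bounded_mono[OF x[rule_format]]]) (use C in auto)
  then show ?thesis by (simp add: restr_right_act(1)[OF True] case_prod_unfold mult_ac)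
next
  case False
  then obtain r where b: "b = (False, r)" and r: "odd r" by (cases b) auto
  have m: "fun_bounded {..<q} (\<lambda>k l h. weight (False, r) * (- edge_part r (x k l) h)) (3 * C)"
    using fun_bounded_scale[OF edge_part_bounded[OF x C], of "-1" r] by simp
  have "fun_bounded ({..<p} \<times> {..<q}) (\<lambda>(i,k) (j,l) (g,h). if g = (0 :: F2) then \<Sum>g'\<in>nbr_blocks r. a i j g' * (weight (False, r) * (- edge_part r (x k l) (g', h))) else 0)
     (fourier_mnorm p a * (3 * C))"
    using fun_bounded_slice_fst[OF a finite_lessThan m _ finite_nbr_blocks[of r]] C edge_part_odd(3)[OF r] by simp
  then show ?thesis
    unfolding b by (subst fun_bounded_cong[where y' = "\<lambda>(i,k) (j,l) (g,h). if g = (0 :: F2) then \<Sum>g'\<in>nbr_blocks r. a i j g' * (weight (False, r) * (- edge_part r (x k l) (g', h))) else 0"])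
      (auto simp: restr_right_act(2)[OF r] sum_distrib_left mult_ac)
qed

lemma left_act_pieces_bounded:
  assumes "a \<in> mats p fourier_algebra" "pieces_bounded q x C" "0 \<le> C"
  shows "pieces_bounded (p * q) (mat_pair left_act q a x) (fourier_mnorm p a * (3 * C))"
proof
  fix b
  have "inj_on (\<lambda>I. (I div q, I mod q)) {..<p * q}" "(\<lambda>I. (I div q, I mod q)) ` {..<p * q} = {..<p} \<times> {..<q}"
    using bij_betw_div_mod[of q p] by (auto simp: bij_betw_def)
  then show "fun_bounded {..<p * q} (\<lambda>i j h. weight b * restr b (mat_pair left_act q a x i j) h) (fourier_mnorm p a * (3 * C))"
    using fun_bounded_image[of "\<lambda>I. (I div q, I mod q)" "{..<p * q}" "\<lambda>(i,k) (j,l) h. weight b * restr b (left_act (a i j) (x k l)) h"]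
      left_act_tensor_bound[OF assms, of b] by (simp add: mat_pair_def)
qed

lemma right_act_pieces_bounded:
  assumes "a \<in> mats p fourier_algebra" "pieces_bounded q x C" "0 \<le> C"
  shows "pieces_bounded (q * p) (mat_pair right_act p x a) (fourier_mnorm p a * (3 * C))"
proof
  fix b
  have bij: "inj_on (\<lambda>I. (I div p, I mod p)) {..<q * p}" "(\<lambda>I. (I div p, I mod p)) ` {..<q * p} = {..<q} \<times> {..<p}"
    using bij_betw_div_mod[of p q] by (auto simp: bij_betw_def)
  \<comment> \<open>The matrix lists the index of \<open>x\<close> before that of \<open>a\<close>,
    the tensor bound the other way round; hence the remainder comes before the quotient.\<close>
  have "inj_on (\<lambda>I. (I mod p, I div p)) {..<q * p}" using bij(1) by (auto simp: inj_on_def)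
  moreover have "(\<lambda>I. (I mod p, I div p)) ` {..<q * p} = prod.swap ` (\<lambda>I. (I div p, I mod p)) ` {..<q * p}"
    by (simp add: image_image)
  moreover have "prod.swap ` ({..<q} \<times> {..<p}) = {..<p} \<times> {..<q}" by (rule product_swap)
  ultimately show "fun_bounded {..<q * p} (\<lambda>i j h. weight b * restr b (mat_pair right_act p x a i j) h) (fourier_mnorm p a * (3 * C))"
    using fun_bounded_image[of "\<lambda>I. (I mod p, I div p)" "{..<q * p}" "\<lambda>(i,k) (j,l) h. weight b * restr b (right_act (x k l) (a i j)) h"]
      right_act_tensor_bound[OF assms, of b] by (simp add: mat_pair_def bij(2))
qed

lemma xspace_support: "x \<in> xspace \<Longrightarrow> h \<notin> (\<Union>b. piece b) \<Longrightarrow> x (enc h) = 0"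
  by (simp add: xspace_def inj_image_mem_iff[OF inj_enc])

lemma ext_outside_pieces:
  assumes i: "i \<notin> enc ` (\<Union>b. piece b)" and y: "\<And>h. h \<notin> (\<Union>b. piece b) \<Longrightarrow> y h = 0"
  shows "ext y i = 0"
proof (cases "i \<in> range enc")
  case True
  then obtain h where h: "i = enc h" by blast
  then have "h \<notin> (\<Union>b. piece b)" using i by blast
  then show ?thesis using y h by simp
qed (simp add: ext_def)

lemma in_nbrs_piece:
  assumes "h \<in> nbrs g"
  shows "(g, h) \<in> piece b \<Longrightarrow> \<exists>r. (g, 0) \<in> piece (False, r)" "(h, g) \<in> piece b \<Longrightarrow> \<exists>r. (0, g) \<in> piece (False, r)"
proof -
  have h: "h \<noteq> 0" using assms zero_notin_nbrs[of g] by auto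
  have g: "g \<noteq> 0" using assms nbrs_zero by auto
  { assume p: "(g, h) \<in> piece b"
    obtain c r where b: "b = (c, r)" by (cases b)
    have c: c using p g h unfolding b by (cases c) (auto split: if_splits)
    have "g \<in> block (fst_index r)" using p c b by auto
    then show "\<exists>r. (g, 0) \<in> piece (False, r)" using even_fst_index by (intro exI[of _ "fst_index r"]) auto }
  { assume p: "(h, g) \<in> piece b"
    obtain c r where b: "b = (c, r)" by (cases b)
    have c: c using p g h unfolding b by (cases c) (auto split: if_splits)
    have "g \<in> block (snd_index r)" using p c b by auto
    then show "\<exists>r. (0, g) \<in> piece (False, r)" using odd_snd_index by (intro exI[of _ "snd_index r"]) auto }
qed

lemma
  assumes a: "a \<in> fourier_algebra" and x: "x \<in> xspace"
  shows left_act_xspace: "left_act a x \<in> xspace" and right_act_xspace: "right_act x a \<in> xspace"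
proof -
  obtain C where C: "C \<ge> 0" "pieces_bounded 1 (\<lambda>_ _. x) C" using x by (auto simp: xspace_def)
  have m: "(\<lambda>_ _. a) \<in> mats 1 fourier_algebra" using a by (simp add: mats_def)
  let ?C = "fourier_mnorm 1 (\<lambda>_ _. a) * (3 * C)"
  have C': "0 \<le> ?C" using C fourier_mnorm_nonneg[OF m] by simp
  have l: "left_fun a (\<lambda>h. x (enc h)) h = 0" if h: "h \<notin> (\<Union>b. piece b)" for h
  proof (cases "snd h = 0")
    case True
    have "x (enc (fst h, h')) = 0" if h': "h' \<in> nbrs (fst h)" for h'
    proof (rule ccontr)
      assume "x (enc (fst h, h')) \<noteq> 0"
      then obtain b where "(fst h, h') \<in> piece b" using xspace_support[OF x] by blast
      then obtain r where "(fst h, 0) \<in> piece (False, r)" using in_nbrs_piece(1)[OF h'] by blast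
      moreover have "(fst h, 0) = h" using True by (simp add: prod_eq_iff)
      ultimately show False using h by (metis UN_I UNIV_I)
    qed
    then show ?thesis using True by (simp add: left_fun_def case_prod_unfold)
  next
    case False
    then show ?thesis using xspace_support[OF x h] by (simp add: left_fun_def case_prod_unfold)
  qed
  have r: "right_fun (\<lambda>h. x (enc h)) a h = 0" if h: "h \<notin> (\<Union>b. piece b)" for h
  proof (cases "fst h = 0")
    case True
    have "x (enc (h', snd h)) = 0" if h': "h' \<in> nbrs (snd h)" for h'
    proof (rule ccontr)
      assume "x (enc (h', snd h)) \<noteq> 0"
      then obtain b where "(h', snd h) \<in> piece b" using xspace_support[OF x] by blast
      then obtain r where "(0, snd h) \<in> piece (False, r)" using in_nbrs_piece(2)[OF h'] by blast
      moreover have "(0, snd h) = h" using True by (simp add: prod_eq_iff)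
      ultimately show False using h by (metis UN_I UNIV_I)
    qed
    then show ?thesis using True by (simp add: right_fun_def case_prod_unfold)
  next
    case False
    then show ?thesis using xspace_support[OF x h] by (simp add: right_fun_def case_prod_unfold)
  qed
  have "mat_pair left_act 1 (\<lambda>_ _. a) (\<lambda>_ _. x) = (\<lambda>_ _. left_act a x)"
    and "mat_pair right_act 1 (\<lambda>_ _. x) (\<lambda>_ _. a) = (\<lambda>_ _. right_act x a)" by (simp_all add: mat_pair_def)
  with left_act_pieces_bounded[OF m C(2,1)] right_act_pieces_bounded[OF m C(2,1)]
  have "pieces_bounded 1 (\<lambda>_ _. left_act a x) ?C" "pieces_bounded 1 (\<lambda>_ _. right_act x a) ?C" by simp_all
  then have "\<exists>C\<ge>0. pieces_bounded 1 (\<lambda>_ _. left_act a x) C" "\<exists>C\<ge>0. pieces_bounded 1 (\<lambda>_ _. right_act x a) C"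
    using C' by blast+
  moreover have "left_act a x i = 0" "right_act x a i = 0" if "i \<notin> enc ` (\<Union>b. piece b)" for i
    unfolding left_act_def right_act_def by (rule ext_outside_pieces[OF that], erule l r)+
  ultimately show "left_act a x \<in> xspace" "right_act x a \<in> xspace"
    unfolding xspace_def mem_Collect_eq by blast+
qed

text \<open>The map \<open>\<Phi>\<close> is the formula of the action in which the product of the
  two factors is replaced by a function of two variables, a group element and an argument of the
  module functions.\<close>

lemma left_act_cb: "induces_cb fourier_algebra fourier_mnorm xspace xnorm xspace xnorm left_act"
proof (rule induces_cbI[OF fourier_operator_space xspace_operator_space xspace_operator_space, where C = 3
    and \<Phi> = "\<lambda>T. ext (\<lambda>(g, h). if h = 0 then \<Sum>h'\<in>nbrs g. T (h', enc (g, h')) else T (h, enc (g, h)))"])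
  fix p q and v :: "(F2 \<Rightarrow> complex) mat" and w :: "((nat \<Rightarrow> complex) \<Rightarrow> complex) mat"
  assume v: "v \<in> mats p fourier_algebra" and w: "w \<in> mats q xspace"
  have "xnorm (p * q) (mat_pair left_act q v w) \<le> fourier_mnorm p v * (3 * xnorm q w)"
    by (rule xnorm_le[OF _ left_act_pieces_bounded[OF v xnorm_bound[OF w]]])
       (use X.pair_norm_nonneg'[OF w] fourier_mnorm_nonneg[OF v] in auto)
  then show "xnorm (p * q) (mat_pair left_act q v w) \<le> 3 * fourier_mnorm p v * xnorm q w" by (simp add: mult_ac)
next
  show "left_act a x \<in> xspace" if "a \<in> fourier_algebra" "x \<in> xspace" for a x by (rule left_act_xspace[OF that])
qed (auto simp: ext_def fun_eq_iff smul_def sum.distrib sum_distrib_left tens_def left_act_def left_fun_def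
      split: prod.split)

lemma right_act_cb: "induces_cb xspace xnorm fourier_algebra fourier_mnorm xspace xnorm right_act"
proof (rule induces_cbI[OF xspace_operator_space fourier_operator_space xspace_operator_space, where C = 3
    and \<Phi> = "\<lambda>T. ext (\<lambda>(g, h). if g = 0 then - (\<Sum>g'\<in>nbrs h. T (enc (g', h), g')) else T (enc (g, h), g))"])
  fix p q and v :: "((nat \<Rightarrow> complex) \<Rightarrow> complex) mat" and w :: "(F2 \<Rightarrow> complex) mat"
  assume v: "v \<in> mats p xspace" and w: "w \<in> mats q fourier_algebra"
  have "xnorm (p * q) (mat_pair right_act q v w) \<le> fourier_mnorm q w * (3 * xnorm p v)"
    by (rule xnorm_le[OF _ right_act_pieces_bounded[OF w xnorm_bound[OF v]]])
       (use X.pair_norm_nonneg'[OF v] fourier_mnorm_nonneg[OF w] in auto)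
  then show "xnorm (p * q) (mat_pair right_act q v w) \<le> 3 * xnorm p v * fourier_mnorm q w" by (simp add: mult_ac)
next
  show "right_act x a \<in> xspace" if "x \<in> xspace" "a \<in> fourier_algebra" for a x by (rule right_act_xspace[OF that(2,1)])
qed (auto simp: ext_def fun_eq_iff smul_def sum.distrib sum_distrib_left tens_def right_act_def right_fun_def mult_ac
      split: prod.split)

lemma enc_ext: "(\<lambda>h. ext y (enc h)) = y"
  by simp

text \<open>A sum at a vertex involves only edge values, because 0 is never a neighbour, and on
  edges the two actions are multiplications by commuting functions. At \<open>(0, 0)\<close> nothing
  happens, as 0 has no neighbours.\<close>

lemma fourier_bimodule:
  "quantized_banach_bimodule fourier_algebra fourier_mnorm (\<lambda>f g x. f x * g x) xspace xnorm left_act right_act"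
proof -
  interpret Q: quantized_banach_algebra "fourier_algebra :: (F2 \<Rightarrow> complex) set" fourier_mnorm "\<lambda>f g x. f x * g x"
    by (rule quantized_banach_algebra_fourier)
  interpret XO: operator_space xspace xnorm by (rule xspace_operator_space)
  show ?thesis
  proof
    fix a b :: "F2 \<Rightarrow> complex" and x
    show "left_act (\<lambda>x. a x * b x) x = left_act a (left_act b x)"
      unfolding left_act_def enc_ext
      by (rule arg_cong[of _ _ ext]) (use zero_notin_nbrs in \<open>auto simp: left_fun_def fun_eq_iff mult.assoc intro!: sum.cong\<close>)
    show "right_act x (\<lambda>x. a x * b x) = right_act (right_act x a) b"
      unfolding right_act_def enc_ext
      by (rule arg_cong[of _ _ ext]) (use zero_notin_nbrs in \<open>auto simp: right_fun_def fun_eq_iff mult_ac intro!: sum.cong\<close>)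
    show "left_act a (right_act x b) = right_act (left_act a x) b"
      unfolding left_act_def right_act_def enc_ext
      by (rule arg_cong[of _ _ ext])
         (use zero_notin_nbrs nbrs_zero in \<open>auto simp: right_fun_def left_fun_def fun_eq_iff mult_ac sum_distrib_left sum_negf intro!: sum.cong\<close>)
  qed (rule left_act_cb right_act_cb)+
qed

subsection \<open>The derivation\<close>

definition vertex :: "nat \<Rightarrow> F2 \<Rightarrow> F2 \<times> F2" where
  "vertex r v = (if even r then (v, 0) else (0, v))"

definition vertex_sum :: "nat \<Rightarrow> (F2 \<Rightarrow> complex) \<Rightarrow> ((nat \<Rightarrow> complex) \<Rightarrow> complex) \<Rightarrow> complex" where
  "vertex_sum r a x = (\<Sum>v\<in>block r. a v * x (enc (vertex r v)))"

definition derivation :: "(F2 \<Rightarrow> complex) \<Rightarrow> ((nat \<Rightarrow> complex) \<Rightarrow> complex) \<Rightarrow> complex" where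
  "derivation a x = (if x \<in> xspace then \<Sum>r. vertex_sum r a x else 0)"

text \<open>For even \<open>r\<close> the vertices lie in the first coordinate and for odd
  \<open>r\<close> in the second, so the sum is a slice in that coordinate, evaluated at
  \<open>(0, 0)\<close>. The weight \<open>2 ^ r\<close> in the norm yields the factor
  \<open>(1/2) ^ r\<close>.\<close>

lemma vertex_sum_matrix_bound:
  assumes a: "a \<in> mats p fourier_algebra" and x: "pieces_bounded q x C" and C: "0 \<le> C"
  shows "bil_bounded ({..<p} \<times> {..<q}) ({..<p} \<times> {..<q}) (\<lambda>(i,k) (j,l). vertex_sum r (a i j) (x k l)) (fourier_mnorm p a * C * (1/2) ^ r)"
proof -
  let ?I = "{..<p} \<times> {..<q}"
  let ?y = "\<lambda>k l h. weight (False, r) * restr (False, r) (x k l) h"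
  have N: "0 \<le> fourier_mnorm p a * C" using C fourier_mnorm_nonneg[OF a] by simp
  have "bil_bounded ?I ?I (\<lambda>(i,k) (j,l). weight (False, r) * vertex_sum r (a i j) (x k l)) (fourier_mnorm p a * C)"
  proof (cases "even r")
    case True
    have "fun_bounded ?I (\<lambda>(i,k) (j,l) (g,h). if g = (0 :: F2) then \<Sum>g'\<in>block r. a i j g' * ?y k l (g', h) else 0) (fourier_mnorm p a * C)"
      by (rule fun_bounded_slice_fst[OF a finite_lessThan x[rule_format] C block_props(1)]) (use True in \<open>auto simp: restr_def\<close>)
    from fun_bounded_value[OF this _ N, of "(0,0)"]
    have "bil_bounded ?I ?I (\<lambda>(i,k) (j,l). \<Sum>g'\<in>block r. a i j g' * ?y k l (g', 0)) (fourier_mnorm p a * C)"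
      by (simp add: case_prod_unfold)
    moreover have "(\<Sum>g'\<in>block r. a i j g' * ?y k l (g', 0)) = weight (False, r) * vertex_sum r (a i j) (x k l)" for i j k l
      using True by (auto simp: vertex_sum_def vertex_def restr_def sum_distrib_left mult_ac intro!: sum.cong)
    ultimately show ?thesis by simp
  next
    case False
    have "fun_bounded ?I (\<lambda>(i,k) (j,l) (g,h). if h = (0 :: F2) then \<Sum>g'\<in>block r. a i j g' * ?y k l (g, g') else 0) (fourier_mnorm p a * C)"
      by (rule fun_bounded_slice_snd[OF a finite_lessThan x[rule_format] C block_props(1)]) (use False in \<open>auto simp: restr_def\<close>)
    from fun_bounded_value[OF this _ N, of "(0,0)"]
    have "bil_bounded ?I ?I (\<lambda>(i,k) (j,l). \<Sum>g'\<in>block r. a i j g' * ?y k l (0, g')) (fourier_mnorm p a * C)"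
      by (simp add: case_prod_unfold)
    moreover have "(\<Sum>g'\<in>block r. a i j g' * ?y k l (0, g')) = weight (False, r) * vertex_sum r (a i j) (x k l)" for i j k l
      using False by (auto simp: vertex_sum_def vertex_def restr_def sum_distrib_left mult_ac intro!: sum.cong)
    ultimately show ?thesis by simp
  qed
  from bil_bounded_scale[OF this, of "(1/2) ^ r"]
  have "bil_bounded ?I ?I (\<lambda>s t. (1/2) ^ r * (case s of (i,k) \<Rightarrow> \<lambda>(j,l). weight (False, r) * vertex_sum r (a i j) (x k l)) t) ((1/2) ^ r * (fourier_mnorm p a * C))"
    by (simp add: norm_power norm_divide)
  moreover have e: "(1/2) ^ r * (weight (False, r) * z) = z" for z by (simp add: weight_def power_divide)
  ultimately show ?thesis unfolding case_prod_unfold e by (simp add: mult_ac)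
qed

lemma bil_bounded_11: "bil_bounded ({..<1::nat} \<times> {..<1::nat}) ({..<1::nat} \<times> {..<1::nat}) K C \<Longrightarrow> cmod (K (0,0) (0,0)) \<le> C"
  by (rule bil_bounded_entry) auto

abbreviation fourier_norm :: "(F2 \<Rightarrow> complex) \<Rightarrow> real" where "fourier_norm a \<equiv> fourier_mnorm (Suc 0) (\<lambda>_ _. a)"
abbreviation xnorm1 :: "((nat \<Rightarrow> complex) \<Rightarrow> complex) \<Rightarrow> real" where "xnorm1 x \<equiv> xnorm (Suc 0) (\<lambda>_ _. x)"

lemma fourier_norm_nonneg: "a \<in> fourier_algebra \<Longrightarrow> 0 \<le> fourier_norm a"
  by (rule fourier_mnorm_nonneg) (simp add: mats_def)

lemma xnorm1_nonneg: "x \<in> xspace \<Longrightarrow> 0 \<le> xnorm1 x"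
  by (rule X.pair_norm_nonneg') (simp add: mats_def)

lemma vertex_sum_bound:
  assumes a: "a \<in> fourier_algebra" and x: "x \<in> xspace"
  shows "cmod (vertex_sum r a x) \<le> fourier_norm a * xnorm1 x * (1/2) ^ r"
proof -
  have "(\<lambda>_ _. x) \<in> mats 1 xspace" "(\<lambda>_ _. a) \<in> mats 1 fourier_algebra" using a x by (simp_all add: mats_def)
  from bil_bounded_11[OF vertex_sum_matrix_bound[OF this(2) xnorm_bound[OF this(1)] X.pair_norm_nonneg'[OF this(1)], of r]]
  show ?thesis by simp
qed

lemma vertex_sum_summable:
  assumes "a \<in> fourier_algebra" "x \<in> xspace"
  shows "summable (\<lambda>r. vertex_sum r a x)"
  by (rule summable_comparison_test'[of "\<lambda>r. fourier_norm a * xnorm1 x * (1/2) ^ r" 0])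
     (auto intro!: vertex_sum_bound assms summable_mult)

lemma derivation_sums:
  assumes "a \<in> fourier_algebra" "x \<in> xspace"
  shows "(\<lambda>r. vertex_sum r a x) sums derivation a x"
  using summable_sums[OF vertex_sum_summable[OF assms]] assms by (simp add: derivation_def)

text \<open>The bounds for the single blocks form a geometric series with sum 2, and the bound for
  the partial sums passes to the entrywise limit.\<close>

lemma derivation_matrix_bound:
  assumes a: "a \<in> mats p fourier_algebra" and x: "x \<in> mats q xspace"
  shows "bil_bounded ({..<p} \<times> {..<q}) ({..<p} \<times> {..<q}) (\<lambda>(i,k) (j,l). derivation (a i j) (x k l)) (2 * fourier_mnorm p a * xnorm q x)"
proof (rule bil_bounded_limit[where F = sequentially and K = "\<lambda>n (i,k) (j,l). \<Sum>r<n. vertex_sum r (a i j) (x k l)"])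
  fix s t :: "nat \<times> nat" assume "s \<in> {..<p} \<times> {..<q}" "t \<in> {..<p} \<times> {..<q}"
  then have "a (fst s) (fst t) \<in> fourier_algebra" "x (snd s) (snd t) \<in> xspace" using a x by (auto simp: mats_def)
  from derivation_sums[OF this] show "(\<lambda>n. (case s of (i,k) \<Rightarrow> \<lambda>(j,l). \<Sum>r<n. vertex_sum r (a i j) (x k l)) t) \<longlonglongrightarrow> (case s of (i,k) \<Rightarrow> \<lambda>(j,l). derivation (a i j) (x k l)) t"
    by (simp add: case_prod_unfold sums_def)
next
  have N: "0 \<le> fourier_mnorm p a * xnorm q x" using fourier_mnorm_nonneg[OF a] X.pair_norm_nonneg'[OF x] by simp
  show "\<forall>\<^sub>F n in sequentially. bil_bounded ({..<p} \<times> {..<q}) ({..<p} \<times> {..<q}) (\<lambda>(i,k) (j,l). \<Sum>r<n. vertex_sum r (a i j) (x k l)) (2 * fourier_mnorm p a * xnorm q x)"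
  proof (rule always_eventually, rule allI)
    fix n
    have "(\<Sum>r<n. fourier_mnorm p a * xnorm q x * (1/2) ^ r) = fourier_mnorm p a * xnorm q x * (\<Sum>r<n. (1/2) ^ r)"
      by (simp add: sum_distrib_left)
    also have "\<dots> \<le> fourier_mnorm p a * xnorm q x * 2"
      by (rule mult_left_mono[OF _ N], subst geometric_sum) (auto simp: field_simps)
    finally have le: "(\<Sum>r<n. fourier_mnorm p a * xnorm q x * (1/2) ^ r) \<le> 2 * fourier_mnorm p a * xnorm q x" by simp
    show "bil_bounded ({..<p} \<times> {..<q}) ({..<p} \<times> {..<q}) (\<lambda>(i,k) (j,l). \<Sum>r<n. vertex_sum r (a i j) (x k l)) (2 * fourier_mnorm p a * xnorm q x)"
      using bil_bounded_mono[OF bil_bounded_sum[OF finite_lessThan vertex_sum_matrix_bound[OF a xnorm_bound[OF x] X.pair_norm_nonneg'[OF x]]] le]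
      by (simp add: case_prod_unfold)
  qed
qed simp

lemma derivation_bound:
  assumes a: "a \<in> fourier_algebra" and x: "x \<in> xspace"
  shows "cmod (derivation a x) \<le> 2 * fourier_norm a * xnorm1 x"
proof -
  have "(\<lambda>_ _. x) \<in> mats 1 xspace" "(\<lambda>_ _. a) \<in> mats 1 fourier_algebra" using a x by (simp_all add: mats_def)
  from bil_bounded_11[OF derivation_matrix_bound[OF this(2,1)]] show ?thesis by simp
qed

lemma vertex_sum_linear:
  "vertex_sum r (a + b) x = vertex_sum r a x + vertex_sum r b x" "vertex_sum r (smul c a) x = c * vertex_sum r a x"
  "vertex_sum r a (x + y) = vertex_sum r a x + vertex_sum r a y" "vertex_sum r a (smul c x) = c * vertex_sum r a x"
  by (simp_all add: vertex_sum_def smul_def sum.distrib sum_distrib_left algebra_simps)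

lemma derivation_linear:
  assumes a: "a \<in> fourier_algebra" and b: "b \<in> fourier_algebra" and x: "x \<in> xspace" and y: "y \<in> xspace"
  shows "derivation (a + b) x = derivation a x + derivation b x" "derivation (smul c a) x = c * derivation a x"
    "derivation a (x + y) = derivation a x + derivation a y" "derivation a (smul c x) = c * derivation a x"
proof -
  note A = cfun.subspace_add[OF subspace_fourier_algebra] cfun.subspace_scale[OF subspace_fourier_algebra]
    cfun.subspace_add[OF X.subspace_V] cfun.subspace_scale[OF X.subspace_V]
  show "derivation (a + b) x = derivation a x + derivation b x"
    using sums_add[OF derivation_sums[OF a x] derivation_sums[OF b x]] derivation_sums[OF A(1)[OF a b] x] unfolding vertex_sum_linear by (rule sums_unique2[symmetric])
  show "derivation (smul c a) x = c * derivation a x"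
    using sums_mult[OF derivation_sums[OF a x]] derivation_sums[OF A(2)[OF a] x] unfolding vertex_sum_linear by (rule sums_unique2[symmetric])
  show "derivation a (x + y) = derivation a x + derivation a y"
    using sums_add[OF derivation_sums[OF a x] derivation_sums[OF a y]] derivation_sums[OF a A(3)[OF x y]] unfolding vertex_sum_linear by (rule sums_unique2[symmetric])
  show "derivation a (smul c x) = c * derivation a x"
    using sums_mult[OF derivation_sums[OF a x]] derivation_sums[OF a A(4)[OF x]] unfolding vertex_sum_linear by (rule sums_unique2[symmetric])
qed

lemma derivation_dual_space:
  assumes a: "a \<in> fourier_algebra"
  shows "derivation a \<in> dual_space xspace xnorm"
  unfolding dual_space_def
proof (intro CollectI conjI allI ballI impI)
  show "\<exists>C. \<forall>x\<in>xspace. cmod (derivation a x) \<le> C * xnorm 1 (\<lambda>_ _. x)"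
    using derivation_bound[OF a] by (intro exI[of _ "2 * fourier_norm a"]) simp
  show "x \<notin> xspace \<Longrightarrow> derivation a x = 0" for x by (simp add: derivation_def)
qed (use derivation_linear(3,4)[OF a a] in auto)

lemma derivation_completely_bounded:
  "completely_bounded fourier_algebra fourier_mnorm (dual_space xspace xnorm) (dual_mnorm xspace xnorm) derivation"
  unfolding completely_bounded_def clinear_on_def
proof (intro conjI ballI allI exI[of _ 2])
  fix a b :: "F2 \<Rightarrow> complex" assume a: "a \<in> fourier_algebra" and b: "b \<in> fourier_algebra"
  show "derivation (a + b) = derivation a + derivation b"
  proof
    show "derivation (a + b) x = (derivation a + derivation b) x" for x
      by (cases "x \<in> xspace") (simp_all add: derivation_linear(1)[OF a b] , simp add: derivation_def)
  qed
next
  fix c and a :: "F2 \<Rightarrow> complex" assume a: "a \<in> fourier_algebra"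
  show "derivation (smul c a) = smul c (derivation a)"
  proof
    show "derivation (smul c a) x = smul c (derivation a) x" for x
      by (cases "x \<in> xspace") (simp_all add: derivation_linear(2)[OF a a] smul_def[of c "derivation a"], simp add: derivation_def)
  qed
next
  fix n and a :: "(F2 \<Rightarrow> complex) mat" assume a: "a \<in> mats n fourier_algebra"
  have N: "0 \<le> 2 * fourier_mnorm n a" using fourier_mnorm_nonneg[OF a] by simp
  show "dual_mnorm xspace xnorm n (\<lambda>i j. derivation (a i j)) \<le> 2 * fourier_mnorm n a"
    unfolding dual_mnorm_def
  proof (rule cSup_least)
    have "0 \<in> mats 0 xspace" "xnorm 0 0 \<le> 1"
      by (simp add: mats_def) (rule xnorm_le, simp, simp add: fun_bounded_def bil_bounded_def)
    then show "{opnorm (n * m) (n * m) (mat_pair (\<lambda>f v. f v) m (\<lambda>i j. derivation (a i j)) x) |m x. x \<in> mats m xspace \<and> xnorm m x \<le> 1} \<noteq> {}"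
      by blast
    fix z assume "z \<in> {opnorm (n * m) (n * m) (mat_pair (\<lambda>f v. f v) m (\<lambda>i j. derivation (a i j)) x) |m x. x \<in> mats m xspace \<and> xnorm m x \<le> 1}"
    then obtain m x where z: "z = opnorm (n * m) (n * m) (mat_pair (\<lambda>f v. f v) m (\<lambda>i j. derivation (a i j)) x)"
      and x: "x \<in> mats m xspace" "xnorm m x \<le> 1" by blast
    have "2 * fourier_mnorm n a * xnorm m x \<le> 2 * fourier_mnorm n a" using mult_left_mono[OF x(2) N] by simp
    from bil_bounded_mono[OF derivation_matrix_bound[OF a x(1)] this]
    show "z \<le> 2 * fourier_mnorm n a" unfolding z opnorm_mat_pair_le_iff[OF N] .
  qed
qed (rule derivation_dual_space)

section \<open>The dual actions and evaluation of functionals\<close>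

lemma left_act_linear: "left_act a (x + y) = left_act a x + left_act a y" "left_act a (smul c x) = smul c (left_act a x)"
  by (auto simp: left_act_def left_fun_def ext_def smul_def fun_eq_iff sum.distrib sum_distrib_left algebra_simps split: prod.split)

lemma right_act_linear: "right_act (x + y) a = right_act x a + right_act y a" "right_act (smul c x) a = smul c (right_act x a)"
  by (auto simp: right_act_def right_fun_def ext_def smul_def fun_eq_iff sum.distrib sum_distrib_left algebra_simps split: prod.split)

lemma
  assumes a: "a \<in> fourier_algebra" and x: "x \<in> xspace"
  shows left_act_bound: "xnorm1 (left_act a x) \<le> 3 * fourier_norm a * xnorm1 x"
    and right_act_bound: "xnorm1 (right_act x a) \<le> 3 * fourier_norm a * xnorm1 x"
proof -
  have m: "(\<lambda>_ _. x) \<in> mats 1 xspace" "(\<lambda>_ _. a) \<in> mats 1 fourier_algebra" using a x by (simp_all add: mats_def)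
  have N: "0 \<le> fourier_norm a * (3 * xnorm1 x)" using fourier_norm_nonneg[OF a] xnorm1_nonneg[OF x] by simp
  note l = left_act_pieces_bounded[OF m(2) xnorm_bound[OF m(1)] X.pair_norm_nonneg'[OF m(1)]]
    and r = right_act_pieces_bounded[OF m(2) xnorm_bound[OF m(1)] X.pair_norm_nonneg'[OF m(1)]]
  show "xnorm1 (left_act a x) \<le> 3 * fourier_norm a * xnorm1 x"
    using xnorm_le[OF _ l] N by (simp add: mat_pair_def mult_ac)
  show "xnorm1 (right_act x a) \<le> 3 * fourier_norm a * xnorm1 x"
    using xnorm_le[OF _ r] N by (simp add: mat_pair_def mult_ac)
qed

lemma dual_action_dual_space:
  assumes f: "f \<in> dual_space xspace xnorm" and
    T: "\<And>x. x \<in> xspace \<Longrightarrow> T x \<in> xspace" "\<And>x y. T (x + y) = T x + T y" "\<And>c x. T (smul c x) = smul c (T x)"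
      "\<And>x. x \<in> xspace \<Longrightarrow> xnorm1 (T x) \<le> K * xnorm1 x"
  shows "(\<lambda>x. if x \<in> xspace then f (T x) else 0) \<in> dual_space xspace xnorm"
proof -
  note A = cfun.subspace_add[OF X.subspace_V] cfun.subspace_scale[OF X.subspace_V]
  obtain C where C: "\<And>x. x \<in> xspace \<Longrightarrow> cmod (f x) \<le> C * xnorm1 x"
    using f unfolding dual_space_def One_nat_def by blast
  have "cmod (f (T x)) \<le> (\<bar>C\<bar> * K) * xnorm1 x" if x: "x \<in> xspace" for x
  proof -
    have "cmod (f (T x)) \<le> C * xnorm1 (T x)" by (rule C[OF T(1)[OF x]])
    also have "\<dots> \<le> \<bar>C\<bar> * xnorm1 (T x)" by (rule mult_right_mono[OF abs_ge_self xnorm1_nonneg[OF T(1)[OF x]]])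
    also have "\<dots> \<le> \<bar>C\<bar> * (K * xnorm1 x)" by (rule mult_left_mono[OF T(4)[OF x]]) simp
    finally show ?thesis by (simp add: mult.assoc)
  qed
  then show ?thesis
    using f T(1) A unfolding dual_space_def by (auto simp: T(2,3) simp del: plus_fun_apply)
qed

lemma dual_space_diff:
  assumes "f \<in> dual_space V N" "g \<in> dual_space V N"
  shows "f - g \<in> dual_space V N"
proof -
  obtain C where C: "\<And>x. x \<in> V \<Longrightarrow> cmod (f x) \<le> C * N 1 (\<lambda>_ _. x)"
    using assms(1) unfolding dual_space_def by blast
  obtain C' where C': "\<And>x. x \<in> V \<Longrightarrow> cmod (g x) \<le> C' * N 1 (\<lambda>_ _. x)"
    using assms(2) unfolding dual_space_def by blast
  have "cmod ((f - g) x) \<le> (C + C') * N 1 (\<lambda>_ _. x)" if x: "x \<in> V" for x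
    using norm_triangle_ineq4[of "f x" "g x"] C[OF x] C'[OF x] by (simp add: distrib_right)
  then have "\<exists>C. \<forall>x\<in>V. cmod ((f - g) x) \<le> C * N 1 (\<lambda>_ _. x)" by blast
  then show ?thesis using assms unfolding dual_space_def by (simp add: algebra_simps)
qed

text \<open>The supremum in \<open>dual_mnorm\<close> dominates a test at size 1 only if it is
  finite, which is guaranteed by \<open>functional_completely_bounded\<close>. An upper bound
  \<open>K > 0\<close> stands in for the norm of \<open>x\<close>, which may vanish and cannot be
  divided by.\<close>

lemma (in operator_space) dual_norm_eval:
  assumes f: "f \<in> dual_space V N" and x: "x \<in> V" and K: "N 1 (\<lambda>_ _. x) \<le> K" "0 < K"
  shows "cmod (f x) \<le> K * dual_mnorm V N 1 (\<lambda>_ _. f)"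
proof -
  let ?S = "{opnorm (1 * m) (1 * m) (mat_pair (\<lambda>f v. f v) m (\<lambda>_ _. f) x) | m x. x \<in> mats m V \<and> N m x \<le> 1}"
  obtain C where C: "\<And>x. x \<in> V \<Longrightarrow> cmod (f x) \<le> C * N 1 (\<lambda>_ _. x)"
    using f unfolding dual_space_def by blast
  have C': "cmod (f x) \<le> \<bar>C\<bar> * N 1 (\<lambda>_ _. x)" if x: "x \<in> V" for x
    using C[OF x] mult_right_mono[OF abs_ge_self[of C], of "N 1 (\<lambda>_ _. x)"] norm_nonneg[of "\<lambda>_ _. x" 1] x
    by (simp add: mats_def)
  have on: "opnorm (1 * m) (1 * m) (mat_pair (\<lambda>f v. f v) m (\<lambda>_ _. f) y) \<le> R \<longleftrightarrow> bil_bounded {..<m} {..<m} (\<lambda>k l. f (y k l)) R"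
    if "0 \<le> R" for m y R
    by (simp only: opnorm_mat_pair_le_iff[OF that] pair_bounded_1_iff[where B = "\<lambda>f v. f v"])
  have bdd: "bdd_above ?S"
  proof (rule bdd_aboveI[of _ "\<bar>C\<bar>"])
    fix z assume "z \<in> ?S"
    then obtain m y where z: "z = opnorm (1 * m) (1 * m) (mat_pair (\<lambda>f v. f v) m (\<lambda>_ _. f) y)"
      and y: "y \<in> mats m V" "N m y \<le> 1" by blast
    have "bil_bounded {..<m} {..<m} (\<lambda>k l. f (y k l)) (\<bar>C\<bar> * N m y)"
      by (rule functional_completely_bounded[OF _ _ C' _ y(1)]) (use f in \<open>auto simp: dual_space_def\<close>)
    from bil_bounded_mono[OF this, of "\<bar>C\<bar>"] mult_left_mono[OF y(2), of "\<bar>C\<bar>"]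
    show "z \<le> \<bar>C\<bar>" unfolding z on[OF abs_ge_zero] by simp
  qed
  define y where "y = smul (1 / of_real K) x"
  have "N 1 (\<lambda>_ _. y) = N 1 (\<lambda>_ _. x) / K"
    using norm_smul[of "\<lambda>_ _. x" 1 "1 / of_real K"] x K by (simp add: y_def mats_def norm_divide)
  then have y: "y \<in> V" "N 1 (\<lambda>_ _. y) \<le> 1"
    using K cfun.subspace_scale[OF subspace x] by (simp_all add: y_def)
  have le: "opnorm (1 * 1) (1 * 1) (mat_pair (\<lambda>f v. f v) 1 (\<lambda>_ _. f) (\<lambda>_ _. y)) \<le> dual_mnorm V N 1 (\<lambda>_ _. f)"
    unfolding dual_mnorm_def
  proof (rule cSup_upper[OF _ bdd])
    have "(\<lambda>_ _. y) \<in> mats 1 V \<and> N 1 (\<lambda>_ _. y) \<le> 1" using y by (simp add: mats_def)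
    then show "opnorm (1 * 1) (1 * 1) (mat_pair (\<lambda>f v. f v) 1 (\<lambda>_ _. f) (\<lambda>_ _. y)) \<in> ?S" by blast
  qed
  have "0 \<le> dual_mnorm V N 1 (\<lambda>_ _. f)" using opnorm_nonneg le by (rule order_trans)
  from le[unfolded on[OF this]]
  have "cmod (f y) \<le> dual_mnorm V N 1 (\<lambda>_ _. f)" by (rule bil_bounded_entry) auto
  moreover have "f y = f x / of_real K" using f x by (simp add: y_def dual_space_def)
  ultimately show ?thesis using K by (simp add: norm_divide field_simps)
qed

section \<open>Edge sums and the derivation identity\<close>

lemma sum_nbr_blocks:
  "(\<Sum>h\<in>nbr_blocks r. f h) = (\<Sum>h\<in>block (Suc r). f h) + (if r = 0 then 0 else \<Sum>h\<in>block (r - 1). f h)"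
  for f :: "F2 \<Rightarrow> complex"
proof (cases "r = 0")
  case False
  then have "block (Suc r) \<inter> block (r - 1) = {}" by (intro block_props(4)) auto
  then show ?thesis using False by (simp add: nbr_blocks_def sum.union_disjoint block_props(1))
qed (simp add: nbr_blocks_def)

definition edge_sum :: "(F2 \<Rightarrow> complex) \<Rightarrow> (F2 \<Rightarrow> complex) \<Rightarrow> ((nat \<Rightarrow> complex) \<Rightarrow> complex) \<Rightarrow> nat \<Rightarrow> complex" where
  "edge_sum a b x n = (\<Sum>g\<in>block (fst_index n). \<Sum>h\<in>block (snd_index n). a g * b h * x (enc (g, h)))"

text \<open>The second coordinate is summed out against \<open>b\<close>, then the first against
  \<open>a\<close>, and the result is evaluated at \<open>(0, 0)\<close>. The weight of the piece
  becomes the factor \<open>(1/2) ^ n\<close>.\<close>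

lemma edge_sum_bound:
  assumes a: "a \<in> fourier_algebra" and b: "b \<in> fourier_algebra" and x: "x \<in> xspace"
  shows "cmod (edge_sum a b x n) \<le> fourier_norm a * fourier_norm b * xnorm1 x * (1/2) ^ n"
proof -
  have m: "(\<lambda>_ _. x) \<in> mats 1 xspace" "(\<lambda>_ _. a) \<in> mats 1 fourier_algebra" "(\<lambda>_ _. b) \<in> mats 1 fourier_algebra"
    using a b x by (simp_all add: mats_def)
  let ?S = "block (fst_index n)" and ?T = "block (snd_index n)"
  define y where "y = (\<lambda>h. weight (True, n) * restr (True, n) x h)"
  have y: "fun_bounded {..<1::nat} (\<lambda>_ _. y) (xnorm1 x)"
    using xnorm_bound[OF m(1), rule_format, of "(True, n)"] by (simp add: y_def)
  have y0: "y (g, h) = 0" if "g \<notin> ?S \<or> h \<notin> ?T" for g h using that by (auto simp: y_def restr_def)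
  define z where "z = (\<lambda>(g :: F2, h). if h = (0 :: F2) then \<Sum>h'\<in>?T. b h' * y (g, h') else 0)"
  let ?A = "{..<1::nat} \<times> {..<1::nat}"
  have "fun_bounded ?A (\<lambda>(i,k) (j,l) (g,h). if h = (0 :: F2) then \<Sum>h'\<in>?T. b h' * y (g, h') else 0) (fourier_norm b * xnorm1 x)"
    using fun_bounded_slice_snd[OF m(3) finite_lessThan y xnorm1_nonneg[OF x] block_props(1)[of "snd_index n"]] y0 by simp
  then have z: "fun_bounded ?A (\<lambda>_ _. z) (fourier_norm b * xnorm1 x)" by (simp add: z_def case_prod_unfold)
  have N: "0 \<le> fourier_norm b * xnorm1 x" "0 \<le> fourier_norm a * (fourier_norm b * xnorm1 x)"
    using fourier_norm_nonneg[OF a] fourier_norm_nonneg[OF b] xnorm1_nonneg[OF x] by simp_all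
  have z0: "z (g, h) = 0" if "g \<notin> ?S" for g h using that by (simp add: z_def y0)
  have "fun_bounded ({..<1::nat} \<times> ?A) (\<lambda>(i,k) (j,l) (g,h). if g = (0 :: F2) then \<Sum>g'\<in>?S. a g' * z (g', h) else 0) (fourier_norm a * (fourier_norm b * xnorm1 x))"
    using fun_bounded_slice_fst[OF m(2) _ z N(1) block_props(1)[of "fst_index n"]] z0 by simp
  from bil_bounded_entry[OF fun_bounded_value[OF this _ N(2), of "(0,0)"], of "(0,(0,0))" "(0,(0,0))"]
  have "cmod (\<Sum>g'\<in>?S. a g' * z (g', 0)) \<le> fourier_norm a * (fourier_norm b * xnorm1 x)" by simp
  moreover have "(\<Sum>g'\<in>?S. a g' * z (g', 0)) = 2 ^ n * edge_sum a b x n"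
    by (auto simp: z_def y_def restr_def weight_def edge_sum_def sum_distrib_left mult_ac intro!: sum.cong)
  ultimately have "2 ^ n * cmod (edge_sum a b x n) \<le> fourier_norm a * (fourier_norm b * xnorm1 x)" by (simp add: norm_mult norm_power)
  then show ?thesis by (simp add: field_simps power_divide)
qed

text \<open>The vertices of even blocks are multiplied under the right action and receive edge
  values under the left one; the two neighbouring edge pieces contribute one edge sum each.\<close>

lemma
  fixes a b :: "F2 \<Rightarrow> complex"
  assumes r: "even r"
  shows vertex_sum_right_even: "vertex_sum r b (right_act x a) = vertex_sum r (\<lambda>g. a g * b g) x"
    and vertex_sum_left_even: "vertex_sum r a (left_act b x) = edge_sum a b x r + (if r = 0 then 0 else edge_sum a b x (r - 1))"
proof -
  have 0: "v \<noteq> 0" if "v \<in> block r" for v using that block_props(3) by auto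
  show "vertex_sum r b (right_act x a) = vertex_sum r (\<lambda>g. a g * b g) x"
    unfolding vertex_sum_def by (intro sum.cong refl) (use 0 r in \<open>simp add: vertex_def right_act_def right_fun_def\<close>)
  have "vertex_sum r a (left_act b x) = (\<Sum>v\<in>block r. a v * (\<Sum>h\<in>nbr_blocks r. b h * x (enc (v, h))))"
    unfolding vertex_sum_def by (intro sum.cong refl) (use r in \<open>simp add: vertex_def left_act_def left_fun_def nbrs_block\<close>)
  also have "\<dots> = edge_sum a b x r + (if r = 0 then 0 else edge_sum a b x (r - 1))"
    using r by (auto simp: sum_nbr_blocks edge_sum_def fst_index_def snd_index_def distrib_left sum.distrib sum_distrib_left mult.assoc)
  finally show "vertex_sum r a (left_act b x) = edge_sum a b x r + (if r = 0 then 0 else edge_sum a b x (r - 1))" .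
qed

text \<open>The roles of the two actions are exchanged in odd blocks, and the minus sign of the
  right action appears in front of the edge sums. The sums over the two coordinates have to be
  interchanged to match \<open>edge_sum\<close>.\<close>

lemma
  fixes a b :: "F2 \<Rightarrow> complex"
  assumes r: "odd r"
  shows vertex_sum_left_odd: "vertex_sum r a (left_act b x) = vertex_sum r (\<lambda>g. a g * b g) x"
    and vertex_sum_right_odd: "vertex_sum r b (right_act x a) = - (edge_sum a b x r + (if r = 0 then 0 else edge_sum a b x (r - 1)))"
proof -
  have 0: "v \<noteq> 0" if "v \<in> block r" for v using that block_props(3) by auto
  have rs: "r \<noteq> 0" "Suc (r - 1) = r" using r by (cases r; simp)+
  show "vertex_sum r a (left_act b x) = vertex_sum r (\<lambda>g. a g * b g) x"
    unfolding vertex_sum_def by (intro sum.cong refl) (use 0 r in \<open>simp add: vertex_def left_act_def left_fun_def mult.assoc\<close>)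
  have "vertex_sum r b (right_act x a) = - (\<Sum>v\<in>block r. b v * (\<Sum>g\<in>nbr_blocks r. a g * x (enc (g, v))))"
    unfolding vertex_sum_def sum_negf[symmetric] by (intro sum.cong refl) (use r in \<open>simp add: vertex_def right_act_def right_fun_def nbrs_block\<close>)
  also have "(\<Sum>v\<in>block r. b v * (\<Sum>g\<in>nbr_blocks r. a g * x (enc (g, v))))
     = (\<Sum>v\<in>block r. \<Sum>g\<in>block (Suc r). a g * b v * x (enc (g, v))) + (\<Sum>v\<in>block r. \<Sum>g\<in>block (r - 1). a g * b v * x (enc (g, v)))"
    using rs by (simp add: sum_nbr_blocks distrib_left sum.distrib sum_distrib_left mult_ac)
  also have "\<dots> = edge_sum a b x r + (if r = 0 then 0 else edge_sum a b x (r - 1))"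
    using r rs unfolding edge_sum_def fst_index_def snd_index_def by (subst (1 2) sum.swap) (simp add: rs)
  finally show "vertex_sum r b (right_act x a) = - (edge_sum a b x r + (if r = 0 then 0 else edge_sum a b x (r - 1)))" .
qed

lemma fourier_algebra_mult: "a \<in> fourier_algebra \<Longrightarrow> b \<in> fourier_algebra \<Longrightarrow> (\<lambda>g :: F2. a g * b g) \<in> fourier_algebra"
  by (rule fourier_functional_mult(1))

lemma derivation_mult:
  assumes a: "a \<in> fourier_algebra" and b: "b \<in> fourier_algebra" and x: "x \<in> xspace"
  shows "derivation (\<lambda>g. a g * b g) x = derivation b (right_act x a) + derivation a (left_act b x)"
proof -
  let ?e = "\<lambda>r. (-1) ^ r * (edge_sum a b x r + (if r = 0 then 0 else edge_sum a b x (r - 1)))"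
  \<comment> \<open>Each edge piece meets two consecutive blocks, which enter with opposite signs;
    only the last piece is left over.\<close>
  have ps: "(\<Sum>r<Suc n. ?e r) = (-1) ^ n * edge_sum a b x n" for n
    by (induction n) (simp_all add: algebra_simps)
  have "(\<lambda>n. edge_sum a b x n) \<longlonglongrightarrow> 0"
  proof (rule Lim_null_comparison)
    show "\<forall>\<^sub>F n in sequentially. cmod (edge_sum a b x n) \<le> fourier_norm a * fourier_norm b * xnorm1 x * (1/2) ^ n"
      by (rule always_eventually) (use edge_sum_bound[OF a b x] in blast)
    show "(\<lambda>n. fourier_norm a * fourier_norm b * xnorm1 x * (1/2) ^ n) \<longlonglongrightarrow> 0"
      by (rule tendsto_mult_right_zero) (rule LIMSEQ_power_zero, simp)
  qed
  then have "(\<lambda>n. (-1) ^ n * edge_sum a b x n) \<longlonglongrightarrow> 0"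
    by (subst (asm) tendsto_norm_zero_iff[symmetric], subst tendsto_norm_zero_iff[symmetric]) (simp add: norm_mult norm_power)
  then have "(\<lambda>n. \<Sum>r<Suc n. ?e r) \<longlonglongrightarrow> 0" by (simp only: ps)
  then have "?e sums 0" unfolding sums_def by (rule LIMSEQ_imp_Suc)
  from sums_add[OF derivation_sums[OF fourier_algebra_mult[OF a b] x] this]
  have "(\<lambda>r. vertex_sum r (\<lambda>g. a g * b g) x + ?e r) sums (derivation (\<lambda>g. a g * b g) x + 0)" .
  moreover have "vertex_sum r (\<lambda>g. a g * b g) x + ?e r = vertex_sum r b (right_act x a) + vertex_sum r a (left_act b x)" for r
    by (cases "even r") (simp_all add: vertex_sum_right_even vertex_sum_left_even vertex_sum_right_odd vertex_sum_left_odd)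
  ultimately have "(\<lambda>r. vertex_sum r b (right_act x a) + vertex_sum r a (left_act b x)) sums derivation (\<lambda>g. a g * b g) x" by simp
  with sums_add[OF derivation_sums[OF b right_act_xspace[OF a x]] derivation_sums[OF a left_act_xspace[OF b x]]]
  show ?thesis by (rule sums_unique2[symmetric])
qed

lemma derivation_cb:
  "cb_derivation_to_dual fourier_algebra fourier_mnorm (\<lambda>f g x. f x * g x) xspace xnorm left_act right_act derivation"
  unfolding cb_derivation_to_dual_def
proof (intro conjI ballI derivation_completely_bounded)
  fix a b :: "F2 \<Rightarrow> complex" assume a: "a \<in> fourier_algebra" and b: "b \<in> fourier_algebra"
  show "derivation (\<lambda>x. a x * b x) = dual_left xspace right_act a (derivation b) + dual_right xspace left_act (derivation a) b"
  proof
    fix x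
    show "derivation (\<lambda>x. a x * b x) x = (dual_left xspace right_act a (derivation b) + dual_right xspace left_act (derivation a) b) x"
      using derivation_mult[OF a b, of x] by (cases "x \<in> xspace") (simp_all add: dual_left_def dual_right_def, simp add: derivation_def)
  qed
qed

subsection \<open>The derivation is not approximately inner\<close>

text \<open>With \<open>even\<close> and \<open>odd\<close> for \<open>P\<close>, these are the
  elements \<open>a'\<close> and \<open>a''\<close>. Blocks are disjoint, so the block that contains
  \<open>g\<close> is unique.\<close>

definition block_weight :: "(nat \<Rightarrow> bool) \<Rightarrow> F2 \<Rightarrow> complex" where
  "block_weight P g = (if \<exists>r. P r \<and> g \<in> block r then (1/8) ^ (THE r. g \<in> block r) else 0)"

lemma the_block: "g \<in> block r \<Longrightarrow> (THE r. g \<in> block r) = r"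
  using block_unique by (intro the_equality) auto

lemma block_weight_eq: "g \<in> block r \<Longrightarrow> block_weight P g = (if P r then (1/8) ^ r else 0)"
  using block_unique by (auto simp: block_weight_def the_block)

text \<open>The squared values \<open>(1/64) ^ r\<close> on \<open>16 ^ r\<close> elements add up to
  \<open>(1/4) ^ r\<close>, so the function is square summable.\<close>

lemma block_weight_fourier_algebra: "block_weight P \<in> fourier_algebra"
proof (rule ell2_in_fourier_algebra, rule ell2I(1)[of _ 2])
  fix F :: "F2 set" assume F: "finite F"
  define t where "t = (\<lambda>g. THE r. g \<in> block r)"
  obtain R where R: "\<And>g. g \<in> F \<Longrightarrow> t g < R"
    using finite_nat_set_iff_bounded[of "t ` F"] F by auto
  let ?B = "\<Union>r<R. block r"
  have fB: "finite ?B" using block_props(1) by blast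
  have "(L2c (block_weight P) F)\<^sup>2 = (\<Sum>g\<in>F. (cmod (block_weight P g))\<^sup>2)" by (rule L2c_power2)
  also have "\<dots> = (\<Sum>g\<in>F \<inter> ?B. (cmod (block_weight P g))\<^sup>2)"
  proof (rule sum.mono_neutral_right)
    show "\<forall>g\<in>F - F \<inter> ?B. (cmod (block_weight P g))\<^sup>2 = 0"
    proof
      fix g assume g: "g \<in> F - F \<inter> ?B"
      have "g \<notin> block r" for r using g R[of g] the_block[of g r] by (auto simp: t_def)
      then show "(cmod (block_weight P g))\<^sup>2 = 0" by (simp add: block_weight_def)
    qed
  qed (use F in auto)
  also have "\<dots> \<le> (\<Sum>g\<in>?B. (cmod (block_weight P g))\<^sup>2)" by (rule sum_mono2[OF fB]) auto
  also have "\<dots> = (\<Sum>r<R. \<Sum>g\<in>block r. (cmod (block_weight P g))\<^sup>2)"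
    by (rule sum.UNION_disjoint) (use block_props(1,4) in auto)
  also have "\<dots> \<le> (\<Sum>r<R. \<Sum>g\<in>block r. (1/64) ^ r)"
    by (intro sum_mono) (simp add: block_weight_eq norm_power norm_divide power_mult_distrib[symmetric] power2_eq_square)
  also have "\<dots> = (\<Sum>r<R. (1/4) ^ r)"
    by (simp add: block_props(2) power_mult_distrib[symmetric] power_divide[symmetric])
  also have "\<dots> \<le> 2\<^sup>2" by (subst geometric_sum) (auto simp: field_simps intro: order_trans[of _ 0])
  finally show "L2c (block_weight P) F \<le> 2" by (rule power2_le_imp_le) simp
qed

definition piecewise :: "(bool \<times> nat \<Rightarrow> complex) \<Rightarrow> (nat \<Rightarrow> complex) \<Rightarrow> complex" where
  "piecewise c = ext (\<lambda>h. if \<exists>b. h \<in> piece b then c (THE b. h \<in> piece b) else 0)"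

lemma piecewise_eq: "h \<in> piece b \<Longrightarrow> piecewise c (enc h) = c b"
proof -
  assume h: "h \<in> piece b"
  then have "(THE b. h \<in> piece b) = b" using piece_unique by (intro the_equality) auto
  moreover have e: "\<exists>b. h \<in> piece b" using h by (rule exI)
  ultimately show ?thesis unfolding piecewise_def ext_enc if_P[OF e] by (simp only:)
qed

lemma restr_piecewise: "restr b (piecewise c) h = (if h \<in> piece b then c b else 0)"
  by (simp add: restr_def piecewise_eq)

lemma fun_bounded_const: "fun_bounded {..<1::nat} (\<lambda>_ _. y) C \<longleftrightarrow> (\<forall>F. finite F \<longrightarrow> bil_bounded F F (\<lambda>s t. y (s - t)) C)"
  for y :: "'h::group_add \<Rightarrow> complex"
proof -
  have "{..<1::nat} \<times> F = (\<lambda>k. (0, k)) ` F" for F :: "'h set" by auto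
  then show ?thesis by (simp add: fun_bounded_def bil_bounded_image inj_on_def)
qed

text \<open>Convolution by the indicator of a product set is the product of two commuting operators:
  convolution by \<open>S\<close> tensor the identity and the identity tensor convolution by
  \<open>T\<close>.\<close>

lemma indicator_Times_bounded:
  fixes S T :: "'g::group_add set"
  assumes S: "\<And>F. finite F \<Longrightarrow> bil_bounded F F (\<lambda>g h. if g - h \<in> S then 1 else 0) C" and C: "0 \<le> C"
    and T: "\<And>F. finite F \<Longrightarrow> bil_bounded F F (\<lambda>g h. if g - h \<in> T then 1 else 0) C'" and C': "0 \<le> C'"
  shows "fun_bounded {..<1::nat} (\<lambda>_ _ h. if h \<in> S \<times> T then 1 else 0) (C * C')"
  unfolding fun_bounded_const
proof (intro allI impI)
  fix F :: "('g \<times> 'g) set" assume F: "finite F"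
  define A B where "A = fst ` F" and "B = snd ` F"
  have fin: "finite A" "finite B" "finite (A \<times> B)" and FAB: "F \<subseteq> A \<times> B" using F by (force simp: A_def B_def)+
  let ?i = "\<lambda>S d. if d \<in> S then 1 else (0 :: complex)"
  have 1: "bil_bounded (A \<times> B) (A \<times> B) (\<lambda>(i,s) (j,t). if s = t then ?i S (i - j) else 0) C"
    by (rule bil_bounded_tensor_id[OF S[OF fin(1)] fin(1,1,2) C])
  have "bil_bounded (prod.swap ` (A \<times> B)) (prod.swap ` (A \<times> B)) (\<lambda>(i,s) (j,t). if s = t then ?i T (i - j) else 0) C'"
    unfolding product_swap by (rule bil_bounded_tensor_id[OF T[OF fin(2)] fin(2,2,1) C'])
  moreover have inj: "inj_on prod.swap (A \<times> B)" by (auto simp: inj_on_def)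
  ultimately have 2: "bil_bounded (A \<times> B) (A \<times> B) (\<lambda>(s,i) (t,j). if s = t then ?i T (i - j) else 0) C'"
    unfolding bil_bounded_image[OF inj inj] by (simp add: case_prod_unfold cong: if_cong)
  have "bil_bounded (A \<times> B) (A \<times> B) (\<lambda>p q. \<Sum>m\<in>A \<times> B. (case p of (i,s) \<Rightarrow> \<lambda>(j,t). if s = t then ?i S (i - j) else 0) m
     * (case m of (s,i) \<Rightarrow> \<lambda>(t,j). if s = t then ?i T (i - j) else 0) q) (C * C')"
    by (rule bil_bounded_mult[OF 1 2 fin(3,3,3) C C'])
  moreover have "(\<Sum>m\<in>A \<times> B. (case p of (i,s) \<Rightarrow> \<lambda>(j,t). if s = t then ?i S (i - j) else 0) m
     * (case m of (s,i) \<Rightarrow> \<lambda>(t,j). if s = t then ?i T (i - j) else 0) q) = ?i (S \<times> T) (p - q)" (is "?l = _")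
    if pq: "p \<in> A \<times> B" "q \<in> A \<times> B" for p q
  proof -
    have "?l = (\<Sum>m\<in>A \<times> B. if m = (fst q, snd p) then ?i S (fst p - fst q) * ?i T (snd p - snd q) else 0)"
      by (intro sum.cong refl) (auto simp: case_prod_unfold prod_eq_iff)
    also have "\<dots> = ?i S (fst p - fst q) * ?i T (snd p - snd q)"
      using pq fin by (subst sum.delta) (auto simp: mem_Times_iff)
    finally show ?thesis by (simp add: mem_Times_iff)
  qed
  ultimately have "bil_bounded (A \<times> B) (A \<times> B) (\<lambda>p q. ?i (S \<times> T) (p - q)) (C * C')"
    by (subst bil_bounded_cong[symmetric]) auto
  from bil_bounded_subset[OF this FAB FAB fin(3,3)]
  show "bil_bounded F F (\<lambda>p q. if p - q \<in> S \<times> T then 1 else 0) (C * C')" .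
qed

text \<open>This is where the square root in the norm of the block indicators pays. The weighted
  norm of the edge piece \<open>r\<close> is at most \<open>2^r * 8^(r+1) / (16^r * 16^(r+1)) * (2 *
  4^r) * (2 * 4^(r+1))\<close>, which equals 8 for every \<open>r\<close>. The only vertex piece is
  that of block 0.\<close>

lemma piecewise_xspace:
  assumes c: "\<And>r. cmod (c (True, r)) \<le> 8 ^ Suc r / (16 ^ r * 16 ^ Suc r)" and c0: "\<And>r. r \<noteq> 0 \<Longrightarrow> c (False, r) = 0"
  shows "piecewise c \<in> xspace"
proof -
  let ?C = "8 + 2 * cmod (c (False, 0))"
  have "fun_bounded {..<1::nat} (\<lambda>_ _ h. weight b * restr b (piecewise c) h) ?C" for b
  proof -
    have sc: "(\<lambda>h. weight b * restr b (piecewise c) h) = (\<lambda>h. (weight b * c b) * (if h \<in> piece b then 1 else 0))"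
      by (auto simp: restr_piecewise)
    obtain k r where b: "b = (k, r)" by (cases b)
    show ?thesis
    proof (cases k)
      case True
      have "fun_bounded {..<1::nat} (\<lambda>_ _ h. if h \<in> block (fst_index r) \<times> block (snd_index r) then 1 else 0)
        ((2 * 4 ^ fst_index r) * (2 * 4 ^ snd_index r))"
        by (rule indicator_Times_bounded[OF block_props(5) _ block_props(5)]) auto
      from fun_bounded_scale[OF this, of "weight b * c b"]
      have "fun_bounded {..<1::nat} (\<lambda>_ _ h. weight b * restr b (piecewise c) h) (cmod (weight b * c b) * ((2 * 4 ^ fst_index r) * (2 * 4 ^ snd_index r)))"
        unfolding sc using True b by simp
      moreover have "cmod (weight b * c b) * ((2 * 4 ^ fst_index r) * (2 * 4 ^ snd_index r)) \<le> ?C"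
      proof -
        \<comment> \<open>The indices \<open>fst_index r\<close> and \<open>snd_index r\<close> are
          \<open>r\<close> and \<open>r + 1\<close> in some order.\<close>
        have i: "(4::real) ^ fst_index r * 4 ^ snd_index r = 4 * 16 ^ r"
          by (simp add: fst_index_def snd_index_def power_mult_distrib[symmetric])
        have "cmod (weight b * c b) * ((2 * 4 ^ fst_index r) * (2 * 4 ^ snd_index r)) = 2 ^ r * cmod (c (True, r)) * (16 * 16 ^ r)"
          using i True b by (simp add: norm_mult cmod_weight)
        also have "\<dots> \<le> 2 ^ r * (8 ^ Suc r / (16 ^ r * 16 ^ Suc r)) * (16 * 16 ^ r)"
          by (intro mult_right_mono mult_left_mono c) auto
        also have "\<dots> = 8 * ((2 * 8) ^ r / 16 ^ r)" by (simp only: power_mult_distrib) (simp add: field_simps)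
        also have "\<dots> = 8" by simp
        finally show ?thesis using norm_ge_zero[of "c (False, 0)"] by linarith
      qed
      ultimately show ?thesis by (rule fun_bounded_mono)
    next
      case False
      show ?thesis
      proof (cases "r = 0")
        case True
        have id: "bil_bounded F F (\<lambda>g h. if g - h \<in> {0} then 1 else 0) 1" if "finite F" for F :: "F2 set"
        proof -
          have "(\<Sum>j\<in>F. (if i - j \<in> {0} then 1 else 0) * z j) = z i" if "i \<in> F" for i and z :: "F2 \<Rightarrow> complex"
          proof -
            have "(\<Sum>j\<in>F. (if i - j \<in> {0} then 1 else 0) * z j) = (\<Sum>j\<in>F. if j = i then z j else 0)"
              by (intro sum.cong) auto
            then show ?thesis using that \<open>finite F\<close> by simp
          qed
          then have "L2c (\<lambda>i. \<Sum>j\<in>F. (if i - j \<in> {0} then 1 else 0) * z j) F = L2c z F" for z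
            by (intro L2_set_cong) auto
          then show ?thesis using that by (simp only: bil_bounded_iff_column[OF that that zero_le_one]) simp
        qed
        have "fun_bounded {..<1::nat} (\<lambda>_ _ h. if h \<in> block 0 \<times> {0 :: F2} then 1 else 0) ((2 * 4 ^ 0) * 1)"
          by (rule indicator_Times_bounded[OF block_props(5) _ id]) auto
        from fun_bounded_scale[OF this, of "weight b * c b"]
        have "fun_bounded {..<1::nat} (\<lambda>_ _ h. weight b * restr b (piecewise c) h) (cmod (weight b * c b) * ((2 * 4 ^ 0) * 1))"
          unfolding sc using True False b by simp
        then show ?thesis by (rule fun_bounded_mono) (use True False b in \<open>simp add: weight_def\<close>)
      next
        case r: False
        then show ?thesis unfolding sc using False b c0[OF r] fun_bounded_zero[of ?C] by simp
      qed
    qed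
  qed
  moreover have "piecewise c i = 0" if "i \<notin> enc ` (\<Union>b. piece b)" for i
    unfolding piecewise_def by (rule ext_outside_pieces[OF that]) auto
  ultimately show ?thesis unfolding xspace_def by (intro CollectI conjI allI impI exI[of _ ?C]) auto
qed

text \<open>The power of 8 is the reciprocal of \<open>block_weight even\<close> at the first end
  point of the edge; in \<open>odd_coeff\<close> it is that of \<open>block_weight odd\<close> at
  the second one. The denominator is the number of edges in the piece. After multiplication every
  edge piece carries the total mass \<open>(-1) ^ r\<close>, and the vertex value 1 in block 0 is
  the source of this flow.\<close>

definition even_coeff :: "bool \<times> nat \<Rightarrow> complex" where
  "even_coeff = (\<lambda>(k, r). if k then (-1) ^ r * 8 ^ fst_index r / (16 ^ r * 16 ^ Suc r) else if r = 0 then 1 else 0)"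

definition odd_coeff :: "bool \<times> nat \<Rightarrow> complex" where
  "odd_coeff = (\<lambda>(k, r). if k then (-1) ^ r * 8 ^ snd_index r / (16 ^ r * 16 ^ Suc r) else 0)"

lemma coeff_bound: "cmod (even_coeff (True, r)) \<le> 8 ^ Suc r / (16 ^ r * 16 ^ Suc r)" "cmod (odd_coeff (True, r)) \<le> 8 ^ Suc r / (16 ^ r * 16 ^ Suc r)"
proof -
  have "(8::real) ^ fst_index r \<le> 8 ^ Suc r" "(8::real) ^ snd_index r \<le> 8 ^ Suc r"
    by (rule power_increasing; simp add: fst_index_def snd_index_def)+
  then show "cmod (even_coeff (True, r)) \<le> 8 ^ Suc r / (16 ^ r * 16 ^ Suc r)" "cmod (odd_coeff (True, r)) \<le> 8 ^ Suc r / (16 ^ r * 16 ^ Suc r)"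
    by (auto simp: even_coeff_def odd_coeff_def norm_mult norm_divide norm_power simp del: power_Suc intro!: divide_right_mono)
qed

lemma even_coeff_xspace: "piecewise even_coeff \<in> xspace" and odd_coeff_xspace: "piecewise odd_coeff \<in> xspace"
  by (rule piecewise_xspace[OF coeff_bound(1)], simp add: even_coeff_def) (rule piecewise_xspace[OF coeff_bound(2)], simp add: odd_coeff_def)

lemma xspace_eqI:
  assumes x: "x \<in> xspace" and y: "y \<in> xspace" and eq: "\<And>b h. h \<in> piece b \<Longrightarrow> restr b x h = restr b y h"
  shows "x = y"
proof
  fix i show "x i = y i"
  proof (cases "i \<in> enc ` (\<Union>b. piece b)")
    case True
    then obtain h b where "i = enc h" "h \<in> piece b" by blast
    then show ?thesis using eq[of h b] by (simp add: restr_def)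
  next
    case False
    then show ?thesis using x y by (simp add: xspace_def)
  qed
qed

lemma edge_part_piecewise:
  assumes "even r" "g \<in> block r"
  shows "h \<in> block (Suc r) \<Longrightarrow> edge_part r (piecewise c) (g, h) = c (True, r)"
    and "r \<noteq> 0 \<Longrightarrow> h \<in> block (r - 1) \<Longrightarrow> edge_part r (piecewise c) (g, h) = c (True, r - 1)"
  using assms edge_part_even(1)[of r g h "piecewise c"] piecewise_eq[of "(g, h)" "(True, r)" c] piecewise_eq[of "(g, h)" "(True, r - 1)" c]
  by (simp_all add: nbr_blocks_def fst_index_def snd_index_def)

lemma edge_part_piecewise':
  assumes "odd r" "h \<in> block r"
  shows "g \<in> block (Suc r) \<Longrightarrow> edge_part r (piecewise c) (g, h) = c (True, r)"
    and "g \<in> block (r - 1) \<Longrightarrow> edge_part r (piecewise c) (g, h) = c (True, r - 1)"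
proof -
  obtain s where s: "r = Suc s" "even s" using assms(1) by (cases r) auto
  show "g \<in> block (Suc r) \<Longrightarrow> edge_part r (piecewise c) (g, h) = c (True, r)" "g \<in> block (r - 1) \<Longrightarrow> edge_part r (piecewise c) (g, h) = c (True, r - 1)"
    using s assms edge_part_odd(1)[of r h g "piecewise c"] piecewise_eq[of "(g, h)" "(True, r)" c] piecewise_eq[of "(g, h)" "(True, s)" c]
    by (simp_all add: nbr_blocks_def fst_index_def snd_index_def)
qed

lemma sum_nbr_blocks_const:
  fixes f :: "F2 \<Rightarrow> complex"
  assumes "\<And>h. h \<in> block (Suc r) \<Longrightarrow> f h = u" "\<And>h. r \<noteq> 0 \<Longrightarrow> h \<in> block (r - 1) \<Longrightarrow> f h = v"
  shows "(\<Sum>h\<in>nbr_blocks r. f h) = 16 ^ Suc r * u + (if r = 0 then 0 else 16 ^ (r - 1) * v)"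
  using assms by (simp add: sum_nbr_blocks block_props(2))

text \<open>On the edge piece \<open>r\<close> both sides are
  \<open>(-1)^r / (16^r * 16^(r+1))\<close>. At a vertex of a block with \<open>r > 0\<close> the
  two adjoining edge pieces contribute \<open>16^(-r)\<close> with opposite signs. Block 0 has one
  adjoining piece, whose contribution 1 equals the value of \<open>block_weight even\<close> times
  the vertex value of \<open>piecewise even_coeff\<close> there.\<close>

lemma cancellation:
  "right_act (piecewise even_coeff) (block_weight even) + right_act (piecewise odd_coeff) (block_weight odd) = left_act (block_weight even) (piecewise even_coeff) + left_act (block_weight odd) (piecewise odd_coeff)"
proof (rule xspace_eqI)
  note A = cfun.subspace_add[OF X.subspace_V] left_act_xspace right_act_xspace block_weight_fourier_algebra even_coeff_xspace odd_coeff_xspace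
  show "right_act (piecewise even_coeff) (block_weight even) + right_act (piecewise odd_coeff) (block_weight odd) \<in> xspace" by (intro A)
  show "left_act (block_weight even) (piecewise even_coeff) + left_act (block_weight odd) (piecewise odd_coeff) \<in> xspace" by (intro A)
  fix b h assume h: "h \<in> piece b"
  obtain g k where gk: "h = (g, k)" by (cases h)
  obtain e r where b: "b = (e, r)" by (cases b)
  show "restr b (right_act (piecewise even_coeff) (block_weight even) + right_act (piecewise odd_coeff) (block_weight odd)) h
    = restr b (left_act (block_weight even) (piecewise even_coeff) + left_act (block_weight odd) (piecewise odd_coeff)) h"
  proof (cases e)
    case True
    then have "g \<in> block (fst_index r)" "k \<in> block (snd_index r)" using h b gk by auto
    then show ?thesis using True h b gk even_fst_index[of r] odd_snd_index[of r]
      by (simp add: restr_linear restr_left_act(1) restr_right_act(1) restr_piecewise block_weight_eq even_coeff_def odd_coeff_def power_one_over)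
  next
    case e: False
    show ?thesis
    proof (cases "even r")
      case True
      then have g: "g \<in> block r" "k = 0" using h b gk e by auto
      have 1: "(\<Sum>h\<in>nbr_blocks r. block_weight odd h * edge_part r (piecewise odd_coeff) (g, h)) = 16 ^ Suc r * ((1/8) ^ Suc r * odd_coeff (True, r))
          + (if r = 0 then 0 else 16 ^ (r - 1) * ((1/8) ^ (r - 1) * odd_coeff (True, r - 1)))"
        by (rule sum_nbr_blocks_const) (use True g in \<open>simp_all add: block_weight_eq edge_part_piecewise\<close>)
      \<comment> \<open>Neighbours of an even block lie in odd blocks, where
        \<open>block_weight even\<close> vanishes.\<close>
      have 2: "(\<Sum>h\<in>nbr_blocks r. block_weight even h * edge_part r (piecewise even_coeff) (g, h)) = 16 ^ Suc r * 0 + (if r = 0 then 0 else 16 ^ (r - 1) * 0)"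
        by (rule sum_nbr_blocks_const) (use True g in \<open>simp_all add: block_weight_eq edge_part_piecewise\<close>)
      have 3: "16 ^ Suc r * ((1/8) ^ Suc r * odd_coeff (True, r))
          + (if r = 0 then 0 else 16 ^ (r - 1) * ((1/8) ^ (r - 1) * odd_coeff (True, r - 1))) = (if r = 0 then 1 else 0)"
      proof (cases r)
        case (Suc s)
        then show ?thesis using True by (simp add: odd_coeff_def snd_index_def power_one_over field_simps)
      qed (simp add: odd_coeff_def snd_index_def)
      have 4: "(\<Sum>h\<in>nbr_blocks r. block_weight odd h * edge_part r (piecewise odd_coeff) (g, h)) = (if r = 0 then 1 else 0)" using 1 3 by (simp only:)
      show ?thesis using h b e True gk g
        by (simp add: restr_linear restr_left_act(2) restr_right_act(1) restr_piecewise block_weight_eq 4 2 del: piece.simps) (simp add: even_coeff_def odd_coeff_def)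
    next
      case False
      then have g: "k \<in> block r" "g = 0" using h b gk e by auto
      \<comment> \<open>Neighbours of an odd block lie in even blocks, so only
        \<open>block_weight even\<close> contributes.\<close>
      have 1: "(\<Sum>g\<in>nbr_blocks r. block_weight even g * (- edge_part r (piecewise even_coeff) (g, k))) = 16 ^ Suc r * ((1/8) ^ Suc r * (- even_coeff (True, r)))
          + (if r = 0 then 0 else 16 ^ (r - 1) * ((1/8) ^ (r - 1) * (- even_coeff (True, r - 1))))"
        by (rule sum_nbr_blocks_const) (use False g in \<open>simp_all add: block_weight_eq edge_part_piecewise'\<close>)
      have 2: "(\<Sum>g\<in>nbr_blocks r. block_weight odd g * (- edge_part r (piecewise odd_coeff) (g, k))) = 16 ^ Suc r * 0 + (if r = 0 then 0 else 16 ^ (r - 1) * 0)"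
        by (rule sum_nbr_blocks_const) (use False g in \<open>simp_all add: block_weight_eq edge_part_piecewise'\<close>)
      have 3: "16 ^ Suc r * ((1/8) ^ Suc r * (- even_coeff (True, r)))
          + (if r = 0 then 0 else 16 ^ (r - 1) * ((1/8) ^ (r - 1) * (- even_coeff (True, r - 1)))) = 0"
      proof (cases r)
        case (Suc s)
        then show ?thesis using False by (simp add: even_coeff_def fst_index_def power_one_over field_simps)
      qed (use False in simp)
      have 4: "(\<Sum>g\<in>nbr_blocks r. block_weight even g * edge_part r (piecewise even_coeff) (g, k)) = 0"
        using trans[OF 1 3] by (simp only: mult_minus_right sum_negf neg_equal_0_iff_equal)
      have 5: "(\<Sum>g\<in>nbr_blocks r. block_weight odd g * edge_part r (piecewise odd_coeff) (g, k)) = 0"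
        using 2 by (simp add: sum_negf split: if_splits)
      have "r \<noteq> 0" using False by (cases r) auto
      then show ?thesis using h b e False gk g
        by (simp add: restr_linear restr_left_act(1) restr_right_act(2) restr_piecewise 4 5 sum_negf del: piece.simps) (simp add: even_coeff_def odd_coeff_def)
    qed
  qed
qed

text \<open>Vertex values other than 0 occur in block 0 only, which has a single element; there both
  \<open>block_weight even\<close> and \<open>even_coeff\<close> are 1.\<close>

lemma derivation_even_coeff: "derivation (block_weight even) (piecewise even_coeff) = 1" and derivation_odd_coeff: "derivation (block_weight odd) (piecewise odd_coeff) = 0"
proof -
  have p: "vertex r v \<in> piece (False, r)" if "v \<in> block r" for r v using that by (simp add: vertex_def)
  have "vertex_sum r (block_weight even) (piecewise even_coeff) = (\<Sum>v\<in>block r. if r = 0 then 1 else 0)" for r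
    unfolding vertex_sum_def by (intro sum.cong refl) (simp add: piecewise_eq[OF p] block_weight_eq even_coeff_def)
  then have "(\<lambda>r. vertex_sum r (block_weight even) (piecewise even_coeff)) sums (\<Sum>r\<in>{0}. vertex_sum r (block_weight even) (piecewise even_coeff))"
    by (intro sums_finite) (auto simp: block_props(2))
  moreover have "(\<Sum>r\<in>{0}. vertex_sum r (block_weight even) (piecewise even_coeff)) = 1"
    by (simp add: vertex_sum_def piecewise_eq[OF p] block_weight_eq even_coeff_def block_props(2))
  ultimately show "derivation (block_weight even) (piecewise even_coeff) = 1"
    using sums_unique2[OF derivation_sums[OF block_weight_fourier_algebra even_coeff_xspace]] by simp
  have "vertex_sum r (block_weight odd) (piecewise odd_coeff) = 0" for r
    unfolding vertex_sum_def by (intro sum.neutral ballI) (simp add: piecewise_eq[OF p] odd_coeff_def)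
  then show "derivation (block_weight odd) (piecewise odd_coeff) = 0" using odd_coeff_xspace by (simp add: derivation_def)
qed

text \<open>For every \<open>\<phi>\<close> in the dual, the defects of the inner derivation at the
  two test elements, evaluated at the two module elements, add up to -1 by
  \<open>cancellation\<close>. Approximation on these two elements would make each of them smaller
  than 1/4.\<close>

lemma derivation_not_approximately_inner: "\<not> approximately_inner fourier_algebra xspace xnorm left_act right_act derivation"
proof
  assume "approximately_inner fourier_algebra xspace xnorm left_act right_act derivation"
  then obtain F where F: "F \<noteq> bot" "\<forall>\<^sub>F \<phi> in F. \<phi> \<in> dual_space xspace xnorm"
    and lim: "\<And>a. a \<in> fourier_algebra \<Longrightarrow> ((\<lambda>\<phi>. dual_mnorm xspace xnorm 1
          (\<lambda>_ _. dual_left xspace right_act a \<phi> - dual_right xspace left_act \<phi> a - derivation a)) \<longlongrightarrow> 0) F"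
    unfolding approximately_inner_def by blast
  interpret XO: operator_space xspace xnorm by (rule xspace_operator_space)
  \<comment> \<open>A common positive bound for both norms, so that closeness within
    \<open>1 / (4 * K)\<close> in the dual norm becomes closeness within 1/4 at both module
    elements.\<close>
  define K where "K = xnorm1 (piecewise even_coeff) + xnorm1 (piecewise odd_coeff) + 1"
  have K: "K > 0" "xnorm1 (piecewise even_coeff) \<le> K" "xnorm1 (piecewise odd_coeff) \<le> K"
    using xnorm1_nonneg[OF even_coeff_xspace] xnorm1_nonneg[OF odd_coeff_xspace] by (simp_all add: K_def)
  let ?\<psi> = "\<lambda>a \<phi>. dual_left xspace right_act a \<phi> - dual_right xspace left_act \<phi> a - derivation a"
  have ev: "\<forall>\<^sub>F \<phi> in F. dual_mnorm xspace xnorm 1 (\<lambda>_ _. ?\<psi> a \<phi>) < 1 / (4 * K)" if "a \<in> fourier_algebra" for a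
    by (rule order_tendstoD(2)[OF lim[OF that]]) (use K in simp)
  have "\<forall>\<^sub>F \<phi> in F. \<phi> \<in> dual_space xspace xnorm \<and> dual_mnorm xspace xnorm 1 (\<lambda>_ _. ?\<psi> (block_weight even) \<phi>) < 1 / (4 * K)
      \<and> dual_mnorm xspace xnorm 1 (\<lambda>_ _. ?\<psi> (block_weight odd) \<phi>) < 1 / (4 * K)"
    by (intro eventually_conj F(2) ev block_weight_fourier_algebra)
  from eventually_happens'[OF F(1) this] obtain \<phi> where \<phi>: "\<phi> \<in> dual_space xspace xnorm"
    and n: "dual_mnorm xspace xnorm 1 (\<lambda>_ _. ?\<psi> (block_weight even) \<phi>) < 1 / (4 * K)"
      "dual_mnorm xspace xnorm 1 (\<lambda>_ _. ?\<psi> (block_weight odd) \<phi>) < 1 / (4 * K)" by blast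
  have dual: "?\<psi> a \<phi> \<in> dual_space xspace xnorm" if a: "a \<in> fourier_algebra" for a
    unfolding dual_left_def dual_right_def
    by (intro dual_space_diff derivation_dual_space a)
       (rule dual_action_dual_space[OF \<phi> right_act_xspace[OF a] right_act_linear right_act_bound[OF a]];
        assumption
       |rule dual_action_dual_space[OF \<phi> left_act_xspace[OF a] left_act_linear left_act_bound[OF a]]; assumption)+
  have small: "cmod (?\<psi> a \<phi> x) < 1 / 4"
    if a: "a \<in> fourier_algebra" and x: "x \<in> xspace" "xnorm1 x \<le> K" and d: "dual_mnorm xspace xnorm 1 (\<lambda>_ _. ?\<psi> a \<phi>) < 1 / (4 * K)" for a x
  proof -
    have "cmod (?\<psi> a \<phi> x) \<le> K * dual_mnorm xspace xnorm 1 (\<lambda>_ _. ?\<psi> a \<phi>)"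
      by (rule XO.dual_norm_eval[OF dual[OF a] x(1)]) (use x K in simp_all)
    also have "\<dots> < K * (1 / (4 * K))" by (rule mult_strict_left_mono[OF d K(1)])
    also have "\<dots> = 1 / 4" using K by simp
    finally show ?thesis .
  qed
  note A = block_weight_fourier_algebra even_coeff_xspace odd_coeff_xspace
  have add: "\<phi> (x + y) = \<phi> x + \<phi> y" if "x \<in> xspace" "y \<in> xspace" for x y using \<phi> that by (simp add: dual_space_def)
  have "?\<psi> (block_weight even) \<phi> (piecewise even_coeff) + ?\<psi> (block_weight odd) \<phi> (piecewise odd_coeff)
    = (\<phi> (right_act (piecewise even_coeff) (block_weight even)) + \<phi> (right_act (piecewise odd_coeff) (block_weight odd)))
      - (\<phi> (left_act (block_weight even) (piecewise even_coeff)) + \<phi> (left_act (block_weight odd) (piecewise odd_coeff))) - 1"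
    using A by (simp add: dual_left_def dual_right_def derivation_even_coeff derivation_odd_coeff)
  also have "\<dots> = - 1"
    by (simp only: add[OF right_act_xspace right_act_xspace, symmetric] add[OF left_act_xspace left_act_xspace, symmetric] A cancellation) simp
  finally have "1 = cmod (?\<psi> (block_weight even) \<phi> (piecewise even_coeff) + ?\<psi> (block_weight odd) \<phi> (piecewise odd_coeff))" by simp
  also have "\<dots> \<le> cmod (?\<psi> (block_weight even) \<phi> (piecewise even_coeff)) + cmod (?\<psi> (block_weight odd) \<phi> (piecewise odd_coeff))" by (rule norm_triangle_ineq)
  also have "\<dots> < 1 / 4 + 1 / 4"
    by (intro add_strict_mono small A K n)
  finally show False by simp
qed

theorem mainTheorem2:
  shows "\<not> operator_approximately_amenable TYPE(nat \<Rightarrow> complex)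
           (fourier_algebra :: (F2 \<Rightarrow> complex) set) fourier_mnorm (\<lambda>f g x. f x * g x)"
  using fourier_bimodule derivation_cb derivation_not_approximately_inner
  unfolding operator_approximately_amenable_def by blast

end
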